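(* Let $-1<q<1$, let $\mathcal H_{\mathbb R}$ be a separable real Hilbert space and $(U_t)_{t\in\mathbb R}$ a strongly continuous orthogonal representation of $\mathbb R$ on $\mathcal H_{\mathbb R}$. Let $M_q=\Gamma_q(\mathcal H_{\mathbb R},U_t)''$ be the associated $q$-Araki-Woods von Neumann algebra and $M_q^{\varphi}$ the centralizer of its vacuum state $\varphi$. Let $\mathcal H_{\mathbb R}^{ap}\subseteq\mathcal H_{\mathbb R}$ denote the almost periodic part of $(U_t)$. If $\dim(\mathcal H_{\mathbb R}^{ap})\ge5$, then $(M_q^{\varphi})'\cap M_q=\mathbb C1$. In particular, $M_q^{\varphi}$ is a factor.
   Context: Almost periodic part: there is a unique decomposition $(\mathcal H_{\mathbb R},U_t)=\bigoplus_{j=1}^{N_1}(\mathbb R,\mathrm{id})\oplus\bigoplus_{k=1}^{N_2}(\mathcal H_{\mathbb R}(k),U_t(k))\oplus(\widetilde{\mathcal H}_{\mathbb R},\widetilde U_t)$ with $0\le N_1,N_2\le\aleph_0$, $\mathcal H_{\mathbb R}(k)=\mathbb R^2$, $U_t(k)=\begin{pmatrix}\cos(t\log\lambda_k)&-\sin(t\log\lambda_k)\\ \sin(t\log\lambda_k)&\cos(t\log\lambda_k)\end{pmatrix}$, $0<\lambda_k<1$, and $(\widetilde{\mathcal H}_{\mathbb R},\widetilde U_t)$ weakly mixing; the almost periodic part $\mathcal H^{ap}_{\mathbb R}$ is the sum of the first two blocks. Construction of $M_q$ (inner products are linear in the second variable). Extend $U_t$ linearly to the complexification $\mathcal H_{\mathbb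 C}$ and let $A$ be its analytic generator (positive, nonsingular, self-adjoint, $U_t=A^{it}$). Put $\langle\xi,\eta\rangle_U=\langle\frac{2}{1+A^{-1}}\xi,\eta\rangle_{\mathcal H_{\mathbb C}}$ and let $\mathcal H$ be the completion of $\mathcal H_{\mathbb C}$ for this inner product; $\mathcal H_{\mathbb R}\subset\mathcal H$. The $q$-Fock space $\mathcal F_q(\mathcal H)$ is the completion of $\mathbb C\Omega\oplus\bigoplus_{n\ge1}\mathcal H^{\otimes n}$ (algebraic tensor powers; $\Omega$ is the unit vacuum vector) for $$\langle\xi_1\otimes\cdots\otimes\xi_n,\zeta_1\otimes\cdots\otimes\zeta_m\rangle_q=\delta_{m,n}\sum_{\pi\in S_n}q^{i(\pi)}\prod_{k=1}^n\langle\xi_k,\zeta_{\pi(k)}\rangle_U,$$ with $i(\pi)$ the number of inversions of $\pi$. For $\xi\in\mathcal H$, $c_q(\xi)$ is the bounded operator with $c_q(\xi)\Omega=\xi$, $c_q(\xi)(\xi_1\otimes\cdots\otimes\xi_n)=\xi\otimes\xi_1\otimes\cdots\otimes\xi_n$. Set $s_q(\xi)=c_q(\xi)+c_q(\xi)^*$ and $M_q=\Gamma_q(\mathcal H_{\mathbb R},U_t)''=\{s_q(\xi):\xi\in\mathcal H_{\mathbb R}\}''\subset\mathbf B(\mathcal F_q(\mathcal H))$. The vacuum state $\varphi=\langle\Omega,\cdot\,\Omega\rangle_q$ is a faithful normal state on $M_q$, and its centralizer is $M_q^{\varphi}=\{x\in M_q:\sigma_t^{\varphi}(x)=x\ \forall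 t\in\mathbb R\}$, where $(\sigma^\varphi_t)$ is the modular automorphism group of $\varphi$. Commutants are taken in $\mathbf B(\mathcal F_q(\mathcal H))$. *)

theory Defs
  imports "HOL-Analysis.Analysis" "HOL-Library.Extended_Nat" "HOL-Combinatorics.Permutations"
begin

section \<open>Complex Hilbert spaces\<close>

text \<open>
  A complex inner product space is a real one (with inner product the real part of the complex
  one), so norm and topology are those of the real inner product.  The complex inner product is
  linear in the second variable.
\<close>

class complex_inner = real_inner +
  fixes scaleC :: "complex \<Rightarrow> 'a \<Rightarrow> 'a" (infixr \<open>*\<^sub>C\<close> 75)
    and cinner :: "'a \<Rightarrow> 'a \<Rightarrow> complex"
  assumes scaleC_add_right: "c *\<^sub>C (x + y) = c *\<^sub>C x + c *\<^sub>C y"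
    and scaleC_add_left: "(c + d) *\<^sub>C x = c *\<^sub>C x + d *\<^sub>C x"
    and scaleC_scaleC: "c *\<^sub>C (d *\<^sub>C x) = (c * d) *\<^sub>C x"
    and scaleC_of_real: "complex_of_real r *\<^sub>C x = r *\<^sub>R x"
    and cinner_commute: "cinner x y = cnj (cinner y x)"
    and cinner_add_right: "cinner x (y + z) = cinner x y + cinner x z"
    and cinner_scaleC_right: "cinner x (c *\<^sub>C y) = c * cinner x y"
    and Re_cinner: "Re (cinner x y) = inner x y"

class complex_hilbert = complex_inner + complete_space

definition clinear :: "('a::complex_inner \<Rightarrow> 'b::complex_inner) \<Rightarrow> bool"
  where "clinear f \<longleftrightarrow> linear f \<and> (\<forall>c x. f (c *\<^sub>C x) = c *\<^sub>C f x)"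

definition bounded_clinear :: "('a::complex_inner \<Rightarrow> 'b::complex_inner) \<Rightarrow> bool"
  where "bounded_clinear f \<longleftrightarrow> bounded_linear f \<and> (\<forall>c x. f (c *\<^sub>C x) = c *\<^sub>C f x)"

definition cadjoint :: "('a::complex_hilbert \<Rightarrow> 'a) \<Rightarrow> 'a \<Rightarrow> 'a"
  where "cadjoint T =
    (THE S. bounded_clinear S \<and> (\<forall>x y. cinner (S x) y = cinner x (T y)))"


section \<open>Complexification of a real Hilbert space\<close>

datatype 'a complexification = Complexify (real_part: 'a) (imag_part: 'a)

instantiation complexification :: (real_inner) complex_inner
begin

definition "0 = Complexify 0 (0::'a)"
definition "x + y = Complexify (real_part x + real_part y) (imag_part x + imag_part (y::'a complexification))"
definition "x - y = Complexify (real_part x - real_part y) (imag_part x - imag_part (y::'a complexification))"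
definition "- x = Complexify (- real_part x) (- imag_part (x::'a complexification))"
definition "r *\<^sub>R x = Complexify (r *\<^sub>R real_part x) (r *\<^sub>R imag_part (x::'a complexification))"
definition "inner x y = inner (real_part x) (real_part y) + inner (imag_part x) (imag_part (y::'a complexification))"
definition "norm (x::'a complexification) = sqrt (inner x x)"
definition "sgn (x::'a complexification) = inverse (norm x) *\<^sub>R x"
definition "dist x (y::'a complexification) = norm (x - y)"
definition [code del]: "(uniformity :: ('a complexification \<times> 'a complexification) filter) =
    (INF e\<in>{0<..}. principal {(x, y). dist x y < e})"
definition [code del]: "open (S :: 'a complexification set) \<longleftrightarrow>
    (\<forall>x\<in>S. \<forall>\<^sub>F (x', y) in uniformity. x' = x \<longrightarrow> y \<in> S)"
definition "c *\<^sub>C x = Complexify (Re c *\<^sub>R real_part x - Im c *\<^sub>R imag_part x)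
    (Re c *\<^sub>R imag_part x + Im c *\<^sub>R real_part (x::'a complexification))"
definition "cinner x y =
    Complex (inner (real_part x) (real_part y) + inner (imag_part x) (imag_part y))
      (inner (real_part x) (imag_part y) - inner (imag_part x) (real_part (y::'a complexification)))"

instance
proof
  fix x y z :: "'a complexification" and r s :: real and c d :: complex
  note defs = zero_complexification_def plus_complexification_def minus_complexification_def
    uminus_complexification_def scaleR_complexification_def inner_complexification_def
    scaleC_complexification_def cinner_complexification_def
  show "x + y + z = x + (y + z)" by (simp add: defs)
  show "x + y = y + x" by (simp add: defs)
  show "0 + x = x" by (simp add: defs)
  show "- x + x = 0" by (simp add: defs)
  show "x - y = x + - y" by (simp add: defs)
  show "r *\<^sub>R (x + y) = r *\<^sub>R x + r *\<^sub>R y" by (simp add: defs scaleR_add_right)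
  show "(r + s) *\<^sub>R x = r *\<^sub>R x + s *\<^sub>R x" by (simp add: defs scaleR_add_left)
  show "r *\<^sub>R s *\<^sub>R x = (r * s) *\<^sub>R x" by (simp add: defs)
  show "1 *\<^sub>R x = x" by (simp add: defs)
  show "inner x y = inner y x" by (simp add: defs inner_commute)
  show "inner (x + y) z = inner x z + inner y z" by (simp add: defs inner_add_left)
  show "inner (r *\<^sub>R x) y = r * inner x y" by (simp add: defs distrib_left)
  show "0 \<le> inner x x" by (simp add: defs)
  show "(inner x x = 0) = (x = 0)"
    by (cases x) (simp add: defs add_nonneg_eq_0_iff)
  show "norm x = sqrt (inner x x)" by (rule norm_complexification_def)
  show "sgn x = inverse (norm x) *\<^sub>R x" by (rule sgn_complexification_def)
  show "dist x y = norm (x - y)" by (rule dist_complexification_def)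
  show "(uniformity :: ('a complexification \<times> 'a complexification) filter) =
    (INF e\<in>{0<..}. principal {(x, y). dist x y < e})" by (rule uniformity_complexification_def)
  show "open S \<longleftrightarrow> (\<forall>x\<in>S. \<forall>\<^sub>F (x', y) in uniformity. x' = x \<longrightarrow> y \<in> S)"
    for S :: "'a complexification set" by (rule open_complexification_def)
  show "c *\<^sub>C (x + y) = c *\<^sub>C x + c *\<^sub>C y" by (simp add: defs algebra_simps)
  show "(c + d) *\<^sub>C x = c *\<^sub>C x + d *\<^sub>C x" by (simp add: defs algebra_simps)
  show "c *\<^sub>C (d *\<^sub>C x) = (c * d) *\<^sub>C x" by (simp add: defs algebra_simps)
  show "complex_of_real r *\<^sub>C x = r *\<^sub>R x" by (simp add: defs)
  show "cinner x y = cnj (cinner y x)" by (simp add: defs complex_eq_iff inner_commute)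
  show "cinner x (y + z) = cinner x y + cinner x z"
    by (simp add: defs complex_eq_iff inner_add_right)
  show "cinner x (c *\<^sub>C y) = c * cinner x y"
    by (simp add: defs complex_eq_iff algebra_simps inner_simps)
  show "Re (cinner x y) = inner x y" by (simp add: defs)
qed

end

instance complexification :: ("{real_inner, complete_space}") complex_hilbert
proof
  fix X :: "nat \<Rightarrow> 'a complexification"
  assume X: "Cauchy X"
  have n: "(norm x)\<^sup>2 = (norm (real_part x))\<^sup>2 + (norm (imag_part x))\<^sup>2" for x :: "'a complexification"
    by (simp add: power2_norm_eq_inner inner_complexification_def)
  have le: "norm (real_part x) \<le> norm x" "norm (imag_part x) \<le> norm x"
    "norm x \<le> norm (real_part x) + norm (imag_part x)" for x :: "'a complexification"
  proof -
    show "norm (real_part x) \<le> norm x" "norm (imag_part x) \<le> norm x"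
      using n[of x] by (simp_all add: power2_le_imp_le)
    have "(norm x)\<^sup>2 \<le> (norm (real_part x) + norm (imag_part x))\<^sup>2"
      using n[of x] by (simp add: power2_sum)
    then show "norm x \<le> norm (real_part x) + norm (imag_part x)"
      by (rule power2_le_imp_le) simp
  qed
  have sub: "real_part (x - y) = real_part x - real_part y"
    "imag_part (x - y) = imag_part x - imag_part y" for x y :: "'a complexification"
    by (simp_all add: minus_complexification_def)
  have "Cauchy (\<lambda>n. real_part (X n))"
  proof (rule metric_CauchyI)
    fix e :: real
    assume "0 < e"
    with X obtain M where M: "\<And>m n. m \<ge> M \<Longrightarrow> n \<ge> M \<Longrightarrow> dist (X m) (X n) < e"
      by (metis metric_CauchyD)
    then show "\<exists>M. \<forall>m\<ge>M. \<forall>n\<ge>M. dist (real_part (X m)) (real_part (X n)) < e"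
      using le(1) unfolding dist_norm sub[symmetric] by (meson le_less_trans)
  qed
  moreover have "Cauchy (\<lambda>n. imag_part (X n))"
  proof (rule metric_CauchyI)
    fix e :: real
    assume "0 < e"
    with X obtain M where M: "\<And>m n. m \<ge> M \<Longrightarrow> n \<ge> M \<Longrightarrow> dist (X m) (X n) < e"
      by (metis metric_CauchyD)
    then show "\<exists>M. \<forall>m\<ge>M. \<forall>n\<ge>M. dist (imag_part (X m)) (imag_part (X n)) < e"
      using le(2) unfolding dist_norm sub[symmetric] by (meson le_less_trans)
  qed
  ultimately obtain a b where ab: "(\<lambda>n. real_part (X n)) \<longlonglongrightarrow> a" "(\<lambda>n. imag_part (X n)) \<longlonglongrightarrow> b"
    using Cauchy_convergent convergent_def by metis
  have lim: "(\<lambda>n. norm (real_part (X n) - a) + norm (imag_part (X n) - b)) \<longlonglongrightarrow> 0"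
    using tendsto_add[OF ab(1)[THEN LIM_zero, THEN tendsto_norm_zero]
        ab(2)[THEN LIM_zero, THEN tendsto_norm_zero]] by simp
  have "norm (X n - Complexify a b) \<le> norm (real_part (X n) - a) + norm (imag_part (X n) - b)"
    for n
    using le(3)[of "X n - Complexify a b"] by (simp add: sub)
  then have "\<forall>\<^sub>F n in sequentially. norm (X n - Complexify a b)
      \<le> norm (real_part (X n) - a) + norm (imag_part (X n) - b)"
    by (rule always_eventually[OF allI])
  from Lim_null_comparison[OF this lim]
  have "(\<lambda>n. X n - Complexify a b) \<longlonglongrightarrow> 0" .
  then have "X \<longlonglongrightarrow> Complexify a b"
    by (rule LIM_zero_cancel)
  then show "convergent X"
    by (rule convergentI)
qed

abbreviation of_real_vector :: "'a::real_inner \<Rightarrow> 'a complexification"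
  where "of_real_vector x \<equiv> Complexify x 0"


section \<open>Unbounded operators and functional calculus\<close>

text \<open>
  An unbounded operator is represented by its graph, so its domain is the domain of this
  relation, its closure is the topological closure of the graph, and the composition of operators is
  relational composition (the operator applied first stands on the left of \<open>O\<close>).
\<close>

definition graph_adjoint :: "('a::complex_hilbert \<times> 'a) set \<Rightarrow> ('a \<times> 'a) set"
  where "graph_adjoint A = {(y, z). \<forall>(x, x') \<in> A. cinner y x' = cinner z x}"

text \<open>For a conjugate-linear operator the adjoint is \<open>\<langle>y, A x\<rangle> = \<langle>x, A\<^sup>* y\<rangle>\<close>.\<close>

definition graph_antiadjoint :: "('a::complex_hilbert \<times> 'a) set \<Rightarrow> ('a \<times> 'a) set"
  where "graph_antiadjoint A = {(y, z). \<forall>(x, x') \<in> A. cinner y x' = cinner x z}"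

text \<open>An adjoint is closed under addition and scaling, and it is single-valued when
  the domain is dense; so a self-adjoint graph is that of a linear operator.\<close>

definition self_adjoint :: "('a::complex_hilbert \<times> 'a) set \<Rightarrow> bool"
  where "self_adjoint A \<longleftrightarrow> closure (Domain A) = UNIV \<and> graph_adjoint A = A"

definition positive_nonsingular :: "('a::complex_hilbert \<times> 'a) set \<Rightarrow> bool"
  where "positive_nonsingular A \<longleftrightarrow> self_adjoint A \<and>
    (\<forall>(x, y) \<in> A. cinner x y \<in> \<real> \<and> 0 \<le> Re (cinner x y)) \<and>
    (\<forall>x. (x, 0) \<in> A \<longrightarrow> x = 0)"

definition orthogonal_projection :: "('a::complex_hilbert \<Rightarrow> 'a) \<Rightarrow> bool"
  where "orthogonal_projection P \<longleftrightarrow>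
    bounded_clinear P \<and> P \<circ> P = P \<and> (\<forall>x y. cinner (P x) y = cinner x (P y))"

definition projection_valued_measure :: "(real set \<Rightarrow> 'a::complex_hilbert \<Rightarrow> 'a) \<Rightarrow> bool"
  where "projection_valued_measure E \<longleftrightarrow>
    (\<forall>B \<in> sets borel. orthogonal_projection (E B)) \<and>
    E UNIV = id \<and>
    (\<forall>B \<in> sets borel. \<forall>C \<in> sets borel. E (B \<inter> C) = E B \<circ> E C) \<and>
    (\<forall>F :: nat \<Rightarrow> real set. range F \<subseteq> sets borel \<longrightarrow> disjoint_family F \<longrightarrow>
      (\<forall>x. (\<lambda>n. E (F n) x) sums E (\<Union>n. F n) x))"

definition spectral_distribution ::
    "(real set \<Rightarrow> 'a::complex_hilbert \<Rightarrow> 'a) \<Rightarrow> 'a \<Rightarrow> real measure"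
  where "spectral_distribution E x =
    measure_of UNIV (sets borel) (\<lambda>B. ennreal (Re (cinner x (E B x))))"

text \<open>
  \<open>E\<close> is the spectral measure of the self-adjoint operator \<open>A\<close>, i.e. \<open>A = \<integral> s dE(s)\<close>;
  by polarization a linear operator on a given domain is determined by its quadratic form.
\<close>

definition spectral_resolution ::
    "('a::complex_hilbert \<times> 'a) set \<Rightarrow> (real set \<Rightarrow> 'a \<Rightarrow> 'a) \<Rightarrow> bool"
  where "spectral_resolution A E \<longleftrightarrow> projection_valued_measure E \<and>
    Domain A = {x. integrable (spectral_distribution E x) (\<lambda>s. s\<^sup>2)} \<and>
    (\<forall>(x, y) \<in> A. cinner x y = complex_of_real (\<integral>s. s \<partial>spectral_distribution E x))"

text \<open>\<open>f(A)\<close> for a self-adjoint \<open>A\<close> and a Borel function \<open>f\<close> that is bounded on its spectrum.\<close>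

definition functional_calculus ::
    "('a::complex_hilbert \<times> 'a) set \<Rightarrow> (real \<Rightarrow> complex) \<Rightarrow> 'a \<Rightarrow> 'a"
  where "functional_calculus A f =
    (THE T. bounded_clinear T \<and>
      (\<exists>E. spectral_resolution A E \<and>
        (\<forall>x. integrable (spectral_distribution E x) f \<and>
             cinner x (T x) = (\<integral>s. f s \<partial>spectral_distribution E x))))"

text \<open>\<open>A\<^sup>i\<^sup>t\<close> for a positive nonsingular self-adjoint \<open>A\<close>, whose spectral measure
  lives on \<open>s > 0\<close>; values of the integrands elsewhere do not matter.\<close>

definition imaginary_power :: "('a::complex_hilbert \<times> 'a) set \<Rightarrow> real \<Rightarrow> 'a \<Rightarrow> 'a"
  where "imaginary_power A t =
    functional_calculus A (\<lambda>s. complex_of_real s powr (\<i> * complex_of_real t))"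


section \<open>Orthogonal representations of the real line\<close>

definition orthogonal_representation :: "(real \<Rightarrow> 'a::real_inner \<Rightarrow> 'a) \<Rightarrow> bool"
  where "orthogonal_representation U \<longleftrightarrow>
    (\<forall>t. orthogonal_transformation (U t)) \<and> U 0 = id \<and> (\<forall>s t. U (s + t) = U s \<circ> U t)"

definition strongly_continuous :: "(real \<Rightarrow> 'a::real_inner \<Rightarrow> 'a) \<Rightarrow> bool"
  where "strongly_continuous U \<longleftrightarrow> (\<forall>x. continuous_on UNIV (\<lambda>t. U t x))"

text \<open>
  Weak mixing of the restriction to an invariant subspace \<open>W\<close>: the zero operator lies in the
  closure of the operators \<open>U t\<close> for the weak operator topology.
\<close>

definition weakly_mixing_on :: "(real \<Rightarrow> 'a::real_inner \<Rightarrow> 'a) \<Rightarrow> 'a set \<Rightarrow> bool"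
  where "weakly_mixing_on U W \<longleftrightarrow>
    (\<forall>F e. finite F \<longrightarrow> F \<subseteq> W \<longrightarrow> e > 0 \<longrightarrow>
      (\<exists>t. \<forall>x\<in>F. \<forall>y\<in>F. \<bar>inner (U t x) y\<bar> < e))"

text \<open>
  The space is the orthogonal direct sum of \<open>N1\<close> lines spanned by the unit vectors \<open>d i\<close>,
  on which \<open>U\<close> acts trivially, of \<open>N2\<close> planes with orthonormal bases \<open>(f k, g k)\<close>, on which
  \<open>U t\<close> is the rotation by the angle \<open>t * ln (l k)\<close>, and of a weakly mixing part;
  \<open>K\<close> is the sum of the lines and planes.
\<close>

definition almost_periodic_decomposition ::
    "(real \<Rightarrow> 'a::real_inner \<Rightarrow> 'a) \<Rightarrow> enat \<Rightarrow> (nat \<Rightarrow> 'a) \<Rightarrow>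
      enat \<Rightarrow> (nat \<Rightarrow> 'a) \<Rightarrow> (nat \<Rightarrow> 'a) \<Rightarrow> (nat \<Rightarrow> real) \<Rightarrow> 'a set \<Rightarrow> bool"
  where "almost_periodic_decomposition U N1 d N2 f g l K \<longleftrightarrow>
    (let I = {i. enat i < N1}; J = {k. enat k < N2} in
      (\<forall>i\<in>I. \<forall>i'\<in>I. inner (d i) (d i') = of_bool (i = i')) \<and>
      (\<forall>k\<in>J. \<forall>k'\<in>J. inner (f k) (f k') = of_bool (k = k') \<and>
          inner (g k) (g k') = of_bool (k = k') \<and> inner (f k) (g k') = 0) \<and>
      (\<forall>i\<in>I. \<forall>k\<in>J. inner (d i) (f k) = 0 \<and> inner (d i) (g k) = 0) \<and>
      (\<forall>i\<in>I. \<forall>t. U t (d i) = d i) \<and>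
      (\<forall>k\<in>J. 0 < l k \<and> l k < 1 \<and>
        (\<forall>t. U t (f k) = cos (t * ln (l k)) *\<^sub>R f k + sin (t * ln (l k)) *\<^sub>R g k \<and>
             U t (g k) = - sin (t * ln (l k)) *\<^sub>R f k + cos (t * ln (l k)) *\<^sub>R g k)) \<and>
      K = closure (span (d ` I \<union> f ` J \<union> g ` J)) \<and>
      weakly_mixing_on U (orthogonal_comp K))"

definition almost_periodic_part :: "(real \<Rightarrow> 'a::real_inner \<Rightarrow> 'a) \<Rightarrow> 'a set"
  where "almost_periodic_part U =
    (THE K. \<exists>N1 d N2 f g l. almost_periodic_decomposition U N1 d N2 f g l K)"

text \<open>The library's \<^const>\<open>dim\<close> is 0 on infinite-dimensional spaces.\<close>

definition dim_at_least :: "nat \<Rightarrow> 'a::real_vector set \<Rightarrow> bool"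
  where "dim_at_least n K \<longleftrightarrow> (\<exists>B \<subseteq> K. independent B \<and> finite B \<and> card B = n)"


section \<open>The deformed inner product\<close>

definition complexified :: "(real \<Rightarrow> 'a \<Rightarrow> 'a) \<Rightarrow> real \<Rightarrow> 'a complexification \<Rightarrow> 'a complexification"
  where "complexified U t = map_complexification (U t)"

definition analytic_generator ::
    "(real \<Rightarrow> 'a::{real_inner, complete_space} \<Rightarrow> 'a) \<Rightarrow> ('a complexification \<times> 'a complexification) set"
  where "analytic_generator U =
    (THE A. positive_nonsingular A \<and> (\<forall>t. complexified U t = imaginary_power A t))"

definition U_inner ::
    "(real \<Rightarrow> 'a::{real_inner, complete_space} \<Rightarrow> 'a) \<Rightarrow> 'a complexification \<Rightarrow> 'a complexification \<Rightarrow> complex"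
  where "U_inner U x y =
    cinner (functional_calculus (analytic_generator U)
      (\<lambda>s. complex_of_real (2 / (1 + inverse s))) x) y"

text \<open>
  Hilbert space completions depend on terms and are therefore not types; they are determined up to
  a unique unitary operator by the canonical dense map, here \<open>j\<close> from the complexification to \<open>\<H>\<close>.
\<close>

definition U_completion ::
    "(real \<Rightarrow> 'a::{real_inner, complete_space} \<Rightarrow> 'a) \<Rightarrow> ('a complexification \<Rightarrow> 'h::complex_hilbert) \<Rightarrow> bool"
  where "U_completion U j \<longleftrightarrow> clinear j \<and> (\<forall>x y. cinner (j x) (j y) = U_inner U x y) \<and>
    closure (range j) = UNIV"


section \<open>The q-Fock space and the q-Araki-Woods algebra\<close>

definition inversions :: "nat \<Rightarrow> (nat \<Rightarrow> nat) \<Rightarrow> nat"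
  where "inversions n p = card {(i, j). i < j \<and> j < n \<and> p j < p i}"

definition q_inner :: "real \<Rightarrow> 'h::complex_hilbert list \<Rightarrow> 'h list \<Rightarrow> complex"
  where "q_inner q xs ys =
    (if length xs = length ys then
       (\<Sum>p | p permutes {..<length xs}.
          complex_of_real (q ^ inversions (length xs) p) * (\<Prod>k<length xs. cinner (xs ! k) (ys ! p k)))
     else 0)"

text \<open>
  \<open>tens\<close> exhibits \<open>'f\<close> as the completion of the algebraic sum of the tensor powers of \<open>'h\<close>
  for the \<open>q\<close>-inner product: \<open>tens [x\<^sub>1, \<dots>, x\<^sub>n]\<close> is the image of the elementary tensor
  \<open>x\<^sub>1 \<otimes> \<dots> \<otimes> x\<^sub>n\<close>, and a linear map on the algebraic tensor powers is a family of
  multilinear maps.  The vacuum vector is \<open>tens []\<close>.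
\<close>

definition q_fock_space :: "real \<Rightarrow> ('h::complex_hilbert list \<Rightarrow> 'f::complex_hilbert) \<Rightarrow> bool"
  where "q_fock_space q tens \<longleftrightarrow>
    (\<forall>xs ys. clinear (\<lambda>x. tens (xs @ x # ys))) \<and>
    (\<forall>xs ys. cinner (tens xs) (tens ys) = q_inner q xs ys) \<and>
    closure (span {c *\<^sub>C tens xs | c xs. True}) = UNIV"

definition creation :: "('h::complex_hilbert list \<Rightarrow> 'f::complex_hilbert) \<Rightarrow> 'h \<Rightarrow> 'f \<Rightarrow> 'f"
  where "creation tens x = (THE T. bounded_clinear T \<and> (\<forall>xs. T (tens xs) = tens (x # xs)))"

definition field_operator :: "('h::complex_hilbert list \<Rightarrow> 'f::complex_hilbert) \<Rightarrow> 'h \<Rightarrow> 'f \<Rightarrow> 'f"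
  where "field_operator tens x = (\<lambda>v. creation tens x v + cadjoint (creation tens x) v)"

definition commutant :: "('f::complex_hilbert \<Rightarrow> 'f) set \<Rightarrow> ('f \<Rightarrow> 'f) set"
  where "commutant S = {T. bounded_clinear T \<and> (\<forall>X\<in>S. T \<circ> X = X \<circ> T)}"

definition q_araki_woods ::
    "('a::real_inner complexification \<Rightarrow> 'h::complex_hilbert) \<Rightarrow> ('h list \<Rightarrow> 'f::complex_hilbert) \<Rightarrow> ('f \<Rightarrow> 'f) set"
  where "q_araki_woods j tens =
    commutant (commutant (range (\<lambda>x. field_operator tens (j (of_real_vector x)))))"


section \<open>Modular theory and factors\<close>

text \<open>
  Modular objects of a von Neumann algebra \<open>M\<close> with cyclic and separating unit vector \<open>w\<close>: the
  operator \<open>S\<close> is the closure of \<open>x w \<mapsto> x\<^sup>* w\<close>, the modular operator is \<open>S\<^sup>* S\<close>, and the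
  automorphism group is that of the faithful normal state \<open>\<langle>w, \<cdot> w\<rangle>\<close>.
\<close>

definition tomita_operator :: "('f::complex_hilbert \<Rightarrow> 'f) set \<Rightarrow> 'f \<Rightarrow> ('f \<times> 'f) set"
  where "tomita_operator M w = closure {(x w, cadjoint x w) | x. x \<in> M}"

definition modular_operator :: "('f::complex_hilbert \<Rightarrow> 'f) set \<Rightarrow> 'f \<Rightarrow> ('f \<times> 'f) set"
  where "modular_operator M w = tomita_operator M w O graph_antiadjoint (tomita_operator M w)"

definition modular_automorphism ::
    "('f::complex_hilbert \<Rightarrow> 'f) set \<Rightarrow> 'f \<Rightarrow> real \<Rightarrow> ('f \<Rightarrow> 'f) \<Rightarrow> ('f \<Rightarrow> 'f)"
  where "modular_automorphism M w t x =
    imaginary_power (modular_operator M w) t \<circ> x \<circ> imaginary_power (modular_operator M w) (- t)"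

definition centralizer :: "('f::complex_hilbert \<Rightarrow> 'f) set \<Rightarrow> 'f \<Rightarrow> ('f \<Rightarrow> 'f) set"
  where "centralizer M w = {x \<in> M. \<forall>t. modular_automorphism M w t x = x}"

definition scalar_operators :: "('f::complex_hilbert \<Rightarrow> 'f) set"
  where "scalar_operators = range (\<lambda>c v. c *\<^sub>C v)"

definition von_neumann_algebra :: "('f::complex_hilbert \<Rightarrow> 'f) set \<Rightarrow> bool"
  where "von_neumann_algebra N \<longleftrightarrow> (\<forall>x\<in>N. cadjoint x \<in> N) \<and> commutant (commutant N) = N"

definition factor :: "('f::complex_hilbert \<Rightarrow> 'f) set \<Rightarrow> bool"
  where "factor N \<longleftrightarrow> von_neumann_algebra N \<and> commutant N \<inter> N = scalar_operators"

end

theory Submission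
 imports Defs "HOL-Probability.Probability"
begin

notation scaleC (infixr "*C" 75)
abbreviation LIMSEQ_ascii (infixr "---->" 60)
  where "X ----> L \<equiv> (X \<longlongrightarrow> L) sequentially"

text \<open>An invariant plane of \<open>U\<close> gives an eigenvector \<open>e\<close> of the analytic generator, and
\<open>y = s(e) s(cconj e)\<close> is fixed by the modular group. Since \<open>y\<close> has no eigenvectors, by Wiener's lemma
the powers \<open>u\<^sup>n\<close> of its Cayley transform tend weakly to zero along a subsequence, and on the Fock space over the block
this forces the low degree parts of \<open>u\<^sup>n \<Omega>\<close> to vanish in norm. Since \<open>y \<Omega>\<close> also equals \<open>y' \<Omega>\<close>
for a self-adjoint \<open>y'\<close> in the commutant, with Cayley transform \<open>u'\<close>, any \<open>x\<close> in \<open>M\<close> commuting with \<open>y\<close> satisfies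
\<open>u\<^sup>n x \<Omega> = u'\<^sup>n x \<Omega>\<close>, and comparing both sides shows that \<open>x \<Omega>\<close> is annihilated by every vector orthogonal
to the block. Dimension at least 5 provides two orthogonal blocks, hence \<open>x \<Omega>\<close> is annihilated by
all vectors and \<open>x\<close> is a scalar.\<close>

section \<open>Complex Hilbert spaces\<close>

text \<open>The field of one vector of a plane is only an eigenvector of the modular group; in the
  product \<open>y\<close> the two eigenvalues cancel. The obstacle is to control \<open>y\<close>
  without computing its spectrum. The lever is that a left field commutes with a right annihilator
  up to a multiple of \<open>num q\<close>, the operator q^N with N the number of letters. Kernels
  and eigenspaces of left operators are invariant under right fields, and the commutator makes them
  orthogonal in pairs for the form <v, q^N w>; such a pair cannot have two nonzero members. In the
  same way a left annihilator commutes with right fields up to q^N, a defect that is small on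
  vectors whose low degree parts are small; this is what makes mixing effective. Right fields carry
  the weights 2 - T and T that are forced by commutation with left fields, which is the origin of
  the constant t (2 - t) in \<open>y'\<close>.\<close>

lemma scaleC_zero_right [simp]: "c *C (0::'a::complex_inner) = 0"
 using scaleC_add_right[of c 0 0] by simp

lemma scaleC_one [simp]: "1 *C (x::'a::complex_inner) = x" using scaleC_of_real[of 1 x] by simp

lemma scaleC_zero_left [simp]: "0 *C (x::'a::complex_inner) = 0" using scaleC_of_real[of 0 x] by simp

lemma scaleC_minus_one: "(-1) *C (x::'a::complex_inner) = - x" using scaleC_of_real[of "-1" x] by simp

lemma scaleC_minus_right [simp]: "c *C (- x::'a::complex_inner) = - (c *C x)"
 using scaleC_add_right[of c x "-x"] by (simp add: eq_neg_iff_add_eq_0 add.commute)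

lemma scaleC_minus_left [simp]: "(- c) *C (x::'a::complex_inner) = - (c *C x)"
 using scaleC_add_left[of c "-c" x] by (simp add: eq_neg_iff_add_eq_0 add.commute)

lemma scaleC_diff_right: "c *C (x - y::'a::complex_inner) = c *C x - c *C y"
 using scaleC_add_right[of c x "-y"] by simp

lemma scaleC_diff_left: "(c - d) *C (x::'a::complex_inner) = c *C x - d *C x"
 using scaleC_add_left[of c "-d" x] by simp

lemma scaleR_scaleC: "r *\<^sub>R (x::'a::complex_inner) = complex_of_real r *C x"
 by (simp add: scaleC_of_real)

lemma scaleC_scaleR_commute: "c *C (r *\<^sub>R (x::'a::complex_inner)) = r *\<^sub>R (c *C x)"
 by (simp add: scaleR_scaleC scaleC_scaleC mult.commute)

lemma cinner_add_left: "cinner (x + y) (z::'a::complex_inner) = cinner x z + cinner y z"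
 by (metis cinner_add_right cinner_commute complex_cnj_add)

lemma cinner_scaleC_left: "cinner (c *C x) (y::'a::complex_inner) = cnj c * cinner x y"
 by (metis cinner_scaleC_right cinner_commute complex_cnj_mult)

lemma cinner_scaleR_right: "cinner x (r *\<^sub>R (y::'a::complex_inner)) = r *\<^sub>R cinner x y"
 by (simp add: scaleR_scaleC cinner_scaleC_right scaleR_conv_of_real)

lemma cinner_scaleR_left: "cinner (r *\<^sub>R x) (y::'a::complex_inner) = r *\<^sub>R cinner x y"
 by (simp add: scaleR_scaleC cinner_scaleC_left scaleR_conv_of_real)

lemma cinner_self: "cinner x (x::'a::complex_inner) = complex_of_real ((norm x)\<^sup>2)"
proof (rule complex_eqI)
 show "Re (cinner x x) = Re (complex_of_real ((norm x)\<^sup>2))" by (simp add: Re_cinner power2_norm_eq_inner)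
 have "cinner x x = cnj (cinner x x)" by (rule cinner_commute)
 then have "Im (cinner x x) = Im (cnj (cinner x x))" by (rule arg_cong)
 then show "Im (cinner x x) = Im (complex_of_real ((norm x)\<^sup>2))" by simp
qed

lemma norm_scaleC: "norm (c *C (x::'a::complex_inner)) = cmod c * norm x"
proof -
 have "complex_of_real ((norm (c *C x))\<^sup>2) = cinner (c *C x) (c *C x)"
  by (rule cinner_self[symmetric])
 also have "\<dots> = (cnj c * c) * cinner x x" by (simp add: cinner_scaleC_left cinner_scaleC_right)
 also have "cnj c * c = complex_of_real ((cmod c)\<^sup>2)" by (metis complex_norm_square mult.commute)
 also have "cinner x x = complex_of_real ((norm x)\<^sup>2)" by (rule cinner_self)
 finally have "(norm (c *C x))\<^sup>2 = (cmod c * norm x)\<^sup>2"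
  by (simp only: of_real_mult [symmetric] of_real_eq_iff power_mult_distrib)
 then show ?thesis by (rule power2_eq_imp_eq) auto
qed

lemma cinner_Cauchy_Schwarz: "cmod (cinner x (y::'a::complex_inner)) \<le> norm x * norm y"
proof (cases "cinner x y = 0")
 case False
 \<comment> \<open>The unit phase that turns the complex inner product into its modulus, so that the
   real Cauchy-Schwarz inequality applies to \<open>c *C y\<close>.\<close>
 define c where "c = cnj (cinner x y) / cmod (cinner x y)"
 have c: "cmod c = 1" using False by (simp add: c_def norm_divide)
 have "cinner x (c *C y) = (cnj (cinner x y) * cinner x y) / cmod (cinner x y)"
  by (simp add: cinner_scaleC_right c_def)
 also have "cnj (cinner x y) * cinner x y = complex_of_real ((cmod (cinner x y))\<^sup>2)"
  by (metis complex_norm_square mult.commute)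
 also have "\<dots> / cmod (cinner x y) = complex_of_real (cmod (cinner x y))"
  using False by (simp add: power2_eq_square)
 finally have "cinner x (c *C y) = complex_of_real (cmod (cinner x y))" .
 then have "cmod (cinner x y) = inner x (c *C y)" by (metis Re_cinner Re_complex_of_real)
 also have "\<dots> \<le> norm x * norm (c *C y)" by (rule norm_cauchy_schwarz)
 finally show ?thesis by (simp add: norm_scaleC c)
qed auto

lemma bounded_bilinear_cinner: "bounded_bilinear (cinner :: 'a::complex_inner \<Rightarrow> 'a \<Rightarrow> complex)"
 by (standard; (simp add: cinner_add_left cinner_add_right cinner_scaleR_left cinner_scaleR_right)?)
  (metis cinner_Cauchy_Schwarz mult.right_neutral)

interpretation cinner: bounded_bilinear "cinner :: 'a::complex_inner \<Rightarrow> 'a \<Rightarrow> complex"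
 by (rule bounded_bilinear_cinner)

lemma bounded_bilinear_scaleC:
 "bounded_bilinear (scaleC :: complex \<Rightarrow> 'a::complex_inner \<Rightarrow> 'a)"
proof
 show "(r *\<^sub>R c) *C x = r *\<^sub>R (c *C (x::'a))" for r c x
  by (simp add: scaleR_scaleC scaleC_scaleC scaleR_conv_of_real)
 show "\<exists>K. \<forall>a (b::'a). norm (a *C b) \<le> norm a * norm b * K"
  by (metis norm_scaleC order_refl mult.right_neutral)
qed (simp_all add: scaleC_add_left scaleC_add_right scaleC_scaleR_commute)

interpretation scaleC: bounded_bilinear "scaleC :: complex \<Rightarrow> 'a::complex_inner \<Rightarrow> 'a"
 by (rule bounded_bilinear_scaleC)

declare cinner.zero_left [simp] cinner.zero_right [simp]

text \<open>The imaginary part is again a real inner product, taken at a multiple by \<i>; this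
  lifts real statements to complex ones.\<close>

lemma Im_cinner: "Im (cinner x (y::'a::complex_inner)) = - inner x (\<i> *C y)"
 unfolding Re_cinner[symmetric] cinner_scaleC_right by simp

lemma cinner_eqI:
 assumes "!!z::'a::complex_inner. cinner z x = cinner z y"
 shows "x = y"
proof -
 have "cinner (x - y) (x - y) = 0" using assms[of "x - y"] by (simp add: cinner.diff_right)
 then show ?thesis by (simp add: cinner_self)
qed

lemma cinner_eqI_left:
 assumes "!!z::'a::complex_inner. cinner x z = cinner y z"
 shows "x = y" using assms by (metis cinner_commute cinner_eqI)

section \<open>Bounded complex-linear operators\<close>

lemma clinear_boundedD: "bounded_clinear T ==> bounded_linear T" by (simp add: bounded_clinear_def)

lemma clinear_scaleC: "bounded_clinear T ==> T (c *C x) = c *C T x" by (simp add: bounded_clinear_def)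

lemma clinear_add: "bounded_clinear T ==> T (x + y) = T x + T y"
 by (simp add: bounded_clinear_def linear_simps)

lemma clinear_diff: "bounded_clinear T ==> T (x - y) = T x - T y"
 by (simp add: bounded_clinear_def linear_simps)

lemma clinear_minus: "bounded_clinear T ==> T (- x) = - T x"
 by (simp add: bounded_clinear_def linear_simps)

lemma clinear_scaleR: "bounded_clinear T ==> T (r *\<^sub>R x) = r *\<^sub>R T x"
 by (simp add: bounded_clinear_def linear_simps)

lemma clinear_zero: "bounded_clinear T ==> T 0 = 0" by (simp add: bounded_clinear_def linear_simps)

lemmas clinear_simps = clinear_scaleC clinear_add clinear_diff
 clinear_minus clinear_scaleR clinear_zero

lemma clinear_tendsto:
 "bounded_clinear T ==> (f \<longlongrightarrow> a) F ==> ((%x. T (f x)) \<longlongrightarrow> T a) F"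
 by (rule bounded_linear.tendsto[OF clinear_boundedD])

lemma clinear_bound:
 assumes "bounded_clinear T"
 obtains K where "0 \<le> K" "!!x. norm (T x) \<le> K * norm x"
 using bounded_linear.nonneg_bounded[OF clinear_boundedD[OF assms]] by (metis mult.commute)

lemma bounded_clinearI:
 assumes "!!x y. T (x + y) = T x + T y" "!!c x. T (c *C x) = c *C T x"
  and "!!x. norm (T x) \<le> K * norm x"
 shows "bounded_clinear T" unfolding bounded_clinear_def
 using assms by (auto intro!: bounded_linear_intro[where K = K] simp: scaleR_scaleC mult.commute)

lemma clinear_id: "bounded_clinear (%x. x)" by (rule bounded_clinearI[where K = 1]) auto

lemma clinear_id': "bounded_clinear id" by (rule bounded_clinearI[where K = 1]) auto

lemma clinear_const_zero: "bounded_clinear (%x. 0)" by (rule bounded_clinearI[where K = 0]) auto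

lemma clinear_compose:
 assumes "bounded_clinear S" "bounded_clinear T"
 shows "bounded_clinear (%x. S (T x))"
 using assms unfolding bounded_clinear_def by (auto intro: bounded_linear_compose)

lemma clinear_comp:
 "bounded_clinear S ==> bounded_clinear T ==> bounded_clinear (S \<circ> T)"
 unfolding comp_def by (rule clinear_compose)

lemma clinear_plus:
 assumes "bounded_clinear S" "bounded_clinear T"
 shows "bounded_clinear (%x. S x + T x)"
 using assms unfolding bounded_clinear_def by (auto intro: bounded_linear_add simp: scaleC_add_right)

lemma clinear_sub:
 assumes "bounded_clinear S" "bounded_clinear T"
 shows "bounded_clinear (%x. S x - T x)"
 using assms unfolding bounded_clinear_def by (auto intro: bounded_linear_sub simp: scaleC_diff_right)

lemma clinear_cmul:
 assumes "bounded_clinear S"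
 shows "bounded_clinear (%x. c *C S x)" using assms unfolding bounded_clinear_def
 by (auto intro!: bounded_linear_compose[OF scaleC.bounded_linear_right] simp: scaleC_scaleC mult.commute)

lemma bounded_linear_eq_on_dense:
 assumes "bounded_linear S" "bounded_linear T" "closure (span X) = UNIV"
  and "!!x. x \<in> X ==> S x = T x"
 shows "S = T"
proof
 fix v
 interpret S: bounded_linear S by fact
 interpret T: bounded_linear T by fact
 have "closed {v. S v = T v}" by (intro closed_Collect_eq linear_continuous_on assms)
 moreover have "span X \<subseteq> {v. S v = T v}" using assms(4) by (intro span_minimal subspaceI)
   (auto simp: S.add T.add S.scaleR T.scaleR S.zero T.zero)
 ultimately have "closure (span X) \<subseteq> {v. S v = T v}" by (rule closure_minimal[rotated])
 then show "S v = T v" using assms(3) by auto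
qed

lemma clinear_eq_on_dense:
 assumes "bounded_clinear S" "bounded_clinear T" "closure (span X) = UNIV"
  and "!!x. x \<in> X ==> S x = T x"
 shows "S = T" using bounded_linear_eq_on_dense[of S T X] assms by (auto dest: clinear_boundedD)

section \<open>Projections, Riesz representation and adjoints\<close>

text \<open>The bound splits into one null sequence per index. The exponent is 2 for estimates by
  the parallelogram law or by integrals of squares, and 1 for direct norm estimates.\<close>

lemma Cauchy_power_bound:
 fixes f :: "nat \<Rightarrow> 'a::metric_space"
 assumes "!!m n. dist (f m) (f n) ^ k \<le> a m + a n" and a: "a ----> 0"
 shows "Cauchy f"
proof (rule metric_CauchyI)
 fix e :: real
 assume "0 < e"
 then have "\<forall>\<^sub>F n in sequentially. a n < e ^ k / 2" using a by (intro order_tendstoD) auto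
 then obtain N where N: "!!n. n \<ge> N ==> a n < e ^ k / 2" by (auto simp: eventually_sequentially)
 have "dist (f m) (f n) < e" if "m \<ge> N" "n \<ge> N" for m n
 proof (rule power_less_imp_less_base[where n = k])
  show "dist (f m) (f n) ^ k < e ^ k" using assms(1)[of m n] N[OF that(1)] N[OF that(2)] by argo
 qed (use \<open>0 < e\<close> in simp)
 then show "\<exists>N. \<forall>m\<ge>N. \<forall>n\<ge>N. dist (f m) (f n) < e" by blast
qed

text \<open>The parallelogram law makes a minimising sequence Cauchy; its limit is a closest point,
  and minimality gives orthogonality.\<close>

lemma projection_exists:
 fixes x :: "'a::{real_inner, complete_space}"
 assumes "closed S" "subspace S"
 shows "\<exists>p\<in>S. \<forall>s\<in>S. inner (x - p) s = 0"
proof -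
 define d where "d = (INF s\<in>S. (norm (x - s))\<^sup>2)"
 have bdd: "bdd_below ((%s. (norm (x - s))\<^sup>2) ` S)" by (rule bdd_belowI[of _ 0]) auto
 have ne: "S \<noteq> {}" using subspace_0[OF assms(2)] by auto
 have d_le: "d \<le> (norm (x - s))\<^sup>2" if "s \<in> S" for s unfolding d_def using bdd that by (rule cINF_lower)
 have "\<exists>s\<in>S. (norm (x - s))\<^sup>2 < d + inverse (Suc n)" for n
 proof -
  have "(INF s\<in>S. (norm (x - s))\<^sup>2) < d + inverse (Suc n)" by (simp add: d_def)
  then show ?thesis using cINF_less_iff[OF ne bdd] by blast
 qed
 then obtain s where s: "!!n. s n \<in> S" "!!n. (norm (x - s n))\<^sup>2 < d + inverse (Suc n)" by metis
 have arith: "2 * a + 2 * b - 4 * c \<le> 2 * (d + i) + 2 * (d + k) - 4 * d"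
  if "a < d + i" "b < d + k" "d \<le> c" for a b c i k :: real using that by (smt (verit))
 have par: "(norm (s m - s n))\<^sup>2 \<le> 2 * inverse (Suc m) + 2 * inverse (Suc n)" for m n
 proof -
  have mid: "(1/2) *\<^sub>R (s m + s n) \<in> S" using s(1) assms(2) by (simp add: subspace_add subspace_scale)
  have "(norm (s m - s n))\<^sup>2 = 2 * (norm (x - s m))\<^sup>2 + 2 * (norm (x - s n))\<^sup>2
    - 4 * (norm (x - (1/2) *\<^sub>R (s m + s n)))\<^sup>2"
   unfolding power2_norm_eq_inner by (simp add: inner_simps inner_commute field_simps)
  also have "\<dots> \<le> 2 * (d + inverse (Suc m)) + 2 * (d + inverse (Suc n)) - 4 * d"
   by (rule arith[OF s(2) s(2) d_le[OF mid]])
  finally show ?thesis by simp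
 qed
 have "Cauchy s"
 proof (rule Cauchy_power_bound[where k = 2])
  show "(dist (s m) (s n))\<^sup>2 \<le> 2 * inverse (Suc m) + 2 * inverse (Suc n)" for m n
   using par by (simp add: dist_norm)
  show "(%n. 2 * inverse (real (Suc n))) ----> 0"
   by (rule tendsto_mult_right_zero[OF LIMSEQ_inverse_real_of_nat])
 qed
 then obtain p where p: "s ----> p" using Cauchy_convergent convergent_def by blast
 have "p \<in> S" using closed_sequentially[OF assms(1) _ p] s(1) by blast
 have "(%n. (norm (x - s n))\<^sup>2) ----> (norm (x - p))\<^sup>2" by (intro tendsto_intros p)
 moreover have "(%n. d + inverse (real (Suc n))) ----> d + 0"
  by (intro tendsto_intros LIMSEQ_inverse_real_of_nat)
 ultimately have "(norm (x - p))\<^sup>2 \<le> d + 0" using s(2) by (intro LIMSEQ_le) (auto intro: less_imp_le)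
 then have min: "(norm (x - p))\<^sup>2 \<le> (norm (x - t))\<^sup>2" if "t \<in> S" for t using d_le[OF that] by linarith
 have "inner (x - p) t = 0" if "t \<in> S" for t
 proof (rule ccontr)
  assume ne: "inner (x - p) t \<noteq> 0"
  \<comment> \<open>The coefficient of the projection of x - p onto t: moving p along t by it would
    lower the squared distance by \<open>(inner (x - p) t)\<^sup>2 / inner t t\<close>.\<close>
  define a where "a = inner (x - p) t / inner t t"
  have tt: "inner t t > 0" using ne by (metis inner_gt_zero_iff inner_zero_right)
  have "p + a *\<^sub>R t \<in> S" using \<open>p \<in> S\<close> that assms(2) by (simp add: subspace_add subspace_scale)
  then have "(norm (x - p))\<^sup>2 \<le> (norm (x - (p + a *\<^sub>R t)))\<^sup>2" by (rule min)
  also have "\<dots> = (norm ((x - p) - a *\<^sub>R t))\<^sup>2" by (simp add: algebra_simps)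
  also have "\<dots> = (norm (x - p))\<^sup>2 - 2 * a * inner (x - p) t + a\<^sup>2 * inner t t"
   unfolding power2_norm_eq_inner by (simp add: inner_simps inner_commute power2_eq_square algebra_simps)
  also have "\<dots> = (norm (x - p))\<^sup>2 - (inner (x - p) t)\<^sup>2 / inner t t"
   using tt by (simp add: a_def power2_eq_square field_simps)
  finally show False using ne tt by (auto simp: divide_le_0_iff)
 qed
 then show ?thesis using \<open>p \<in> S\<close> by blast
qed

lemma subspace_closure:
 fixes S :: "'a::real_normed_vector set"
 assumes "subspace S"
 shows "subspace (closure S)"
proof (rule subspaceI)
 show "0 \<in> closure S" using subspace_0[OF assms] closure_subset by blast
next
 fix x y
 assume "x \<in> closure S" "y \<in> closure S"
 then obtain f g where "!!n. f n \<in> S" "f ----> x" "!!n. g n \<in> S" "g ----> y" unfolding closure_sequential by blast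
 then show "x + y \<in> closure S" unfolding closure_sequential
  by (intro exI[of _ "%n. f n + g n"]) (auto intro: tendsto_add subspace_add assms)
next
 fix c x
 assume "x \<in> closure S"
 then obtain f where "!!n. f n \<in> S" "f ----> x" unfolding closure_sequential by blast
 then show "c *\<^sub>R x \<in> closure S" unfolding closure_sequential
  by (intro exI[of _ "%n. c *\<^sub>R f n"]) (auto intro: tendsto_scaleR tendsto_const subspace_scale assms)
qed

lemma dense_if_orthogonal_trivial:
 fixes X :: "'a::{real_inner, complete_space} set"
 assumes "!!v. (!!x. x \<in> X ==> inner v x = 0) ==> v = 0"
 shows "closure (span X) = UNIV"
proof -
 have "v \<in> closure (span X)" for v
 proof -
  obtain p where p: "p \<in> closure (span X)" "\<forall>s\<in>closure (span X). inner (v - p) s = 0"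
   using projection_exists[of "closure (span X)" v] by (auto intro: subspace_closure)
  have "v - p = 0" using p(2) by (intro assms) (meson closure_subset span_base subsetD)
  then show ?thesis using p(1) by simp
 qed
 then show ?thesis by auto
qed

lemma orthogonal_to_dense:
 fixes v :: "'a::real_inner"
 assumes "closure (span X) = UNIV" "!!x. x \<in> X ==> inner v x = 0"
 shows "v = 0"
proof -
 have "inner v = (%x. 0)"
  using bounded_linear_eq_on_dense[OF bounded_linear_inner_right bounded_linear_zero assms(1)] assms(2)
  by blast
 then show ?thesis by (metis inner_eq_zero_iff)
qed

lemma corthogonal_to_dense:
 fixes v :: "'a::complex_inner"
 assumes "closure (span X) = UNIV" "!!x. x \<in> X ==> cinner v x = 0"
 shows "v = 0" using orthogonal_to_dense[OF assms(1)] assms(2) by (metis Re_cinner zero_complex.sel(1))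

lemma Riesz_real:
 fixes f :: "'a::{real_inner, complete_space} \<Rightarrow> real"
 assumes "bounded_linear f"
 shows "\<exists>z. \<forall>x. f x = inner z x"
proof (cases "\<forall>x. f x = 0")
 case True
 then show ?thesis by (auto intro: exI[of _ 0])
next
 case False
 interpret bounded_linear f by fact
 obtain x where x: "f x \<noteq> 0" using False by auto
 have "closed {v. f v = 0}" by (intro closed_Collect_eq linear_continuous_on assms continuous_on_const)
 moreover have "subspace {v. f v = 0}" by (rule subspaceI) (auto simp: add scaleR zero)
 ultimately obtain p where p: "f p = 0" "!!s. f s = 0 ==> inner (x - p) s = 0"
  using projection_exists[of "{v. f v = 0}" x] by auto
 \<comment> \<open>The component of x orthogonal to the kernel of f; a multiple of it represents
   f.\<close>
 define w where "w = x - p"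
 have fw: "f w = f x" by (simp add: w_def diff p)
 then have w0: "inner w w \<noteq> 0" using x zero by auto
 have "f y = inner ((f w / inner w w) *\<^sub>R w) y" for y
 proof -
  have "f (y - (f y / f w) *\<^sub>R w) = 0" using x fw by (simp add: diff scaleR)
  then have "inner w (y - (f y / f w) *\<^sub>R w) = 0" using p(2) w_def by blast
  then show ?thesis using w0 x fw by (simp add: inner_simps field_simps)
 qed
 then show ?thesis by blast
qed

text \<open>The real part of f is represented by some z, and complex linearity carries this over to
  the imaginary part through \<open>\<i> *C x\<close>.\<close>

lemma Riesz_complex:
 fixes f :: "'a::complex_hilbert \<Rightarrow> complex"
 assumes "bounded_linear f" "!!c x. f (c *C x) = c * f x"
 shows "\<exists>z. \<forall>x. f x = cinner z x"
proof -
 obtain z where z: "!!x. Re (f x) = inner z x"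
  using Riesz_real[OF bounded_linear_compose[OF bounded_linear_Re assms(1)]] by auto
 have "f x = cinner z x" for x
 proof (rule complex_eqI)
  show "Re (f x) = Re (cinner z x)" by (simp add: z Re_cinner)
  show "Im (f x) = Im (cinner z x)" using z[of "\<i> *C x"] by (simp add: assms(2) Im_cinner)
 qed
 then show ?thesis by blast
qed

lemma cadjoint_exists:
 fixes T :: "'a::complex_hilbert \<Rightarrow> 'a"
 assumes T: "bounded_clinear T"
 shows "\<exists>S. bounded_clinear S \<and> (\<forall>x y. cinner (S x) y = cinner x (T y))"
proof -
 have "\<exists>z. \<forall>y. cinner x (T y) = cinner z y" for x using T by (intro Riesz_complex)
   (auto simp: clinear_simps cinner_scaleC_right
    intro: bounded_linear_compose[OF cinner.bounded_linear_right] clinear_boundedD)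
 then obtain S where S: "!!x y. cinner x (T y) = cinner (S x) y" by metis
 obtain K where K: "0 \<le> K" "!!x. norm (T x) \<le> K * norm x" using clinear_bound[OF T] by blast
 have "bounded_clinear S"
 proof (rule bounded_clinearI[where K = K])
  show "S (x + y) = S x + S y" for x y by (rule cinner_eqI_left) (simp add: S[symmetric] cinner_add_left)
  show "S (c *C x) = c *C S x" for c x
   by (rule cinner_eqI_left) (simp add: S[symmetric] cinner_scaleC_left)
  show "norm (S x) \<le> K * norm x" for x
  proof (cases "S x = 0")
   case False
   have "(norm (S x))\<^sup>2 = cmod (cinner (S x) (S x))" by (simp add: cinner_self norm_power)
   also have "\<dots> = cmod (cinner x (T (S x)))" by (simp add: S)
   also have "\<dots> \<le> norm x * norm (T (S x))" by (rule cinner_Cauchy_Schwarz)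
   also have "\<dots> \<le> norm x * (K * norm (S x))" by (intro mult_left_mono K) auto
   finally show ?thesis using False by (simp add: power2_eq_square mult_ac)
  qed (use K in auto)
 qed
 then show ?thesis using S by metis
qed

lemma cadjoint_unique:
 assumes "bounded_clinear S" "!!x y. cinner (S x) y = cinner x (T y)"
 shows "cadjoint T = S" unfolding cadjoint_def
proof (rule the_equality)
 show "bounded_clinear S \<and> (\<forall>x y. cinner (S x) y = cinner x (T y))" using assms by blast
 show "S' = S" if "bounded_clinear S' \<and> (\<forall>x y. cinner (S' x) y = cinner x (T y))" for S'
  using that assms(2) by (intro ext cinner_eqI_left) simp
qed

lemma
 assumes "bounded_clinear T"
 shows clinear_cadjoint: "bounded_clinear (cadjoint T)"
  and cinner_cadjoint_left: "cinner (cadjoint T x) y = cinner x (T y)"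
  and cinner_cadjoint_right: "cinner x (cadjoint T y) = cinner (T x) y"
proof -
 obtain S where S: "bounded_clinear S" "!!x y. cinner (S x) y = cinner x (T y)"
  using cadjoint_exists[OF assms] by blast
 then have eq: "cadjoint T = S" by (rule cadjoint_unique)
 show "bounded_clinear (cadjoint T)" "cinner (cadjoint T x) y = cinner x (T y)" using S eq by auto
 then show "cinner x (cadjoint T y) = cinner (T x) y" using S eq by (metis cinner_commute)
qed

lemma cadjoint_cadjoint: "bounded_clinear T ==> cadjoint (cadjoint T) = T"
 by (rule cadjoint_unique) (auto simp: cinner_cadjoint_right)

lemma cadjoint_comp:
 "bounded_clinear S ==> bounded_clinear T ==> cadjoint (S \<circ> T) = cadjoint T \<circ> cadjoint S"
 by (rule cadjoint_unique) (auto simp: cinner_cadjoint_left intro: clinear_comp clinear_cadjoint)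

text \<open>Polarization: the quadratic form of the difference at x + y and at x + \<i> y isolates
  the sesquilinear form. The functional calculus is specified by quadratic forms, so this is its
  uniqueness principle.\<close>

lemma clinear_ext_cinner:
 assumes "bounded_clinear S" "bounded_clinear T" "!!x. cinner x (S x) = cinner x (T x)"
 shows "S = T"
proof
 fix y
 define D where "D = (%x. S x - T x)"
 have D: "bounded_clinear D" unfolding D_def using assms by (intro clinear_sub)
 have q: "cinner x (D x) = 0" for x using assms(3) by (simp add: D_def cinner.diff_right)
 have "cinner x (D y) = 0" for x
 proof -
  have 1: "cinner x (D y) + cinner y (D x) = 0" using q[of "x + y"] q[of x] q[of y] D
   by (simp add: clinear_simps cinner_add_left cinner_add_right add.commute)
  have "\<i> * cinner x (D y) - \<i> * cinner y (D x) = 0" using q[of "x + \<i> *C y"] q[of x] q[of y] D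
   by (simp add: clinear_simps cinner_add_left cinner_add_right cinner_scaleC_left
     cinner_scaleC_right)
  then have 2: "cinner x (D y) - cinner y (D x) = 0" by (simp add: right_diff_distrib[symmetric])
  have "2 * cinner x (D y) = (cinner x (D y) + cinner y (D x)) + (cinner x (D y) - cinner y (D x))"
   by simp
  then show ?thesis unfolding 1 2 by simp
 qed
 then have "D y = 0" by (intro cinner_eqI) simp
 then show "S y = T y" by (simp add: D_def)
qed

section \<open>Complex subspaces and orthogonal projections\<close>

definition csubspace :: "'a::complex_inner set \<Rightarrow> bool"
 where "csubspace S \<longleftrightarrow> subspace S \<and> (\<forall>c. \<forall>x\<in>S. c *C x \<in> S)"

lemma csubspace_closure:
 assumes "csubspace S"
 shows "csubspace (closure S)"
proof -
 have "c *C x \<in> closure S" if "x \<in> closure S" for c x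
 proof -
  have "(%x. c *C x) ` closure S \<subseteq> closure ((%x. c *C x) ` S)"
   by (intro closure_bounded_linear_image_subset scaleC.bounded_linear_right)
  also have "\<dots> \<subseteq> closure S" using assms by (intro closure_mono) (auto simp: csubspace_def)
  finally show ?thesis using that by auto
 qed
 then show ?thesis using assms by (auto simp: csubspace_def intro: subspace_closure)
qed

lemma csubspace_span:
 assumes "!!c x. x \<in> X ==> c *C x \<in> X"
 shows "csubspace (span X)"
proof -
 have "c *C x \<in> span X" if "x \<in> span X" for c x using that
 proof (induction rule: span_induct_alt)
  case (step r y z)
  have "r *\<^sub>R c *C y \<in> span X" using assms step(1) by (intro span_scale span_base)
  then show ?case using step by (simp add: scaleC_add_right scaleC_scaleR_commute span_add)
 qed (simp add: span_zero)
 then show ?thesis by (auto simp: csubspace_def)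
qed

text \<open>The subspace contains \<i> s along with s, and real orthogonality to \<i> s is the
  vanishing of the imaginary part.\<close>

lemma corthogonal_if_orthogonal:
 fixes S :: "'a::complex_inner set"
 assumes "csubspace S" "!!s. s \<in> S ==> inner v s = 0" "s \<in> S"
 shows "cinner v s = 0" using assms by (auto simp: csubspace_def complex_eq_iff Re_cinner Im_cinner)

lemma orthogonal_projection_onto:
 fixes S :: "'a::complex_hilbert set"
 assumes "closed S" "csubspace S"
 obtains P where "orthogonal_projection P" "!!x. P x \<in> S" "!!x. x \<in> S ==> P x = x"
  "!!x s. s \<in> S ==> cinner s (x - P x) = 0"
proof -
 have S: "subspace S" "!!c x. x \<in> S ==> c *C x \<in> S" using assms(2) by (auto simp: csubspace_def)
 have "\<exists>p. p \<in> S \<and> (\<forall>s\<in>S. inner (x - p) s = 0)" for x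
  using projection_exists[OF assms(1) S(1), of x] by blast
 then obtain P where P: "!!x. P x \<in> S" "!!x s. s \<in> S ==> inner (x - P x) s = 0" by metis
 have Pc: "cinner (x - P x) s = 0" if "s \<in> S" for x s
  using corthogonal_if_orthogonal[OF assms(2) P(2) that] by blast
 then have Pc': "cinner s (x - P x) = 0" if "s \<in> S" for x s
  using that by (metis cinner_commute complex_cnj_zero)
 \<comment> \<open>Linearity is read off from uniqueness: a point of S with orthogonal remainder is
   the projection.\<close>
 have uniq: "P x = p" if "p \<in> S" "!!s. s \<in> S ==> cinner s (x - p) = 0" for x p
 proof -
  have *: "P x - p \<in> S" using P(1) that(1) S(1) by (simp add: subspace_diff)
  have "cinner (P x - p) (P x - p) = cinner (P x - p) (x - p) - cinner (P x - p) (x - P x)"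
   by (simp add: cinner.diff_right)
  also have "\<dots> = 0" using that(2)[OF *] Pc'[OF *] by simp
  finally show ?thesis by (simp add: cinner_self)
 qed
 have P_id: "P x = x" if "x \<in> S" for x using that by (intro uniq) auto
 have "bounded_clinear P"
 proof (rule bounded_clinearI[where K = 1])
  show "P (x + y) = P x + P y" for x y
  proof (rule uniq)
   show "P x + P y \<in> S" using P(1) S(1) by (simp add: subspace_add)
   have "x + y - (P x + P y) = (x - P x) + (y - P y)" by simp
   then show "cinner s (x + y - (P x + P y)) = 0" if "s \<in> S" for s
    using Pc'[OF that] by (simp only: cinner_add_right) simp
  qed
  show "P (c *C x) = c *C P x" for c x
   using P(1) S Pc' by (intro uniq) (simp_all add: scaleC_diff_right[symmetric] cinner_scaleC_right)
  show "norm (P x) \<le> 1 * norm x" for x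
  proof -
   have "inner (x - P x) (P x) = 0" using P by blast
   then have "(norm x)\<^sup>2 = (norm (P x))\<^sup>2 + (norm (x - P x))\<^sup>2"
    unfolding power2_norm_eq_inner by (simp add: inner_simps inner_commute)
   then show ?thesis by (simp add: power2_le_imp_le)
  qed
 qed
 moreover have "P \<circ> P = P" using P(1) P_id by auto
 moreover have "cinner (P x) y = cinner x (P y)" for x y
 proof -
  have "cinner (P x) (y - P y) = 0" "cinner (x - P x) (P y) = 0" using Pc Pc' P(1) by auto
  then show ?thesis by (simp add: cinner.diff_right cinner.diff_left)
 qed
 ultimately have "orthogonal_projection P" by (auto simp: orthogonal_projection_def)
 then show ?thesis using that P(1) P_id Pc' by blast
qed

lemma csubspace_all_if_complement_trivial:
 fixes S :: "'a::complex_hilbert set"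
 assumes "closed S" "subspace S" "!!v. (!!s. s \<in> S ==> inner v s = 0) ==> v = 0"
 shows "S = UNIV"
 using dense_if_orthogonal_trivial[of S] assms by (simp add: span_eq_iff[THEN iffD2] closure_closed)

section \<open>Spectral measures of unitary operators\<close>

lemma tendsto_zero_norm_square:
 fixes f :: "'b \<Rightarrow> 'a::real_normed_vector"
 assumes "((%n. (norm (f n))\<^sup>2) \<longlongrightarrow> 0) F"
 shows "(f \<longlongrightarrow> 0) F"
proof -
 have "((%n. sqrt ((norm (f n))\<^sup>2)) \<longlongrightarrow> sqrt 0) F" by (intro tendsto_intros assms)
 then show ?thesis by (simp add: tendsto_norm_zero_iff)
qed

lemma tendsto_zero_norm_square_le:
 fixes f :: "nat \<Rightarrow> 'a::real_normed_vector"
 assumes "!!n. (norm (f n))\<^sup>2 \<le> g n" "g ----> 0"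
 shows "f ----> 0"
proof (rule tendsto_zero_norm_square, rule tendsto_sandwich[OF _ _ tendsto_const assms(2)])
 show "\<forall>\<^sub>F n in sequentially. 0 \<le> (norm (f n))\<^sup>2" "\<forall>\<^sub>F n in sequentially. (norm (f n))\<^sup>2 \<le> g n"
  using assms(1) by auto
qed

section \<open>Fejer densities and the Herglotz measure of an isometry\<close>

lemma integral_cis:
 "(\<integral>t. indicator {0..2*pi} t *\<^sub>R cis (of_int d * t) \<partial>lborel) = (if d = 0 then 2 * pi else 0)"
proof (cases "d = 0")
 case True
 have "(\<integral>t. indicator {0..2*pi} t *\<^sub>R (1::complex) \<partial>lborel) = complex_of_real (2*pi) - complex_of_real 0"
  by (rule integral_FTC_atLeastAtMost) (auto intro!: derivative_eq_intros has_vector_derivative_of_real)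
 then show ?thesis using True by simp
next
 case False
 define F where "F t = - \<i> / of_int d * cis (of_int d * t)" for t
 have "(\<integral>t. indicator {0..2*pi} t *\<^sub>R cis (of_int d * t) \<partial>lborel) = F (2*pi) - F 0"
 proof (rule integral_FTC_atLeastAtMost)
  show "(F has_vector_derivative cis (of_int d * t)) (at t within {0..2*pi})" for t
   using False unfolding F_def has_vector_derivative_def
   by (auto intro!: derivative_eq_intros simp: scaleR_conv_of_real field_simps)
  show "continuous_on {0..2*pi} (%t. cis (of_int d * t))"
   by (auto simp: cis_conv_exp intro!: continuous_intros)
 qed auto
 also have "cis (of_int d * (2 * pi)) = 1" using cis_multiple_2pi[of "of_int d"] by (simp add: mult_ac)
 then have "F (2*pi) - F 0 = 0" by (simp add: F_def)
 finally show ?thesis using False by simp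
qed

lemma set_integrable_cis:
 "integrable lborel (%t. indicator {0..2*pi} t *\<^sub>R cis (of_int d * t))"
proof -
 have "continuous_on {0..2*pi} (%t. cis (of_int d * t))"
  by (auto simp: cis_conv_exp intro!: continuous_intros)
 from borel_integrable_atLeastAtMost'[OF this] show ?thesis by (simp add: set_integrable_def)
qed

text \<open>Only the difference of the exponents matters. Both powers are raised by a common amount
  and then lowered by another, so no inverse of W occurs.\<close>

lemma isometry_power_cinner:
 fixes W :: "'a::complex_hilbert \<Rightarrow> 'a"
 assumes "!!x y. cinner (W x) (W y) = cinner x y" and "j + m = k + n"
 shows "cinner ((W ^^ j) x) ((W ^^ k) x) = cinner ((W ^^ n) x) ((W ^^ m) x)"
proof -
 have pow: "cinner ((W ^^ i) x) ((W ^^ i) y) = cinner x y" for i x y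
  by (induction i) (auto simp: assms(1))
 have "cinner ((W ^^ j) x) ((W ^^ k) x) = cinner ((W ^^ (m + j)) x) ((W ^^ (m + k)) x)"
  by (simp add: funpow_add pow)
 also have "m + j = k + n" using assms(2) by simp
 also have "m + k = k + m" by simp
 finally show ?thesis by (simp only: funpow_add o_apply pow)
qed

text \<open>The Fejer mean of the Fourier series whose coefficients are the inner products of powers
  of W at x. As a squared norm it is visibly nonnegative.\<close>

definition fejer_density :: "('a::complex_hilbert \<Rightarrow> 'a) \<Rightarrow> 'a \<Rightarrow> nat \<Rightarrow> real \<Rightarrow> real"
 where "fejer_density W x N t = indicator {0..2*pi} t *
  (norm (\<Sum>k<N. cis (- real k * t) *C (W ^^ k) x))\<^sup>2 / (2 * pi * N)"

lemma fejer_density_measurable [measurable]: "fejer_density W x N \<in> borel_measurable borel"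
proof -
 have "continuous_on UNIV (%t. norm (\<Sum>k<N. cis (- real k * t) *C (W ^^ k) x))"
  by (auto simp: cis_conv_exp intro!: continuous_intros
    bounded_linear.continuous_on[OF scaleC.bounded_linear_left])
 then have [measurable]: "(%t. norm (\<Sum>k<N. cis (- real k * t) *C (W ^^ k) x)) \<in> borel_measurable borel"
  by (rule borel_measurable_continuous_onI)
 show ?thesis unfolding fejer_density_def by measurable
qed

text \<open>The number of index pairs below N with difference n - m, that is N - |n - m| while this
  is positive. Divided by N it is the Fejer factor of a Fourier coefficient.\<close>

definition fejer_count :: "nat \<Rightarrow> nat \<Rightarrow> nat \<Rightarrow> real"
 where "fejer_count m n N = (\<Sum>j<N. \<Sum>k<N. of_bool (j + m = k + n))"

lemma fejer_count_bounds: "real N - m - n \<le> fejer_count m n N" "fejer_count m n N \<le> real N"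
proof -
 have inner: "(\<Sum>k<N. of_bool (j + m = k + n)) = (of_bool (n \<le> j + m \<and> j + m < N + n) :: real)" for j
 proof -
  have "(\<Sum>k<N. of_bool (j + m = k + n)) = (\<Sum>k\<in>{k\<in>{..<N}. j + m = k + n}. 1::real)"
   unfolding of_bool_def by (rule sum.inter_filter[symmetric]) simp
  also have "{k\<in>{..<N}. j + m = k + n} = (if n \<le> j + m \<and> j + m < N + n then {j + m - n} else {})" by auto
  finally show ?thesis by simp
 qed
 have eq: "fejer_count m n N = card {j. j < N \<and> n \<le> j + m \<and> j + m < N + n}"
 proof -
  have "fejer_count m n N = (\<Sum>j<N. of_bool (n \<le> j + m \<and> j + m < N + n))"
   by (simp add: fejer_count_def inner)
  also have "\<dots> = (\<Sum>j\<in>{j\<in>{..<N}. n \<le> j + m \<and> j + m < N + n}. 1)"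
   unfolding of_bool_def by (rule sum.inter_filter[symmetric]) simp
  finally show ?thesis by simp
 qed
 have "card {j. j < N \<and> n \<le> j + m \<and> j + m < N + n} \<le> card {..<N}" by (intro card_mono) auto
 then show "fejer_count m n N \<le> real N" by (simp add: eq)
 have "card {n..<N - m} \<le> card {j. j < N \<and> n \<le> j + m \<and> j + m < N + n}" by (intro card_mono) auto
 then show "real N - m - n \<le> fejer_count m n N" unfolding eq by simp
qed

lemma fejer_count_limit: "(%N. fejer_count m n (Suc N) / Suc N) ----> 1"
proof (rule tendsto_sandwich)
 have "(%N. 1 - (real m + n) * inverse (real (Suc N))) ----> 1 - (real m + n) * 0"
  by (intro tendsto_intros LIMSEQ_inverse_real_of_nat)
 then show "(%N. 1 - (real m + n) * inverse (real (Suc N))) ----> 1" by simp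
 show "(%N. 1::real) ----> 1" by simp
 show "\<forall>\<^sub>F N in sequentially. fejer_count m n (Suc N) / Suc N \<le> 1"
  using fejer_count_bounds(2)[of m n] by (intro always_eventually) (simp add: divide_le_eq_1 del: of_nat_Suc)
 show "\<forall>\<^sub>F N in sequentially. 1 - (real m + n) * inverse (real (Suc N)) \<le> fejer_count m n (Suc N) / Suc N"
 proof (intro always_eventually allI)
  fix N
  have "1 - (real m + n) * inverse (real (Suc N)) = (real (Suc N) - m - n) / Suc N"
   by (simp add: field_simps del: of_nat_Suc)
  also have "\<dots> \<le> fejer_count m n (Suc N) / Suc N" by (intro divide_right_mono fejer_count_bounds) simp
  finally show "1 - (real m + n) * inverse (real (Suc N)) \<le> fejer_count m n (Suc N) / Suc N" .
 qed
qed

text \<open>Expanding the squared norm gives exponentials of integer frequencies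
  \<open>d j k\<close>. Over a full period only frequency 0 survives, and all surviving terms carry
  the same inner product.\<close>

lemma fejer_moment:
 fixes W :: "'a::complex_hilbert \<Rightarrow> 'a"
 assumes W: "!!x y. cinner (W x) (W y) = cinner x y"
 shows "integrable lborel (%t. fejer_density W x N t *\<^sub>R (cis t ^ m * cnj (cis t) ^ n))"
  and "(\<integral>t. fejer_density W x N t *\<^sub>R (cis t ^ m * cnj (cis t) ^ n) \<partial>lborel) =
   complex_of_real (fejer_count m n N / N) * cinner ((W ^^ n) x) ((W ^^ m) x)"
proof -
 define c where "c j k = cinner ((W ^^ j) x) ((W ^^ k) x) / (2 * pi * N)" for j k
 define d where "d j k = int j + int m - int k - int n" for j k
 have eq: "fejer_density W x N t *\<^sub>R (cis t ^ m * cnj (cis t) ^ n) =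
   (\<Sum>j<N. \<Sum>k<N. c j k * (indicator {0..2*pi} t *\<^sub>R cis (of_int (d j k) * t)))" for t
 proof -
  have norm_sq: "complex_of_real ((norm (\<Sum>k<N. cis (- real k * t) *C (W ^^ k) x))\<^sup>2) =
    (\<Sum>j<N. \<Sum>k<N. cis (real j * t) * (cis (- real k * t) * cinner ((W ^^ j) x) ((W ^^ k) x)))"
   unfolding cinner_self[symmetric] cinner.sum_left cinner.sum_right
   by (subst sum.swap) (simp add: cinner_scaleC_left cinner_scaleC_right cis_cnj mult_ac)
  have phase: "cis (real j * t) * (cis (- real k * t) * z) * (cis t ^ m * cnj (cis t) ^ n)
    = z * cis (of_int (d j k) * t)" for j k z
  proof -
   have "cis t ^ m * cnj (cis t) ^ n = cis (real m * t + real n * (- t))"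
    by (simp only: cis_cnj Complex.DeMoivre cis_mult)
   moreover have "cis (real j * t) * cis (- real k * t) * cis (real m * t + real n * (- t)) =
     cis (of_int (d j k) * t)"
    unfolding cis_mult by (simp add: d_def algebra_simps)
   ultimately show ?thesis by (metis mult.assoc mult.commute)
  qed
  have "fejer_density W x N t *\<^sub>R (cis t ^ m * cnj (cis t) ^ n) =
    complex_of_real (indicator {0..2*pi} t / (2 * pi * N)) *
    (complex_of_real ((norm (\<Sum>k<N. cis (- real k * t) *C (W ^^ k) x))\<^sup>2) * (cis t ^ m * cnj (cis t) ^ n))"
   by (simp add: fejer_density_def scaleR_conv_of_real)
  also have "\<dots> = (\<Sum>j<N. \<Sum>k<N. complex_of_real (indicator {0..2*pi} t / (2 * pi * N)) *
    (cis (real j * t) * (cis (- real k * t) * cinner ((W ^^ j) x) ((W ^^ k) x)) * (cis t ^ m * cnj (cis t) ^ n)))"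
   by (simp only: norm_sq sum_distrib_left sum_distrib_right)
  also have "\<dots> = (\<Sum>j<N. \<Sum>k<N. c j k * (indicator {0..2*pi} t *\<^sub>R cis (of_int (d j k) * t)))"
   unfolding phase by (simp add: c_def scaleR_conv_of_real mult_ac)
  finally show ?thesis .
 qed
 have int: "integrable lborel (%t. c j k * (indicator {0..2*pi} t *\<^sub>R cis (of_int (d j k) * t)))" for j k
  using set_integrable_cis by (rule integrable_mult_right)
 show "integrable lborel (%t. fejer_density W x N t *\<^sub>R (cis t ^ m * cnj (cis t) ^ n))"
  unfolding eq by (intro Bochner_Integration.integrable_sum int)
 have "(\<integral>t. fejer_density W x N t *\<^sub>R (cis t ^ m * cnj (cis t) ^ n) \<partial>lborel) =
   (\<Sum>j<N. \<integral>t. (\<Sum>k<N. c j k * (indicator {0..2*pi} t *\<^sub>R cis (of_int (d j k) * t))) \<partial>lborel)"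
  unfolding eq by (rule Bochner_Integration.integral_sum) (intro Bochner_Integration.integrable_sum int)
 also have "\<dots> = (\<Sum>j<N. \<Sum>k<N. \<integral>t. c j k * (indicator {0..2*pi} t *\<^sub>R cis (of_int (d j k) * t)) \<partial>lborel)"
  by (intro sum.cong refl Bochner_Integration.integral_sum int)
 also have "\<dots> = (\<Sum>j<N. \<Sum>k<N. c j k * (if d j k = 0 then 2 * pi else 0))"
  by (simp only: integral_mult_right_zero integral_cis)
 also have "\<dots> = (\<Sum>j<N. \<Sum>k<N. of_bool (j + m = k + n) * cinner ((W ^^ n) x) ((W ^^ m) x) / N)"
 proof (intro sum.cong refl)
  fix j k
  show "c j k * (if d j k = 0 then 2 * pi else 0) =
    of_bool (j + m = k + n) * cinner ((W ^^ n) x) ((W ^^ m) x) / N"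
  proof (cases "j + m = k + n")
   case True
   then show ?thesis using isometry_power_cinner[of W j m k n x, OF W True] by (simp add: c_def d_def)
  next
   case False
   then have "d j k \<noteq> 0" by (auto simp: d_def)
   then show ?thesis using False by simp
  qed
 qed
 also have "\<dots> = complex_of_real (fejer_count m n N / N) * cinner ((W ^^ n) x) ((W ^^ m) x)"
  by (simp add: fejer_count_def sum_distrib_right sum_divide_distrib of_bool_def if_distrib[of complex_of_real]
    cong: if_cong)
 finally show "(\<integral>t. fejer_density W x N t *\<^sub>R (cis t ^ m * cnj (cis t) ^ n) \<partial>lborel) =
   complex_of_real (fejer_count m n N / N) * cinner ((W ^^ n) x) ((W ^^ m) x)" .
qed

text \<open>The measures with Fejer densities are tight since they live on one bounded interval.\<close>

lemma Herglotz:
 fixes W :: "'a::complex_hilbert \<Rightarrow> 'a"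
 assumes W: "!!x y. cinner (W x) (W y) = cinner x y" and x: "norm x = 1"
 shows "\<exists>M. real_distribution M \<and>
  (\<forall>m n. (\<integral>t. cis t ^ m * cnj (cis t) ^ n \<partial>M) = cinner ((W ^^ n) x) ((W ^^ m) x))"
proof -
 define \<nu> where "\<nu> N = density lborel (fejer_density W x (Suc N))" for N
 have nonneg: "0 \<le> fejer_density W x N t" for N t by (simp add: fejer_density_def)
 have mom: "(\<integral>t. cis t ^ m * cnj (cis t) ^ n \<partial>\<nu> N) =
   complex_of_real (fejer_count m n (Suc N) / Suc N) * cinner ((W ^^ n) x) ((W ^^ m) x)" for m n N
 proof -
  have [measurable]: "(%t. cis t ^ m * cnj (cis t) ^ n) \<in> borel_measurable borel"
   by (intro borel_measurable_continuous_onI) (auto simp: cis_conv_exp intro!: continuous_intros)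
  have "(\<integral>t. cis t ^ m * cnj (cis t) ^ n \<partial>\<nu> N) =
    (\<integral>t. fejer_density W x (Suc N) t *\<^sub>R (cis t ^ m * cnj (cis t) ^ n) \<partial>lborel)"
   unfolding \<nu>_def by (rule integral_density) (auto simp: nonneg)
  then show ?thesis by (simp only: fejer_moment(2)[OF W])
 qed
 have count0: "fejer_count 0 0 N = N" for N
  using fejer_count_bounds(1)[of N 0 0] fejer_count_bounds(2)[of 0 0 N] by simp
 have int0: "integrable lborel (fejer_density W x (Suc N))"
  and int1: "(\<integral>t. fejer_density W x (Suc N) t \<partial>lborel) = 1" for N
 proof -
  have i: "integrable lborel (%t. complex_of_real (fejer_density W x (Suc N) t))"
   using fejer_moment(1)[OF W, of x "Suc N" 0 0] by (simp add: scaleR_conv_of_real)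
  then show "integrable lborel (fejer_density W x (Suc N))" by (simp add: complex_of_real_integrable_eq)
  have "complex_of_real (\<integral>t. fejer_density W x (Suc N) t \<partial>lborel) = 1"
   using fejer_moment(2)[OF W, of x "Suc N" 0 0]
   by (simp add: scaleR_conv_of_real count0 cinner_self x del: of_nat_Suc)
  then show "(\<integral>t. fejer_density W x (Suc N) t \<partial>lborel) = 1" by (simp only: of_real_eq_1_iff)
 qed
 have dist: "real_distribution (\<nu> N)" for N
 proof (rule real_distribution.intro)
  have "emeasure (\<nu> N) (space (\<nu> N)) = (\<integral>\<^sup>+t. ennreal (fejer_density W x (Suc N) t) \<partial>lborel)"
   unfolding \<nu>_def by (subst emeasure_density) auto
  also have "\<dots> = 1" using nn_integral_eq_integral[OF int0] nonneg by (simp add: int1)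
  finally show "prob_space (\<nu> N)" by (rule prob_spaceI)
  show "real_distribution_axioms (\<nu> N)" by standard (simp add: \<nu>_def)
 qed
 \<comment> \<open>A bounded interval around [0, 2 \<pi>]; its left end lies below 0 because
   tightness is stated with half-open intervals.\<close>
 have supp: "measure (\<nu> N) {-1<..7} = 1" for N
 proof -
  interpret real_distribution "\<nu> N" by (rule dist)
  have pi: "2 * pi < 7" using pi_approx by simp
  have "emeasure (\<nu> N) {-1<..7} = (\<integral>\<^sup>+t. ennreal (fejer_density W x (Suc N) t) * indicator {-1<..7} t \<partial>lborel)"
   unfolding \<nu>_def by (rule emeasure_density) auto
  also have "\<dots> = (\<integral>\<^sup>+t. ennreal (fejer_density W x (Suc N) t) \<partial>lborel)"
   using pi by (intro nn_integral_cong) (auto simp: fejer_density_def indicator_def)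
  also have "\<dots> = 1" using nn_integral_eq_integral[OF int0] nonneg by (simp add: int1)
  finally show ?thesis by (simp add: measure_def)
 qed
 have "tight \<nu>" unfolding tight_def using dist supp
  by (intro conjI allI impI exI[of _ "-1"] exI[of _ 7]) auto
 from tight_imp_convergent_subsubsequence[OF this strict_mono_id]
 obtain r M where r: "strict_mono r" "real_distribution M" "weak_conv_m (\<nu> \<circ> r) M" by auto
 have "(\<integral>t. cis t ^ m * cnj (cis t) ^ n \<partial>M) = cinner ((W ^^ n) x) ((W ^^ m) x)" for m n
 proof -
  have "(%N. \<integral>t. cis t ^ m * cnj (cis t) ^ n \<partial>(\<nu> \<circ> r) N) ----> (\<integral>t. cis t ^ m * cnj (cis t) ^ n \<partial>M)"
   by (rule weak_conv_imp_integral_bdd_continuous_conv[where B = 1, OF _ r(2,3)])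
    (auto simp: dist norm_mult norm_power cis_conv_exp intro!: continuous_intros)
  moreover have "(%N. complex_of_real (fejer_count m n (Suc (r N)) / Suc (r N)) * cinner ((W ^^ n) x) ((W ^^ m) x))
    ----> complex_of_real 1 * cinner ((W ^^ n) x) ((W ^^ m) x)"
   by (intro tendsto_intros LIMSEQ_subseq_LIMSEQ[OF fejer_count_limit r(1), unfolded o_def])
  ultimately show ?thesis by (simp add: mom LIMSEQ_unique)
 qed
 then show ?thesis using r(2) by blast
qed

section \<open>The Cayley parametrisation of the circle\<close>

definition cayley :: "real \<Rightarrow> complex"
 where "cayley s = (complex_of_real s - \<i>) / (complex_of_real s + \<i>)"

text \<open>The argument of \<open>Re\<close> is already real when w lies on the unit circle and
  differs from 1; taking the real part makes the function real-valued everywhere.\<close>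

definition cayley_inv :: "complex \<Rightarrow> real"
 where "cayley_inv w = Re (\<i> * (1 + w) / (1 - w))"

lemma real_plus_i_nonzero [simp]: "complex_of_real s + \<i> \<noteq> 0" "complex_of_real s - \<i> \<noteq> 0"
 "\<i> + complex_of_real s \<noteq> 0" by (auto simp: complex_eq_iff)

lemma norm_cayley [simp]: "cmod (cayley s) = 1"
proof -
 have "cnj (complex_of_real s + \<i>) = complex_of_real s - \<i>" by simp
 then have "cmod (complex_of_real s - \<i>) = cmod (complex_of_real s + \<i>)" by (metis complex_mod_cnj)
 then show ?thesis by (simp add: cayley_def norm_divide)
qed

lemma cayley_cnj: "cnj (cayley s) * cayley s = 1"
 using complex_norm_square[of "cayley s"] by (simp add: mult.commute)

lemma cayley_eq: "cayley s = 1 - 2 * \<i> * inverse (complex_of_real s + \<i>)"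
 by (simp add: cayley_def field_simps)

lemma cayley_inv_cayley [simp]: "cayley_inv (cayley s) = s"
proof -
 have "1 - cayley s = 2 * \<i> / (complex_of_real s + \<i>)" "1 + cayley s = 2 * s / (complex_of_real s + \<i>)"
  by (simp_all add: cayley_def field_simps)
 then show ?thesis by (simp add: cayley_inv_def)
qed

lemma cayley_cayley_inv:
 assumes "cmod w = 1" "w \<noteq> 1"
 shows "cayley (cayley_inv w) = w"
proof -
 have w1: "1 - w \<noteq> 0" using assms(2) by simp
 have wc: "w * cnj w = 1" using complex_norm_square[of w] assms(1) by simp
 have "w \<noteq> 0" using assms(1) by auto
 then have cw: "cnj w = 1 / w" using wc by (simp add: field_simps)
 have "cnj (\<i> * (1 + w) / (1 - w)) = \<i> * (1 + w) / (1 - w)"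
  using w1 \<open>w \<noteq> 0\<close> by (simp add: cw divide_simps) (simp add: algebra_simps)
 then have "complex_of_real (cayley_inv w) = \<i> * (1 + w) / (1 - w)"
  unfolding cayley_inv_def by (metis Reals_cnj_iff of_real_Re)
 then show ?thesis unfolding cayley_def using w1 by (simp add: divide_simps) (simp add: algebra_simps)
qed

lemma continuous_on_cayley [continuous_intros]: "continuous_on S cayley"
 unfolding cayley_def by (intro continuous_intros) auto

lemma cayley_measurable [measurable]: "cayley \<in> borel_measurable borel"
 by (rule borel_measurable_continuous_onI[OF continuous_on_cayley])

lemma cayley_inv_measurable [measurable]: "cayley_inv \<in> borel_measurable borel"
 unfolding cayley_inv_def by measurable

lemma cis_measurable [measurable]: "cis \<in> borel_measurable borel"
 by (intro borel_measurable_continuous_onI) (auto simp: cis_conv_exp intro!: continuous_intros)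

text \<open>Trigonometric polynomials: the monomial \<open>(a, m, n)\<close> stands for \<open>a w\<^sup>m cnj w\<^sup>n\<close>.\<close>

definition trigf :: "(complex \<times> nat \<times> nat) list \<Rightarrow> complex \<Rightarrow> complex"
 where "trigf l w = (\<Sum>(a, m, n)\<leftarrow>l. a * (w ^ m * cnj w ^ n))"

definition trig_mul :: "(complex \<times> nat \<times> nat) list \<Rightarrow> (complex \<times> nat \<times> nat) list \<Rightarrow> (complex \<times> nat \<times> nat) list"
 where "trig_mul l k = concat (map (%(a, m, n). map (%(b, m', n'). (a * b, m + m', n + n')) k) l)"

definition trig_adj :: "(complex \<times> nat \<times> nat) list \<Rightarrow> (complex \<times> nat \<times> nat) list"
 where "trig_adj l = map (%(a, m, n). (cnj a, n, m)) l"

lemma trigf_simps [simp]: "trigf [] w = 0" "trigf ((a, m, n) # l) w = a * (w ^ m * cnj w ^ n) + trigf l w"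
 "trigf (l @ k) w = trigf l w + trigf k w" by (simp_all add: trigf_def)

lemma trigf_mul [simp]: "trigf (trig_mul l k) w = trigf l w * trigf k w"
proof -
 have 1: "trigf (map (%(b, m', n'). (a * b, m + m', n + n')) k) w = a * (w ^ m * cnj w ^ n) * trigf k w" for a m n
  by (induction k) (auto simp: power_add algebra_simps)
 show ?thesis by (induction l) (auto simp: trig_mul_def 1 algebra_simps)
qed

lemma trigf_adj [simp]: "trigf (trig_adj l) w = cnj (trigf l w)"
 by (induction l) (auto simp: trig_adj_def algebra_simps)

definition trig_neg :: "(complex \<times> nat \<times> nat) list \<Rightarrow> (complex \<times> nat \<times> nat) list"
 where "trig_neg l = map (%(a, p). (- a, p)) l"

lemma trigf_neg [simp]: "trigf (trig_neg l) w = - trigf l w" by (induction l) (auto simp: trig_neg_def)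

lemma continuous_on_trigf: "continuous_on S (trigf l)"
proof (induction l)
 case (Cons p l)
 have "trigf (p # l) = (%w. fst p * (w ^ fst (snd p) * cnj w ^ snd (snd p)) + trigf l w)"
  by (auto simp: trigf_def split: prod.splits)
 then show ?case using Cons by (auto intro!: continuous_intros)
qed (auto simp: trigf_def)

lemma trigf_measurable [measurable]: "trigf l \<in> borel_measurable borel"
 by (rule borel_measurable_continuous_onI[OF continuous_on_trigf])

lemma trigf_bounded: "\<exists>K. \<forall>w. cmod w = 1 \<longrightarrow> cmod (trigf l w) \<le> K"
proof (induction l)
 case (Cons p l)
 then obtain K where K: "!!w. cmod w = 1 ==> cmod (trigf l w) \<le> K" by blast
 have "cmod (trigf (p # l) w) \<le> cmod (fst p) + K" if "cmod w = 1" for w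
  using norm_triangle_ineq[of "fst p * (w ^ fst (snd p) * cnj w ^ snd (snd p))" "trigf l w"] K[OF that] that
  by (cases p) (auto simp: norm_mult norm_power)
 then show ?case by blast
qed auto

section \<open>Trigonometric polynomials of a unitary operator\<close>

locale unitary_operator =
 fixes W V :: "'h::complex_hilbert \<Rightarrow> 'h"
 assumes W: "bounded_clinear W" and V: "bounded_clinear V"
  and WV: "W (V x) = x" and VW: "V (W x) = x"
  and adj: "cinner (W x) y = cinner x (V y)"
begin

text \<open>W interprets the variable and its inverse V the conjugate variable. One list thus
  encodes a function on the circle and an operator, and products and conjugates go to products and
  adjoints.\<close>

definition trigT :: "(complex \<times> nat \<times> nat) list \<Rightarrow> 'h \<Rightarrow> 'h"
 where "trigT l x = (\<Sum>(a, m, n)\<leftarrow>l. a *C (W ^^ m) ((V ^^ n) x))"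

lemma trigT_simps [simp]: "trigT [] x = 0"
 "trigT ((a, m, n) # l) x = a *C (W ^^ m) ((V ^^ n) x) + trigT l x"
 "trigT (l @ k) x = trigT l x + trigT k x" by (simp_all add: trigT_def)

lemma trigT_neg [simp]: "trigT (trig_neg l) x = - trigT l x" by (induction l) (auto simp: trig_neg_def)

lemma W_iso: "cinner (W x) (W y) = cinner x y" by (simp add: adj VW)

lemma bounded_W_pow: "bounded_clinear (W ^^ m)" "bounded_clinear (V ^^ m)"
 by (induction m) (auto intro: clinear_id' clinear_comp W V)

lemma pow_commute: "(W ^^ m) ((V ^^ n) x) = (V ^^ n) ((W ^^ m) x)"
proof -
 have 1: "W ((V ^^ n) x) = (V ^^ n) (W x)" for x by (induction n) (simp_all add: WV, metis VW)
 show ?thesis by (induction m) (auto simp: 1)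
qed

lemma pow_adj: "cinner ((W ^^ m) x) y = cinner x ((V ^^ m) y)"
 by (induction m arbitrary: x y) (auto simp: adj funpow_swap1)

lemma pow_adj': "cinner ((V ^^ m) x) y = cinner x ((W ^^ m) y)" by (metis pow_adj cinner_commute)

lemma bounded_trigT: "bounded_clinear (trigT l)"
proof (induction l)
 case Nil
 then show ?case by (simp add: trigT_def[abs_def] clinear_const_zero)
next
 case (Cons p l)
 obtain a m n where p: "p = (a, m, n)" by (cases p)
 have "trigT (p # l) = (%x. a *C (W ^^ m) ((V ^^ n) x) + trigT l x)" by (auto simp: p)
 then show ?case
  using Cons by (auto intro!: clinear_plus clinear_cmul clinear_compose[OF bounded_W_pow(1,2)])
qed

lemma trigT_mul: "trigT (trig_mul l k) x = trigT l (trigT k x)"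
proof -
 have 1: "trigT (map (%(b, m', n'). (a * b, m + m', n + n')) k) x = a *C (W ^^ m) ((V ^^ n) (trigT k x))" for a m n
 proof (induction k)
  case (Cons p k)
  then show ?case by (cases p) (simp add: clinear_simps bounded_W_pow funpow_add scaleC_add_right
     scaleC_scaleC pow_commute mult_ac)
 qed (simp add: clinear_simps bounded_W_pow)
 show ?thesis by (induction l) (auto simp: trig_mul_def 1)
qed

lemma trigT_adj: "cinner (trigT l x) y = cinner x (trigT (trig_adj l) y)"
 by (induction l) (auto simp: trig_adj_def cinner_add_left cinner_add_right cinner_scaleC_left
   cinner_scaleC_right pow_adj pow_adj' pow_commute)

lemma norm_trigT: "complex_of_real ((norm (trigT l x))\<^sup>2) = cinner x (trigT (trig_mul (trig_adj l) l) x)"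
 unfolding cinner_self[symmetric] by (simp add: trigT_mul trigT_adj)

text \<open>The spectral measure of x on a line that parametrises the circle by u:
  \<open>cis\<close> at first, \<open>cayley\<close> in the end. It is not normalised; its total
  mass is the squared norm of x.\<close>

definition spectral_mass :: "(real \<Rightarrow> complex) \<Rightarrow> 'h \<Rightarrow> real measure \<Rightarrow> bool"
 where "spectral_mass u x \<mu> \<longleftrightarrow> sets \<mu> = sets borel \<and> finite_measure \<mu> \<and> u \<in> borel_measurable borel \<and>
  (\<forall>l. (\<integral>s. trigf l (u s) \<partial>\<mu>) = cinner x (trigT l x))"

lemma spectral_massD:
 assumes "spectral_mass u x \<mu>"
 shows "sets \<mu> = sets borel" "finite_measure \<mu>" "u \<in> borel_measurable borel"
  "(\<integral>s. trigf l (u s) \<partial>\<mu>) = cinner x (trigT l x)"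
 using assms by (simp_all add: spectral_mass_def)

text \<open>Polynomials, with the L2 norm of the measure, map isometrically to vectors; this turns
  convergence of functions into norm convergence.\<close>

lemma norm_trigT_mass:
 assumes "spectral_mass u x \<mu>"
 shows "(norm (trigT l x))\<^sup>2 = (\<integral>s. (cmod (trigf l (u s)))\<^sup>2 \<partial>\<mu>)"
proof -
 have "complex_of_real ((norm (trigT l x))\<^sup>2) = (\<integral>s. cnj (trigf l (u s)) * trigf l (u s) \<partial>\<mu>)"
  unfolding norm_trigT spectral_massD(4)[OF assms, symmetric] by simp
 also have "\<dots> = (\<integral>s. complex_of_real ((cmod (trigf l (u s)))\<^sup>2) \<partial>\<mu>)"
  by (simp only: complex_norm_square mult.commute)
 finally show ?thesis by (simp only: integral_complex_of_real of_real_eq_iff)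
qed

end

text \<open>Bounded convergence almost everywhere, rather than convergence in L2, because it is
  stable under products and one sequence can serve several measures.\<close>

definition approximates :: "(real \<Rightarrow> complex) \<Rightarrow> (nat \<Rightarrow> (complex \<times> nat \<times> nat) list) \<Rightarrow> (real \<Rightarrow> complex) \<Rightarrow> real measure \<Rightarrow> bool"
 where "approximates u l f \<mu> \<longleftrightarrow> (\<exists>K. \<forall>n s. cmod (trigf (l n) (u s)) \<le> K) \<and>
  (AE s in \<mu>. (%n. trigf (l n) (u s)) ----> f s)"

lemma approximatesI:
 "(!!n s. cmod (trigf (l n) (u s)) \<le> K) ==> (AE s in \<mu>. (%n. trigf (l n) (u s)) ----> f s) ==> approximates u l f \<mu>"
 by (auto simp: approximates_def)

lemma approximates_mult:
 assumes "approximates u l f \<mu>" "approximates u k g \<mu>"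
 shows "approximates u (%n. trig_mul (l n) (k n)) (%s. f s * g s) \<mu>"
proof -
 obtain K L where "!!n s. cmod (trigf (l n) (u s)) \<le> K" "!!n s. cmod (trigf (k n) (u s)) \<le> L"
  using assms unfolding approximates_def by blast
 then have "cmod (trigf (trig_mul (l n) (k n)) (u s)) \<le> K * L" for n s
  by (auto simp: norm_mult intro!: mult_mono order_trans[OF norm_ge_zero])
 moreover have "AE s in \<mu>. (%n. trigf (trig_mul (l n) (k n)) (u s)) ----> f s * g s"
  using assms[unfolded approximates_def, THEN conjunct2] by eventually_elim (auto intro: tendsto_mult)
 ultimately show ?thesis by (rule approximatesI)
qed

lemma approximates_diff:
 assumes "approximates u l f \<mu>" "approximates u k f \<mu>"
 shows "approximates u (%n. l n @ trig_neg (k n)) (%_. 0) \<mu>"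
proof -
 obtain K L where "!!n s. cmod (trigf (l n) (u s)) \<le> K" "!!n s. cmod (trigf (k n) (u s)) \<le> L"
  using assms unfolding approximates_def by blast
 then have "cmod (trigf (l n @ trig_neg (k n)) (u s)) \<le> K + L" for n s
  using norm_triangle_le_diff[OF add_mono, of "trigf (l n) (u s)" K "trigf (k n) (u s)" L] by simp
 moreover have "AE s in \<mu>. (%n. trigf (l n @ trig_neg (k n)) (u s)) ----> 0"
  using assms[unfolded approximates_def, THEN conjunct2]
  by eventually_elim (use tendsto_diff in \<open>fastforce simp del: diff_self\<close>)
 ultimately show ?thesis by (rule approximatesI)
qed

lemma approximates_subseq:
 "approximates u l f \<mu> ==> filterlim r sequentially sequentially ==> approximates u (%n. l (r n)) f \<mu>"
 unfolding approximates_def by (auto elim!: eventually_mono intro: filterlim_compose)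

context unitary_operator
begin

lemma approximates_norm:
 assumes m: "spectral_mass u x \<mu>" and f [measurable]: "f \<in> borel_measurable borel" and l: "approximates u l f \<mu>"
 shows "(%n. (norm (trigT (l n) x))\<^sup>2) ----> (\<integral>s. (cmod (f s))\<^sup>2 \<partial>\<mu>)"
proof -
 note [measurable_cong] = spectral_massD(1)[OF m] and [measurable] = spectral_massD(3)[OF m]
 obtain K where K: "!!n s. cmod (trigf (l n) (u s)) \<le> K" using l by (auto simp: approximates_def)
 show ?thesis unfolding norm_trigT_mass[OF m]
 proof (rule integral_dominated_convergence[where w = "%_. K\<^sup>2"])
  show "integrable \<mu> (%_. K\<^sup>2)" using spectral_massD(2)[OF m] by (rule finite_measure.integrable_const)
  show "AE s in \<mu>. (%n. (cmod (trigf (l n) (u s)))\<^sup>2) ----> (cmod (f s))\<^sup>2"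
   using l unfolding approximates_def by (auto elim!: eventually_mono intro!: tendsto_intros)
  show "AE s in \<mu>. norm ((cmod (trigf (l n) (u s)))\<^sup>2) \<le> K\<^sup>2" for n
   using power_mono[OF K, of n _ 2] by simp
 qed auto
qed

lemma approximates_diff_tendsto:
 assumes "spectral_mass u x \<mu>" "approximates u l f \<mu>" "approximates u k f \<mu>"
 shows "(%n. trigT (l n) x - trigT (k n) x) ----> 0" by (rule tendsto_zero_norm_square)
  (use approximates_norm[OF assms(1) _ approximates_diff[OF assms(2,3)]] in simp)

text \<open>If the vectors were not Cauchy, two index sequences tending to infinity would keep a
  fixed distance. Both still approximate f, so the difference approximates 0 and its vectors vanish
  in the limit.\<close>

lemma approximates_convergent:
 assumes m: "spectral_mass u x \<mu>" and l: "approximates u l f \<mu>"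
 shows "convergent (%n. trigT (l n) x)"
proof (rule Cauchy_convergent, rule ccontr)
 assume "\<not> Cauchy (%n. trigT (l n) x)"
 then obtain e where e: "0 < e" "\<forall>N. \<exists>m\<ge>N. \<exists>n\<ge>N. e \<le> dist (trigT (l m) x) (trigT (l n) x)"
  by (auto simp: Cauchy_def not_less)
 then obtain r r' where r: "!!N. N \<le> r N" "!!N. N \<le> r' N" "!!N. e \<le> dist (trigT (l (r N)) x) (trigT (l (r' N)) x)"
  by metis
 have "filterlim r sequentially sequentially" "filterlim r' sequentially sequentially"
  using r(1,2) by (auto intro: filterlim_at_top_mono[OF filterlim_ident])
 then have "(%n. trigT (l (r n)) x - trigT (l (r' n)) x) ----> 0"
  by (intro approximates_diff_tendsto[OF m, where f = f] approximates_subseq[OF l])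
 then have "(%n. dist (trigT (l (r n)) x) (trigT (l (r' n)) x)) ----> 0"
  by (simp add: dist_norm tendsto_norm_zero)
 then have "e \<le> 0" using r(3) by (intro LIMSEQ_le_const) auto
 then show False using e(1) by simp
qed

lemma approximates_limit:
 assumes "spectral_mass u x \<mu>" "f \<in> borel_measurable borel" "approximates u l f \<mu>"
 obtains v where "(%n. trigT (l n) x) ----> v" "(norm v)\<^sup>2 = (\<integral>s. (cmod (f s))\<^sup>2 \<partial>\<mu>)"
proof -
 obtain v where v: "(%n. trigT (l n) x) ----> v"
  using approximates_convergent[OF assms(1,3)] by (auto simp: convergent_def)
 have "(%n. (norm (trigT (l n) x))\<^sup>2) ----> (norm v)\<^sup>2" by (intro tendsto_intros v)
 then show thesis using that v approximates_norm[OF assms] LIMSEQ_unique by blast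
qed

lemma spectral_mass_cis:
 assumes x: "norm x = 1"
 shows "\<exists>M. real_distribution M \<and> spectral_mass cis x M"
proof -
 obtain M where "real_distribution M"
  and mom: "!!m n. (\<integral>t. cis t ^ m * cnj (cis t) ^ n \<partial>M) = cinner ((W ^^ n) x) ((W ^^ m) x)"
  using Herglotz[OF W_iso x] by blast
 interpret M: real_distribution M by fact
 have intt: "integrable M (%t. trigf l (cis t))" for l
 proof -
  obtain K where "!!w. cmod w = 1 ==> cmod (trigf l w) \<le> K" using trigf_bounded by blast
  then show ?thesis by (intro M.integrable_const_bound[where B = K]) auto
 qed
 have "(\<integral>t. trigf l (cis t) \<partial>M) = cinner x (trigT l x)" for l
 proof (induction l)
  case (Cons p l)
  obtain a m n where p: "p = (a, m, n)" by (cases p)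
  have "integrable M (%t. a * (cis t ^ m * cnj (cis t) ^ n))" using intt[of "[(a, m, n)]"] by simp
  then show ?case
   using Cons by (simp add: p intt mom cinner_add_right cinner_scaleC_right pow_adj pow_adj' pow_commute
     del: complex_cnj_power)
 qed simp
 then show ?thesis using \<open>real_distribution M\<close> M.finite_measure_axioms by (auto simp: spectral_mass_def)
qed

text \<open>A mean ergodic argument: on the circle the polynomials ((1 + w)/2)^n tend to the
  indicator of w = 1. The limit of the corresponding vectors is fixed by W, hence zero, and its
  squared norm is the mass of that point.\<close>

lemma spectral_mass_no_atom:
 assumes inj: "!!x. W x = x ==> x = 0" and M: "real_distribution M" and m: "spectral_mass cis x M"
 shows "AE t in M. cis t \<noteq> 1"
proof -
 interpret M: real_distribution M by fact
 define Z where "Z = {t. cis t = 1}"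
 have Z [measurable]: "Z \<in> sets borel" unfolding Z_def by measurable
 define h where "h n = (trig_mul [(1/2, 0, 0), (1/2, 1, 0)] ^^ n) [(1, 0, 0)]" for n
 have hf: "trigf (h n) w = ((1 + w) / 2) ^ n" for n w by (induction n) (auto simp: h_def field_simps)
 have hle: "cmod ((1 + cis t) / 2) \<le> 1" for t
  using norm_triangle_ineq[of 1 "cis t"] by (simp add: norm_divide)
 have hless: "cmod ((1 + cis t) / 2) < 1" if "t \<notin> Z" for t
 proof -
  have "cos t \<noteq> 1" using that by (auto simp: Z_def complex_eq_iff) (metis cos_one_sin_zero)
  then have "cos t < 1" using cos_le_one[of t] by linarith
  have "(cmod (1 + cis t))\<^sup>2 = (1 + cos t)\<^sup>2 + (sin t)\<^sup>2" by (simp add: cmod_power2)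
  also have "\<dots> = 2 + 2 * cos t"
   using sin_cos_squared_add[of t] by (simp add: power2_eq_square algebra_simps)
  also have "\<dots> < 2\<^sup>2" using \<open>cos t < 1\<close> by simp
  finally have "cmod (1 + cis t) < 2" by (rule power_less_imp_less_base) simp
  then show ?thesis by (simp add: norm_divide)
 qed
 have h: "approximates cis h (indicator Z) M"
 proof (rule approximatesI[where K = 1])
  show "cmod (trigf (h n) (cis t)) \<le> 1" for n t
   unfolding hf norm_power using hle by (intro power_le_one) auto
  have "(%n. trigf (h n) (cis t)) ----> indicator Z t" for t
   unfolding hf using LIMSEQ_power_zero[OF hless] by (cases "t \<in> Z") (auto simp: Z_def)
  then show "AE t in M. (%n. trigf (h n) (cis t)) ----> indicator Z t" by simp
 qed
 obtain v where v: "(%n. trigT (h n) x) ----> v" "(norm v)\<^sup>2 = (\<integral>s. (cmod (indicator Z s))\<^sup>2 \<partial>M)"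
  by (rule approximates_limit[OF m _ h]) auto
 let ?d = "[(1, 1, 0), (-1, 0, 0)]"
 have "approximates cis (%n. ?d) (%s. cis s - 1) M"
  using norm_triangle_ineq4[of "cis _" 1] by (intro approximatesI[where K = 2]) auto
 from approximates_norm[OF m _ approximates_mult[OF this h]]
 have "(%n. (norm (trigT (trig_mul ?d (h n)) x))\<^sup>2) ----> (\<integral>s. (cmod ((cis s - 1) * indicator Z s))\<^sup>2 \<partial>M)"
  by simp
 moreover have z: "(cis s - 1) * indicator Z s = 0" for s by (auto simp: Z_def indicator_def)
 ultimately have "(%n. (norm (trigT (trig_mul ?d (h n)) x))\<^sup>2) ----> 0" unfolding z by simp
 then have "(%n. trigT (trig_mul ?d (h n)) x) ----> 0" by (rule tendsto_zero_norm_square)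
 moreover have "(%n. trigT (trig_mul ?d (h n)) x) ----> W v - v"
  using tendsto_diff[OF clinear_tendsto[OF W v(1)] v(1)] by (simp add: trigT_mul)
 ultimately have "v = 0" using inj LIMSEQ_unique[of _ 0 "W v - v"] by simp
 moreover have "(cmod (indicator Z s))\<^sup>2 = indicator Z s" for s by (simp add: indicator_def)
 ultimately have "measure M Z = 0" using v(2) by simp
 then show ?thesis by (intro AE_I[of _ _ Z]) (auto simp: Z_def M.emeasure_eq_measure)
qed

text \<open>The Cayley map misses exactly the point 1 of the circle, which has no mass since W has
  no fixed vector; so the measure on angles can be pushed to the line. The constant density undoes
  the normalisation to a unit vector.\<close>

lemma spectral_mass_exists:
 assumes inj: "!!x. W x = x ==> x = 0"
 shows "\<exists>\<mu>. spectral_mass cayley x \<mu>"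
proof (cases "x = 0")
 case True
 have "spectral_mass cayley x (null_measure borel)"
  unfolding spectral_mass_def using True by (auto intro!: finite_measureI)
 then show ?thesis by blast
next
 case False
 define y where "y = inverse (norm x) *\<^sub>R x"
 have y: "norm y = 1" and xy: "x = norm x *\<^sub>R y" using False by (simp_all add: y_def)
 obtain M where M: "real_distribution M" "spectral_mass cis y M" using spectral_mass_cis[OF y] by blast
 interpret M: real_distribution M by fact
 define \<mu> where "\<mu> = distr M borel (%t. cayley_inv (cis t))"
 have mom: "(\<integral>s. trigf l (cayley s) \<partial>\<mu>) = cinner y (trigT l y)" for l
 proof -
  have "(\<integral>s. trigf l (cayley s) \<partial>\<mu>) = (\<integral>t. trigf l (cayley (cayley_inv (cis t))) \<partial>M)"
   unfolding \<mu>_def by (rule integral_distr) auto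
  also have "\<dots> = (\<integral>t. trigf l (cis t) \<partial>M)" using spectral_mass_no_atom[OF inj M]
   by (intro integral_cong_AE) (auto simp: cayley_cayley_inv elim!: eventually_mono)
  finally show ?thesis by (simp add: spectral_massD[OF M(2)])
 qed
 interpret finite_measure \<mu>
  unfolding \<mu>_def by (intro finite_measure.finite_measure_distr) (auto intro: M.finite_measure_axioms)
 have [measurable_cong]: "sets \<mu> = sets borel" by (simp add: \<mu>_def)
 have "spectral_mass cayley x (density \<mu> (%_. ennreal ((norm x)\<^sup>2)))" unfolding spectral_mass_def
 proof (intro conjI allI)
  show "finite_measure (density \<mu> (%_. ennreal ((norm x)\<^sup>2)))"
   by (rule finite_measureI) (simp add: emeasure_density ennreal_mult_eq_top_iff)
  fix l
  have "(\<integral>s. trigf l (cayley s) \<partial>density \<mu> (%_. ennreal ((norm x)\<^sup>2))) =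
    (\<integral>s. (norm x)\<^sup>2 *\<^sub>R trigf l (cayley s) \<partial>\<mu>)"
   by (rule integral_density) auto
  also have "\<dots> = cinner x (trigT l x)"
   by (subst (2 3) xy) (simp add: mom clinear_simps bounded_trigT cinner_scaleR_left
     cinner_scaleR_right power2_eq_square)
  finally show "(\<integral>s. trigf l (cayley s) \<partial>density \<mu> (%_. ennreal ((norm x)\<^sup>2))) = cinner x (trigT l x)" .
 qed (auto simp: \<mu>_def)
 then show ?thesis by blast
qed

end

section \<open>Polynomial approximation of Borel indicators\<close>

lemma Stone_Weierstrass_circle:
 fixes g :: "complex \<Rightarrow> real"
 assumes "continuous_on (sphere 0 1) g" "0 < e"
 shows "\<exists>l. \<forall>w. cmod w = 1 \<longrightarrow> cmod (trigf l w - complex_of_real (g w)) < e"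
proof -
 \<comment> \<open>The real functions that are trigonometric polynomials form an algebra containing
   \<open>Re\<close> and \<open>Im\<close>, which separate points.\<close>
 define R where "R = {f. \<exists>l. \<forall>w. complex_of_real (f w) = trigf l w}"
 interpret function_ring_on R "sphere (0::complex) 1"
 proof
  show "compact (sphere (0::complex) 1)" by simp
  show "continuous_on (sphere 0 1) f" if fR: "f \<in> R" for f
  proof -
   obtain l where l: "!!w. complex_of_real (f w) = trigf l w" using fR by (auto simp: R_def)
   have "f = (%w. Re (trigf l w))" by (simp flip: l)
   then show ?thesis by (simp add: continuous_on_Re continuous_on_trigf)
  qed
  show "(%x. f x + g x) \<in> R" if "f \<in> R" "g \<in> R" for f g
   using that unfolding R_def by clarsimp (metis trigf_simps(3))
  show "(%x. f x * g x) \<in> R" if "f \<in> R" "g \<in> R" for f g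
   using that unfolding R_def by clarsimp (metis trigf_mul)
  show "(%_. c) \<in> R" for c unfolding R_def by (auto intro!: exI[of _ "[(complex_of_real c, 0, 0)]"])
  show "\<exists>f\<in>R. f x \<noteq> f y" if "x \<noteq> y" for x y
  proof -
   have "complex_of_real (Re w) = trigf [(1/2, 1, 0), (1/2, 0, 1)] w" for w by (simp add: complex_eq_iff)
   then have "Re \<in> R" unfolding R_def by blast
   have "complex_of_real (Im w) = trigf [(-\<i>/2, 1, 0), (\<i>/2, 0, 1)] w" for w
    by (simp add: complex_eq_iff)
   then have "Im \<in> R" unfolding R_def by blast
   then show ?thesis using that \<open>Re \<in> R\<close> complex_eq_iff by blast
  qed
 qed
 obtain f where f: "f \<in> R" "!!w. w \<in> sphere 0 1 ==> \<bar>g w - f w\<bar> < e"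
  using Stone_Weierstrass_basic[OF assms] by blast
 obtain l where l: "!!w. complex_of_real (f w) = trigf l w" using f(1) by (auto simp: R_def)
 have "cmod (trigf l w - complex_of_real (g w)) < e" if "cmod w = 1" for w
  using f(2)[of w] that by (simp add: norm_minus_commute flip: l of_real_diff)
 then show ?thesis by blast
qed

lemma finite_measure_integrable_bounded:
 fixes f :: "'a \<Rightarrow> 'b::{banach, second_countable_topology}"
 assumes "finite_measure M" "f \<in> borel_measurable M" "!!x. norm (f x) \<le> K"
 shows "integrable M f"
 using finite_measure.integrable_const_bound[OF assms(1), of f K] assms(2,3) by auto

lemma compact_approximation:
 fixes \<mu> :: "real measure"
 assumes "finite_measure \<mu>" and sets: "sets \<mu> = sets borel" and B: "B \<in> sets borel" and "0 < e"
 obtains K where "compact K" "K \<subseteq> B" "measure \<mu> (B - K) < e"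
proof (rule ccontr)
 assume "\<not> thesis"
 then have big: "e \<le> measure \<mu> (B - K)" if "compact K" "K \<subseteq> B" for K
  using that \<open>!!K. compact K ==> K \<subseteq> B ==> measure \<mu> (B - K) < e ==> thesis\<close> not_less by blast
 interpret finite_measure \<mu> by fact
 have "emeasure \<mu> B = (SUP K \<in> {K. K \<subseteq> B \<and> compact K}. emeasure \<mu> K)"
  using inner_regular[OF sets _ B] by simp
 also have "\<dots> \<le> ennreal (measure \<mu> B - e)"
 proof (rule SUP_least)
  fix K
  assume "K \<in> {K. K \<subseteq> B \<and> compact K}"
  then have K: "K \<subseteq> B" "compact K" by auto
  then have "measure \<mu> (B - K) = measure \<mu> B - measure \<mu> K"
   using B by (intro finite_measure_Diff) (auto simp: sets compact_imp_closed)
  then show "emeasure \<mu> K \<le> ennreal (measure \<mu> B - e)"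
   using big[OF K(2,1)] by (simp add: emeasure_eq_measure ennreal_leI)
 qed
 finally show False using big[of "{}"] \<open>0 < e\<close> by (simp add: emeasure_eq_measure)
qed

text \<open>Finitely many measures are treated at once, since linearity of spectral projections
  needs a common sequence for several vectors. Compact subsets of B and of its complement are
  separated by a Urysohn function, to which Stone-Weierstrass applies; the bound 2 is 1 plus an
  error below 1.\<close>

lemma trig_approx_indicator:
 assumes I: "finite I" "!!\<mu>. \<mu> \<in> I ==> finite_measure \<mu>" "!!\<mu>. \<mu> \<in> I ==> sets \<mu> = sets borel"
  and B: "B \<in> sets borel" and "0 < e"
 shows "\<exists>l A. (\<forall>w. cmod w = 1 \<longrightarrow> cmod (trigf l w) \<le> 2) \<and> A \<in> sets borel \<and> (\<forall>\<mu>\<in>I. measure \<mu> A < e) \<and>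
  (\<forall>s. s \<notin> A \<longrightarrow> cmod (trigf l (cayley s) - indicator B s) < e)"
proof -
 have "\<exists>K. compact K \<and> K \<subseteq> D \<and> measure \<mu> (D - K) < e / 2" if "D \<in> sets borel" "\<mu> \<in> I" for \<mu> D
  using compact_approximation[OF I(2,3)[OF that(2)] that(1), of "e/2"] \<open>0 < e\<close> by (metis half_gt_zero)
 from this[OF B] this[OF borel_comp[OF B]] obtain K L where
  K: "!!\<mu>. \<mu> \<in> I ==> compact (K \<mu>) \<and> K \<mu> \<subseteq> B \<and> measure \<mu> (B - K \<mu>) < e / 2" and
  L: "!!\<mu>. \<mu> \<in> I ==> compact (L \<mu>) \<and> L \<mu> \<subseteq> - B \<and> measure \<mu> (- B - L \<mu>) < e / 2" by metis
 define C where "C = (\<Union>\<mu>\<in>I. K \<mu>)"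
 define D where "D = (\<Union>\<mu>\<in>I. L \<mu>)"
 have CD: "compact C" "compact D" "C \<subseteq> B" "D \<subseteq> - B"
  using K L I(1) by (auto simp: C_def D_def intro!: compact_UN)
 have "closed (cayley ` D)" "closed (cayley ` C)"
  using CD by (auto intro!: compact_imp_closed compact_continuous_image continuous_on_cayley)
 moreover have "cayley ` D \<inter> cayley ` C = {}"
  using CD(3,4) by (auto dest!: arg_cong[where f = cayley_inv])
 ultimately obtain g :: "complex \<Rightarrow> real" where g: "continuous_on UNIV g" "!!w. g w \<in> closed_segment 0 1"
  "!!w. w \<in> cayley ` D ==> g w = 0" "!!w. w \<in> cayley ` C ==> g w = 1"
  by (rule Urysohn[where a = 0 and b = 1]) (rule that)
 obtain l where l: "!!w. cmod w = 1 ==> cmod (trigf l w - complex_of_real (g w)) < min 1 e"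
  using Stone_Weierstrass_circle[of g "min 1 e", OF continuous_on_subset[OF g(1) subset_UNIV]] \<open>0 < e\<close> by auto
 have "cmod (trigf l w) \<le> 2" if "cmod w = 1" for w
  using norm_triangle_ineq[of "trigf l w - complex_of_real (g w)" "complex_of_real (g w)"] l[OF that] g(2)[of w]
  by (auto simp: closed_segment_eq_real_ivl)
 moreover have "measure \<mu> (- (C \<union> D)) < e" if \<mu>: "\<mu> \<in> I" for \<mu>
 proof -
  interpret finite_measure \<mu> by (rule I(2)[OF \<mu>])
  note [simp] = I(3)[OF \<mu>]
  have m: "B - K \<mu> \<in> sets borel" "- B - L \<mu> \<in> sets borel"
   using B K[OF \<mu>] L[OF \<mu>] by (simp_all add: sets.Diff borel_compact borel_comp)
  have "measure \<mu> (- (C \<union> D)) \<le> measure \<mu> ((B - K \<mu>) \<union> (- B - L \<mu>))"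
   using \<mu> m by (intro finite_measure_mono) (auto simp: C_def D_def)
  also have "\<dots> \<le> measure \<mu> (B - K \<mu>) + measure \<mu> (- B - L \<mu>)" using m by (intro measure_Un_le) auto
  finally show ?thesis using K[OF \<mu>] L[OF \<mu>] by argo
 qed
 moreover have "cmod (trigf l (cayley s) - indicator B s) < e" if "s \<notin> - (C \<union> D)" for s
 proof -
  have "complex_of_real (g (cayley s)) = indicator B s"
   using that CD(3,4) g(3,4)[of "cayley s"] by (auto simp: indicator_def)
  then show ?thesis using l[of "cayley s"] by simp
 qed
 moreover have "- (C \<union> D) \<in> sets borel" using CD(1,2) by (intro borel_comp sets.Un borel_compact)
 ultimately show ?thesis by blast
qed

text \<open>Errors of size \<open>(1/2) ^ n\<close> are summable, so by Borel-Cantelli almost every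
  point lies in finitely many exceptional sets.\<close>

lemma approximates_exists:
 assumes I: "finite I" "!!\<mu>. \<mu> \<in> I ==> finite_measure \<mu>" "!!\<mu>. \<mu> \<in> I ==> sets \<mu> = sets borel"
  and B: "B \<in> sets borel"
 shows "\<exists>l. (\<forall>n s. cmod (trigf (l n) (cayley s)) \<le> 2) \<and> (\<forall>\<mu>\<in>I. approximates cayley l (indicator B) \<mu>)"
proof -
 have "\<exists>l A. (\<forall>w. cmod w = 1 \<longrightarrow> cmod (trigf l w) \<le> 2) \<and> A \<in> sets borel \<and>
   (\<forall>\<mu>\<in>I. measure \<mu> A < (1/2) ^ n) \<and> (\<forall>s. s \<notin> A \<longrightarrow> cmod (trigf l (cayley s) - indicator B s) < (1/2) ^ n)" for n
  by (intro trig_approx_indicator I B) auto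
 then obtain l A where l: "!!n w. cmod w = 1 ==> cmod (trigf (l n) w) \<le> 2"
  and A: "!!n. A n \<in> sets borel" "!!n \<mu>. \<mu> \<in> I ==> measure \<mu> (A n) < (1/2) ^ n"
   "!!n s. s \<notin> A n ==> cmod (trigf (l n) (cayley s) - indicator B s) < (1/2) ^ n"
  by metis
 have half: "(%n. (1/2) ^ n :: real) ----> 0" by (rule LIMSEQ_power_zero) simp
 have "approximates cayley l (indicator B) \<mu>" if "\<mu> \<in> I" for \<mu>
 proof (rule approximatesI[where K = 2])
  interpret finite_measure \<mu> by (rule I(2)[OF that])
  have "summable (%n. measure \<mu> (A n))"
   using A(2)[OF that] by (intro summable_comparison_test'[OF summable_geometric[of "1/2 :: real"]]) (auto intro: less_imp_le)
  then have "AE s in \<mu>. \<forall>\<^sub>F n in sequentially. s \<in> space \<mu> - A n"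
   by (intro borel_cantelli_AE1) (auto simp: A(1) I(3)[OF that] emeasure_eq_measure)
  then show "AE s in \<mu>. (%n. trigf (l n) (cayley s)) ----> indicator B s"
  proof (rule eventually_mono)
   fix s
   assume "\<forall>\<^sub>F n in sequentially. s \<in> space \<mu> - A n"
   then have "\<forall>\<^sub>F n in sequentially. norm (trigf (l n) (cayley s) - indicator B s) \<le> (1/2) ^ n"
    by eventually_elim (auto intro: less_imp_le A(3))
   then show "(%n. trigf (l n) (cayley s)) ----> indicator B s"
    by (rule LIM_zero_cancel[OF Lim_null_comparison[OF _ half]])
  qed
 qed (simp add: l)
 then show ?thesis using l by (intro exI[of _ l]) simp
qed

section \<open>Projection-valued measures\<close>

lemma projection_norm:
 assumes "orthogonal_projection P"
 shows "cinner x (P x) = complex_of_real ((norm (P x))\<^sup>2)"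
proof -
 have "cinner x (P x) = cinner x (P (P x))"
  using assms by (simp add: orthogonal_projection_def fun_eq_iff)
 also have "\<dots> = cinner (P x) (P x)" using assms by (simp add: orthogonal_projection_def)
 finally show ?thesis by (simp only: cinner_self)
qed

lemma pvm_projection: "projection_valued_measure E ==> B \<in> sets borel ==> orthogonal_projection (E B)"
 by (simp add: projection_valued_measure_def)

lemma pvm_bounded: "projection_valued_measure E ==> B \<in> sets borel ==> bounded_clinear (E B)"
 using pvm_projection orthogonal_projection_def by blast

lemma pvm_Int:
 "projection_valued_measure E ==> B \<in> sets borel ==> C \<in> sets borel ==> E B (E C x) = E (B \<inter> C) x"
 by (simp add: projection_valued_measure_def)

lemma pvm_UNIV: "projection_valued_measure E ==> E UNIV x = x" by (simp add: projection_valued_measure_def)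

lemma pvm_adj:
 "projection_valued_measure E ==> B \<in> sets borel ==> cinner (E B x) y = cinner x (E B y)"
 using pvm_projection orthogonal_projection_def by blast

lemma pvm_norm:
 "projection_valued_measure E ==> B \<in> sets borel ==> cinner x (E B x) = complex_of_real ((norm (E B x))\<^sup>2)"
 by (rule projection_norm[OF pvm_projection])

lemma sets_spectral_distribution [simp, measurable_cong]: "sets (spectral_distribution E x) = sets borel"
 unfolding spectral_distribution_def using sets.space_closed[of "borel :: real measure"]
 by (simp add: sets.sigma_sets_eq[of borel, simplified])

lemma space_spectral_distribution [simp]: "space (spectral_distribution E x) = UNIV"
 using sets_eq_imp_space_eq[OF sets_spectral_distribution] by simp

text \<open>Countable additivity over constantly empty sets makes a constant series
  converge.\<close>

lemma pvm_empty:
 assumes "projection_valued_measure E"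
 shows "E {} x = 0"
proof -
 have "(%n::nat. E {} x) sums E (\<Union>n::nat. {}) x" using assms unfolding projection_valued_measure_def
  by (elim conjE allE[of _ "%n::nat. {}"]) (auto simp: disjoint_family_on_def)
 then have "(%n::nat. E {} x) ----> 0" by (intro summable_LIMSEQ_zero sums_summable)
 then show ?thesis by (simp add: LIMSEQ_const_iff)
qed

lemma emeasure_spectral_distribution:
 assumes E: "projection_valued_measure E" and B: "B \<in> sets borel"
 shows "emeasure (spectral_distribution E x) B = ennreal ((norm (E B x))\<^sup>2)"
proof -
 have eq: "Re (cinner x (E C x)) = (norm (E C x))\<^sup>2" if "C \<in> sets borel" for C
  using pvm_norm[OF E that] by simp
 have "emeasure (spectral_distribution E x) B = ennreal (Re (cinner x (E B x)))"
 proof (rule emeasure_measure_of[OF spectral_distribution_def])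
  show "positive (sets (spectral_distribution E x)) (%B. ennreal (Re (cinner x (E B x))))"
   by (simp add: positive_def pvm_empty[OF E])
  show "countably_additive (sets (spectral_distribution E x)) (%B. ennreal (Re (cinner x (E B x))))"
  proof (rule countably_additiveI)
   fix A :: "nat \<Rightarrow> real set"
   assume A: "range A \<subseteq> sets (spectral_distribution E x)" "disjoint_family A"
   then have "(%n. E (A n) x) sums E (\<Union>n. A n) x" using E by (simp add: projection_valued_measure_def)
   then have "(%n. Re (cinner x (E (A n) x))) sums Re (cinner x (E (\<Union>n. A n) x))"
    by (intro sums_Re cinner.bounded_linear_right[THEN bounded_linear.sums])
   then show "(\<Sum>i. ennreal (Re (cinner x (E (A i) x)))) = ennreal (Re (cinner x (E (\<Union> (range A)) x)))"
    using A by (intro suminf_ennreal_eq) (auto simp: eq)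
  qed
 qed (use B in auto)
 then show ?thesis by (simp add: eq B)
qed

lemma finite_spectral_distribution:
 "projection_valued_measure E ==> finite_measure (spectral_distribution E x)"
 by (rule finite_measureI) (simp add: emeasure_spectral_distribution)

lemma measure_spectral_distribution:
 "projection_valued_measure E ==> B \<in> sets borel ==> measure (spectral_distribution E x) B = (norm (E B x))\<^sup>2"
 by (simp add: measure_def emeasure_spectral_distribution)

section \<open>Spectral projections of a unitary operator without fixed vectors\<close>

locale cayley_operator = unitary_operator +
 assumes inj: "!!x. W x = x ==> x = 0"
begin

definition mass :: "'a \<Rightarrow> real measure"
 where "mass x = (SOME \<mu>. spectral_mass cayley x \<mu>)"

lemma mass: "spectral_mass cayley x (mass x)"
 unfolding mass_def by (rule someI_ex[OF spectral_mass_exists[OF inj]])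

lemmas finite_mass = spectral_massD(2)[OF mass]
 and mass_moment = spectral_massD(4)[OF mass]

lemma sets_mass [simp, measurable_cong]: "sets (mass x) = sets borel"
 by (rule spectral_massD(1)[OF mass])

lemma measure_mass_UNIV: "measure (mass x) UNIV = (norm x)\<^sup>2"
 using norm_trigT_mass[OF mass, of "[(1, 0, 0)]" x] sets_eq_imp_space_eq[OF sets_mass] by simp

lemma approximates_mass:
 assumes "finite X" "B \<in> sets borel"
 shows "\<exists>l. (\<forall>n s. cmod (trigf (l n) (cayley s)) \<le> 2) \<and> (\<forall>x\<in>X. approximates cayley l (indicator B) (mass x))"
proof -
 have "\<exists>l. (\<forall>n s. cmod (trigf (l n) (cayley s)) \<le> 2) \<and> (\<forall>\<mu>\<in>mass ` X. approximates cayley l (indicator B) \<mu>)"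
  by (rule approximates_exists) (use assms in \<open>auto simp: finite_mass\<close>)
 then show ?thesis by simp
qed

text \<open>The choice is harmless: two sequences approximating the same indicator give vectors
  whose difference tends to 0.\<close>

definition spectral_proj :: "real set \<Rightarrow> 'a \<Rightarrow> 'a"
 where "spectral_proj B x = lim (%n. trigT ((SOME l. approximates cayley l (indicator B) (mass x)) n) x)"

lemma spectral_proj_lim:
 assumes l: "approximates cayley l (indicator B) (mass x)"
 shows "(%n. trigT (l n) x) ----> spectral_proj B x"
proof -
 define k where "k = (SOME l. approximates cayley l (indicator B) (mass x))"
 have k: "approximates cayley k (indicator B) (mass x)"
  unfolding k_def by (rule someI[where P = "%l. approximates cayley l (indicator B) (mass x)", OF l])
 have "(%n. trigT (k n) x) ----> spectral_proj B x"
  using approximates_convergent[OF mass k] by (simp add: spectral_proj_def convergent_LIMSEQ_iff flip: k_def)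
 from tendsto_add[OF approximates_diff_tendsto[OF mass l k] this] show ?thesis by simp
qed

text \<open>One sequence that approximates the indicator for x, y and x + y at the same time reduces
  additivity to that of polynomials.\<close>

lemma spectral_proj_add: "B \<in> sets borel ==> spectral_proj B (x + y) = spectral_proj B x + spectral_proj B y"
proof -
 assume B: "B \<in> sets borel"
 obtain l where l: "approximates cayley l (indicator B) (mass x)" "approximates cayley l (indicator B) (mass y)" "approximates cayley l (indicator B) (mass (x + y))"
  using approximates_mass[of "{x, y, x + y}", OF _ B] by auto
 have "(%n. trigT (l n) (x + y)) ----> spectral_proj B x + spectral_proj B y"
  unfolding clinear_add[OF bounded_trigT] by (intro tendsto_intros spectral_proj_lim l)
 then show ?thesis using spectral_proj_lim[OF l(3)] LIMSEQ_unique by blast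
qed

lemma spectral_proj_scaleC: "B \<in> sets borel ==> spectral_proj B (c *C x) = c *C spectral_proj B x"
proof -
 assume B: "B \<in> sets borel"
 obtain l where l: "approximates cayley l (indicator B) (mass x)" "approximates cayley l (indicator B) (mass (c *C x))"
  using approximates_mass[of "{x, c *C x}", OF _ B] by auto
 have "(%n. trigT (l n) (c *C x)) ----> c *C spectral_proj B x" unfolding clinear_scaleC[OF bounded_trigT]
  by (intro scaleC.tendsto tendsto_const spectral_proj_lim l)
 then show ?thesis using spectral_proj_lim[OF l(2)] LIMSEQ_unique by blast
qed

lemma norm_trigT_le:
 assumes "!!s. cmod (trigf l (cayley s)) \<le> K" "0 \<le> K"
 shows "norm (trigT l x) \<le> K * norm x"
proof -
 interpret finite_measure "mass x" by (rule finite_mass)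
 have "(norm (trigT l x))\<^sup>2 = (\<integral>s. (cmod (trigf l (cayley s)))\<^sup>2 \<partial>mass x)"
  by (rule norm_trigT_mass[OF mass])
 also have "\<dots> \<le> (\<integral>s. K\<^sup>2 \<partial>mass x)" using power_mono[OF assms(1), of _ 2]
  by (intro integral_mono finite_measure_integrable_bounded[OF finite_mass, where K = "K\<^sup>2"]) auto
 also have "\<dots> = (K * norm x)\<^sup>2"
  using sets_eq_imp_space_eq[OF sets_mass] by (simp add: measure_mass_UNIV power_mult_distrib)
 finally show ?thesis by (rule power2_le_imp_le) (use assms(2) in auto)
qed

lemma spectral_proj_norm_sq:
 assumes B: "B \<in> sets borel"
 shows "(norm (spectral_proj B x))\<^sup>2 = measure (mass x) B"
proof -
 obtain l where l: "approximates cayley l (indicator B) (mass x)"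
  using approximates_mass[of "{x}", OF _ B] by auto
 have "(%n. (norm (trigT (l n) x))\<^sup>2) ----> (norm (spectral_proj B x))\<^sup>2"
  by (intro tendsto_intros spectral_proj_lim l)
 then have "(norm (spectral_proj B x))\<^sup>2 = (\<integral>s. (cmod (indicator B s))\<^sup>2 \<partial>mass x)"
  using approximates_norm[OF mass _ l] B LIMSEQ_unique by force
 also have "(%s. (cmod (indicator B s))\<^sup>2) = indicator B" by (auto simp: indicator_def)
 finally show ?thesis using B by simp
qed

lemma bounded_spectral_proj:
 assumes B: "B \<in> sets borel"
 shows "bounded_clinear (spectral_proj B)"
proof (rule bounded_clinearI[where K = 1])
 show "norm (spectral_proj B x) \<le> 1 * norm x" for x
 proof -
  have "(norm (spectral_proj B x))\<^sup>2 \<le> measure (mass x) UNIV" unfolding spectral_proj_norm_sq[OF B]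
   using B finite_measure.finite_measure_mono[OF finite_mass, of B UNIV x] by simp
  then have "(norm (spectral_proj B x))\<^sup>2 \<le> (norm x)\<^sup>2" by (simp only: measure_mass_UNIV)
  then have "norm (spectral_proj B x) \<le> norm x" by (rule power2_le_imp_le) simp
  then show ?thesis by simp
 qed
qed (auto simp: spectral_proj_add spectral_proj_scaleC B)

lemma spectral_proj_adj:
 assumes B: "B \<in> sets borel"
 shows "cinner (spectral_proj B x) y = cinner x (spectral_proj B y)"
proof -
 obtain l where l: "approximates cayley l (indicator B) (mass x)" "approximates cayley l (indicator B) (mass y)"
  using approximates_mass[of "{x, y}", OF _ B] by auto
 obtain K where "!!n s. cmod (trigf (l n) (cayley s)) \<le> K" and ae: "AE s in mass y. (%n. trigf (l n) (cayley s)) ----> indicator B s"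
  using l(2) unfolding approximates_def by blast
 \<comment> \<open>The conjugate polynomials approximate the same indicator because it is
   real.\<close>
 then have adj: "approximates cayley (%n. trig_adj (l n)) (indicator B) (mass y)"
 proof (intro approximatesI[where K = K])
  show "AE s in mass y. (%n. trigf (trig_adj (l n)) (cayley s)) ----> indicator B s"
  proof (rule eventually_mono[OF ae])
   show "(%n. trigf (trig_adj (l n)) (cayley s)) ----> indicator B s" if "(%n. trigf (l n) (cayley s)) ----> indicator B s" for s
    using tendsto_cnj[OF that] by (cases "s \<in> B") simp_all
  qed
 qed simp
 have "(%n. cinner (trigT (l n) x) y) ----> cinner (spectral_proj B x) y"
  by (intro cinner.tendsto tendsto_const spectral_proj_lim l)
 moreover have "(%n. cinner x (trigT (trig_adj (l n)) y)) ----> cinner x (spectral_proj B y)"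
  by (intro cinner.tendsto tendsto_const spectral_proj_lim adj)
 ultimately show ?thesis using LIMSEQ_unique by (simp add: trigT_adj)
qed

text \<open>Products of approximants handle the intersection; the iterated limit agrees with theirs
  because the outer polynomials are uniformly bounded as operators.\<close>

lemma spectral_proj_Int:
 assumes B: "B \<in> sets borel" and C: "C \<in> sets borel"
 shows "spectral_proj B (spectral_proj C x) = spectral_proj (B \<inter> C) x"
proof -
 obtain l where l: "!!n s. cmod (trigf (l n) (cayley s)) \<le> 2" "approximates cayley l (indicator B) (mass x)" "approximates cayley l (indicator B) (mass (spectral_proj C x))"
  using approximates_mass[of "{x, spectral_proj C x}", OF _ B] by auto
 obtain k where k: "!!n s. cmod (trigf (k n) (cayley s)) \<le> 2" "approximates cayley k (indicator C) (mass x)"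
  using approximates_mass[of "{x}", OF _ C] by auto
 have "approximates cayley (%n. trig_mul (l n) (k n)) (indicator (B \<inter> C)) (mass x)"
  using approximates_mult[OF l(2) k(2)] by (simp flip: indicator_inter_arith)
 then have "(%n. trigT (l n) (trigT (k n) x)) ----> spectral_proj (B \<inter> C) x"
  using spectral_proj_lim by (fastforce simp: trigT_mul)
 moreover have "(%n. trigT (l n) (trigT (k n) x)) ----> spectral_proj B (spectral_proj C x)"
 proof -
  have "(%n. trigT (l n) (trigT (k n) x - spectral_proj C x)) ----> 0"
  proof (rule Lim_null_comparison)
   show "\<forall>\<^sub>F n in sequentially. norm (trigT (l n) (trigT (k n) x - spectral_proj C x)) \<le> 2 * norm (trigT (k n) x - spectral_proj C x)"
    using norm_trigT_le[OF l(1)] by simp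
   show "(%n. 2 * norm (trigT (k n) x - spectral_proj C x)) ----> 0"
    using spectral_proj_lim[OF k(2)] by (intro tendsto_mult_right_zero tendsto_norm_zero LIM_zero)
  qed
  from tendsto_add[OF this spectral_proj_lim[OF l(3)]] show ?thesis
   by (simp add: clinear_diff bounded_trigT)
 qed
 ultimately show ?thesis using LIMSEQ_unique by blast
qed

text \<open>By polarization it suffices to compare quadratic forms, and these are masses of sets,
  which add.\<close>

lemma spectral_proj_Un:
 assumes B: "B \<in> sets borel" and C: "C \<in> sets borel" and "B \<inter> C = {}"
 shows "spectral_proj (B \<union> C) x = spectral_proj B x + spectral_proj C x"
proof -
 have disj: "spectral_proj B (spectral_proj C x) = 0" "spectral_proj C (spectral_proj B x) = 0"
  using spectral_proj_Int[OF B C] spectral_proj_Int[OF C B] assms(3) spectral_proj_norm_sq[of "{}" x]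
  by (simp_all add: Int_commute)
 define d where "d = spectral_proj (B \<union> C) x - spectral_proj B x - spectral_proj C x"
 have D: "B \<union> C \<in> sets borel" using B C by auto
 have n: "cinner x (spectral_proj A x) = complex_of_real (measure (mass x) A)" if "A \<in> sets borel" for A x
 proof -
  have "orthogonal_projection (spectral_proj A)"
   using that by (auto simp: orthogonal_projection_def bounded_spectral_proj spectral_proj_Int spectral_proj_adj)
  then show ?thesis by (simp only: projection_norm spectral_proj_norm_sq[OF that])
 qed
 have "cinner x (spectral_proj (B \<union> C) x) = cinner x (spectral_proj B x + spectral_proj C x)" for x
  using B C D assms(3) finite_measure.finite_measure_Union[OF finite_mass, of B x C]
  by (simp add: n cinner_add_right)
 then have "spectral_proj (B \<union> C) = (%x. spectral_proj B x + spectral_proj C x)"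
  using B C D by (intro clinear_ext_cinner clinear_plus bounded_spectral_proj) auto
 then show ?thesis by simp
qed

lemma pvm_spectral_proj: "projection_valued_measure spectral_proj"
 unfolding projection_valued_measure_def
proof (intro conjI ballI allI impI)
 show "orthogonal_projection (spectral_proj B)" if "B \<in> sets borel" for B
  using that by (auto simp: orthogonal_projection_def bounded_spectral_proj spectral_proj_Int spectral_proj_adj)
 show "spectral_proj UNIV = id"
 proof
  fix x
  have "approximates cayley (%n. [(1, 0, 0)]) (indicator UNIV) (mass x)" by (auto simp: approximates_def)
  from spectral_proj_lim[OF this] show "spectral_proj UNIV x = id x" by (simp add: LIMSEQ_const_iff)
 qed
 show "spectral_proj (B \<inter> C) = spectral_proj B \<circ> spectral_proj C" if "B \<in> sets borel" "C \<in> sets borel" for B C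
  using that by (auto simp: spectral_proj_Int)
 fix F :: "nat \<Rightarrow> real set" and x
 assume F: "range F \<subseteq> sets borel" "disjoint_family F"
 \<comment> \<open>Finite partial unions: the squared norm of the remainder is the mass not yet
   exhausted, which tends to 0 by continuity of measure.\<close>
 define T where "T n = (\<Union>i<n. F i)" for n
 have Tm: "T n \<in> sets borel" "(\<Union>i. F i) \<in> sets borel" for n using F by (auto simp: T_def)
 have sum: "(\<Sum>i<n. spectral_proj (F i) x) = spectral_proj (T n) x" for n
 proof (induction n)
  case 0
  then show ?case using spectral_proj_norm_sq[of "{}" x] by (simp add: T_def)
 next
  case (Suc n)
  have "T n \<inter> F n = {}"
   using F(2) by (auto simp: T_def disjoint_family_on_def) (metis disjoint_iff less_irrefl)
  then show ?case
   using spectral_proj_Un[of "T n" "F n" x] Tm F Suc by (auto simp: T_def lessThan_Suc Un_commute)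
 qed
 have diff: "spectral_proj (\<Union>i. F i) x - spectral_proj (T n) x = spectral_proj ((\<Union>i. F i) - T n) x" for n
 proof -
  have "T n \<union> ((\<Union>i. F i) - T n) = (\<Union>i. F i)" by (auto simp: T_def)
  then show ?thesis using spectral_proj_Un[of "T n" "(\<Union>i. F i) - T n" x] Tm by auto
 qed
 have "(%n. spectral_proj (\<Union>i. F i) x - spectral_proj (T n) x) ----> 0"
 proof (rule tendsto_zero_norm_square_le)
  show "(norm (spectral_proj (\<Union>i. F i) x - spectral_proj (T n) x))\<^sup>2 \<le>
    measure (mass x) (\<Union>i. F i) - measure (mass x) (T n)" for n
   unfolding diff using Tm
   by (subst spectral_proj_norm_sq) (auto simp: T_def intro!: finite_measure.finite_measure_Diff[OF finite_mass, THEN eq_refl])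
  have "(%n. measure (mass x) (T n)) ----> measure (mass x) (\<Union>n. T n)"
   using Tm by (intro finite_measure.finite_Lim_measure_incseq[OF finite_mass]) (force simp: incseq_def T_def)+
  also have "(\<Union>n. T n) = (\<Union>i. F i)" by (auto simp: T_def)
  finally show "(%n. measure (mass x) (\<Union>i. F i) - measure (mass x) (T n)) ----> 0"
   using tendsto_diff[OF tendsto_const] by (metis diff_self)
 qed
 from tendsto_diff[OF tendsto_const[of "spectral_proj (\<Union>i. F i) x"] this]
 show "(%n. spectral_proj (F n) x) sums spectral_proj (\<Union>n. F n) x" by (simp add: sums_def sum)
qed

lemma spectral_distribution_mass: "spectral_distribution spectral_proj x = mass x" by (rule measure_eqI)
  (auto simp: emeasure_spectral_distribution[OF pvm_spectral_proj] spectral_proj_norm_sq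
   finite_measure.emeasure_eq_measure[OF finite_mass])

lemma spectral_theorem:
 "\<exists>E. projection_valued_measure E \<and>
  (\<forall>x l. (\<integral>s. trigf l (cayley s) \<partial>spectral_distribution E x) = cinner x (trigT l x))"
 using pvm_spectral_proj mass_moment spectral_distribution_mass by metis

end

section \<open>Functional calculus of a projection-valued measure\<close>

definition bdd_borel :: "(real \<Rightarrow> complex) \<Rightarrow> bool"
 where "bdd_borel f \<longleftrightarrow> f \<in> borel_measurable borel \<and> (\<exists>K. \<forall>s. cmod (f s) \<le> K)"

lemma bdd_borelI: "f \<in> borel_measurable borel ==> (!!s. cmod (f s) \<le> K) ==> bdd_borel f"
 by (auto simp: bdd_borel_def)

lemma bdd_borel_measurable [measurable_dest]: "bdd_borel f ==> f \<in> borel_measurable borel"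
 by (simp add: bdd_borel_def)

lemma bdd_borel_bound:
 assumes "bdd_borel f"
 obtains K where "0 \<le> K" "!!s. cmod (f s) \<le> K"
 using assms unfolding bdd_borel_def by (meson norm_ge_zero order_trans)

lemma bdd_borel_const [simp]: "bdd_borel (%_. c)" by (auto simp: bdd_borel_def)

lemma bdd_borel_indicator [simp]: "B \<in> sets borel ==> bdd_borel (indicator B)"
 by (rule bdd_borelI[where K = 1]) (auto simp: indicator_def)

lemma bdd_borel_add [simp]: "bdd_borel f ==> bdd_borel g ==> bdd_borel (%s. f s + g s)"
 unfolding bdd_borel_def by (auto intro: order_trans[OF norm_triangle_ineq add_mono])

lemma bdd_borel_diff [simp]: "bdd_borel f ==> bdd_borel g ==> bdd_borel (%s. f s - g s)"
 unfolding bdd_borel_def by (auto intro: order_trans[OF norm_triangle_ineq4 add_mono])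

lemma bdd_borel_mult [simp]: "bdd_borel f ==> bdd_borel g ==> bdd_borel (%s. f s * g s)"
proof -
 assume f: "bdd_borel f" and g: "bdd_borel g"
 obtain K where K: "0 \<le> K" "!!s. cmod (f s) \<le> K" using bdd_borel_bound[OF f] by blast
 obtain L where L: "0 \<le> L" "!!s. cmod (g s) \<le> L" using bdd_borel_bound[OF g] by blast
 show ?thesis
  using f g mult_mono[OF K(2) L(2)] K L by (intro bdd_borelI[where K = "K * L"]) (auto simp: norm_mult bdd_borel_def)
qed

lemma bdd_borel_cnj [simp]: "bdd_borel f ==> bdd_borel (%s. cnj (f s))"
proof -
 have "cnj \<in> borel_measurable borel" by (intro borel_measurable_continuous_onI continuous_intros)
 then show "bdd_borel f ==> bdd_borel (%s. cnj (f s))"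
  by (auto simp: bdd_borel_def intro: measurable_compose)
qed

lemma bdd_borel_sum [simp]: "(!!i. i \<in> I ==> bdd_borel (f i)) ==> bdd_borel (%s. \<Sum>i\<in>I. f i s)"
 by (induction I rule: infinite_finite_induct) auto

lemma bdd_borel_trigf [simp]: "bdd_borel (%s. trigf l (cayley s))"
proof -
 obtain K where "!!w. cmod w = 1 ==> cmod (trigf l w) \<le> K" using trigf_bounded by blast
 then show ?thesis by (intro bdd_borelI[where K = K]) auto
qed

text \<open>Rounding the values down to a grid exhibits a bounded Borel function as a uniform limit
  of simple ones; uniform limits of functions become operator norm limits in the calculus.\<close>

lemma bdd_borel_induct [consumes 1, case_names indicator add cmul limit]:
 assumes f: "bdd_borel f"
  and ind: "!!B. B \<in> sets borel ==> P (indicator B)"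
  and add: "!!f g. bdd_borel f ==> bdd_borel g ==> P f ==> P g ==> P (%s. f s + g s)"
  and cmul: "!!f c. bdd_borel f ==> P f ==> P (%s. c * f s)"
  and lim: "!!f g e. (!!n. bdd_borel (g n)) ==> (!!n. P (g n)) ==> bdd_borel f ==>
   (!!n s. cmod (f s - g n s) \<le> e n) ==> e ----> 0 ==> P f"
 shows "P f"
proof -
 obtain K where K: "0 \<le> K" "!!s. cmod (f s) \<le> K" using bdd_borel_bound[OF f] by blast
 note [measurable] = bdd_borel_measurable[OF f]
 \<comment> \<open>Grid of mesh 1/(2 (n + 1)), so that the errors of the two coordinates add up to
   at most 1/(n + 1). \<open>M n\<close> bounds the grid indices and makes \<open>I n\<close>
   finite.\<close>
 define fl where "fl n s = (\<lfloor>2 * Suc n * Re (f s)\<rfloor>, \<lfloor>2 * Suc n * Im (f s)\<rfloor>)" for n s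
 define M where "M n = \<lceil>2 * Suc n * K\<rceil> + 1" for n
 define I where "I n = {-M n..M n} \<times> {-M n..M n}" for n
 define c where "c n i = Complex (real_of_int (fst i) / (2 * Suc n)) (real_of_int (snd i) / (2 * Suc n))" for n i
 define g where "g n s = (\<Sum>i\<in>I n. c n i * indicator {s. fl n s = i} s)" for n s
 have B: "{s. fl n s = i} \<in> sets borel" for n i
 proof -
  have "{s. fl n s = i} = {s. \<lfloor>2 * Suc n * Re (f s)\<rfloor> = fst i} \<inter> {s. \<lfloor>2 * Suc n * Im (f s)\<rfloor> = snd i}"
   by (auto simp: fl_def)
  then show ?thesis by simp
 qed
 have "bdd_borel (%s. \<Sum>i\<in>J. c n i * indicator {s. fl n s = i} s) \<and> P (%s. \<Sum>i\<in>J. c n i * indicator {s. fl n s = i} s)"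
  if "finite J" for J n using that
 proof (induction J)
  case empty
  show ?case using cmul[of "indicator {}" 0, OF _ ind] by simp
 next
  case (insert i J)
  show ?case unfolding sum.insert[OF insert(1,2)]
   by (intro conjI add cmul ind bdd_borel_add bdd_borel_mult bdd_borel_const bdd_borel_indicator B
     insert.IH[THEN conjunct1] insert.IH[THEN conjunct2])
 qed
 then have gP: "bdd_borel (g n)" "P (g n)" for n unfolding g_def by (simp_all add: I_def)
 have "fl n s \<in> I n" for n s
 proof -
  have 1: "\<lfloor>2 * Suc n * r\<rfloor> \<in> {-M n..M n}" if "\<bar>r\<bar> \<le> K" for r :: real
  proof -
   have "\<bar>2 * Suc n * r\<bar> \<le> 2 * Suc n * K" unfolding abs_mult using that by (intro mult_mono) auto
   also have "\<dots> \<le> real_of_int (\<lceil>2 * Suc n * K\<rceil>)" by (rule le_of_int_ceiling)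
   finally have "- real_of_int \<lceil>2 * Suc n * K\<rceil> \<le> 2 * Suc n * r" "2 * Suc n * r \<le> real_of_int \<lceil>2 * Suc n * K\<rceil>"
    by linarith+
   then show ?thesis by (auto simp: M_def floor_le_iff le_floor_iff)
  qed
  show ?thesis using 1[OF order_trans[OF abs_Re_le_cmod K(2)]] 1[OF order_trans[OF abs_Im_le_cmod K(2)]]
   by (auto simp: I_def fl_def)
 qed
 then have g_eq: "g n s = c n (fl n s)" for n s
  by (simp add: g_def indicator_def I_def if_distrib[of "times _"] cong: if_cong)
 have "cmod (f s - g n s) \<le> inverse (Suc n)" for n s
 proof -
  have fl: "\<bar>r - real_of_int \<lfloor>2 * Suc n * r\<rfloor> / (2 * Suc n)\<bar> \<le> inverse (Suc n) / 2" for r :: real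
  proof -
   have "r - real_of_int \<lfloor>2 * Suc n * r\<rfloor> / (2 * Suc n) = (2 * Suc n * r - real_of_int \<lfloor>2 * Suc n * r\<rfloor>) / (2 * Suc n)"
    by (simp add: diff_divide_distrib)
   moreover have "\<bar>2 * Suc n * r - real_of_int \<lfloor>2 * Suc n * r\<rfloor>\<bar> \<le> 1" by linarith
   ultimately have "\<bar>r - real_of_int \<lfloor>2 * Suc n * r\<rfloor> / (2 * Suc n)\<bar> \<le> 1 / (2 * Suc n)"
    by (simp only: abs_divide) (simp add: divide_right_mono)
   then show ?thesis by (simp add: inverse_eq_divide mult.commute)
  qed
  have "cmod (f s - g n s) \<le> \<bar>Re (f s - g n s)\<bar> + \<bar>Im (f s - g n s)\<bar>" by (rule cmod_le)
  then show ?thesis using fl[of "Re (f s)"] fl[of "Im (f s)"] unfolding g_eq c_def fl_def by simp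
 qed
 then show ?thesis by (rule lim[OF gP f _ LIMSEQ_inverse_real_of_nat])
qed

text \<open>Polarization expresses <y, D x> by four values of the form. The parallelogram law and a
  y parallel to D x with the norm of x give the factor 2.\<close>

lemma numerical_radius_bound:
 assumes D: "bounded_clinear D" and q: "!!x. cmod (cinner x (D x)) \<le> c * (norm x)\<^sup>2" and "0 \<le> c"
 shows "norm (D x) \<le> 2 * c * norm x"
proof (cases "D x = 0 \<or> x = 0")
 case False
 have polar: "4 * cinner y (D x) = cinner (x + y) (D (x + y)) - cinner (x - y) (D (x - y)) +
   \<i> * cinner (x + \<i> *C y) (D (x + \<i> *C y)) - \<i> * cinner (x - \<i> *C y) (D (x - \<i> *C y))" for y
  using D by (simp add: clinear_simps cinner_add_left cinner_add_right cinner.diff_left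
    cinner.diff_right cinner_scaleC_left cinner_scaleC_right algebra_simps)
 have bound: "4 * cmod (cinner y (D x)) \<le> 4 * c * ((norm x)\<^sup>2 + (norm y)\<^sup>2)" for y
 proof -
  have sq: "(norm (x + z))\<^sup>2 + (norm (x - z))\<^sup>2 = 2 * ((norm x)\<^sup>2 + (norm z)\<^sup>2)" for z
   unfolding power2_norm_eq_inner by (simp add: inner_simps inner_commute)
  have "4 * cmod (cinner y (D x)) = cmod (4 * cinner y (D x))" by (simp add: norm_mult)
  also have "\<dots> \<le> cmod (cinner (x + y) (D (x + y))) + cmod (cinner (x - y) (D (x - y))) +
    cmod (cinner (x + \<i> *C y) (D (x + \<i> *C y))) + cmod (cinner (x - \<i> *C y) (D (x - \<i> *C y)))"
   unfolding polar
   by (rule order_trans[OF norm_triangle_ineq4] order_trans[OF norm_triangle_ineq] add_mono order_refl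
     | simp add: norm_mult)+
  also have "\<dots> \<le> c * (norm (x + y))\<^sup>2 + c * (norm (x - y))\<^sup>2 +
    c * (norm (x + \<i> *C y))\<^sup>2 + c * (norm (x - \<i> *C y))\<^sup>2"
   by (intro add_mono q)
  also have "\<dots> = c * ((norm (x + y))\<^sup>2 + (norm (x - y))\<^sup>2) + c * ((norm (x + \<i> *C y))\<^sup>2 + (norm (x - \<i> *C y))\<^sup>2)"
   by (simp add: algebra_simps)
  also have "\<dots> = 4 * c * ((norm x)\<^sup>2 + (norm y)\<^sup>2)" unfolding sq by (simp add: norm_scaleC)
  finally show ?thesis .
 qed
 define y where "y = (norm x / norm (D x)) *\<^sub>R D x"
 have "norm y = norm x" using False by (simp add: y_def)
 moreover have "cmod (cinner y (D x)) = norm x * norm (D x)"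
  using False by (simp add: y_def cinner_scaleR_left cinner_self norm_mult norm_power power2_eq_square)
 ultimately have "norm x * norm (D x) \<le> norm x * (2 * c * norm x)"
  using bound[of y] by (simp add: power2_eq_square mult_ac)
 then show ?thesis using False by simp
qed (use assms(3) clinear_zero[OF D] in auto)

locale pvm =
 fixes E :: "real set \<Rightarrow> 'h::complex_hilbert \<Rightarrow> 'h"
 assumes E: "projection_valued_measure E"
begin

abbreviation sd where "sd \<equiv> spectral_distribution E"

lemma finite_sd: "finite_measure (sd x)" by (rule finite_spectral_distribution[OF E])

lemma measure_sd: "B \<in> sets borel ==> measure (sd x) B = (norm (E B x))\<^sup>2"
 by (rule measure_spectral_distribution[OF E])

lemma measure_sd_UNIV: "measure (sd x) UNIV = (norm x)\<^sup>2" by (simp add: measure_sd pvm_UNIV[OF E])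

lemma integrable_sd: "bdd_borel f ==> integrable (sd x) f"
 unfolding bdd_borel_def by (auto intro!: finite_measure_integrable_bounded finite_sd)

lemma integral_sd_bound:
 assumes "bdd_borel f" "!!s. cmod (f s) \<le> K"
 shows "cmod (\<integral>s. f s \<partial>sd x) \<le> K * (norm x)\<^sup>2"
proof -
 have "cmod (\<integral>s. f s \<partial>sd x) \<le> (\<integral>s. K \<partial>sd x)" using assms finite_measure.integrable_const[OF finite_sd]
  by (intro Bochner_Integration.integral_norm_bound_integral) (auto intro: integrable_sd)
 also have "\<dots> = K * (norm x)\<^sup>2" by (simp add: measure_sd_UNIV)
 finally show ?thesis .
qed

definition represents :: "('h \<Rightarrow> 'h) \<Rightarrow> (real \<Rightarrow> complex) \<Rightarrow> bool"
 where "represents T f \<longleftrightarrow> bounded_clinear T \<and> (\<forall>x. cinner x (T x) = (\<integral>s. f s \<partial>sd x))"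

definition calc :: "(real \<Rightarrow> complex) \<Rightarrow> 'h \<Rightarrow> 'h"
 where "calc f = (THE T. represents T f)"

lemma represents_unique: "represents S f ==> represents T f ==> S = T"
 by (auto simp: represents_def intro: clinear_ext_cinner)

lemma represents_calcI: "represents T f ==> calc f = T"
 unfolding calc_def using represents_unique by (intro the_equality)

lemma represents_indicator:
 assumes "B \<in> sets borel"
 shows "represents (E B) (indicator B)" unfolding represents_def
proof (intro conjI allI)
 show "bounded_clinear (E B)" by (rule pvm_bounded[OF E assms])
 fix x
 interpret finite_measure "sd x" by (rule finite_sd)
 have "(\<integral>s. indicator B s \<partial>sd x) = (\<integral>s. complex_of_real (indicator B s) \<partial>sd x)"
  by (intro Bochner_Integration.integral_cong) (auto simp: indicator_def)
 also have "\<dots> = complex_of_real (measure (sd x) B)" using assms by (simp add: integral_complex_of_real)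
 finally show "cinner x (E B x) = (\<integral>s. indicator B s \<partial>sd x)"
  using pvm_norm[OF E assms] assms by (simp add: measure_sd)
qed

lemma represents_add: "represents S f ==> represents T g ==> bdd_borel f ==> bdd_borel g ==>
  represents (%x. S x + T x) (%s. f s + g s)"
 by (simp add: represents_def clinear_plus cinner_add_right integrable_sd)

lemma represents_diff: "represents S f ==> represents T g ==> bdd_borel f ==> bdd_borel g ==>
  represents (%x. S x - T x) (%s. f s - g s)"
 by (simp add: represents_def clinear_sub cinner.diff_right integrable_sd)

lemma represents_cmul: "represents S f ==> represents (%x. c *C S x) (%s. c * f s)"
 by (simp add: represents_def clinear_cmul cinner_scaleC_right)

lemma represents_bound:
 assumes "represents T f" "bdd_borel f" "!!s. cmod (f s) \<le> K"
 shows "norm (T x) \<le> 2 * K * norm x"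
proof (rule numerical_radius_bound)
 show "0 \<le> K" using assms(3)[of 0] norm_ge_zero order_trans by blast
qed (use assms integral_sd_bound in \<open>auto simp: represents_def\<close>)

text \<open>A uniform bound on functions bounds quadratic forms and hence operator norms, so the
  representing operators converge at each vector, and their limit represents the limit
  function.\<close>

lemma represents_limit:
 assumes "!!n. represents (S n) (g n)" "!!n. bdd_borel (g n)" "bdd_borel f"
  and "!!n s. cmod (f s - g n s) \<le> e n" "e ----> 0"
 shows "\<exists>T. represents T f"
proof -
 have sub: "norm (S m x - S n x) \<le> 2 * (e m + e n) * norm x" for m n x
 proof (rule represents_bound[of "%x. S m x - S n x"])
  show "cmod (g m s - g n s) \<le> e m + e n" for s
   using norm_triangle_ineq4[of "f s - g n s" "f s - g m s"] assms(4)[of s m] assms(4)[of s n] by simp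
  show "represents (%x. S m x - S n x) (%s. g m s - g n s)" by (intro represents_diff assms)
  show "bdd_borel (%s. g m s - g n s)" by (intro bdd_borel_diff assms)
 qed
 have Cau: "Cauchy (%n. S n x)" for x
 proof (rule Cauchy_power_bound[where k = 1])
  show "dist (S m x) (S n x) ^ 1 \<le> 2 * e m * norm x + 2 * e n * norm x" for m n
   using sub[of m x n] by (simp add: dist_norm algebra_simps)
  show "(%n. 2 * e n * norm x) ----> 0" by (intro tendsto_mult_left_zero tendsto_mult_right_zero assms)
 qed
 define T where "T x = lim (%n. S n x)" for x
 have T: "(%n. S n x) ----> T x" for x
  using Cauchy_convergent[OF Cau] by (simp add: T_def convergent_LIMSEQ_iff)
 obtain K where K: "0 \<le> K" "!!s. cmod (f s) \<le> K" using bdd_borel_bound[OF assms(3)] by blast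
 have S: "bounded_clinear (S n)" for n using assms(1) by (simp add: represents_def)
 have nS: "norm (S n x) \<le> 2 * (K + e n) * norm x" for n x
 proof (rule represents_bound[OF assms(1,2)])
  show "cmod (g n s) \<le> K + e n" for s
   using norm_triangle_ineq4[of "f s" "f s - g n s"] assms(4)[of s n] K(2)[of s] by simp
 qed
 have "bounded_clinear T"
 proof (rule bounded_clinearI[where K = "2 * K"])
  show "T (x + y) = T x + T y" for x y using tendsto_add[OF T[of x] T[of y]] T[of "x + y"] LIMSEQ_unique
   by (simp add: clinear_add[OF S])
  show "T (c *C x) = c *C T x" for c x
   using scaleC.tendsto[OF tendsto_const[of c] T[of x]] T[of "c *C x"] LIMSEQ_unique
   by (simp add: clinear_scaleC[OF S])
  show "norm (T x) \<le> 2 * K * norm x" for x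
  proof (rule LIMSEQ_le)
   show "(%n. norm (S n x)) ----> norm (T x)" by (intro tendsto_intros T)
   have "(%n. 2 * (K + e n) * norm x) ----> 2 * (K + 0) * norm x" by (intro tendsto_intros assms)
   then show "(%n. 2 * (K + e n) * norm x) ----> 2 * K * norm x" by simp
  qed (use nS in auto)
 qed
 moreover have "cinner x (T x) = (\<integral>s. f s \<partial>sd x)" for x
 proof -
  have "(%n. cinner x (S n x)) ----> cinner x (T x)" by (intro cinner.tendsto tendsto_const T)
  moreover have "(%n. (\<integral>s. f s \<partial>sd x) - cinner x (S n x)) ----> 0"
  proof (rule Lim_null_comparison)
   have "norm ((\<integral>s. f s \<partial>sd x) - cinner x (S n x)) \<le> e n * (norm x)\<^sup>2" for n
    using integral_sd_bound[of "%s. f s - g n s" "e n" x] assms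
    by (simp add: represents_def integrable_sd)
   then show "\<forall>\<^sub>F n in sequentially. norm ((\<integral>s. f s \<partial>sd x) - cinner x (S n x)) \<le> e n * (norm x)\<^sup>2"
    by simp
   have "(%n. e n * (norm x)\<^sup>2) ----> 0 * (norm x)\<^sup>2" by (intro tendsto_intros assms)
   then show "(%n. e n * (norm x)\<^sup>2) ----> 0" by simp
  qed
  from tendsto_diff[OF tendsto_const[of "\<integral>s. f s \<partial>sd x"] this]
  have "(%n. cinner x (S n x)) ----> (\<integral>s. f s \<partial>sd x)" by simp
  ultimately show ?thesis by (rule LIMSEQ_unique)
 qed
 ultimately show ?thesis by (auto simp: represents_def)
qed

lemma represents_calc:
 assumes "bdd_borel f"
 shows "represents (calc f) f"
proof -
 have "\<exists>T. represents T f" using assms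
 proof (induct rule: bdd_borel_induct)
  case (limit f g e)
  then show ?case using represents_limit[of _ g f e] by metis
 qed (blast intro: represents_indicator represents_add represents_cmul)+
 then show ?thesis using represents_calcI by metis
qed

lemma bounded_calc: "bdd_borel f ==> bounded_clinear (calc f)"
 using represents_calc by (simp add: represents_def)

lemma cinner_calc: "bdd_borel f ==> cinner x (calc f x) = (\<integral>s. f s \<partial>sd x)"
 using represents_calc by (simp add: represents_def)

lemma calc_indicator: "B \<in> sets borel ==> calc (indicator B) = E B"
 by (intro represents_calcI represents_indicator)

lemma calc_add: "bdd_borel f ==> bdd_borel g ==> calc (%s. f s + g s) x = calc f x + calc g x"
 using represents_calcI[OF represents_add[OF represents_calc represents_calc]] by simp

lemma calc_diff: "bdd_borel f ==> bdd_borel g ==> calc (%s. f s - g s) x = calc f x - calc g x"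
 using represents_calcI[OF represents_diff[OF represents_calc represents_calc]] by simp

lemma calc_cmul: "bdd_borel f ==> calc (%s. c * f s) x = c *C calc f x"
 using represents_calcI[OF represents_cmul[OF represents_calc]] by simp

lemma calc_const: "calc (%_. c) x = c *C x"
proof -
 have "represents (%x. c *C x) (%_. c)"
  by (auto simp: represents_def measure_sd_UNIV cinner_scaleC_right cinner_self scaleR_conv_of_real
    mult.commute intro: clinear_cmul clinear_id)
 then show ?thesis using represents_calcI by simp
qed

lemma calc_bound: "bdd_borel f ==> (!!s. cmod (f s) \<le> K) ==> norm (calc f x) \<le> 2 * K * norm x"
 by (rule represents_bound[OF represents_calc])

lemma calc_uniform_limit:
 assumes "!!n. bdd_borel (g n)" "bdd_borel f" "!!n s. cmod (f s - g n s) \<le> e n" "e ----> 0"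
 shows "(%n. calc (g n) x) ----> calc f x"
proof (rule LIM_zero_cancel, rule Lim_null_comparison)
 have "norm (calc (g n) x - calc f x) \<le> 2 * e n * norm x" for n
  using calc_bound[of "%s. g n s - f s" "e n" x] assms by (simp add: calc_diff norm_minus_commute)
 then show "\<forall>\<^sub>F n in sequentially. norm (calc (g n) x - calc f x) \<le> 2 * e n * norm x" by simp
 have "(%n. 2 * e n * norm x) ----> 2 * 0 * norm x" by (intro tendsto_intros assms)
 then show "(%n. 2 * e n * norm x) ----> 0" by simp
qed

text \<open>Projecting by \<open>E B\<close> restricts the spectral distribution to B: on indicators
  this is the intersection property, and the induction over bounded Borel functions does the
  rest.\<close>

lemma sd_restrict:
 assumes B: "B \<in> sets borel" and f: "bdd_borel f"
 shows "(\<integral>s. f s \<partial>sd (E B x)) = (\<integral>s. f s * indicator B s \<partial>sd x)" using f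
proof (induct rule: bdd_borel_induct)
 case (indicator C)
 have "cinner (E B x) (E C (E B x)) = cinner x (E (C \<inter> B) x)"
  using B indicator by (simp add: pvm_adj[OF E] pvm_Int[OF E] Int_commute Int_left_commute)
 then have "cinner (E B x) (calc (indicator C) (E B x)) = cinner x (calc (indicator (C \<inter> B)) x)"
  using B indicator by (simp add: calc_indicator)
 then show ?case using B indicator by (simp add: cinner_calc indicator_inter_arith)
next
 case (add f g)
 then show ?case using B by (simp add: integrable_sd distrib_right)
next
 case (cmul f c)
 then show ?case by (simp add: mult.assoc)
next
 case (limit f g e)
 have e0: "0 \<le> e n" for n using limit(4)[of 0 n] norm_ge_zero order_trans by blast
 have "(%n. cinner (E B x) (calc (g n) (E B x))) ----> cinner (E B x) (calc f (E B x))"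
  using limit by (intro cinner.tendsto tendsto_const calc_uniform_limit)
 moreover have "(%n. cinner x (calc (%s. g n s * indicator B s) x)) ----> cinner x (calc (%s. f s * indicator B s) x)"
 proof (intro cinner.tendsto tendsto_const calc_uniform_limit)
  show "cmod (f s * indicator B s - g n s * indicator B s) \<le> e n" for n s
   using limit(4)[of s n] e0[of n] by (auto simp: indicator_def)
 qed (use limit B in auto)
 ultimately show ?case using limit B LIMSEQ_unique by (simp add: cinner_calc)
qed

lemma calc_indicator_mult:
 assumes B: "B \<in> sets borel" and f: "bdd_borel f"
 shows "calc (%s. f s * indicator B s) x = E B (calc f (E B x))"
proof -
 have "represents (%x. E B (calc f (E B x))) (%s. f s * indicator B s)" unfolding represents_def
 proof (intro conjI allI)
  show "bounded_clinear (%x. E B (calc f (E B x)))"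
   using clinear_compose[OF pvm_bounded[OF E B] clinear_compose[OF bounded_calc[OF f] pvm_bounded[OF E B]]] .
  show "cinner x (E B (calc f (E B x))) = (\<integral>s. f s * indicator B s \<partial>sd x)" for x
   using sd_restrict[OF B f, of x] cinner_calc[OF f] by (simp add: pvm_adj[OF E B, symmetric])
 qed
 then show ?thesis using represents_calcI by simp
qed

lemma E_calc_commute:
 assumes B: "B \<in> sets borel" and f: "bdd_borel f"
 shows "E B (calc f x) = calc f (E B x)" "calc (%s. f s * indicator B s) x = E B (calc f x)"
proof -
 have C: "- B \<in> sets borel" using B by auto
 \<comment> \<open>Splitting f over B and its complement writes \<open>calc f\<close> as a block
   diagonal operator, from which commutation with \<open>E B\<close> follows.\<close>
 have eq: "calc f y = E B (calc f (E B y)) + E (- B) (calc f (E (- B) y))" for y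
 proof -
  have "f = (%s. f s * indicator B s + f s * indicator (- B) s)" by (auto simp: indicator_def)
  then have "calc f y = calc (%s. f s * indicator B s + f s * indicator (- B) s) y" by (rule arg_cong)
  also have "\<dots> = calc (%s. f s * indicator B s) y + calc (%s. f s * indicator (- B) s) y"
   using B C f by (intro calc_add) auto
  finally show ?thesis by (simp only: calc_indicator_mult[OF B f] calc_indicator_mult[OF C f])
 qed
 have z: "E B (E (- B) y) = 0" "E (- B) (E B y) = 0" for y
  using B C pvm_empty[OF E] by (simp_all add: pvm_Int[OF E])
 have i: "E B (E B y) = E B y" for y using B by (simp add: pvm_Int[OF E])
 have zero: "E C 0 = 0" "calc f 0 = 0" if "C \<in> sets borel" for C
  using clinear_zero bounded_calc[OF f] pvm_bounded[OF E that] by auto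
 have "E B (calc f x) = E B (calc f (E B x))"
  unfolding eq[of x] using B C by (simp add: clinear_add[OF pvm_bounded[OF E B]] z i)
 moreover have "calc f (E B x) = E B (calc f (E B x))" using eq[of "E B x"] B C by (simp add: z i zero)
 ultimately show "E B (calc f x) = calc f (E B x)" "calc (%s. f s * indicator B s) x = E B (calc f x)"
  using calc_indicator_mult[OF B f] by simp_all
qed

lemma calc_mult:
 assumes f: "bdd_borel f" and g: "bdd_borel g"
 shows "calc (%s. f s * g s) x = calc f (calc g x)" using f
proof (induct rule: bdd_borel_induct)
 case (indicator B)
 then show ?case using E_calc_commute(2)[OF indicator g] by (simp add: calc_indicator mult.commute)
next
 case (add f1 f2)
 then show ?case using g by (simp add: distrib_right calc_add)
next
 case (cmul f c)
 then show ?case using g by (simp add: mult.assoc calc_cmul)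
next
 case (limit f h e)
 obtain K where K: "0 \<le> K" "!!s. cmod (g s) \<le> K" using bdd_borel_bound[OF g] by blast
 have "(%n. calc (%s. h n s * g s) x) ----> calc (%s. f s * g s) x"
 proof (rule calc_uniform_limit)
  have e0: "0 \<le> e n" for n using limit(4)[of 0 n] norm_ge_zero order_trans by blast
  show "cmod (f s * g s - h n s * g s) \<le> e n * K" for n s
   using mult_mono[OF limit(4) K(2) e0] by (simp add: left_diff_distrib[symmetric] norm_mult)
  show "(%n. e n * K) ----> 0" using limit(5) by (rule tendsto_mult_left_zero)
 qed (use limit g in auto)
 moreover have "(%n. calc (h n) (calc g x)) ----> calc f (calc g x)"
  using limit by (intro calc_uniform_limit)
 ultimately show ?case using limit LIMSEQ_unique by simp
qed

lemma calc_adj: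
 assumes f: "bdd_borel f"
 shows "cinner (calc f x) y = cinner x (calc (%s. cnj (f s)) y)"
proof -
 have "represents (cadjoint (calc f)) (%s. cnj (f s))" unfolding represents_def
 proof (intro conjI allI)
  show "bounded_clinear (cadjoint (calc f))" by (intro clinear_cadjoint bounded_calc f)
  show "cinner x (cadjoint (calc f) x) = (\<integral>s. cnj (f s) \<partial>sd x)" for x
   by (subst cinner_cadjoint_right[OF bounded_calc[OF f]], subst cinner_commute) (simp add: cinner_calc[OF f])
 qed
 then have "calc (%s. cnj (f s)) = cadjoint (calc f)" by (rule represents_calcI)
 then show ?thesis by (simp add: cinner_cadjoint_right[OF bounded_calc[OF f]])
qed

lemma norm_calc:
 assumes f: "bdd_borel f"
 shows "(norm (calc f x))\<^sup>2 = (\<integral>s. (cmod (f s))\<^sup>2 \<partial>sd x)"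
proof -
 have "complex_of_real ((norm (calc f x))\<^sup>2) = cinner x (calc (%s. cnj (f s) * f s) x)"
  using f cinner_self[of "calc f x"] by (simp add: calc_mult calc_adj)
 also have "\<dots> = (\<integral>s. complex_of_real ((cmod (f s))\<^sup>2) \<partial>sd x)"
  using f by (subst cinner_calc) (auto simp: complex_norm_square mult_ac simp del: of_real_power)
 finally show ?thesis by (simp only: integral_complex_of_real of_real_eq_iff)
qed

text \<open>For the resolvent function this density decides the domain of the unbounded
  operator.\<close>

lemma sd_calc:
 assumes f: "bdd_borel f"
 shows "sd (calc f x) = density (sd x) (%s. ennreal ((cmod (f s))\<^sup>2))"
proof (rule measure_eqI)
 fix B
 assume "B \<in> sets (sd (calc f x))"
 then have B [measurable]: "B \<in> sets borel" by simp
 note [measurable] = bdd_borel_measurable[OF f]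
 have eq: "(cmod (f s * indicator B s))\<^sup>2 = (cmod (f s))\<^sup>2 * indicator B s" for s
  by (simp add: indicator_def)
 obtain K where K: "!!s. cmod (f s) \<le> K" using bdd_borel_bound[OF f] by blast
 then have int: "integrable (sd x) (%s. (cmod (f s))\<^sup>2 * indicator B s)" using power_mono[OF K, of _ 2]
  by (intro finite_measure_integrable_bounded[OF finite_sd, where K = "K\<^sup>2"]) (auto simp: indicator_def)
 have "emeasure (sd (calc f x)) B = ennreal ((norm (calc (%s. f s * indicator B s) x))\<^sup>2)"
  by (simp add: emeasure_spectral_distribution[OF E] E_calc_commute(2)[OF B f] B)
 also have "\<dots> = ennreal (\<integral>s. (cmod (f s))\<^sup>2 * indicator B s \<partial>sd x)" using B f by (simp add: norm_calc eq)
 also have "\<dots> = (\<integral>\<^sup>+s. ennreal ((cmod (f s))\<^sup>2 * indicator B s) \<partial>sd x)"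
  by (rule nn_integral_eq_integral[OF int, symmetric]) simp
 also have "\<dots> = emeasure (density (sd x) (%s. ennreal ((cmod (f s))\<^sup>2))) B"
  by (simp add: emeasure_density ennreal_mult ennreal_indicator)
 finally show "emeasure (sd (calc f x)) B = emeasure (density (sd x) (%s. ennreal ((cmod (f s))\<^sup>2))) B" .
qed simp

lemma calc_eq_AE:
 assumes f: "bdd_borel f" and g: "bdd_borel g" and "AE s in sd x. f s = g s"
 shows "calc f x = calc g x"
proof -
 note [measurable] = bdd_borel_measurable[OF f] bdd_borel_measurable[OF g]
 have "(norm (calc f x - calc g x))\<^sup>2 = (\<integral>s. (cmod (f s - g s))\<^sup>2 \<partial>sd x)"
  using norm_calc[of "%s. f s - g s" x] f g by (simp add: calc_diff)
 also have "\<dots> = (\<integral>s. 0 \<partial>sd x)" using assms(3) by (intro integral_cong_AE) (auto elim!: eventually_mono)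
 finally show ?thesis by simp
qed

lemma calc_dominated_AE:
 assumes "!!n. bdd_borel (g n)" "bdd_borel f" "!!n s. cmod (g n s) \<le> K" "AE s in sd x. (%n. g n s) ----> f s"
 shows "(%n. calc (g n) x) ----> calc f x"
proof (rule LIM_zero_cancel, rule tendsto_zero_norm_square)
 note [measurable] = bdd_borel_measurable[OF assms(1)] bdd_borel_measurable[OF assms(2)]
 obtain L where L: "0 \<le> L" "!!s. cmod (f s) \<le> L" using bdd_borel_bound[OF assms(2)] by blast
 have "(%n. \<integral>s. (cmod (g n s - f s))\<^sup>2 \<partial>sd x) ----> (\<integral>s. 0 \<partial>sd x)"
 proof (rule integral_dominated_convergence[where w = "%_. (K + L)\<^sup>2"])
  show "integrable (sd x) (%_. (K + L)\<^sup>2)" using finite_sd by (rule finite_measure.integrable_const)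
  show "AE s in sd x. (%n. (cmod (g n s - f s))\<^sup>2) ----> 0"
   using assms(4) by eventually_elim (auto intro!: tendsto_eq_intros)
  have "cmod (g n s - f s) \<le> K + L" for n s
   using norm_triangle_ineq4[of "g n s" "f s"] assms(3)[of n s] L(2)[of s] by simp
  then show "AE s in sd x. norm ((cmod (g n s - f s))\<^sup>2) \<le> (K + L)\<^sup>2" for n by (auto intro!: power_mono)
 qed auto
 then show "(%n. (norm (calc (g n) x - calc f x))\<^sup>2) ----> 0"
  using norm_calc[of "%s. g _ s - f s" x] assms by (simp add: calc_diff)
qed

lemmas calc_dominated = calc_dominated_AE[OF _ _ _ AE_I2]

end

section \<open>The spectral theorem for self-adjoint operators\<close>

context pvm
begin

lemma bdd_borel_cayley [simp]: "bdd_borel cayley" by (rule bdd_borelI[where K = 1]) auto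

end

text \<open>Intertwining passes from the Cayley function and its conjugate to monomials,
  polynomials, indicators and all bounded Borel functions. For indicators one approximating sequence
  serves the distributions of x and of y x. With y the identity this gives uniqueness, with equal
  measures commutation.\<close>

lemma calc_intertwine:
 assumes E: "pvm E" and F: "pvm F" and y: "bounded_clinear y"
  and comm: "!!x. y (pvm.calc F cayley x) = pvm.calc E cayley (y x)"
   "!!x. y (pvm.calc F (%s. cnj (cayley s)) x) = pvm.calc E (%s. cnj (cayley s)) (y x)"
  and f: "bdd_borel f"
 shows "y (pvm.calc F f x) = pvm.calc E f (y x)"
proof -
 interpret E: pvm E by fact
 interpret F: pvm F by fact
 define m where "m i j s = cayley s ^ i * cnj (cayley s) ^ j" for i j s
 have mb: "bdd_borel (m i j)" for i j
  using bdd_borel_trigf[of "[(1, i, j)]"] by (simp add: m_def[abs_def])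
 have mono0: "y (F.calc (m 0 j) x) = E.calc (m 0 j) (y x)" for j x
 proof (induction j arbitrary: x)
  case 0
  show ?case using F.calc_const[of 1 x] E.calc_const[of 1 "y x"] by (simp add: m_def[abs_def])
 next
  case (Suc j)
  have "m 0 (Suc j) = (%s. cnj (cayley s) * m 0 j s)" by (auto simp: m_def)
  then show ?case using Suc mb by (simp add: E.calc_mult F.calc_mult comm)
 qed
 have mono: "y (F.calc (m i j) x) = E.calc (m i j) (y x)" for i j x
 proof (induction i arbitrary: x)
  case (Suc i)
  have "m (Suc i) j = (%s. cayley s * m i j s)" by (auto simp: m_def)
  then show ?case using Suc mb by (simp add: E.calc_mult F.calc_mult comm)
 qed (rule mono0)
 have trig: "y (F.calc (%s. trigf l (cayley s)) x) = E.calc (%s. trigf l (cayley s)) (y x)" for l x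
 proof (induction l)
  case Nil
  show ?case using F.calc_const[of 0 x] E.calc_const[of 0 "y x"] y by (simp add: clinear_zero)
 next
  case (Cons p l)
  obtain a i j where p: "p = (a, i, j)" by (cases p)
  have "(%s. trigf (p # l) (cayley s)) = (%s. a * m i j s + trigf l (cayley s))" by (auto simp: p m_def)
  then show ?case
   using Cons mb y mono by (simp add: E.calc_add F.calc_add E.calc_cmul F.calc_cmul clinear_simps)
 qed
 have ind: "y (F B x) = E B (y x)" if B: "B \<in> sets borel" for B x
 proof -
  have "\<exists>l. (\<forall>n s. cmod (trigf (l n) (cayley s)) \<le> 2) \<and>
    (\<forall>\<mu>\<in>{F.sd x, E.sd (y x)}. approximates cayley l (indicator B) \<mu>)"
   by (rule approximates_exists) (use B in \<open>auto simp: E.finite_sd F.finite_sd\<close>)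
  then obtain l where l: "!!n s. cmod (trigf (l n) (cayley s)) \<le> 2" "approximates cayley l (indicator B) (F.sd x)"
   "approximates cayley l (indicator B) (E.sd (y x))" by blast
  have "(%n. F.calc (%s. trigf (l n) (cayley s)) x) ----> F.calc (indicator B) x"
   using l(2) B by (intro F.calc_dominated_AE[where K = 2] l) (auto simp: approximates_def)
  then have "(%n. y (F.calc (%s. trigf (l n) (cayley s)) x)) ----> y (F B x)"
   unfolding F.calc_indicator[OF B] by (rule clinear_tendsto[OF y])
  moreover have "(%n. E.calc (%s. trigf (l n) (cayley s)) (y x)) ----> E.calc (indicator B) (y x)"
   using l(3) B by (intro E.calc_dominated_AE[where K = 2] l) (auto simp: approximates_def)
  then have "(%n. y (F.calc (%s. trigf (l n) (cayley s)) x)) ----> E B (y x)"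
   unfolding trig E.calc_indicator[OF B] .
  ultimately show ?thesis by (rule LIMSEQ_unique)
 qed
 show ?thesis using f
 proof (induct rule: bdd_borel_induct)
  case (indicator B)
  then show ?case by (simp add: E.calc_indicator F.calc_indicator ind)
 next
  case (add f g)
  then show ?case using y by (simp add: E.calc_add F.calc_add clinear_simps)
 next
  case (cmul f c)
  then show ?case using y by (simp add: E.calc_cmul F.calc_cmul clinear_simps)
 next
  case (limit f g e)
  have "(%n. y (F.calc (g n) x)) ----> y (F.calc f x)"
   using limit by (intro clinear_tendsto[OF y] F.calc_uniform_limit)
  moreover have "(%n. E.calc (g n) (y x)) ----> E.calc f (y x)" using limit by (intro E.calc_uniform_limit)
  ultimately show ?case using limit LIMSEQ_unique by simp
 qed
qed

definition resolvent_fun :: "real \<Rightarrow> complex"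
 where "resolvent_fun s = inverse (complex_of_real s + \<i>)"

lemma cayley_resolvent: "cayley s = 1 - 2 * \<i> * resolvent_fun s"
 by (simp add: cayley_eq resolvent_fun_def)

lemma cmod_real_plus_i: "(cmod (complex_of_real s + \<i>))\<^sup>2 = s\<^sup>2 + 1" by (simp add: cmod_power2)

lemma norm_resolvent_fun: "cmod (resolvent_fun s) \<le> 1"
proof -
 have "1\<^sup>2 \<le> (cmod (complex_of_real s + \<i>))\<^sup>2" by (simp add: cmod_real_plus_i)
 then have "1 \<le> cmod (complex_of_real s + \<i>)" by (rule power2_le_imp_le) simp
 then show ?thesis by (simp add: resolvent_fun_def norm_inverse inverse_le_1_iff)
qed

lemma norm_resolvent_fun_sq: "(cmod (resolvent_fun s))\<^sup>2 = inverse (s\<^sup>2 + 1)"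
 by (simp add: resolvent_fun_def norm_inverse power_inverse cmod_real_plus_i)

lemma resolvent_fun_mult: "resolvent_fun s * (complex_of_real s + \<i>) = 1"
 by (simp add: resolvent_fun_def)

lemma resolvent_fun_eq: "s * resolvent_fun s = 1 - \<i> * resolvent_fun s"
 using resolvent_fun_mult[of s] by (simp add: algebra_simps)

lemma cnj_resolvent_fun_mult: "cnj (resolvent_fun s) * (1 - \<i> * resolvent_fun s) = complex_of_real (s / (s\<^sup>2 + 1))"
proof -
 have "cnj (resolvent_fun s) * (1 - \<i> * resolvent_fun s) = s * (resolvent_fun s * cnj (resolvent_fun s))"
  unfolding resolvent_fun_eq[symmetric] by simp
 also have "resolvent_fun s * cnj (resolvent_fun s) = complex_of_real (inverse (s\<^sup>2 + 1))"
  unfolding complex_norm_square[symmetric] norm_resolvent_fun_sq ..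
 finally show ?thesis by (simp add: divide_inverse)
qed

lemma bdd_borel_resolvent [simp]: "bdd_borel resolvent_fun"
 by (rule bdd_borelI[where K = 1, OF _ norm_resolvent_fun]) (simp add: resolvent_fun_def[abs_def])

text \<open>With A + \<i> onto, an element of the adjoint differs from one of A by a vector
  orthogonal to the range of A - \<i>, which is everything.\<close>

lemma symmetric_self_adjoint:
 fixes A :: "('a::complex_hilbert \<times> 'a) set"
 assumes sub: "subspace A" and scale: "!!x y. (x, y) \<in> A ==> (\<i> *C x, \<i> *C y) \<in> A"
  and sym: "!!x x' y y'. (x, x') \<in> A ==> (y, y') \<in> A ==> cinner y x' = cinner y' x"
  and surj: "!!w. \<exists>x x'. (x, x') \<in> A \<and> x' + \<i> *C x = w" "!!w. \<exists>x x'. (x, x') \<in> A \<and> x' - \<i> *C x = w"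
  and fun_like: "!!v. (0, v) \<in> A ==> v = 0"
 shows "self_adjoint A" unfolding self_adjoint_def
proof
 show adj: "graph_adjoint A = A"
 proof (intro set_eqI iffI)
  fix p
  assume "p \<in> A"
  then show "p \<in> graph_adjoint A" using sym by (cases p) (auto simp: graph_adjoint_def)
 next
  fix p
  assume p: "p \<in> graph_adjoint A"
  obtain y z where yz: "p = (y, z)" by (cases p)
  obtain x x' where x: "(x, x') \<in> A" "x' + \<i> *C x = z + \<i> *C y" using surj(1) by blast
  have d': "z - x' = - (\<i> *C (y - x))" using x(2) by (simp add: scaleC_diff_right algebra_simps)
  have "cinner (y - x) (q' - \<i> *C q) = 0" if "(q, q') \<in> A" for q q'
  proof -
   have "cinner y q' = cinner z q" using p that by (auto simp: graph_adjoint_def yz)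
   moreover have "cinner x q' = cinner x' q" using sym[OF that x(1)] .
   ultimately have "cinner (y - x) q' = cinner (z - x') q" by (simp add: cinner.diff_left)
   then show ?thesis
    unfolding d' by (simp add: cinner.diff_right cinner.minus_left cinner_scaleC_left cinner_scaleC_right)
  qed
  then have "cinner (y - x) w = 0" for w using surj(2)[of w] by blast
  then have "y - x = 0" by (metis cinner_eqI_left cinner.zero_left)
  then show "p \<in> A" using d' x(1) yz by simp
 qed
 have "v = 0" if v: "!!x. x \<in> Domain A ==> inner v x = 0" for v
 proof -
  have "cinner v x = 0" if "(x, y) \<in> A" for x y
   using v[of x] v[of "\<i> *C x"] scale[OF that] that by (auto simp: complex_eq_iff Re_cinner Im_cinner)
  then have "(0, v) \<in> graph_adjoint A" by (auto simp: graph_adjoint_def)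
  then show ?thesis using adj fun_like by simp
 qed
 then have "closure (span (Domain A)) = UNIV" by (rule dense_if_orthogonal_trivial)
 moreover have "subspace (Domain A)"
  unfolding Domain_fst by (intro linear_subspace_image sub bounded_linear.linear[OF bounded_linear_fst])
 ultimately show "closure (Domain A) = UNIV" by (simp add: span_eq_iff[THEN iffD2])
qed

lemma closed_graph_adjoint: "closed (graph_adjoint (A :: ('a::complex_hilbert \<times> 'a) set))"
proof -
 have "graph_adjoint A = (\<Inter>(x, x')\<in>A. {p. cinner (fst p) x' = cinner (snd p) x})"
  by (auto simp: graph_adjoint_def)
 moreover have "closed {p :: 'a \<times> 'a. cinner (fst p) x' = cinner (snd p) x}" for x x'
  by (intro closed_Collect_eq bounded_linear.continuous_on[OF cinner.bounded_linear_left]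
    continuous_on_fst continuous_on_snd continuous_on_id)
 ultimately show ?thesis by (auto intro!: closed_INT)
qed

lemma subspace_graph_adjoint: "subspace (graph_adjoint (A :: ('a::complex_hilbert \<times> 'a) set))"
proof (rule subspaceI)
 show "0 \<in> graph_adjoint A" by (auto simp: graph_adjoint_def zero_prod_def)
 show "p + q \<in> graph_adjoint A" if "p \<in> graph_adjoint A" "q \<in> graph_adjoint A" for p q
  using that by (cases p; cases q) (fastforce simp: graph_adjoint_def cinner_add_left)
 show "c *\<^sub>R p \<in> graph_adjoint A" if "p \<in> graph_adjoint A" for c p
  using that by (cases p) (fastforce simp: graph_adjoint_def cinner_scaleR_left)
qed

lemma graph_adjoint_scaleC: "(x, y) \<in> graph_adjoint A ==> (c *C x, c *C y) \<in> graph_adjoint A"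
 by (auto simp: graph_adjoint_def cinner_scaleC_left)

section \<open>Graphs of self-adjoint operators and their resolvents\<close>

context
 fixes A :: "('a::complex_hilbert \<times> 'a) set"
 assumes A: "self_adjoint A"
begin

lemma self_adjoint_subspace: "subspace A"
 using A subspace_graph_adjoint[of A] by (simp add: self_adjoint_def)

lemma self_adjoint_closed: "closed A" using A closed_graph_adjoint[of A] by (simp add: self_adjoint_def)

lemma self_adjoint_scaleC: "(x, y) \<in> A ==> (c *C x, c *C y) \<in> A"
 using A graph_adjoint_scaleC[of x y A c] by (simp add: self_adjoint_def)

lemma self_adjoint_symmetric: "(x, x') \<in> A ==> (y, y') \<in> A ==> cinner y x' = cinner y' x"
proof -
 assume "(x, x') \<in> A" "(y, y') \<in> A"
 moreover from this have "(y, y') \<in> graph_adjoint A" using A by (simp add: self_adjoint_def)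
 ultimately show ?thesis by (auto simp: graph_adjoint_def)
qed

lemma self_adjointI:
 assumes "!!x x'. (x, x') \<in> A ==> cinner y x' = cinner z x"
 shows "(y, z) \<in> A"
proof -
 have "(y, z) \<in> graph_adjoint A" using assms by (auto simp: graph_adjoint_def)
 then show ?thesis using A by (simp add: self_adjoint_def)
qed

lemma self_adjoint_add: "(x, x') \<in> A ==> (y, y') \<in> A ==> (x + y, x' + y') \<in> A"
 using subspace_add[OF self_adjoint_subspace, of "(x, x')" "(y, y')"] by simp

lemma self_adjoint_diff: "(x, x') \<in> A ==> (y, y') \<in> A ==> (x - y, x' - y') \<in> A"
 using subspace_diff[OF self_adjoint_subspace, of "(x, x')" "(y, y')"] by simp

lemma self_adjoint_dense: "(!!x x'. (x, x') \<in> A ==> cinner v x = 0) ==> v = 0"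
proof -
 assume v: "!!x x'. (x, x') \<in> A ==> cinner v x = 0"
 have "closure (span (Domain A)) = UNIV"
  using A closure_mono[OF span_superset, of "Domain A"] by (auto simp: self_adjoint_def)
 then show "v = 0" by (rule corthogonal_to_dense) (use v in auto)
qed

lemma self_adjoint_zero: "(0, v) \<in> A ==> v = 0"
 using self_adjoint_symmetric[of 0 v] by (intro self_adjoint_dense) (metis cinner.zero_right cinner_commute complex_cnj_zero)

text \<open>Von Neumann's argument: the remainder of projecting (w, 0) onto the graph is orthogonal
  to the graph, hence lies in the adjoint up to swapping coordinates and a sign. This solves (1 +
  A^2) x = w.\<close>

lemma self_adjoint_square: "\<exists>x x'. (x, x') \<in> A \<and> (x', w - x) \<in> A"
proof -
 obtain p where p: "p \<in> A" "\<forall>a\<in>A. inner ((w, 0) - p) a = 0"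
  using projection_exists[OF self_adjoint_closed self_adjoint_subspace] by blast
 obtain x x' where x: "p = (x, x')" by (cases p)
 have inn: "inner (w - x) a - inner x' a' = 0" if "(a, a') \<in> A" for a a'
  using p(2) that x by (auto simp: inner_Pair)
 have "cinner x' a' = cinner (w - x) a" if "(a, a') \<in> A" for a a'
  using inn[OF that] inn[OF self_adjoint_scaleC[OF that, of \<i>]]
  by (simp add: complex_eq_iff Re_cinner Im_cinner)
 then have "(x', w - x) \<in> A" by (rule self_adjointI)
 then show ?thesis using p(1) x by blast
qed

text \<open>The operator 1 + A^2 factors as (A + \<i>) (A - \<i>) in either order.\<close>

lemma self_adjoint_surj:
 "\<exists>x x'. (x, x') \<in> A \<and> x' + \<i> *C x = w" "\<exists>x x'. (x, x') \<in> A \<and> x' - \<i> *C x = w"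
proof -
 obtain x x' where x: "(x, x') \<in> A" "(x', w - x) \<in> A" using self_adjoint_square by blast
 have "(x' - \<i> *C x, (w - x) - \<i> *C x') \<in> A" "(x' + \<i> *C x, (w - x) + \<i> *C x') \<in> A"
  by (intro self_adjoint_diff self_adjoint_add self_adjoint_scaleC x)+
 moreover have "((w - x) - \<i> *C x') + \<i> *C (x' - \<i> *C x) = w" "((w - x) + \<i> *C x') - \<i> *C (x' + \<i> *C x) = w"
  by (simp_all add: scaleC_diff_right scaleC_add_right scaleC_scaleC scaleC_minus_one)
 ultimately show "\<exists>x x'. (x, x') \<in> A \<and> x' + \<i> *C x = w" "\<exists>x x'. (x, x') \<in> A \<and> x' - \<i> *C x = w"
  by blast+
qed

lemma self_adjoint_norm:
 assumes "(x, x') \<in> A"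
 shows "(norm (x' + \<i> *C x))\<^sup>2 = (norm x')\<^sup>2 + (norm x)\<^sup>2" "(norm (x' - \<i> *C x))\<^sup>2 = (norm x')\<^sup>2 + (norm x)\<^sup>2"
proof -
 have s: "cinner x x' = cinner x' x" by (rule self_adjoint_symmetric[OF assms assms])
 have "complex_of_real ((norm (x' + \<i> *C x))\<^sup>2) = complex_of_real ((norm x')\<^sup>2 + (norm x)\<^sup>2)"
  "complex_of_real ((norm (x' - \<i> *C x))\<^sup>2) = complex_of_real ((norm x')\<^sup>2 + (norm x)\<^sup>2)"
  unfolding of_real_add cinner_self[symmetric]
  by (simp_all add: cinner_add_left cinner_add_right cinner.diff_left cinner.diff_right
    cinner_scaleC_left cinner_scaleC_right s right_diff_distrib distrib_left)
 then show "(norm (x' + \<i> *C x))\<^sup>2 = (norm x')\<^sup>2 + (norm x)\<^sup>2" "(norm (x' - \<i> *C x))\<^sup>2 = (norm x')\<^sup>2 + (norm x)\<^sup>2"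
  by (simp_all only: of_real_eq_iff)
qed

lemma self_adjoint_inj:
 assumes "(x, x') \<in> A" "(y, y') \<in> A" "x' + \<i> *C x = y' + \<i> *C y \<or> x' - \<i> *C x = y' - \<i> *C y"
 shows "x = y"
proof -
 have "(norm (x' - y'))\<^sup>2 + (norm (x - y))\<^sup>2 = 0"
  using self_adjoint_norm[OF self_adjoint_diff[OF assms(1,2)]] assms(3)
  by (auto simp: scaleC_diff_right algebra_simps)
 then show ?thesis by (simp add: sum_power2_eq_zero_iff)
qed

text \<open>Von Neumann's Cayley transform \<open>(A - \<i>) (A + \<i>)\<^sup>-\<^sup>1\<close> reduces the spectral theorem to the unitary case.\<close>

lemma self_adjoint_resolvent:
 obtains Q W V where "bounded_clinear Q" "A = range (%z. (Q z, z - \<i> *C Q z))"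
  "cayley_operator W V" "!!z. W z = z - (2 * \<i>) *C Q z"
proof -
 obtain Q Q' where Q: "!!w. (Q w, Q' w) \<in> A" "!!w. Q' w + \<i> *C Q w = w"
  using self_adjoint_surj(1) by metis
 obtain P P' where P: "!!w. (P w, P' w) \<in> A" "!!w. P' w - \<i> *C P w = w"
  using self_adjoint_surj(2) by metis
 have Q': "Q' w = w - \<i> *C Q w" and P': "P' w = w + \<i> *C P w" for w
  using Q(2)[of w] P(2)[of w] by (metis add_diff_cancel_right' , metis diff_add_cancel)
 have Qx: "Q (x' + \<i> *C x) = x" and Px: "P (x' - \<i> *C x) = x" if "(x, x') \<in> A" for x x'
  using self_adjoint_inj[OF Q(1) that] self_adjoint_inj[OF P(1) that] Q(2) P(2) by blast+
 have bQ: "bounded_clinear Q"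
 proof (rule bounded_clinearI[where K = 1])
  show "Q (x + y) = Q x + Q y" for x y using Qx[OF self_adjoint_add[OF Q(1)[of x] Q(1)[of y]]]
   by (simp add: Q' scaleC_add_right algebra_simps)
  show "Q (c *C x) = c *C Q x" for c x using Qx[OF self_adjoint_scaleC[OF Q(1)[of x], of c]]
   by (simp add: Q' scaleC_diff_right scaleC_scaleC mult.commute)
  show "norm (Q x) \<le> 1 * norm x" for x
   using self_adjoint_norm(1)[OF Q(1)[of x]] by (simp add: Q(2) power2_le_imp_le)
 qed
 have bP: "bounded_clinear P"
 proof (rule bounded_clinearI[where K = 1])
  show "P (x + y) = P x + P y" for x y using Px[OF self_adjoint_add[OF P(1)[of x] P(1)[of y]]]
   by (simp add: P' scaleC_add_right algebra_simps)
  show "P (c *C x) = c *C P x" for c x using Px[OF self_adjoint_scaleC[OF P(1)[of x], of c]]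
   by (simp add: P' scaleC_add_right scaleC_scaleC mult.commute)
  show "norm (P x) \<le> 1 * norm x" for x
   using self_adjoint_norm(2)[OF P(1)[of x]] by (simp add: P(2) power2_le_imp_le)
 qed
 define W where "W z = z - (2 * \<i>) *C Q z" for z
 define V where "V z = z + (2 * \<i>) *C P z" for z
 have two: "(2 * \<i>) *C z = \<i> *C z + \<i> *C z" for z :: 'a by (simp flip: scaleC_add_left)
 have Wx: "W (x' + \<i> *C x) = x' - \<i> *C x" and Vx: "V (x' - \<i> *C x) = x' + \<i> *C x" if "(x, x') \<in> A" for x x'
  using Qx[OF that] Px[OF that] by (simp_all add: W_def V_def two)
 have "cayley_operator W V"
 proof
  show "bounded_clinear W" "bounded_clinear V" unfolding W_def[abs_def] V_def[abs_def]
   by (intro clinear_sub clinear_plus clinear_id clinear_cmul bQ bP)+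
  show "V (W x) = x" for x using Wx[OF Q(1)[of x]] Vx[OF Q(1)[of x]] by (simp add: Q(2))
  show "W (V x) = x" for x using Vx[OF P(1)[of x]] Wx[OF P(1)[of x]] by (simp add: P(2))
  show "cinner (W x) y = cinner x (V y)" for x y
  proof -
   obtain u u' where u: "(u, u') \<in> A" "u' + \<i> *C u = x" using Q by blast
   obtain v v' where v: "(v, v') \<in> A" "v' - \<i> *C v = y" using P by blast
   have "cinner (u' - \<i> *C u) (v' - \<i> *C v) = cinner (u' + \<i> *C u) (v' + \<i> *C v)"
    using self_adjoint_symmetric[OF v(1) u(1)]
    by (simp add: cinner_add_left cinner_add_right cinner.diff_left cinner.diff_right
      cinner_scaleC_left cinner_scaleC_right right_diff_distrib distrib_left)
   then show ?thesis using Wx[OF u(1)] Vx[OF v(1)] u(2) v(2) by simp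
  qed
  show "x = 0" if "W x = x" for x
  proof -
   have "(2 * \<i>) *C Q x = 0" using that by (simp add: W_def)
   then have "Q x = 0"
    by (metis norm_scaleC norm_eq_zero mult_eq_0_iff complex_i_not_zero norm_zero zero_neq_numeral)
   then have "(0, x) \<in> A" using Q(1)[of x] Q'[of x] by simp
   then show ?thesis by (rule self_adjoint_zero)
  qed
 qed
 moreover have "A = range (%z. (Q z, z - \<i> *C Q z))"
 proof (intro set_eqI iffI)
  fix p
  assume "p \<in> A"
  then show "p \<in> range (%z. (Q z, z - \<i> *C Q z))"
   using Qx by (cases p) (auto intro!: image_eqI[of _ _ "snd p + \<i> *C fst p"])
 qed (use Q(1) Q' in auto)
 ultimately show ?thesis using that bQ W_def by blast
qed

end

section \<open>The self-adjoint operator of a projection-valued measure\<close>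

context pvm
begin

abbreviation Q where "Q \<equiv> calc resolvent_fun"

text \<open>The operator A given by the integral of s. Its graph is parametrised by z = (A + \<i>)
  x, so that only the bounded resolvent enters.\<close>

definition op :: "('h \<times> 'h) set"
 where "op = range (%z. (Q z, z - \<i> *C Q z))"

lemma calc_cayley: "calc cayley z = z - (2 * \<i>) *C Q z"
proof -
 have "cayley = (%s. 1 - (2 * \<i>) * resolvent_fun s)" by (auto simp: cayley_resolvent)
 then show ?thesis
  using calc_diff[of "%_. 1" "%s. (2 * \<i>) * resolvent_fun s" z] by (simp add: calc_cmul calc_const)
qed

lemma calc_cayley_inverse:
 "calc cayley (calc (%s. cnj (cayley s)) x) = x" "calc (%s. cnj (cayley s)) (calc cayley x) = x"
 using calc_mult[of cayley "%s. cnj (cayley s)" x] calc_mult[of "%s. cnj (cayley s)" cayley x] calc_const[of 1 x]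
 by (simp_all add: cayley_cnj mult.commute[of "cayley _"])

text \<open>The reciprocal of the resolvent function, cut off to a bounded interval; it inverts
  \<open>Q\<close> in the limit.\<close>

definition trunc :: "nat \<Rightarrow> real \<Rightarrow> complex"
 where "trunc n s = (complex_of_real s + \<i>) * indicator {- real n..real n} s"

lemma bdd_borel_trunc [simp]: "bdd_borel (trunc n)"
proof (rule bdd_borelI[where K = "real n + 1"])
 show "cmod (trunc n s) \<le> real n + 1" for s
  using norm_triangle_ineq[of "complex_of_real s" \<i>] by (auto simp: trunc_def indicator_def)
qed (simp add: trunc_def[abs_def])

lemma indicator_lim: "(%n. indicator {- real n..real n} s :: 'x::{zero_neq_one, t1_space}) ----> 1"
proof (rule tendsto_eventually)
 obtain N where "\<bar>s\<bar> \<le> real N" using real_arch_simple by blast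
 then have "indicator {- real n..real n} s = (1::'x)" if "n \<ge> N" for n
  using that by (auto simp: indicator_def)
 then show "\<forall>\<^sub>F n in sequentially. indicator {- real n..real n} s = (1::'x)"
  by (auto simp: eventually_sequentially)
qed

lemma E_lim: "(%n. calc (indicator {- real n..real n}) x) ----> x"
proof -
 have "(%n. calc (indicator {- real n..real n}) x) ----> calc (%_. 1) x"
 proof (rule calc_dominated[where K = 1])
  show "(%n. indicator {- real n..real n} s :: complex) ----> 1" for s by (rule indicator_lim)
  show "cmod (indicator {- real n..real n} s) \<le> 1" for n s by (simp add: indicator_def)
 qed auto
 then show ?thesis by (simp add: calc_const)
qed

lemma Q_trunc_lim: "(%n. Q (calc (trunc n) x)) ----> x"
proof -
 have "(%s. resolvent_fun s * trunc n s) = indicator {- real n..real n}" for n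
  by (auto simp: trunc_def resolvent_fun_mult mult.assoc[symmetric])
 then have "Q (calc (trunc n) x) = calc (indicator {- real n..real n}) x" for n
  using calc_mult[of resolvent_fun "trunc n" x] by simp
 then show ?thesis using E_lim by simp
qed

lemma sd_Q: "sd (Q z) = density (sd z) (%s. ennreal (inverse (s\<^sup>2 + 1)))"
 by (simp add: sd_calc norm_resolvent_fun_sq)

lemma integrable_square_op: "integrable (sd (Q z)) (%s. s\<^sup>2)"
proof -
 have "inverse (s\<^sup>2 + 1) * s\<^sup>2 \<le> 1" for s :: real
  by (simp add: divide_inverse[symmetric] mult.commute[of "inverse _"] divide_le_eq_1 add_nonneg_pos)
 then have "integrable (sd z) (%s. inverse (s\<^sup>2 + 1) *\<^sub>R s\<^sup>2)"
  by (intro finite_measure_integrable_bounded[OF finite_sd, where K = 1]) auto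
 then show ?thesis unfolding sd_Q by (subst integrable_density) auto
qed

lemma Domain_op: "Domain op = {x. integrable (sd x) (%s. s\<^sup>2)}"
proof (intro set_eqI iffI)
 fix x
 assume "x \<in> Domain op"
 then show "x \<in> {x. integrable (sd x) (%s. s\<^sup>2)}" using integrable_square_op by (auto simp: op_def)
next
 fix x
 assume "x \<in> {x. integrable (sd x) (%s. s\<^sup>2)}"
 then have int: "integrable (sd x) (%s. 1 + s\<^sup>2)"
  by (intro Bochner_Integration.integrable_add finite_measure.integrable_const[OF finite_sd]) simp
 \<comment> \<open>The tail of the integral of |s + \<i>|^2. It tends to 0 by integrability and
   controls the distance of two truncations.\<close>
 define a where "a n = (\<integral>s. (1 + s\<^sup>2) * (1 - indicator {- real n..real n} s) \<partial>sd x)" for n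
 have inta: "integrable (sd x) (%s. (1 + s\<^sup>2) * (1 - indicator {- real n..real n} s))" for n
  by (rule Bochner_Integration.integrable_bound[OF int]) (auto simp: indicator_def)
 have a0: "a ----> 0"
 proof -
  have "a ----> (\<integral>s. 0 \<partial>sd x)" unfolding a_def
  proof (rule integral_dominated_convergence[OF _ _ int])
   have "(%n. (1 + s\<^sup>2) * (1 - indicator {- real n..real n} s)) ----> (1 + s\<^sup>2) * (1 - 1)" for s :: real
    by (intro tendsto_intros indicator_lim)
   then show "AE s in sd x. (%n. (1 + s\<^sup>2) * (1 - indicator {- real n..real n} s)) ----> 0" by simp
  qed (auto simp: indicator_def)
  then show ?thesis by simp
 qed
 have diff: "(norm (calc (trunc m) x - calc (trunc n) x))\<^sup>2 \<le> a m + a n" for m n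
 proof -
  have "(norm (calc (trunc m) x - calc (trunc n) x))\<^sup>2 = (\<integral>s. (cmod (trunc m s - trunc n s))\<^sup>2 \<partial>sd x)"
   using norm_calc[of "%s. trunc m s - trunc n s" x] by (simp add: calc_diff)
  also have "\<dots> \<le> (\<integral>s. (1 + s\<^sup>2) * (1 - indicator {- real m..real m} s) + (1 + s\<^sup>2) * (1 - indicator {- real n..real n} s) \<partial>sd x)"
  proof (rule integral_mono)
   obtain K where K: "!!s. cmod (trunc m s - trunc n s) \<le> K"
    using bdd_borel_bound[OF bdd_borel_diff[OF bdd_borel_trunc bdd_borel_trunc]] by blast
   then show "integrable (sd x) (%s. (cmod (trunc m s - trunc n s))\<^sup>2)" using power_mono[OF K, of _ 2]
    by (intro finite_measure_integrable_bounded[OF finite_sd, where K = "K\<^sup>2"]) (auto simp: trunc_def)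
   show "(cmod (trunc m s - trunc n s))\<^sup>2 \<le> (1 + s\<^sup>2) * (1 - indicator {- real m..real m} s) + (1 + s\<^sup>2) * (1 - indicator {- real n..real n} s)" for s
    using cmod_real_plus_i[of s] by (auto simp: trunc_def indicator_def norm_minus_commute add.commute)
  qed (use inta in auto)
  also have "\<dots> = a m + a n" using inta by (simp add: a_def)
  finally show ?thesis .
 qed
 have "Cauchy (%n. calc (trunc n) x)"
  using diff by (intro Cauchy_power_bound[OF _ a0, where k = 2]) (simp add: dist_norm)
 then obtain z where "(%n. calc (trunc n) x) ----> z" using Cauchy_convergent convergent_def by blast
 then have "(%n. Q (calc (trunc n) x)) ----> Q z" by (intro clinear_tendsto[OF bounded_calc]) auto
 then have "x = Q z" using Q_trunc_lim LIMSEQ_unique by blast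
 then show "x \<in> Domain op" by (auto simp: op_def)
qed

lemma op_quadratic:
 assumes "(x, y) \<in> op"
 shows "cinner x y = complex_of_real (\<integral>s. s \<partial>sd x)"
proof -
 obtain z where z: "x = Q z" "y = z - \<i> *C Q z" using assms by (auto simp: op_def)
 define h where "h s = complex_of_real (s / (s\<^sup>2 + 1))" for s
 note hmult = cnj_resolvent_fun_mult[folded h_def]
 have "y = calc (%s. 1 - \<i> * resolvent_fun s) z" by (simp add: z calc_diff calc_cmul calc_const)
 then have "cinner x y = cinner z (calc (%s. cnj (resolvent_fun s) * (1 - \<i> * resolvent_fun s)) z)"
  by (simp add: z calc_adj calc_mult)
 also have "\<dots> = (\<integral>s. h s \<partial>sd z)"
  using bdd_borel_mult[of "%s. cnj (resolvent_fun s)" "%s. 1 - \<i> * resolvent_fun s"]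
  by (subst cinner_calc) (auto simp: hmult)
 also have "\<dots> = complex_of_real (\<integral>s. inverse (s\<^sup>2 + 1) *\<^sub>R s \<partial>sd z)"
  unfolding h_def integral_complex_of_real by (simp add: divide_inverse mult.commute)
 also have "(\<integral>s. inverse (s\<^sup>2 + 1) *\<^sub>R s \<partial>sd z) = (\<integral>s. s \<partial>sd x)"
  unfolding z sd_Q by (rule integral_density[symmetric]) auto
 finally show ?thesis .
qed

lemma Q_inj:
 assumes "Q z = 0"
 shows "z = 0"
proof -
 have "(norm (calc (%s. trunc n s * resolvent_fun s) z))\<^sup>2 = 0" for n
  using assms by (simp add: calc_mult clinear_zero[OF bounded_calc])
 moreover have "(%s. trunc n s * resolvent_fun s) = indicator {- real n..real n}" for n
  by (auto simp: trunc_def resolvent_fun_mult mult.commute indicator_def)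
 ultimately have "calc (indicator {- real n..real n}) z = 0" for n by simp
 then show ?thesis using E_lim[of z] by (simp add: LIMSEQ_const_iff)
qed

lemma self_adjoint_op: "self_adjoint op"
proof (rule symmetric_self_adjoint)
 have bQ: "bounded_clinear Q" by (simp add: bounded_calc)
 show "subspace op" unfolding op_def
 proof (rule subspaceI)
  show "0 \<in> range (%z. (Q z, z - \<i> *C Q z))"
   using bQ by (intro image_eqI[of _ _ 0]) (auto simp: clinear_zero zero_prod_def)
  show "p + p' \<in> range (%z. (Q z, z - \<i> *C Q z))"
   if p: "p \<in> range (%z. (Q z, z - \<i> *C Q z))" "p' \<in> range (%z. (Q z, z - \<i> *C Q z))" for p p'
  proof -
   obtain z z' where "p = (Q z, z - \<i> *C Q z)" "p' = (Q z', z' - \<i> *C Q z')" using p by auto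
   then show ?thesis
    using bQ by (intro image_eqI[of _ _ "z + z'"]) (auto simp: clinear_simps scaleC_add_right)
  qed
  show "c *\<^sub>R p \<in> range (%z. (Q z, z - \<i> *C Q z))" if p: "p \<in> range (%z. (Q z, z - \<i> *C Q z))" for c p
  proof -
   obtain z where "p = (Q z, z - \<i> *C Q z)" using p by auto
   then show ?thesis using bQ by (intro image_eqI[of _ _ "c *\<^sub>R z"])
     (auto simp: clinear_simps scaleR_diff_right scaleC_scaleR_commute)
  qed
 qed
 show "(\<i> *C x, \<i> *C y) \<in> op" if xy: "(x, y) \<in> op" for x y
 proof -
  obtain z where "x = Q z" "y = z - \<i> *C Q z" using xy by (auto simp: op_def)
  then show ?thesis
   unfolding op_def using bQ by (intro image_eqI[of _ _ "\<i> *C z"]) (auto simp: clinear_simps scaleC_diff_right)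
 qed
 show "cinner y x' = cinner y' x" if xy: "(x, x') \<in> op" "(y, y') \<in> op" for x x' y y'
 proof -
  obtain z w where zw: "x = Q z" "x' = z - \<i> *C Q z" "y = Q w" "y' = w - \<i> *C Q w"
   using xy by (auto simp: op_def)
  have 1: "z - \<i> *C Q z = calc (%s. 1 - \<i> * resolvent_fun s) z" for z
   by (simp add: calc_diff calc_cmul calc_const)
  have "cinner y x' = cinner w (calc (%s. cnj (resolvent_fun s) * (1 - \<i> * resolvent_fun s)) z)"
   unfolding zw 1 by (simp add: calc_adj calc_mult)
  also have "(%s. cnj (resolvent_fun s) * (1 - \<i> * resolvent_fun s)) = (%s. cnj (1 - \<i> * resolvent_fun s) * resolvent_fun s)"
  proof
   fix s
   show "cnj (resolvent_fun s) * (1 - \<i> * resolvent_fun s) = cnj (1 - \<i> * resolvent_fun s) * resolvent_fun s"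
    unfolding resolvent_fun_eq[symmetric] by simp
  qed
  also have "cinner w (calc (%s. cnj (1 - \<i> * resolvent_fun s) * resolvent_fun s) z) = cinner y' x"
   unfolding zw 1 by (subst calc_mult) (auto simp: calc_adj simp del: complex_cnj_diff complex_cnj_mult)
  finally show ?thesis .
 qed
 show "\<exists>x x'. (x, x') \<in> op \<and> x' + \<i> *C x = w" for w
  unfolding op_def by (intro exI[of _ "Q w"] exI[of _ "w - \<i> *C Q w"]) auto
 show "\<exists>x x'. (x, x') \<in> op \<and> x' - \<i> *C x = w" for w
 proof -
  \<comment> \<open>The inverse Cayley transform of w: as the Cayley transform is 1 - 2 \<i> Q,
    applying it to z returns w in the form z - 2 \<i> Q z.\<close>
  define z where "z = calc (%s. cnj (cayley s)) w"
  have "z - (2 * \<i>) *C Q z = w" using calc_cayley_inverse(1)[of w] by (simp add: z_def calc_cayley)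
  moreover have "(2 * \<i>) *C Q z = \<i> *C Q z + \<i> *C Q z" unfolding mult_2 by (rule scaleC_add_left)
  ultimately have "z - \<i> *C Q z - \<i> *C Q z = w" by (metis diff_diff_add)
  then show ?thesis unfolding op_def by (intro exI[of _ "Q z"] exI[of _ "z - \<i> *C Q z"]) auto
 qed
 show "v = 0" if "(0, v) \<in> op" for v using that Q_inj by (auto simp: op_def)
qed

lemma spectral_resolution_op: "spectral_resolution op E"
 unfolding spectral_resolution_def using E Domain_op op_quadratic by auto

end

text \<open>A spectral resolution fixes the domain and the quadratic form on it; polarization inside
  this dense domain recovers the operator.\<close>

lemma spectral_resolution_unique_op:
 assumes A: "self_adjoint A" and res: "spectral_resolution A E"
 shows "pvm E" "pvm.op E = A"
proof -
 show "pvm E" using res by (simp add: spectral_resolution_def pvm_def)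
 then interpret pvm E .
 have dom: "Domain A = Domain op" using res by (simp add: spectral_resolution_def Domain_op)
 have eq: "cinner x y = cinner x y'" if "(x, y) \<in> A" "(x, y') \<in> op" for x y y'
  using res that op_quadratic by (auto simp: spectral_resolution_def)
 note add = self_adjoint_add[OF A] self_adjoint_add[OF self_adjoint_op]
 note scale = self_adjoint_scaleC[OF A] self_adjoint_scaleC[OF self_adjoint_op]
 have same: "y = y'" if y: "(x, y) \<in> A" "(x, y') \<in> op" for x y y'
 proof -
  have "cinner (y - y') u = 0" if uv: "(u, v) \<in> A" for u v
  proof -
   obtain v' where v: "(u, v) \<in> A" "(u, v') \<in> op" using uv dom by blast
   have 1: "cinner u (y - y') + cinner x (v - v') = 0"
    using eq[OF add(1)[OF y(1) v(1)] add(2)[OF y(2) v(2)]] eq[OF y] eq[OF v]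
    by (simp add: cinner_add_left cinner_add_right cinner.diff_right algebra_simps)
   have "\<i> * (cinner x (v - v') - cinner u (y - y')) = 0"
    using eq[OF add(1)[OF y(1) scale(1)[OF v(1), of \<i>]] add(2)[OF y(2) scale(2)[OF v(2), of \<i>]]] eq[OF y] eq[OF v]
    by (simp add: cinner_add_left cinner_add_right cinner.diff_right cinner_scaleC_left
      cinner_scaleC_right algebra_simps)
   then have 2: "cinner x (v - v') - cinner u (y - y') = 0" by simp
   have "2 * cinner u (y - y') = (cinner u (y - y') + cinner x (v - v')) - (cinner x (v - v') - cinner u (y - y'))"
    by simp
   then have "cinner u (y - y') = 0" unfolding 1 2 by simp
   then show ?thesis by (metis cinner_commute complex_cnj_zero)
  qed
  then have "y - y' = 0" by (rule self_adjoint_dense[OF A])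
  then show ?thesis by simp
 qed
 show "op = A" using same dom by (auto; blast)
qed

text \<open>The Cayley transform of A is unitary without fixed vectors, so it has a spectral measure
  on the line. Comparing it with 1 - 2 \<i> Q identifies the resolvents and with them the
  graphs.\<close>

theorem spectral_theorem_self_adjoint:
 assumes A: "self_adjoint A"
 shows "\<exists>E. pvm E \<and> pvm.op E = A \<and> spectral_resolution A E"
proof -
 obtain Q W V where Q: "bounded_clinear Q" "A = range (%z. (Q z, z - \<i> *C Q z))"
  "cayley_operator W V" "!!z. W z = z - (2 * \<i>) *C Q z"
  by (rule self_adjoint_resolvent[OF A]) (rule that)
 interpret W: cayley_operator W V by (rule Q(3))
 obtain E where spec: "projection_valued_measure E"
  "!!x l. (\<integral>s. trigf l (cayley s) \<partial>spectral_distribution E x) = cinner x (W.trigT l x)"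
  using W.spectral_theorem by blast
 interpret pvm E by unfold_locales (rule spec(1))
 have "represents W cayley" unfolding represents_def using W.W spec(2)[where l = "[(1, 1, 0)]"] by simp
 then have "calc cayley = W" by (rule represents_calcI)
 then have "(2 * \<i>) *C calc resolvent_fun z = (2 * \<i>) *C Q z" for z
  using calc_cayley[of z] Q(4)[of z] by simp
 then have "inverse (2 * \<i>) *C (2 * \<i>) *C calc resolvent_fun z = inverse (2 * \<i>) *C (2 * \<i>) *C Q z" for z
  by simp
 then have "calc resolvent_fun z = Q z" for z by (simp add: scaleC_scaleC)
 then have "op = A" by (simp add: op_def Q(2))
 then show ?thesis using pvm_axioms spectral_resolution_op by auto
qed

lemma pvm_unique:
 assumes "pvm E" "pvm F" "pvm.op E = pvm.op F" and f: "bdd_borel f"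
 shows "pvm.calc E f = pvm.calc F f"
proof -
 interpret E: pvm E by fact
 interpret F: pvm F by fact
 have "E.Q z = F.Q z" for z
 proof -
  have "(F.Q z, z - \<i> *C F.Q z) \<in> E.op" by (simp add: assms(3) F.op_def)
  then obtain w where w: "F.Q z = E.Q w" "z - \<i> *C F.Q z = w - \<i> *C E.Q w" by (auto simp: E.op_def)
  then show ?thesis by simp
 qed
 then have c: "E.calc cayley x = F.calc cayley x" for x by (simp add: E.calc_cayley F.calc_cayley)
 have c': "E.calc (%s. cnj (cayley s)) x = F.calc (%s. cnj (cayley s)) x" for x
  by (metis c E.calc_cayley_inverse F.calc_cayley_inverse)
 show ?thesis using calc_intertwine[OF assms(2,1) clinear_id _ _ f] c c' by auto
qed

section \<open>Stone's theorem\<close>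

instance complex_hilbert \<subseteq> banach ..

definition character :: "real \<Rightarrow> real \<Rightarrow> complex"
 where "character t s = iexp (t * s)"

text \<open>Levy's uniqueness theorem concerns probability measures. The character at 0 gives equal
  total masses, by which both measures are normalised unless the mass is 0.\<close>

lemma finite_measure_char_unique:
 fixes M N :: "real measure"
 assumes M: "finite_measure M" "sets M = sets borel" and N: "finite_measure N" "sets N = sets borel"
  and eq: "!!t. (\<integral>s. character t s \<partial>M) = (\<integral>s. character t s \<partial>N)"
 shows "M = N"
proof -
 have sp: "space M = UNIV" "space N = UNIV"
  using sets_eq_imp_space_eq[OF M(2)] sets_eq_imp_space_eq[OF N(2)] by simp_all
 define m where "m = measure M UNIV"
 have "complex_of_real (measure M UNIV) = complex_of_real (measure N UNIV)"
  using eq[of 0] sp by (simp add: scaleR_conv_of_real character_def)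
 then have mN: "measure N UNIV = m" by (simp add: m_def)
 have em: "emeasure M A = ennreal (measure M A)" "emeasure N A = ennreal (measure N A)" for A
  using M N finite_measure.emeasure_eq_measure by blast+
 show ?thesis
 proof (cases "m = 0")
  case True
  have "measure M A = 0" "measure N A = 0" for A
   using finite_measure.bounded_measure[OF M(1), of A] finite_measure.bounded_measure[OF N(1), of A]
    sp mN True measure_nonneg[of M A] measure_nonneg[of N A]
   by (auto simp: m_def order_antisym)
  then show ?thesis using M N by (intro measure_eqI) (simp_all add: em)
 next
  case False
  then have m: "m > 0" using measure_nonneg[of M UNIV] by (simp add: m_def order_less_le)
  define D where "D X = density X (%_. ennreal (1 / m))" for X :: "real measure"
  have D: "real_distribution (D X)" if X: "finite_measure X" "sets X = sets borel" "measure X UNIV = m" for X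
  proof -
   have "space X = UNIV" using sets_eq_imp_space_eq[OF X(2)] by simp
   then have "emeasure (D X) (space (D X)) = 1"
    using X m by (simp add: D_def emeasure_density_const finite_measure.emeasure_eq_measure flip: ennreal_mult)
   then show ?thesis
    using X \<open>space X = UNIV\<close> by (auto simp: D_def real_distribution_def real_distribution_axioms_def intro!: prob_spaceI)
  qed
  have c: "(%s. iexp (t * s)) \<in> borel_measurable borel" for t
   by (intro borel_measurable_continuous_onI continuous_intros)
  have "char (D X) t = (1 / m) *\<^sub>R (\<integral>s. iexp (t * s) \<partial>X)" if "sets X = sets borel" for X t
   unfolding char_def D_def using m that c[of t]
   by (subst integral_density) (simp_all add: measurable_cong_sets[OF that refl])
  then have "char (D M) = char (D N)" using M N eq by (auto simp: character_def)
  then have DD: "D M = D N" using M N mN by (intro Levy_uniqueness D) (auto simp: m_def)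
  show ?thesis
  proof (rule measure_eqI)
   fix A
   assume A: "A \<in> sets M"
   have "emeasure (D M) A = emeasure (D N) A" by (simp add: DD)
   then have "enn2real (ennreal (1 / m) * ennreal (measure M A)) = enn2real (ennreal (1 / m) * ennreal (measure N A))"
    using A M N by (simp add: D_def emeasure_density_const em)
   then have "measure M A = measure N A" using m by (simp add: enn2real_mult)
   then show "emeasure M A = emeasure N A" using m by (simp add: em)
  qed (use M N in simp)
 qed
qed

lemma norm_le_of_dense:
 fixes w :: "'x::complex_inner"
 assumes "closure D = UNIV" "!!x. x \<in> D ==> cmod (cinner w x) \<le> c * norm x" "0 \<le> c"
 shows "norm w \<le> c"
proof -
 have "closed {x. cmod (cinner w x) \<le> c * norm x}"
  by (intro closed_Collect_le continuous_intros bounded_linear.continuous_on[OF cinner.bounded_linear_right])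
 then have "closure D \<subseteq> {x. cmod (cinner w x) \<le> c * norm x}"
  using assms(2) by (intro closure_minimal) auto
 then have "cmod (cinner w w) \<le> c * norm w" using assms(1) by auto
 then have n: "norm w * norm w \<le> c * norm w"
  by (simp add: cinner_self norm_power power2_eq_square norm_mult)
 then show ?thesis using \<open>0 \<le> c\<close> by (cases "w = 0") auto
qed

section \<open>One-parameter unitary groups and their generators\<close>

locale unitary_group =
 fixes V :: "real \<Rightarrow> 'h::complex_hilbert \<Rightarrow> 'h"
 assumes V_bounded: "!!t. bounded_clinear (V t)"
  and V_0: "!!x. V 0 x = x"
  and V_add: "!!s t x. V (s + t) x = V s (V t x)"
  and V_cinner: "!!t x y. cinner (V t x) (V t y) = cinner x y"
  and V_cont: "!!x. ((%t. V t x) \<longlongrightarrow> x) (at 0)"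
begin

text \<open>The factor \<i> makes the generator self-adjoint: \<open>V t\<close> is the exponential
  of \<i> t times it.\<close>

definition gen :: "('h \<times> 'h) set"
 where "gen = {(x, y). ((%t. V t x) has_vector_derivative \<i> *C y) (at 0)}"

lemma V_inverse: "V t (V (- t) x) = x" "V (- t) (V t x) = x"
 using V_add[of t "- t" x] V_add[of "- t" t x] V_0 by simp_all

lemma V_adj: "cinner (V t x) y = cinner x (V (- t) y)"
 using V_cinner[of t x "V (- t) y"] by (simp add: V_inverse)

lemma V_norm: "norm (V t x) = norm x"
proof -
 have "complex_of_real ((norm (V t x))\<^sup>2) = complex_of_real ((norm x)\<^sup>2)"
  using V_cinner[of t x x] by (simp only: cinner_self)
 then show ?thesis by (simp flip: of_real_power)
qed

lemma V_commute: "V s (V t x) = V t (V s x)" by (metis V_add add.commute)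

lemma V_continuous: "continuous_on UNIV (%t. V t x)"
 unfolding continuous_on_eq_continuous_at[OF open_UNIV]
proof
 fix s
 have "((%t. V s (V t x)) \<longlongrightarrow> V s x) (at 0)" by (intro clinear_tendsto[OF V_bounded] V_cont)
 then have "((%t. V (s + t) x) \<longlongrightarrow> V s x) (at 0)" by (simp add: V_add)
 then show "isCont (%t. V t x) s" by (simp add: isCont_def LIM_offset_zero_iff)
qed

lemma gen_derivative:
 assumes "(x, y) \<in> gen"
 shows "((%t. V t x) has_vector_derivative V s (\<i> *C y)) (at s)"
proof -
 have "((%t. V s (V t x)) has_vector_derivative V s (\<i> *C y)) (at 0)" using assms unfolding gen_def
  by (intro bounded_linear.has_vector_derivative[OF clinear_boundedD[OF V_bounded]]) simp
 moreover have "((%t. t - s) has_vector_derivative 1) (at s)" by (auto intro!: derivative_eq_intros)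
 ultimately have "((%t. V s (V t x)) \<circ> (%t. t - s) has_vector_derivative 1 *\<^sub>R V s (\<i> *C y)) (at s)"
  by (intro vector_diff_chain_at) simp_all
 moreover have "(%t. V s (V t x)) \<circ> (%t. t - s) = (%t. V t x)" by (simp add: fun_eq_iff V_add[symmetric])
 ultimately show ?thesis by simp
qed

lemma gen_invariant:
 assumes "(x, y) \<in> gen"
 shows "(V s x, V s y) \<in> gen"
proof -
 have "((%t. V s (V t x)) has_vector_derivative V s (\<i> *C y)) (at 0)" using assms unfolding gen_def
  by (intro bounded_linear.has_vector_derivative[OF clinear_boundedD[OF V_bounded]]) simp
 then show ?thesis by (simp add: gen_def V_commute[of s] clinear_scaleC[OF V_bounded])
qed

lemma gen_symmetric:
 assumes x: "(x, x') \<in> gen" and y: "(y, y') \<in> gen"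
 shows "cinner y x' = cinner y' x"
proof -
 have "((%t. cinner (V t y) (V t x)) has_vector_derivative
   cinner (V 0 y) (V 0 (\<i> *C x')) + cinner (V 0 (\<i> *C y')) (V 0 x)) (at 0)"
  by (intro cinner.has_vector_derivative gen_derivative x y)
 moreover have "((%t. cinner (V t y) (V t x)) has_vector_derivative 0) (at 0)" by (simp add: V_cinner)
 ultimately have "cinner (V 0 y) (V 0 (\<i> *C x')) + cinner (V 0 (\<i> *C y')) (V 0 x) = 0"
  by (rule vector_derivative_unique_at)
 then have "\<i> * (cinner y x' - cinner y' x) = 0"
  by (simp add: V_0 cinner_scaleC_left cinner_scaleC_right algebra_simps)
 then show ?thesis by simp
qed

lemma gen_smoothing:
 assumes h: "0 < h"
 shows "(integral {0..h} (%s. V s x), - \<i> *C (V h x - x)) \<in> gen"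
proof -
 \<comment> \<open>The primitive starts at -1, so that 0 is an interior point and two-sided
   derivatives are available there.\<close>
 define G where "G t = integral {-1..t} (%s. V s x)" for t
 have cont: "continuous_on S (%s. V s x)" for S by (rule continuous_on_subset[OF V_continuous]) simp
 have dG: "(G has_vector_derivative V t x) (at t)" if "-1 < t" for t
 proof -
  have "(G has_vector_derivative V t x) (at t within {-1..t + 1})"
   unfolding G_def using that by (intro integral_has_vector_derivative cont) auto
  moreover have "at t within {-1..t + 1} = at t" using that by (intro at_within_interior) auto
  ultimately show ?thesis by simp
 qed
 define x0 where "x0 = integral {0..h} (%s. V s x)"
 have int: "(%s. V s x) integrable_on {a..b}" for a b by (intro integrable_continuous_interval cont)
 have G_diff: "integral {a..b} (%s. V s x) = G b - G a" if "-1 \<le> a" "a \<le> b" for a b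
  using Henstock_Kurzweil_Integration.integral_combine[OF that int] by (simp add: G_def eq_diff_eq add.commute)
 have Vx0: "V t x0 = G (h + t) - G t" if "-1 < t" for t
 proof -
  have "V t x0 = integral {0..h} (V t \<circ> (%s. V s x))"
   unfolding x0_def by (intro integral_linear[symmetric] int clinear_boundedD V_bounded)
  also have "V t \<circ> (%s. V s x) = (%s. V (s + t) x)" by (auto simp: V_add V_commute)
  also have "integral {0..h} (%s. V (s + t) x) = integral {0 + t..h + t} (%s. V s x)"
   using integral_shift_Icc_real[of 0 h "%s. V s x" t] by (simp add: o_def add.commute)
  also have "\<dots> = G (h + t) - G t" using h that by (simp add: G_diff)
  finally show ?thesis .
 qed
 have "((%t. G (h + t) - G t) has_vector_derivative 1 *\<^sub>R V (h + 0) x - V 0 x) (at 0)"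
 proof (intro has_vector_derivative_diff dG)
  have "((%t. h + t) has_vector_derivative 1) (at 0)" by (auto intro!: derivative_eq_intros)
  then have "(G \<circ> (%t. h + t) has_vector_derivative 1 *\<^sub>R V (h + 0) x) (at 0)"
   using h by (intro vector_diff_chain_at dG) auto
  then show "((%t. G (h + t)) has_vector_derivative 1 *\<^sub>R V (h + 0) x) (at 0)" by (simp add: o_def)
 qed simp
 then have "((%t. V t x0) has_vector_derivative 1 *\<^sub>R V (h + 0) x - V 0 x) (at 0)"
  by (rule has_vector_derivative_transform_within_open[where S = "{-1<..<1}"]) (auto simp: Vx0)
 then show ?thesis by (simp add: gen_def x0_def[symmetric] V_0 scaleC_scaleC flip: scaleC_minus_right)
qed

lemma gen_dense: "closure (Domain gen) = UNIV"
proof -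
 have "x \<in> closure (Domain gen)" for x
 proof -
  define z where "z h = (1 / h) *\<^sub>R integral {0..h} (%s. V s x)" for h :: real
  have "((%h. integral {0..h} (%s. V s x)) has_vector_derivative V 0 x) (at 0 within {0..1})"
   by (intro integral_has_vector_derivative continuous_on_subset[OF V_continuous]) auto
  then have "((%h. (1 / norm (h - 0)) *\<^sub>R (integral {0..h} (%s. V s x) - (integral {0..0} (%s. V s x) + (h - 0) *\<^sub>R V 0 x))) \<longlongrightarrow> 0)
    (at 0 within {0..1})"
   by (simp only: has_vector_derivative_def has_derivative_within)
  then have lim: "((%h. (1 / norm h) *\<^sub>R (integral {0..h} (%s. V s x) - h *\<^sub>R x)) \<longlongrightarrow> 0) (at 0 within {0..1})"
   by (simp add: V_0)
  have "z h \<in> Domain gen" if "0 < h" for h using gen_smoothing[OF that, of "(1 / h) *\<^sub>R x"]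
   by (auto simp: z_def clinear_scaleR[OF V_bounded])
  moreover have "(%n. z (inverse (real (Suc n)))) ----> x"
  proof (rule LIM_zero_cancel)
   have "((%h. (1 / norm h) *\<^sub>R (integral {0..h} (%s. V s x) - h *\<^sub>R x)) \<circ> (%n. inverse (real (Suc n)))) ----> 0"
    using lim LIMSEQ_inverse_real_of_nat unfolding tendsto_at_iff_sequentially by (force simp: field_simps)
   then show "(%n. z (inverse (real (Suc n))) - x) ----> 0" by (simp add: z_def o_def scaleR_diff_right)
  qed
  ultimately show ?thesis
   unfolding closure_sequential by (metis inverse_positive_iff_positive of_nat_0_less_iff zero_less_Suc)
 qed
 then show ?thesis by auto
qed


text \<open>Tested against x in the domain, \<open>V s y\<close> has derivative \<i>
  \<open>V s z\<close>, although y is only known to lie in the domain of the adjoint. The mean value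
  inequality bounds the remainder, and density removes the test vector.\<close>

lemma gen_difference_bound:
 assumes yz: "(y, z) \<in> graph_adjoint gen" and e: "0 \<le> e"
  and d: "!!s. \<bar>s\<bar> < d ==> norm (V s z - z) \<le> e" and t: "\<bar>t\<bar> < d"
 shows "norm (V t y - y - t *\<^sub>R (\<i> *C z)) \<le> e * \<bar>t\<bar>"
proof (rule norm_le_of_dense[OF gen_dense])
 fix x
 assume "x \<in> Domain gen"
 then obtain x' where x: "(x, x') \<in> gen" by auto
 define m where "m s = cinner (V s y - y - s *\<^sub>R (\<i> *C z)) x" for s
 have m: "m s = cinner y (V (- s) x) - cinner y x - s *\<^sub>R cinner (\<i> *C z) x" for s
  by (simp add: m_def cinner.diff_left cinner_scaleR_left V_adj)
 have deriv: "(m has_vector_derivative - \<i> * cinner (V s z - z) x) (at s within {- d<..<d})" for s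
 proof -
  have "((%s. - s) has_vector_derivative - 1) (at s)" by (auto intro!: derivative_eq_intros)
  then have "((%t. V t x) \<circ> (%s. - s) has_vector_derivative (- 1) *\<^sub>R V (- s) (\<i> *C x')) (at s)"
   by (rule vector_diff_chain_at[OF _ gen_derivative[OF x]])
  then have "((%s. V (- s) x) has_vector_derivative - V (- s) (\<i> *C x')) (at s)" by (simp add: o_def)
  then have "((%s. cinner y (V (- s) x) - cinner y x - s *\<^sub>R cinner (\<i> *C z) x) has_vector_derivative
    cinner y (- V (- s) (\<i> *C x')) - 0 - 1 *\<^sub>R cinner (\<i> *C z) x) (at s)"
   by (intro has_vector_derivative_diff bounded_linear.has_vector_derivative[OF cinner.bounded_linear_right]
     has_vector_derivative_const bounded_linear.has_vector_derivative[OF bounded_linear_scaleR_left]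
     has_vector_derivative_id)
  moreover have "cinner y (V (- s) x') = cinner (V s z) x"
   using yz gen_invariant[OF x, of "- s"] by (auto simp: graph_adjoint_def V_adj)
  ultimately have "(m has_vector_derivative - \<i> * cinner (V s z - z) x) (at s)"
   by (simp add: m[abs_def] cinner.minus_right clinear_scaleC[OF V_bounded] cinner_scaleC_right
     cinner_scaleC_left cinner.diff_left algebra_simps)
  then show ?thesis by (rule has_vector_derivative_at_within)
 qed
 have "norm (m t - m 0) \<le> (e * norm x) * norm (t - 0)"
 proof (rule differentiable_bound[where S = "{- d<..<d}"])
  show "(m has_derivative (%h. h *\<^sub>R (- \<i> * cinner (V s z - z) x))) (at s within {- d<..<d})" for s
   using deriv by (simp add: has_vector_derivative_def)
  show "onorm (%h::real. h *\<^sub>R (- \<i> * cinner (V s z - z) x)) \<le> e * norm x" if "s \<in> {- d<..<d}" for s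
  proof (rule onorm_bound)
   have "cmod (cinner (V s z - z) x) \<le> norm (V s z - z) * norm x" by (rule cinner_Cauchy_Schwarz)
   also have "\<dots> \<le> e * norm x" using that by (intro mult_right_mono d) auto
   finally show "norm (h *\<^sub>R (- \<i> * cinner (V s z - z) x)) \<le> e * norm x * norm h" for h :: real
    by (simp add: norm_mult mult.commute mult_left_mono)
  qed (use e in simp)
 qed (use t in auto)
 moreover have "m 0 = 0" by (simp add: m_def V_0)
 ultimately show "cmod (cinner (V t y - y - t *\<^sub>R (\<i> *C z)) x) \<le> e * \<bar>t\<bar> * norm x"
  by (simp add: m_def mult_ac)
qed (use e in simp)

lemma self_adjoint_gen: "self_adjoint gen"
proof -
 have "(y, z) \<in> gen" if yz: "(y, z) \<in> graph_adjoint gen" for y z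
 proof -
  have "((%t. V t y) has_derivative (%h. h *\<^sub>R (\<i> *C z))) (at 0)" unfolding has_derivative_at_alt
  proof (intro conjI allI impI)
   show "bounded_linear (%h::real. h *\<^sub>R (\<i> *C z))" by (rule bounded_linear_scaleR_left)
   fix e :: real
   assume "0 < e"
   then obtain d where d: "d > 0" "!!s. s \<noteq> 0 ==> \<bar>s\<bar> < d ==> norm (V s z - z) < e"
    using LIM_D[OF V_cont[of z], of e] by auto
   have "norm (V s z - z) \<le> e" if "\<bar>s\<bar> < d" for s
    using d(2)[of s] that \<open>0 < e\<close> by (cases "s = 0") (auto simp: V_0)
   from gen_difference_bound[OF yz _ this] show "\<exists>d>0. \<forall>t. norm (t - 0) < d \<longrightarrow>
     norm (V t y - V 0 y - (t - 0) *\<^sub>R (\<i> *C z)) \<le> e * norm (t - 0)"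
    using \<open>0 < e\<close> \<open>d > 0\<close> by (intro exI[of _ d]) (simp add: V_0)
  qed
  then show ?thesis by (simp add: gen_def has_vector_derivative_def)
 qed
 moreover have "(y, z) \<in> graph_adjoint gen" if "(y, z) \<in> gen" for y z
  using gen_symmetric[OF _ that] by (auto simp: graph_adjoint_def)
 ultimately show ?thesis using gen_dense by (auto simp: self_adjoint_def)
qed

end

section \<open>The unitary group of a projection-valued measure\<close>

lemma bdd_borel_character [simp]: "bdd_borel (character t)" unfolding character_def[abs_def]
 by (rule bdd_borelI[where K = 1]) (auto intro!: borel_measurable_continuous_onI continuous_intros)

lemma character_simps [simp]: "character 0 s = 1" "cmod (character t s) = 1"
 by (simp_all add: character_def)

lemma character_add: "character (r + t) s = character r s * character t s"
 by (simp add: character_def distrib_left distrib_right flip: exp_add)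

lemma character_cnj: "cnj (character t s) = character (- t) s" by (simp add: character_def exp_cnj)

lemma character_inverse: "character (- t) s * character t s = 1" by (simp flip: character_add)

lemma has_vector_derivative_at_0_iff:
 "(f has_vector_derivative d) (at (0::real)) \<longleftrightarrow> ((%h. (1 / h) *\<^sub>R (f h - f 0)) \<longlongrightarrow> d) (at 0)"
proof -
 have "norm (f h - f 0 - h *\<^sub>R d) / norm h = norm ((1 / h) *\<^sub>R (f h - f 0) - d)" if "h \<noteq> 0" for h
 proof -
  have "(1 / h) *\<^sub>R (f h - f 0) - d = (1 / h) *\<^sub>R (f h - f 0 - h *\<^sub>R d)"
   using that by (simp add: scaleR_diff_right)
  then show ?thesis by simp
 qed
 then have "((%h. norm (f h - f 0 - h *\<^sub>R d) / norm h) \<longlongrightarrow> 0) (at 0) \<longleftrightarrow>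
   ((%h. norm ((1 / h) *\<^sub>R (f h - f 0) - d)) \<longlongrightarrow> 0) (at 0)"
  by (intro tendsto_cong) (auto simp: eventually_at_filter)
 then show ?thesis by (simp add: has_vector_derivative_def has_derivative_at bounded_linear_scaleR_left
    tendsto_norm_zero_iff LIM_zero_iff)
qed

lemma character_derivative: "((%h. (character h s - 1) / of_real h) \<longlongrightarrow> \<i> * s) (at 0)"
proof -
 have "(iexp \<circ> (%h. h * s) has_vector_derivative s *\<^sub>R (\<i> * iexp (0 * s))) (at 0)"
  by (intro vector_diff_chain_at has_vector_derivative_iexp) (auto intro!: derivative_eq_intros)
 then have "((%h. character h s) has_vector_derivative \<i> * s) (at 0)"
  by (simp add: o_def character_def[abs_def] scaleR_conv_of_real mult.commute)
 then show ?thesis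
  by (simp add: has_vector_derivative_at_0_iff scaleR_conv_of_real divide_inverse mult.commute)
qed

context pvm
begin

lemma unitary_group_calc: "unitary_group (%t. calc (character t))"
proof
 show "calc (character 0) x = x" for x
  using calc_const[of 1 x] by (simp add: character_simps(1)[abs_def])
 show "calc (character (r + t)) x = calc (character r) (calc (character t) x)" for r t x
  by (simp add: character_add[abs_def] calc_mult)
 show "cinner (calc (character t) x) (calc (character t) y) = cinner x y" for t x y
  using calc_mult[of "character (- t)" "character t" y] calc_const[of 1 y]
  by (simp add: calc_adj character_cnj character_inverse)
 show "((%t. calc (character t) x) \<longlongrightarrow> x) (at 0)" for x unfolding tendsto_at_iff_sequentially o_def
 proof (intro allI impI)
  fix X :: "nat \<Rightarrow> real"
  assume "X ----> 0"
  then have "(%n. character (X n) s) ----> character 0 s" for s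
   unfolding character_def by (intro tendsto_intros)
  then have "(%n. calc (character (X n)) x) ----> calc (%s. 1) x" by (intro calc_dominated[where K = 1]) auto
  then show "(%n. calc (character (X n)) x) ----> x" by (simp add: calc_const)
 qed
qed (simp add: bounded_calc)

sublocale calc_group: unitary_group "%t. calc (character t)" by (rule unitary_group_calc)

lemma op_subset_gen: "op \<subseteq> calc_group.gen"
proof
 fix p
 assume "p \<in> op"
 then obtain z where p: "p = (Q z, z - \<i> *C Q z)" by (auto simp: op_def)
 \<comment> \<open>Difference quotient of the character times the resolvent function. As |exp (\<i>
   h s) - 1| is at most |h s| and |s| is at most |s + \<i>|, it is bounded by 1, which permits
   dominated convergence.\<close>
 define D where "D h s = (character h s - 1) * resolvent_fun s / of_real h" for h s
 have D_bound: "cmod (D h s) \<le> 1" if "h \<noteq> 0" for h s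
 proof -
  have "cmod (character h s - 1) \<le> \<bar>h * s\<bar>" using iexp_approx1[of "h * s" 0] by (simp add: character_def)
  moreover have "\<bar>s\<bar> * cmod (resolvent_fun s) \<le> 1"
  proof (rule power2_le_imp_le)
   show "(\<bar>s\<bar> * cmod (resolvent_fun s))\<^sup>2 \<le> 1\<^sup>2"
    by (simp add: power_mult_distrib norm_resolvent_fun_sq divide_simps add_nonneg_pos)
  qed simp
  ultimately have "cmod (character h s - 1) * cmod (resolvent_fun s) \<le> \<bar>h\<bar> * 1"
   using mult_right_mono[of "cmod (character h s - 1)" "\<bar>h * s\<bar>" "cmod (resolvent_fun s)"]
    mult_left_mono[of "\<bar>s\<bar> * cmod (resolvent_fun s)" 1 "\<bar>h\<bar>"]
   by (simp add: abs_mult mult.assoc)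
  then show ?thesis using that by (simp add: D_def norm_mult norm_divide divide_le_eq)
 qed
 have D_b: "bdd_borel (D h)" for h
  unfolding D_def divide_inverse by (intro bdd_borel_mult bdd_borel_diff bdd_borel_character bdd_borel_const bdd_borel_resolvent)
 have calc_D: "calc (D h) z = (1 / h) *\<^sub>R (calc (character h) (Q z) - Q z)" for h
 proof -
  have "D h = (%s. of_real (1 / h) * (character h s * resolvent_fun s - resolvent_fun s))"
   by (auto simp: D_def algebra_simps divide_simps)
  then have "calc (D h) z = of_real (1 / h) *C calc (%s. character h s * resolvent_fun s - resolvent_fun s) z"
   by (simp only:) (rule calc_cmul, simp)
  then show ?thesis
   by (subst (asm) calc_diff) (simp_all add: calc_mult scaleC_of_real del: of_real_divide)
 qed
 have "((%h. calc (D h) z) \<longlongrightarrow> \<i> *C (z - \<i> *C Q z)) (at 0)" unfolding tendsto_at_iff_sequentially o_def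
 proof (intro allI impI)
  fix X :: "nat \<Rightarrow> real"
  assume X0: "\<forall>i. X i \<in> UNIV - {0}" and X: "X ----> 0"
  have "(%n. (character (X n) s - 1) / of_real (X n) * resolvent_fun s) ----> \<i> * s * resolvent_fun s" for s
   using character_derivative[of s] X0 X unfolding tendsto_at_iff_sequentially o_def
   by (intro tendsto_mult tendsto_const) auto
  then have "(%n. D (X n) s) ----> \<i> * s * resolvent_fun s" for s by (simp add: D_def)
  moreover have eq: "(%s. \<i> * s * resolvent_fun s) = (%s. \<i> * (1 - \<i> * resolvent_fun s))"
   by (simp only: mult.assoc resolvent_fun_eq)
  moreover have "bdd_borel (%s. \<i> * s * resolvent_fun s)"
   unfolding eq by (intro bdd_borel_mult bdd_borel_diff bdd_borel_const bdd_borel_resolvent)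
  ultimately have "(%n. calc (D (X n)) z) ----> calc (%s. \<i> * s * resolvent_fun s) z"
   using X0 by (intro calc_dominated[where K = 1] D_b D_bound) auto
  then show "(%n. calc (D (X n)) z) ----> \<i> *C (z - \<i> *C Q z)"
   by (simp add: eq calc_cmul calc_diff calc_const)
 qed
 then have "((%t. calc (character t) (Q z)) has_vector_derivative \<i> *C (z - \<i> *C Q z)) (at 0)"
  using calc_const[of 1 "Q z"] by (simp add: has_vector_derivative_at_0_iff calc_D character_simps(1)[abs_def])
 then show "p \<in> calc_group.gen" by (simp add: p calc_group.gen_def)
qed

text \<open>A self-adjoint operator has no proper symmetric extension.\<close>

lemma op_eq_gen: "op = calc_group.gen"
proof -
 have "(x, y) \<in> op" if xy: "(x, y) \<in> calc_group.gen" for x y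
  using calc_group.gen_symmetric[OF _ xy] op_subset_gen by (intro self_adjointI[OF self_adjoint_op]) blast
 then show ?thesis using op_subset_gen by auto
qed

end

theorem (in unitary_group) Stone:
 obtains E where "pvm E" "!!t. V t = pvm.calc E (character t)"
proof -
 obtain E where E: "pvm E" "pvm.op E = gen"
  using spectral_theorem_self_adjoint[OF self_adjoint_gen] by blast
 note op_E = E(2)
 interpret pvm E by fact
 have gen: "calc_group.gen = gen" using op_eq_gen op_E by simp
 have eq: "V t x = calc (character t) x" if x: "(x, y) \<in> gen" for t x y
 proof -
  \<comment> \<open>The inner product of the two candidate orbits has derivative zero, so it keeps
    its value at 0, the squared norm of x. Both orbits have that norm, hence they coincide.\<close>
  define k where "k s = cinner (V s x) (calc (character s) x)" for s
  have "(k has_derivative (%h. 0)) (at s within UNIV)" for s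
  proof -
   have "(k has_vector_derivative cinner (V s x) (calc (character s) (\<i> *C y)) + cinner (V s (\<i> *C y)) (calc (character s) x)) (at s)"
    unfolding k_def using x gen by (intro cinner.has_vector_derivative gen_derivative calc_group.gen_derivative) simp_all
   moreover have "cinner (V s x) (calc (character s) y) = cinner (V s y) (calc (character s) x)"
    using calc_group.gen_invariant[of x y s] gen_invariant[OF x, of s] x gen by (intro gen_symmetric) simp_all
   ultimately show ?thesis by (simp add: has_vector_derivative_def clinear_scaleC[OF V_bounded]
      clinear_scaleC[OF bounded_calc] cinner_scaleC_left cinner_scaleC_right)
  qed
  then obtain c where "!!s. k s = c" using has_derivative_zero_constant[OF convex_UNIV] by blast
  then have "k t = k 0" by simp
  also have "k 0 = cinner x x" by (simp add: k_def V_0 calc_group.V_0)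
  finally have "Re (cinner (V t x) (calc (character t) x)) = (norm x)\<^sup>2" by (simp add: k_def cinner_self)
  then have "(norm (V t x - calc (character t) x))\<^sup>2 = 0"
   using dot_norm_neg[of "V t x" "calc (character t) x"] by (simp add: Re_cinner V_norm calc_group.V_norm)
  then show ?thesis by simp
 qed
 have "V t = calc (character t)" for t
 proof (rule clinear_eq_on_dense[OF V_bounded bounded_calc])
  show "closure (span (Domain gen)) = UNIV" using gen_dense closure_mono[OF span_superset] by blast
 qed (use eq in auto)
 then show thesis using that pvm_axioms by blast
qed

section \<open>Positive nonsingular operators\<close>

context pvm
begin

lemma AE_sd_iff: "B \<in> sets borel ==> (AE s in sd x. s \<in> B) \<longleftrightarrow> E (- B) x = 0"
 using measure_sd[of "- B" x] finite_measure.emeasure_eq_measure[OF finite_sd, of x]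
 by (subst AE_iff_measurable[of "- B"]) (auto simp: Compl_eq_Diff_UNIV[symmetric])

lemma sd_eq: "pvm F ==> (!!t. cinner x (calc (character t) x) = cinner y (pvm.calc F (character t) y)) ==>
  sd x = spectral_distribution F y"
 using pvm.finite_sd[of F] by (intro finite_measure_char_unique finite_sd)
  (auto simp: cinner_calc pvm.cinner_calc)

text \<open>The spectral distribution of an eigenvector of the group is a point mass at r, as its
  characters show, so functions act by their value at r.\<close>

lemma calc_eigenvector:
 assumes "!!t. calc (character t) x = character t r *C x" and f: "bdd_borel f"
 shows "calc f x = f r *C x"
proof -
 let ?M = "density (return borel r) (%_. ennreal ((norm x)\<^sup>2))"
 have int: "(\<integral>s. g s \<partial>?M) = of_real ((norm x)\<^sup>2) * g r" if [measurable]: "g \<in> borel_measurable borel" for g :: "real \<Rightarrow> complex"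
  by (subst integral_density) (auto simp: integral_return scaleR_conv_of_real)
 have sd: "sd x = ?M"
 proof (rule finite_measure_char_unique[OF finite_sd])
  show "(\<integral>s. character t s \<partial>sd x) = (\<integral>s. character t s \<partial>?M)" for t
   using cinner_calc[of "character t" x] int[of "character t"] bdd_borel_measurable[OF bdd_borel_character, of t]
   by (simp add: assms(1) cinner_scaleC_right cinner_self mult.commute)
  show "finite_measure ?M" by (rule finite_measureI) (simp add: emeasure_density_const emeasure_return)
 qed simp_all
 have "(norm (calc (%s. f s - f r) x))\<^sup>2 = (\<integral>s. (cmod (f s - f r))\<^sup>2 \<partial>?M)"
  using norm_calc[of "%s. f s - f r" x] f by (simp add: sd)
 also have "\<dots> = 0"
  using bdd_borel_measurable[OF f] by (subst integral_density) (auto simp: integral_return)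
 finally show ?thesis using f by (simp add: calc_diff calc_const)
qed

text \<open>The prescribed integrand f may be unbounded off the spectrum; g is a bounded version of
  it. The \<open>THE\<close> is resolved because all spectral resolutions of the operator have the
  same distributions.\<close>

lemma functional_calculus_op:
 assumes g: "bdd_borel g" and f: "f \<in> borel_measurable borel" and eq: "!!x. AE s in sd x. f s = g s"
 shows "functional_calculus op f = calc g" unfolding functional_calculus_def
proof (rule the_equality)
 have sets: "f \<in> borel_measurable (sd x)" "g \<in> borel_measurable (sd x)" for x
  using f bdd_borel_measurable[OF g] by simp_all
 have int: "integrable (sd x) f \<and> (\<integral>s. f s \<partial>sd x) = (\<integral>s. g s \<partial>sd x)" for x
  using integrable_sd[OF g, of x] integrable_cong_AE[OF sets eq, of x] integral_cong_AE[OF sets eq, of x] by simp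
 then show "bounded_clinear (calc g) \<and> (\<exists>E. spectral_resolution op E \<and>
   (\<forall>x. integrable (spectral_distribution E x) f \<and> cinner x (calc g x) = (\<integral>s. f s \<partial>spectral_distribution E x)))"
  using spectral_resolution_op bounded_calc[OF g] cinner_calc[OF g] by auto
 fix T
 assume T: "bounded_clinear T \<and> (\<exists>E. spectral_resolution op E \<and>
   (\<forall>x. integrable (spectral_distribution E x) f \<and> cinner x (T x) = (\<integral>s. f s \<partial>spectral_distribution E x)))"
 then obtain F where F: "spectral_resolution op F" "!!x. cinner x (T x) = (\<integral>s. f s \<partial>spectral_distribution F x)"
  by blast
 have "pvm F" "pvm.op F = op" using spectral_resolution_unique_op[OF self_adjoint_op F(1)] by auto
 then have "spectral_distribution F x = sd x" for x
  using pvm_unique[OF \<open>pvm F\<close> pvm_axioms] by (intro sd_eq[symmetric]) auto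
 then show "T = calc g"
  using T F(2) int cinner_calc[OF g] by (intro clinear_ext_cinner bounded_calc g) auto
qed

text \<open>On vectors Q z the form of the operator is the integral of s/(s^2 + 1). It is negative
  for nonzero z living on the negative half line, so positivity kills that part, and an atom at 0
  would give a kernel vector.\<close>

lemma positive_nonsingular_support:
 assumes pos: "positive_nonsingular op"
 shows "E {..0} x = 0"
proof -
 define h where "h s = s / (s\<^sup>2 + 1)" for s :: real
 note h_eq = cnj_resolvent_fun_mult[folded h_def, symmetric]
 have hb: "bdd_borel (%s. of_real (h s))"
  unfolding h_eq by (intro bdd_borel_mult bdd_borel_cnj bdd_borel_diff bdd_borel_const bdd_borel_resolvent)
 have h_nonneg: "0 \<le> Re (\<integral>s. of_real (h s) \<partial>sd z)" for z
 proof -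
  have "(Q z, z - \<i> *C Q z) \<in> op" by (simp add: op_def)
  then have "0 \<le> Re (cinner (Q z) (z - \<i> *C Q z))" using pos by (auto simp: positive_nonsingular_def)
  also have "cinner (Q z) (z - \<i> *C Q z) = cinner z (calc (%s. cnj (resolvent_fun s)) (calc (%s. 1 - \<i> * resolvent_fun s) z))"
   by (simp add: calc_adj calc_diff calc_cmul calc_const)
  also have "\<dots> = (\<integral>s. of_real (h s) \<partial>sd z)" using hb by (simp add: h_eq cinner_calc flip: calc_mult)
  finally show ?thesis .
 qed
 have neg: "E {..<0} x = 0"
 proof -
  have int: "integrable (sd x) (%s. h s * indicator {..<0} s)"
   using integrable_sd[OF bdd_borel_mult[OF hb bdd_borel_indicator[of "{..<0}"]], of x, THEN integrable_Re]
   by (simp add: indicator_def of_bool_def if_distrib[of Re] cong: if_cong)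
  have "(\<integral>s. complex_of_real (h s) \<partial>sd (E {..<0} x)) = (\<integral>s. of_real (h s) * indicator {..<0} s \<partial>sd x)"
   using hb by (intro sd_restrict) auto
  also have "\<dots> = complex_of_real (\<integral>s. h s * indicator {..<0} s \<partial>sd x)"
   by (simp flip: integral_complex_of_real add: of_real_indicator)
  finally have "0 \<le> (\<integral>s. h s * indicator {..<0} s \<partial>sd x)" using h_nonneg[of "E {..<0} x"] by simp
  then have "(\<integral>s. - (h s * indicator {..<0} s) \<partial>sd x) \<le> 0" by simp
  moreover have nn: "0 \<le> - (h s * indicator {..<0} s)" for s
   by (auto simp: h_def indicator_def divide_nonpos_nonneg)
  ultimately have "(\<integral>s. - (h s * indicator {..<0} s) \<partial>sd x) = 0"
   using Bochner_Integration.integral_nonneg[OF nn] by (intro order_antisym)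
  then have "AE s in sd x. - (h s * indicator {..<0} s) = 0"
   using int nn by (subst (asm) integral_nonneg_eq_0_iff_AE) auto
  then have "AE s in sd x. s \<in> {0..}"
   by eventually_elim (auto simp: h_def indicator_def add_nonneg_eq_0_iff split: if_splits)
  then show ?thesis by (subst (asm) AE_sd_iff) (auto simp: Compl_eq_Diff_UNIV[symmetric] Compl_atLeast)
 qed
 have zero: "E {0} x = 0"
 proof -
  define z where "z = E {0} x"
  have "Q z = calc (%s. resolvent_fun s * indicator {0} s) x"
   using E_calc_commute[of "{0}" resolvent_fun x] by (simp add: z_def)
  also have "(%s. resolvent_fun s * indicator {0} s) = (%s. - \<i> * indicator {0} s)"
   by (auto simp: resolvent_fun_def indicator_def)
  also have "calc (%s. - \<i> * indicator {0} s) x = - \<i> *C z"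
   by (subst calc_cmul) (auto simp: calc_indicator z_def)
  finally have Qz: "Q z = - (\<i> *C z)" by simp
  have "(Q z, z - \<i> *C Q z) \<in> op" by (simp add: op_def)
  then have "(- (\<i> *C z), 0) \<in> op" by (simp add: Qz scaleC_scaleC)
  then have "- (\<i> *C z) = 0" using pos unfolding positive_nonsingular_def by blast
  then have "norm (\<i> *C z) = 0" by simp
  then show ?thesis by (simp add: norm_scaleC z_def)
 qed
 have "(%s. indicator {..<0} s + indicator {0} s) = (indicator {..0} :: real \<Rightarrow> complex)"
  by (auto simp: indicator_def)
 then have "E {..0} x = calc (%s. indicator {..<0} s + indicator {0} s) x" by (simp add: calc_indicator)
 then show ?thesis by (simp add: calc_add calc_indicator neg zero)
qed

lemma support_positive_nonsingular:
 assumes supp: "!!x. E {..0} x = 0"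
 shows "positive_nonsingular op"
proof -
 have AE: "AE s in sd x. s > 0" for x
  using supp[of x] AE_sd_iff[of "{0<..}" x] by (simp add: Compl_greaterThan)
 have "cinner x y \<in> \<real> \<and> 0 \<le> Re (cinner x y)" if "(x, y) \<in> op" for x y
 proof -
  have "0 \<le> (\<integral>s. s \<partial>sd x)" using AE[of x] by (intro integral_nonneg_AE) (auto elim: eventually_mono)
  then show ?thesis using op_quadratic[OF that] by simp
 qed
 moreover have "x = 0" if "(x, 0) \<in> op" for x
 proof -
  obtain z where z: "x = Q z" "z = \<i> *C Q z" using \<open>(x, 0) \<in> op\<close> by (auto simp: op_def)
  have b: "bdd_borel (%s. 1 - \<i> * resolvent_fun s)" by simp
  have "calc (%s. 1 - \<i> * resolvent_fun s) z = 0"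
   using z(2) by (simp add: calc_diff calc_cmul calc_const)
  then have "(\<integral>s. (cmod (1 - \<i> * resolvent_fun s))\<^sup>2 \<partial>sd z) = 0" using norm_calc[OF b, of z] by simp
  moreover have "integrable (sd z) (%s. (cmod (1 - \<i> * resolvent_fun s))\<^sup>2)"
   using integrable_sd[OF bdd_borel_mult[OF b bdd_borel_cnj[OF b]], of z, THEN integrable_Re]
   by (simp only: cmod_power2) (simp add: power2_eq_square)
  ultimately have "AE s in sd z. (cmod (1 - \<i> * resolvent_fun s))\<^sup>2 = 0"
   by (subst (asm) integral_nonneg_eq_0_iff_AE) auto
  then have "AE s in sd z. s \<in> {}" using AE[of z]
  proof eventually_elim
   case (elim s)
   then show ?case using resolvent_fun_mult[of s] by (auto simp flip: resolvent_fun_eq)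
  qed
  then have "z = 0" by (subst (asm) AE_sd_iff) (auto simp: pvm_UNIV[OF E])
  then show "x = 0" using z(1) by (simp add: clinear_zero bounded_calc)
 qed
 ultimately show ?thesis using self_adjoint_op by (auto simp: positive_nonsingular_def)
qed

lemma pvm_vimage:
 assumes g: "g \<in> borel_measurable borel"
 shows "pvm (%B. E (g -` B))"
proof
 have m: "g -` B \<in> sets borel" if "B \<in> sets borel" for B using measurable_sets[OF g that] by simp
 note P = E[unfolded projection_valued_measure_def]
 have "(%n. E (g -` F n) x) sums E (g -` (\<Union>n. F n)) x"
  if "range F \<subseteq> sets borel" "disjoint_family F" for F x
 proof -
  have "range (%n. g -` F n) \<subseteq> sets borel" "disjoint_family (%n. g -` F n)"
   using that m by (auto simp: disjoint_family_on_def)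
  then show ?thesis using P by (simp add: vimage_UN)
 qed
 then show "projection_valued_measure (%B. E (g -` B))"
  unfolding projection_valued_measure_def using P m by (auto simp: vimage_Int)
qed

lemma calc_vimage:
 assumes g: "g \<in> borel_measurable borel" and f: "bdd_borel f"
 shows "pvm.calc (%B. E (g -` B)) f = calc (%s. f (g s))"
proof -
 interpret F: pvm "%B. E (g -` B)" by (rule pvm_vimage[OF g])
 have fg: "bdd_borel (%s. f (g s))" using f measurable_compose[OF g] by (auto simp: bdd_borel_def)
 have "F.sd x = distr (sd x) borel g" for x
 proof (rule measure_eqI)
  fix B
  assume "B \<in> sets (F.sd x)"
  then have B: "B \<in> sets borel" "g -` B \<in> sets borel" using measurable_sets[OF g, of B] by simp_all
  then show "emeasure (F.sd x) B = emeasure (distr (sd x) borel g) B"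
   using g by (simp add: emeasure_distr emeasure_spectral_distribution[OF E] emeasure_spectral_distribution[OF F.E])
 qed simp
 moreover have "f \<in> borel_measurable borel" using f by (simp add: bdd_borel_def)
 ultimately have "F.represents (calc (%s. f (g s))) f"
  using g fg bounded_calc[OF fg] by (simp add: F.represents_def cinner_calc integral_distr)
 then show ?thesis by (rule F.represents_calcI)
qed

end

lemma bdd_borel_character_ln: "bdd_borel (%s. character t (ln s))"
proof -
 have "character t \<in> borel_measurable borel" by (rule bdd_borel_measurable) simp
 then show ?thesis by (intro bdd_borelI[where K = 1] measurable_compose[OF borel_measurable_ln]) auto
qed

lemma imaginary_power_op:
 assumes "pvm E" and supp: "!!x. E {..0} x = 0"
 shows "imaginary_power (pvm.op E) t = pvm.calc E (%s. character t (ln s))"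
proof -
 interpret pvm E by fact
 have AE: "AE s in sd x. s > 0" for x
  using supp[of x] AE_sd_iff[of "{0<..}" x] by (simp add: Compl_greaterThan)
 have pow: "complex_of_real s powr (\<i> * complex_of_real t) = character t (ln s)" if "s > 0" for s
  using that by (simp add: powr_def Ln_of_real character_def mult_ac)
 then have eq: "AE s in sd x. complex_of_real s powr (\<i> * complex_of_real t) = character t (ln s)" for x
  using AE[of x] by (auto elim: eventually_mono)
 \<comment> \<open>Values at s < 0 lie off the spectrum; the explicit formula there shows that the
   integrand is Borel.\<close>
 have "(%s. complex_of_real s powr (\<i> * complex_of_real t)) =
   (%s. if s = 0 then 0 else if 0 < s then character t (ln s) else exp (- of_real (pi * t)) * character t (ln (- s)))"
  (is "_ = ?f")
 proof
  fix s :: real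
  show "complex_of_real s powr (\<i> * complex_of_real t) = ?f s"
  proof (cases "s < 0")
   case True
   then have "Ln (complex_of_real s) = of_real (ln (- s)) + \<i> * pi" using Ln_of_real'[of s] by simp
   then show ?thesis using True by (simp add: powr_def character_def algebra_simps flip: exp_add)
  qed (use pow in auto)
 qed
 then have "(%s. complex_of_real s powr (\<i> * complex_of_real t)) \<in> borel_measurable borel"
  using bdd_borel_measurable[OF bdd_borel_character_ln, of t]
   measurable_compose[OF borel_measurable_uminus[OF measurable_id] bdd_borel_measurable[OF bdd_borel_character_ln, of t]]
  by simp
 then show ?thesis
  unfolding imaginary_power_def by (rule functional_calculus_op[OF bdd_borel_character_ln _ eq])
qed

lemma positive_nonsingular_pvm:
 assumes "positive_nonsingular A"
 obtains E where "pvm E" "pvm.op E = A" "!!x. E {..0} x = 0"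
proof -
 obtain E where E: "pvm E" "pvm.op E = A"
  using spectral_theorem_self_adjoint[of A] assms by (auto simp: positive_nonsingular_def)
 then show thesis using that pvm.positive_nonsingular_support assms by metis
qed

text \<open>With H the generator from Stone's theorem, the operator is exp H, obtained by pushing
  the spectral measure forward along \<open>exp\<close>. For uniqueness the spectral measure of a
  competitor is pushed along \<open>ln\<close> and characters are compared.\<close>

lemma (in unitary_group) analytic_generator_exists:
 obtains E where "pvm E" "!!t. V t = pvm.calc E (character t)"
  "positive_nonsingular (pvm.op (%B. E (exp -` B)))"
  "!!t. V t = imaginary_power (pvm.op (%B. E (exp -` B))) t"
  "!!A. positive_nonsingular A ==> (!!t. V t = imaginary_power A t) ==> A = pvm.op (%B. E (exp -` B))"
proof -
 obtain E where E: "pvm E" "!!t. V t = pvm.calc E (character t)" by (rule Stone) (rule that)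
 interpret E: pvm E by fact
 have exp: "(exp :: real \<Rightarrow> real) \<in> borel_measurable borel" and ln: "(ln :: real \<Rightarrow> real) \<in> borel_measurable borel"
  by measurable
 interpret F: pvm "%B. E (exp -` B)" by (rule E.pvm_vimage[OF exp])
 have supp: "E (exp -` {..0}) x = 0" for x
 proof -
  have "exp -` {..0} = ({} :: real set)" by (auto simp: not_le)
  then show ?thesis by (simp add: pvm_empty[OF E.E])
 qed
 have V: "V t = imaginary_power F.op t" for t
  using imaginary_power_op[OF F.pvm_axioms supp, of t] E.calc_vimage[OF exp, of "%s. character t (ln s)"]
  by (simp add: E(2) bdd_borel_character_ln)
 have "A = F.op" if pos: "positive_nonsingular A" and A: "!!t. V t = imaginary_power A t" for A
 proof -
  obtain G where G: "pvm G" "pvm.op G = A" "!!x. G {..0} x = 0"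
   by (rule positive_nonsingular_pvm[OF pos]) (rule that)
  interpret G: pvm G by fact
  interpret L: pvm "%B. G (ln -` B)" by (rule G.pvm_vimage[OF ln])
  have "L.calc (character t) = E.calc (character t)" for t
   using imaginary_power_op[OF G(1,3), of t] A[of t] E(2)[of t] G.calc_vimage[OF ln bdd_borel_character]
   by (simp add: G(2))
  then have sd: "L.sd x = E.sd x" for x by (intro L.sd_eq E.pvm_axioms) simp
  have LE: "L.calc f = E.calc f" if "bdd_borel f" for f
   using that by (intro clinear_ext_cinner L.bounded_calc E.bounded_calc) (simp_all add: L.cinner_calc E.cinner_calc sd)
  have exp_ln: "bdd_borel (%s. f (exp s))" "bdd_borel (%s. f (exp (ln s)))" if "bdd_borel f" for f
   using that measurable_compose[OF exp] measurable_compose[OF ln measurable_compose[OF exp]] by (auto simp: bdd_borel_def)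
  have "F.Q z = G.calc (%s. resolvent_fun (exp (ln s))) z" for z
   using E.calc_vimage[OF exp bdd_borel_resolvent] G.calc_vimage[OF ln, of "%s. resolvent_fun (exp s)"] LE[of "%s. resolvent_fun (exp s)"]
    exp_ln[OF bdd_borel_resolvent] by simp
  moreover have "G.calc (%s. resolvent_fun (exp (ln s))) z = G.Q z" for z
  proof (rule G.calc_eq_AE)
   have "AE s in G.sd z. s > 0"
    using G(3)[of z] G.AE_sd_iff[of "{0<..}" z] by (simp add: Compl_greaterThan)
   then show "AE s in G.sd z. resolvent_fun (exp (ln s)) = resolvent_fun s" by eventually_elim simp
  qed (use exp_ln in auto)
  ultimately have "G.Q z = F.Q z" for z by simp
  then show ?thesis using G(2) by (simp add: G.op_def F.op_def)
 qed
 then show thesis using that E V F.support_positive_nonsingular supp by blast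
qed

section \<open>The deformed inner product\<close>

lemmas complexification_defs = zero_complexification_def plus_complexification_def minus_complexification_def
 uminus_complexification_def scaleR_complexification_def inner_complexification_def
 scaleC_complexification_def cinner_complexification_def

definition cconj :: "'a::real_inner complexification \<Rightarrow> 'a complexification"
 where "cconj x = Complexify (real_part x) (- imag_part x)"

lemma cconj_simps [simp]: "cconj (cconj x) = x" "cconj (x + y) = cconj x + cconj y" "cconj (x - y) = cconj x - cconj y"
  "cconj (- x) = - cconj x" "cconj (c *C x) = cnj c *C cconj x" "cconj 0 = 0" "cconj x = 0 \<longleftrightarrow> x = 0"
  "cconj (r *\<^sub>R x) = r *\<^sub>R cconj x" "cconj (of_real_vector z) = of_real_vector z"
 by (cases x; cases y; auto simp: cconj_def complexification_defs)+

lemma cinner_cconj: "cinner (cconj x) (cconj y) = cnj (cinner x y)"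
 by (simp add: cconj_def complexification_defs complex_eq_iff)

lemma cinner_cconj_left: "cinner (cconj x) y = cnj (cinner x (cconj y))"
 using cinner_cconj[of x "cconj y"] by simp

text \<open>The function 2/(1 + 1/a) at a = exp s: the deformation in terms of the logarithm of the
  analytic generator.\<close>

definition weight :: "real \<Rightarrow> real"
 where "weight s = 2 / (1 + exp (- s))"

lemma weight_pos: "0 < weight s" and weight_less: "weight s < 2"
 by (simp_all add: weight_def add_pos_pos divide_less_eq)

lemma weight_minus: "weight (- s) = 2 - weight s"
proof -
 have "exp s \<noteq> - 1" "1 + exp s \<noteq> 0" using exp_gt_zero[of s] by linarith+
 then show ?thesis
  by (simp add: weight_def exp_minus divide_simps add_pos_pos algebra_simps add_eq_0_iff)
qed

lemma bdd_borel_weight [simp]: "bdd_borel (%s. complex_of_real (weight s))"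
proof (rule bdd_borelI[where K = 2])
 show "(%s. complex_of_real (weight s)) \<in> borel_measurable borel" unfolding weight_def by measurable
 show "cmod (complex_of_real (weight s)) \<le> 2" for s
  using weight_pos[of s] weight_less[of s] unfolding norm_of_real by linarith
qed

locale orthogonal_flow =
 fixes U :: "real \<Rightarrow> 'a::{real_inner, complete_space} \<Rightarrow> 'a"
 assumes U_rep: "orthogonal_representation U" and U_cont: "strongly_continuous U"
begin

abbreviation V where "V \<equiv> complexified U"

lemma V_Complexify: "V t (Complexify a b) = Complexify (U t a) (U t b)" by (simp add: complexified_def)

lemma U_linear: "linear (U t)" and U_inner_eq: "inner (U t x) (U t y) = inner x y"
 using U_rep by (auto simp: orthogonal_representation_def orthogonal_transformation_def)

lemmas U_lin = linear_add[OF U_linear] linear_diff[OF U_linear] linear_cmul[OF U_linear] linear_neg[OF U_linear]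
 linear_0[OF U_linear]

lemma U_0: "U 0 x = x" and U_add: "U (s + t) x = U s (U t x)"
 using U_rep by (auto simp: orthogonal_representation_def)

lemma U_adj: "inner (U t x) y = inner x (U (- t) y)"
 using U_inner_eq[of t x "U (- t) y"] U_add[of t "- t" y] by (simp add: U_0)

sublocale unitary_group V
proof
 have V_c: "cinner (V t x) (V t y) = cinner x y" for t x y
  by (cases x; cases y) (simp add: V_Complexify cinner_complexification_def U_inner_eq)
 show "cinner (V t x) (V t y) = cinner x y" for t x y by (rule V_c)
 show "bounded_clinear (V t)" for t
 proof (rule bounded_clinearI[where K = 1])
  show "norm (V t x) \<le> 1 * norm x" for x
   using arg_cong[OF V_c[of t x x], of Re] by (simp add: norm_eq_sqrt_inner Re_cinner)
  show "V t (x + y) = V t x + V t y" "V t (c *C x) = c *C V t x" for x y c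
   by (cases x; cases y; simp add: V_Complexify complexification_defs U_lin)+
 qed
 show "V 0 x = x" "V (s + t) x = V s (V t x)" for s t x by (cases x; simp add: V_Complexify U_0 U_add)+
 show "((%t. V t x) \<longlongrightarrow> x) (at 0)" for x
 proof -
  have U: "((%t. U t a) \<longlongrightarrow> a) (at 0)" for a
   using U_cont U_0[of a] by (metis strongly_continuous_def continuous_on_def at_within_open UNIV_I open_UNIV)
  obtain a b where x: "x = Complexify a b" by (cases x)
  have n: "(norm (V t x - x))\<^sup>2 = (norm (U t a - a))\<^sup>2 + (norm (U t b - b))\<^sup>2" for t
   by (simp add: x V_Complexify power2_norm_eq_inner complexification_defs)
  have "((%t. (norm (U t a - a))\<^sup>2 + (norm (U t b - b))\<^sup>2) \<longlongrightarrow> (norm (a - a))\<^sup>2 + (norm (b - b))\<^sup>2) (at 0)"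
   by (intro tendsto_intros U)
  then have "((%t. (norm (V t x - x))\<^sup>2) \<longlongrightarrow> 0) (at 0)" by (simp add: n)
  then have "((%t. V t x - x) \<longlongrightarrow> 0) (at 0)" by (rule tendsto_zero_norm_square)
  then show ?thesis by (rule LIM_zero_cancel)
 qed
qed

lemma V_cconj: "V t (cconj x) = cconj (V t x)" by (cases x) (simp add: V_Complexify cconj_def U_lin)

text \<open>The spectral measure of the logarithm of the analytic generator.\<close>

definition spec :: "real set \<Rightarrow> 'a complexification \<Rightarrow> 'a complexification"
 where "spec = (SOME E. pvm E \<and> (\<forall>t. V t = pvm.calc E (character t)) \<and>
  analytic_generator U = pvm.op (%B. E (exp -` B)))"

lemma spec: "pvm spec" "V t = pvm.calc spec (character t)"
  "analytic_generator U = pvm.op (%B. spec (exp -` B))"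
proof -
 have "\<exists>E. pvm E \<and> (\<forall>t. V t = pvm.calc E (character t)) \<and> analytic_generator U = pvm.op (%B. E (exp -` B))"
 proof (rule analytic_generator_exists)
  fix E
  assume E: "pvm E" "!!t. V t = pvm.calc E (character t)"
   and A: "positive_nonsingular (pvm.op (%B. E (exp -` B)))"
   "!!t. V t = imaginary_power (pvm.op (%B. E (exp -` B))) t"
   "!!A. positive_nonsingular A ==> (!!t. V t = imaginary_power A t) ==> A = pvm.op (%B. E (exp -` B))"
  have "analytic_generator U = pvm.op (%B. E (exp -` B))"
   unfolding analytic_generator_def using A by (intro the_equality) auto
  then show ?thesis using E by blast
 qed
 from someI_ex[OF this] show "pvm spec" "V t = pvm.calc spec (character t)"
  "analytic_generator U = pvm.op (%B. spec (exp -` B))" unfolding spec_def by blast+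
qed

sublocale spec: pvm spec by (rule spec(1))

definition T :: "'a complexification \<Rightarrow> 'a complexification"
 where "T = spec.calc (%s. complex_of_real (weight s))"

lemma T_bounded: "bounded_clinear T" by (simp add: T_def spec.bounded_calc)

lemmas T_simps = clinear_simps[OF T_bounded]

lemma T_sym: "cinner (T x) y = cinner x (T y)" unfolding T_def by (subst spec.calc_adj) simp_all

lemma U_inner_T: "U_inner U x y = cinner (T x) y"
proof -
 have exp: "(exp :: real \<Rightarrow> real) \<in> borel_measurable borel" by measurable
 interpret F: pvm "%B. spec (exp -` B)" by (rule spec.pvm_vimage[OF exp])
 define g where "g s = (if 0 < s then complex_of_real (2 / (1 + inverse s)) else 0)" for s
 have "g \<in> borel_measurable borel" unfolding g_def by measurable
 moreover have "cmod (g s) \<le> 2" for s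
 proof (cases "0 < s")
  case True
  moreover define d where "d = 1 + inverse s"
  ultimately have "1 \<le> d" by simp
  then have "0 \<le> 2 / (1 + inverse s)" "2 / (1 + inverse s) \<le> 2"
   unfolding d_def[symmetric] by (simp_all add: divide_le_eq)
  then show ?thesis using True by (simp only: g_def if_True norm_of_real)
 qed (simp add: g_def)
 ultimately have g: "bdd_borel g" by (rule bdd_borelI)
 have "exp -` {..0} = ({} :: real set)" by (auto simp: not_le)
 then have "AE s in F.sd x. s > 0" for x
  using F.AE_sd_iff[of "{0<..}" x] by (simp add: Compl_greaterThan pvm_empty[OF spec.E])
 then have "AE s in F.sd x. complex_of_real (2 / (1 + inverse s)) = g s" for x
  by eventually_elim (simp add: g_def)
 then have "functional_calculus F.op (%s. complex_of_real (2 / (1 + inverse s))) = F.calc g"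
  by (intro F.functional_calculus_op g) measurable
 also have "F.calc g = T" unfolding spec.calc_vimage[OF exp g] T_def
  by (rule arg_cong[of _ _ spec.calc]) (auto simp: g_def weight_def exp_minus)
 finally show ?thesis by (simp add: U_inner_def spec(3))
qed

lemma character_minus: "character t (- s) = character (- t) s" by (simp add: character_def)

text \<open>The flow commutes with the antilinear conjugation, which therefore reflects the spectral
  parameter, and weight (-s) = 2 - weight s. This symmetry relates left and right fields.\<close>

lemma T_cconj: "T (cconj x) = cconj (2 *C x - T x)"
proof -
 define R where "R x = cconj (T (cconj x))" for x
 have bR: "bounded_clinear R"
 proof -
  obtain K where K: "!!x. norm (T x) \<le> K * norm x" using clinear_bound[OF T_bounded] by blast
  have nc: "norm (cconj x) = norm x" for x :: "'a complexification"
   by (simp add: norm_eq_sqrt_inner cconj_def inner_complexification_def)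
  show ?thesis
   using K[of "cconj _"] by (intro bounded_clinearI[where K = K]) (auto simp: R_def T_simps nc)
 qed
 have "R = (%x. 2 *C x - T x)"
 proof (rule clinear_ext_cinner[OF bR])
  show "bounded_clinear (%x. 2 *C x - T x)" by (intro clinear_sub clinear_cmul clinear_id T_bounded)
  fix x
  have meas: "uminus \<in> borel_measurable (borel :: real measure)" by measurable
  have "spec.sd (cconj x) = distr (spec.sd x) borel uminus"
  proof (rule finite_measure_char_unique[OF spec.finite_sd])
   show "finite_measure (distr (spec.sd x) borel uminus)"
    by (intro finite_measure.finite_measure_distr spec.finite_sd) simp
   fix t
   have "(\<integral>s. character t s \<partial>spec.sd (cconj x)) = cinner (cconj x) (V t (cconj x))"
    by (simp add: spec.cinner_calc spec(2))
   also have "\<dots> = cinner (V t x) x"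
    using cinner_commute[of "V t x" x] by (simp add: V_cconj cinner_cconj)
   also have "\<dots> = cinner x (V (- t) x)" by (rule V_adj)
   also have "\<dots> = (\<integral>s. character (- t) s \<partial>spec.sd x)" by (simp add: spec.cinner_calc spec(2))
   also have "\<dots> = (\<integral>s. character t s \<partial>distr (spec.sd x) borel uminus)"
    by (subst integral_distr) (simp_all add: bdd_borel_measurable character_minus)
   finally show "(\<integral>s. character t s \<partial>spec.sd (cconj x)) = (\<integral>s. character t s \<partial>distr (spec.sd x) borel uminus)" .
  qed simp_all
  then have "cinner (cconj x) (T (cconj x)) = (\<integral>s. complex_of_real (weight (- s)) \<partial>spec.sd x)"
   unfolding T_def spec.cinner_calc[OF bdd_borel_weight]
   by (simp only:) (rule integral_distr; simp add: bdd_borel_measurable)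
  also have "\<dots> = cinner x (spec.calc (%s. 2 - complex_of_real (weight s)) x)"
   by (subst spec.cinner_calc) (simp_all add: weight_minus)
  also have "\<dots> = cinner x (2 *C x - T x)" by (simp add: spec.calc_diff spec.calc_const T_def)
  finally have eq: "cinner (cconj x) (T (cconj x)) = cinner x (2 *C x - T x)" .
  have "cinner x (R x) = cnj (cinner (cconj x) (T (cconj x)))" by (simp add: R_def cinner_cconj_left)
  also have "\<dots> = cinner (T (cconj x)) (cconj x)" by (rule cinner_commute[symmetric])
  also have "\<dots> = cinner (cconj x) (T (cconj x))" by (rule T_sym)
  finally show "cinner x (R x) = cinner x (2 *C x - T x)" using eq by simp
 qed
 then have "cconj (R x) = cconj (2 *C x - T x)" by simp
 then show ?thesis by (simp add: R_def)
qed

lemma T_inj: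
 assumes "T x = 0"
 shows "x = 0"
proof -
 \<comment> \<open>The truncated reciprocal of the weight, a bounded function; composed with T it
   gives the spectral projection of [-n, n].\<close>
 define g where "g n s = complex_of_real ((1 + exp (- s)) / 2) * indicator {- real n..real n} s" for n s
 have g: "bdd_borel (g n)" for n
 proof (rule bdd_borelI[where K = "1 + exp (real n)"])
  show "g n \<in> borel_measurable borel" unfolding g_def by measurable
  show "cmod (g n s) \<le> 1 + exp (real n)" for s
  proof (cases "s \<in> {- real n..real n}")
   case True
   then have "exp (- s) \<le> exp (real n)" by auto
   moreover have "cmod (g n s) = (1 + exp (- s)) / 2"
    using True by (simp add: g_def norm_divide add_pos_pos del: of_real_add of_real_divide)
   ultimately show ?thesis using exp_gt_zero[of "- s"] by argo
  qed (simp add: g_def add_nonneg_nonneg)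
 qed
 have "spec.calc (%s. g n s * weight s) x = 0" for n
  using assms g by (simp add: spec.calc_mult T_def[symmetric] clinear_zero spec.bounded_calc)
 moreover have "(%s. g n s * weight s) = indicator {- real n..real n}" for n
 proof
  fix s :: real
  have "1 + exp (- s) \<noteq> 0" using exp_gt_zero[of "- s"] by linarith
  then have "(1 + exp (- s)) / 2 * weight s = 1" by (simp add: weight_def)
  then have "complex_of_real ((1 + exp (- s)) / 2) * complex_of_real (weight s) = 1"
   by (metis of_real_1 of_real_mult)
  moreover have "g n s * weight s = (complex_of_real ((1 + exp (- s)) / 2) * weight s) * indicator {- real n..real n} s"
   by (simp only: g_def mult_ac)
  ultimately show "g n s * weight s = indicator {- real n..real n} s" by simp
 qed
 ultimately have "spec.calc (indicator {- real n..real n}) x = 0" for n by simp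
 then show ?thesis using spec.E_lim[of x] by (simp add: LIMSEQ_const_iff)
qed

lemma T_eigenvector:
 assumes "!!t. V t x = character t r *C x"
 shows "T x = complex_of_real (weight r) *C x"
 unfolding T_def by (rule spec.calc_eigenvector) (simp_all add: assms flip: spec(2))

end

section \<open>The q-inner product\<close>

definition skip :: "nat \<Rightarrow> nat \<Rightarrow> nat"
 where "skip k m = (if m < k then m else Suc m)"

text \<open>The permutation sending 0 to k and acting on the later positions like p with the value k
  skipped. Permutations are classified in this way by the image of 0.\<close>

definition insert_perm :: "nat \<Rightarrow> (nat \<Rightarrow> nat) \<Rightarrow> nat \<Rightarrow> nat"
 where "insert_perm k p i = (case i of 0 \<Rightarrow> k | Suc m \<Rightarrow> skip k (p m))"

lemma insert_perm_simps [simp]: "insert_perm k p 0 = k" "insert_perm k p (Suc m) = skip k (p m)"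
 by (simp_all add: insert_perm_def)

lemma skip_simps [simp]: "skip k a = skip k b \<longleftrightarrow> a = b" "skip k a \<noteq> k" "skip k a < k \<longleftrightarrow> a < k"
  "skip k a < skip k b \<longleftrightarrow> a < b" "skip k a \<noteq> k"
 by (auto simp: skip_def)

lemma insert_perm_permutes:
 assumes p: "p permutes {..<n}" and k: "k \<le> n"
 shows "insert_perm k p permutes {..<Suc n}"
proof (rule bij_imp_permutes)
 have "insert_perm k p i = insert_perm k p j ==> i = j" for i j
  using permutes_inj[OF p] skip_simps(2)[of k, symmetric] by (cases i; cases j) (auto simp: inj_eq)
 then have "inj_on (insert_perm k p) {..<Suc n}" by (rule inj_onI)
 moreover have "insert_perm k p ` {..<Suc n} \<subseteq> {..<Suc n}"
 proof (rule image_subsetI)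
  fix i
  assume "i \<in> {..<Suc n}"
  then show "insert_perm k p i \<in> {..<Suc n}"
   using k permutes_in_image[OF p, of "i - 1"] by (cases i) (auto simp: skip_def)
 qed
 ultimately show "bij_betw (insert_perm k p) {..<Suc n} {..<Suc n}"
  by (auto simp: bij_betw_def endo_inj_surj)
 show "insert_perm k p i = i" if "i \<notin> {..<Suc n}" for i
  using that k permutes_not_in[OF p, of "i - 1"] by (cases i) (auto simp: skip_def)
qed

lemma insert_perm_image:
 "(%(k, p). insert_perm k p) ` ({..n} \<times> {p. p permutes {..<n}}) = {p. p permutes {..<Suc n}}"
  (is "?f ` ?A = ?B")
 and insert_perm_inj: "inj_on (%(k, p). insert_perm k p) ({..n} \<times> {p. p permutes {..<n}})"
proof -
 show inj: "inj_on ?f ?A"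
 proof (rule inj_onI, clarsimp)
  fix k p k' p'
  assume eq: "insert_perm k p = insert_perm k' p'"
  have "k = k'" using fun_cong[OF eq, of 0] by simp
  moreover have "skip k (p m) = skip k' (p' m)" for m using fun_cong[OF eq, of "Suc m"] by simp
  ultimately show "k = k' \<and> p = p'" by auto
 qed
 show "?f ` ?A = ?B"
 proof (rule card_subset_eq)
  show "finite ?B" by (simp add: finite_permutations)
  show "?f ` ?A \<subseteq> ?B" using insert_perm_permutes by auto
  have "card ?A = card ?B"
   using card_permutations[of "{..<n}" n] card_permutations[of "{..<Suc n}" "Suc n"] by (simp add: card_cartesian_product)
  then show "card (?f ` ?A) = card ?B" using card_image[OF inj] by simp
 qed
qed

text \<open>The value k at position 0 exceeds exactly k later values; the remaining inversions are
  those of p.\<close>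

lemma inversions_insert_perm:
 assumes p: "p permutes {..<n}" and k: "k \<le> n"
 shows "inversions (Suc n) (insert_perm k p) = k + inversions n p"
proof -
 let ?A = "{m. m < n \<and> p m < k}" and ?B = "{(i, j). i < j \<and> j < n \<and> p j < p i}"
 have "p ` ?A = {..<k}"
 proof (intro equalityI subsetI)
  fix a
  assume a: "a \<in> {..<k}"
  then have "a \<in> p ` {..<n}" using k permutes_image[OF p] by auto
  then show "a \<in> p ` ?A" using a by auto
 qed auto
 then have A: "card ?A = k" using card_image[OF inj_on_subset[OF permutes_inj[OF p]], of ?A] by simp
 have fin: "finite ?B" by (rule finite_subset[of _ "{..<n} \<times> {..<n}"]) auto
 have "{(i, j). i < j \<and> j < Suc n \<and> insert_perm k p j < insert_perm k p i} =
   (%m. (0, Suc m)) ` ?A \<union> map_prod Suc Suc ` ?B" (is "?L = ?R")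
 proof (intro set_eqI iffI)
  fix x
  assume "x \<in> ?L"
  then obtain i m where x: "x = (i, Suc m)" "i < Suc m" "m < n" "insert_perm k p (Suc m) < insert_perm k p i"
   by (cases x, case_tac "snd x") auto
  then show "x \<in> ?R" by (cases i) (auto simp: image_iff)
 qed auto
 then have "inversions (Suc n) (insert_perm k p) = card ?R" by (simp add: inversions_def)
 also have "\<dots> = card ?A + card ?B"
  using fin by (subst card_Un_disjoint) (auto simp: card_image inj_on_def)
 finally show ?thesis by (simp add: A inversions_def)
qed

text \<open>Grouping the permutations by the image of 0 peels off the first letter with a factor
  q^k.\<close>

lemma q_inner_Cons:
 assumes xs: "length xs = Suc (length ys)"
 shows "q_inner q (h # ys) xs =
  (\<Sum>k\<le>length ys. complex_of_real (q ^ k) * cinner h (xs ! k) * q_inner q ys (take k xs @ drop (Suc k) xs))"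
proof -
 define n where "n = length ys"
 let ?P = "{p. p permutes {..<n}}"
 define F where "F p = complex_of_real (q ^ inversions (Suc n) p) * (\<Prod>i<Suc n. cinner ((h # ys) ! i) (xs ! p i))" for p
 have nth: "(take k xs @ drop (Suc k) xs) ! a = xs ! skip k a" if "k \<le> n" "a < n" for k a
  using that xs by (auto simp: nth_append skip_def n_def min_def)
 have "q_inner q (h # ys) xs = sum F {p. p permutes {..<Suc n}}"
  using xs by (simp add: q_inner_def F_def n_def)
 also have "\<dots> = (\<Sum>(k, p)\<in>{..n} \<times> ?P. F (insert_perm k p))"
  unfolding insert_perm_image[symmetric] by (subst sum.reindex[OF insert_perm_inj]) (simp add: o_def case_prod_unfold)
 also have "\<dots> = (\<Sum>k\<le>n. \<Sum>p\<in>?P. F (insert_perm k p))" by (simp add: sum.cartesian_product)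
 also have "\<dots> = (\<Sum>k\<le>n. complex_of_real (q ^ k) * cinner h (xs ! k) * q_inner q ys (take k xs @ drop (Suc k) xs))"
 proof (rule sum.cong)
  fix k
  assume "k \<in> {..n}"
  then have k: "k \<le> n" by simp
  have "F (insert_perm k p) = complex_of_real (q ^ k) * cinner h (xs ! k) *
    (complex_of_real (q ^ inversions n p) * (\<Prod>i<n. cinner (ys ! i) ((take k xs @ drop (Suc k) xs) ! p i)))"
   if p: "p permutes {..<n}" for p
  proof -
   have "p i < n" if "i < n" for i using that permutes_in_image[OF p, of i] by simp
   then have "(\<Prod>i<n. cinner (ys ! i) ((take k xs @ drop (Suc k) xs) ! p i)) = (\<Prod>i<n. cinner (ys ! i) (xs ! skip k (p i)))"
    by (intro prod.cong) (auto simp: nth k)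
   then show ?thesis
    unfolding F_def inversions_insert_perm[OF p k] prod.lessThan_Suc_shift by (simp add: power_add)
  qed
  then have "(\<Sum>p\<in>?P. F (insert_perm k p)) = (\<Sum>p\<in>?P. complex_of_real (q ^ k) * cinner h (xs ! k) *
    (complex_of_real (q ^ inversions n p) * (\<Prod>i<n. cinner (ys ! i) ((take k xs @ drop (Suc k) xs) ! p i))))"
   by (intro sum.cong) auto
  moreover have "length (take k xs @ drop (Suc k) xs) = n" using k xs by (simp add: n_def)
  ultimately show "(\<Sum>p\<in>?P. F (insert_perm k p)) = complex_of_real (q ^ k) * cinner h (xs ! k) * q_inner q ys (take k xs @ drop (Suc k) xs)"
   by (simp add: q_inner_def n_def sum_distrib_left mult.assoc)
 qed simp
 finally show ?thesis by (simp add: n_def)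
qed

text \<open>Conjugating a permutation with the reversal of positions preserves the number of
  inversions.\<close>

lemma q_inner_rev: "q_inner q (rev xs) (rev ys) = q_inner q xs ys"
proof (cases "length xs = length ys")
 case True
 define n where "n = length xs"
 \<comment> \<open>Extended by the identity beyond n, so that it is an involution on all natural
   numbers.\<close>
 define r where "r i = (if i < n then n - 1 - i else i)" for i
 have r: "r (r i) = i" "r i < n \<longleftrightarrow> i < n" "i < n ==> j < n ==> r i < r j \<longleftrightarrow> j < i" for i j
  by (auto simp: r_def)
 have perm: "r \<circ> p \<circ> r permutes {..<n}" if "p permutes {..<n}" for p
 proof -
  have "r permutes {..<n}"
   by (rule bij_imp_permutes[OF bij_betwI[where g = r]]) (auto simp: r, auto simp: r_def)
  then show ?thesis using that by (simp add: permutes_compose)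
 qed
 have inv: "inversions n (r \<circ> p \<circ> r) = inversions n p" if p: "p permutes {..<n}" for p
 proof -
  have p': "p i < n \<longleftrightarrow> i < n" for i using permutes_in_image[OF p] by simp
  show ?thesis unfolding inversions_def
  proof (rule bij_betw_same_card[OF bij_betwI[where g = "%(i, j). (r j, r i)"]])
   show "(%(i, j). (r j, r i)) \<in> {(i, j). i < j \<and> j < n \<and> (r \<circ> p \<circ> r) j < (r \<circ> p \<circ> r) i} \<rightarrow> {(i, j). i < j \<and> j < n \<and> p j < p i}"
    by (auto simp: r p' dest: order.strict_trans)
   show "(%(i, j). (r j, r i)) \<in> {(i, j). i < j \<and> j < n \<and> p j < p i} \<rightarrow> {(i, j). i < j \<and> j < n \<and> (r \<circ> p \<circ> r) j < (r \<circ> p \<circ> r) i}"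
    by (auto simp: r p' dest: order.strict_trans)
  qed (auto simp: r)
 qed
 have nth: "rev xs ! i = xs ! r i" "rev ys ! i = ys ! r i" if "i < n" for i
  using that True by (simp_all add: rev_nth n_def r_def)
 have prod: "(\<Prod>i<n. cinner (rev xs ! i) (rev ys ! (r \<circ> p \<circ> r) i)) = (\<Prod>i<n. cinner (xs ! i) (ys ! p i))" if p: "p permutes {..<n}" for p
 proof -
  have p': "p i < n \<longleftrightarrow> i < n" for i using permutes_in_image[OF p] by simp
  have "(\<Prod>i<n. cinner (rev xs ! i) (rev ys ! (r \<circ> p \<circ> r) i)) = (\<Prod>i<n. cinner (xs ! r i) (ys ! p (r i)))"
   by (intro prod.cong) (auto simp: nth r p')
  also have "\<dots> = (\<Prod>i<n. cinner (xs ! i) (ys ! p i))"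
   by (rule prod.reindex_bij_witness[of _ r r]) (auto simp: r)
  finally show ?thesis .
 qed
 have "(\<Sum>p | p permutes {..<n}. complex_of_real (q ^ inversions n p) * (\<Prod>i<n. cinner (rev xs ! i) (rev ys ! p i)))
   = (\<Sum>p | p permutes {..<n}. complex_of_real (q ^ inversions n p) * (\<Prod>i<n. cinner (xs ! i) (ys ! p i)))"
 proof (rule sum.reindex_bij_witness[of _ "%p. r \<circ> p \<circ> r" "%p. r \<circ> p \<circ> r"])
  fix p
  assume "p \<in> {p. p permutes {..<n}}"
  then have p: "p permutes {..<n}" by simp
  show "r \<circ> (r \<circ> p \<circ> r) \<circ> r = p" "r \<circ> (r \<circ> p \<circ> r) \<circ> r = p" by (simp_all add: fun_eq_iff r)
  show "r \<circ> p \<circ> r \<in> {p. p permutes {..<n}}" "r \<circ> p \<circ> r \<in> {p. p permutes {..<n}}"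
   using perm[OF p] by simp_all
  have "r \<circ> (r \<circ> p \<circ> r) \<circ> r = p" by (simp add: fun_eq_iff r)
  then show "complex_of_real (q ^ inversions n (r \<circ> p \<circ> r)) * (\<Prod>i<n. cinner (xs ! i) (ys ! (r \<circ> p \<circ> r) i)) =
    complex_of_real (q ^ inversions n p) * (\<Prod>i<n. cinner (rev xs ! i) (rev ys ! p i))"
   using prod[OF perm[OF p]] by (simp add: inv p)
 qed
 then show ?thesis using True by (simp add: q_inner_def n_def)
qed (simp add: q_inner_def)

lemma q_inner_Nil: "q_inner q [] [] = 1"
proof -
 have "{p. p permutes {..<0::nat}} = {id}" by (auto simp: permutes_empty)
 moreover have "inversions 0 id = 0" by (simp add: inversions_def)
 ultimately show ?thesis by (simp add: q_inner_def)
qed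

text \<open>The annihilation operator on a word, as a formal combination of words that is available
  before any operator on the completion.\<close>

fun annihilate :: "real \<Rightarrow> 'h::complex_inner \<Rightarrow> 'h list \<Rightarrow> (complex \<times> 'h list) list"
 where "annihilate q g [] = []"
 | "annihilate q g (x # xs) = (cinner g x, xs) # map (%(c, w). (of_real q * c, x # w)) (annihilate q g xs)"

lemma annihilate_eq: "annihilate q g xs =
  map (%k. (complex_of_real (q ^ k) * cinner g (xs ! k), take k xs @ drop (Suc k) xs)) [0..<length xs]"
proof (induction xs)
 case (Cons x xs)
 have "[0..<length (x # xs)] = 0 # map Suc [0..<length xs]"
  by (simp add: map_Suc_upt upt_conv_Cons del: upt_Suc)
 then show ?case by (simp only: annihilate.simps Cons) (simp add: mult.assoc)
qed simp

lemma annihilate_length: "(c, w) \<in> set (annihilate q g xs) ==> length xs = Suc (length w)"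
 by (auto simp: annihilate_eq)

lemma q_inner_annihilate:
 "q_inner q (g # ys) xs = (\<Sum>(c, w)\<leftarrow>annihilate q g xs. c * q_inner q ys w)"
proof (cases "length xs = Suc (length ys)")
 case True
 then show ?thesis by (subst q_inner_Cons)
   (simp_all add: annihilate_eq o_def sum_list_distinct_conv_sum_set atLeast0LessThan lessThan_Suc_atMost
    del: upt_Suc sum.lessThan_Suc)
next
 case False
 then have "c * q_inner q ys w = 0" if "(c, w) \<in> set (annihilate q g xs)" for c w
  using annihilate_length[OF that] by (auto simp: q_inner_def)
 then have "(\<Sum>(c, w)\<leftarrow>annihilate q g xs. c * q_inner q ys w) = (\<Sum>(c, w)\<leftarrow>annihilate q g xs. 0)"
  by (intro arg_cong[of _ _ sum_list] map_cong) auto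
 also have "\<dots> = 0" by (simp add: case_prod_unfold)
 finally show ?thesis using False by (auto simp: q_inner_def)
qed

section \<open>Bounded extension from spanning families\<close>

text \<open>Formal combinations are lists, possibly with repetitions; linear relations between the
  vectors are left to be settled by a norm bound.\<close>

definition lin_comb :: "('w \<Rightarrow> 'a::complex_inner) \<Rightarrow> (complex \<times> 'w) list \<Rightarrow> 'a"
 where "lin_comb W F = (\<Sum>(c, w)\<leftarrow>F. c *C W w)"

lemma lin_comb_simps [simp]: "lin_comb W [] = 0" "lin_comb W ((c, w) # F) = c *C W w + lin_comb W F"
  "lin_comb W (F @ G) = lin_comb W F + lin_comb W G"
 by (simp_all add: lin_comb_def)

lemma lin_comb_scale: "lin_comb W (map (%(c, w). (a * c, w)) F) = a *C lin_comb W F"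
 by (induction F) (auto simp: scaleC_add_right scaleC_scaleC)

lemma lin_comb_span:
 assumes "x \<in> span {c *C W w | c w. True}"
 obtains F where "x = lin_comb W F"
proof -
 have "\<exists>F. x = lin_comb W F" using assms
 proof (induction rule: span_induct_alt)
  case base
  show ?case by (rule exI[of _ "[]"]) simp
 next
  case (step r z y)
  then obtain c w F where "z = c *C W w" "y = lin_comb W F" by auto
  then show ?case by (intro exI[of _ "(of_real r * c, w) # F"]) (simp add: scaleR_scaleC scaleC_scaleC)
 qed
 then show thesis using that by blast
qed

text \<open>The relation generated by the pairs (W w, G w) is closed up in the product. The norm
  bound survives in the closure and makes it single-valued, which settles well-definedness and
  extension together.\<close>

lemma bounded_extension:
 fixes W :: "'w \<Rightarrow> 'a::complex_inner" and G :: "'w \<Rightarrow> 'b::complex_hilbert"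
 assumes dense: "closure (span {c *C W w | c w. True}) = UNIV"
  and bound: "!!F. norm (lin_comb G F) \<le> K * norm (lin_comb W F)"
 obtains T where "bounded_clinear T" "!!w. T (W w) = G w" "!!x. norm (T x) \<le> K * norm x"
proof -
 define S where "S = range (%F. (lin_comb W F, lin_comb G F))"
 define R where "R = closure S"
 have S_I: "(lin_comb W F, lin_comb G F) \<in> S" for F by (simp add: S_def)
 have R_I: "(lin_comb W F, lin_comb G F) \<in> R" for F
  unfolding R_def using subsetD[OF closure_subset S_I] .
 have R_bound: "norm y \<le> K * norm x" if "(x, y) \<in> R" for x y
 proof -
  have "closed {p :: 'a \<times> 'b. norm (snd p) \<le> K * norm (fst p)}"
   by (intro closed_Collect_le continuous_intros)
  then have "R \<subseteq> {p. norm (snd p) \<le> K * norm (fst p)}"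
   unfolding R_def using bound by (intro closure_minimal) (auto simp: S_def)
  then show ?thesis using that by auto
 qed
 have R_lin: "(x + a *C x', y + a *C y') \<in> R" if xy: "(x, y) \<in> R" "(x', y') \<in> R" for x x' y y' a
 proof -
  obtain F where F: "!!n. F n \<in> S" "F ----> (x, y)" using xy(1) unfolding R_def closure_sequential by blast
  obtain F' where F': "!!n. F' n \<in> S" "F' ----> (x', y')"
   using xy(2) unfolding R_def closure_sequential by blast
  have "(fst (F n) + a *C fst (F' n), snd (F n) + a *C snd (F' n)) \<in> S" for n
  proof -
   obtain H H' where "F n = (lin_comb W H, lin_comb G H)" "F' n = (lin_comb W H', lin_comb G H')"
    using F(1)[of n] F'(1)[of n] by (auto simp: S_def)
   then show ?thesis
    unfolding S_def by (intro image_eqI[of _ _ "H @ map (%(c, w). (a * c, w)) H'"]) (simp_all add: lin_comb_scale)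
  qed
  moreover have "(%n. (fst (F n) + a *C fst (F' n), snd (F n) + a *C snd (F' n))) ----> (x + a *C x', y + a *C y')"
   using tendsto_fst[OF F(2)] tendsto_snd[OF F(2)] tendsto_fst[OF F'(2)] tendsto_snd[OF F'(2)]
   by (intro tendsto_Pair tendsto_add bounded_linear.tendsto[OF scaleC.bounded_linear_right]) simp_all
  ultimately show ?thesis unfolding R_def closure_sequential
   by (intro exI[of _ "%n. (fst (F n) + a *C fst (F' n), snd (F n) + a *C snd (F' n))"]) blast
 qed
 have ex: "\<exists>y. (x, y) \<in> R" for x
 proof -
  have "x \<in> closure (span {c *C W w | c w. True})" unfolding dense by (rule UNIV_I)
  then obtain X where X: "!!n. X n \<in> span {c *C W w | c w. True}" "X ----> x"
   unfolding closure_sequential by blast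
  have "\<forall>n. \<exists>F. X n = lin_comb W F" using lin_comb_span[OF X(1)] by blast
  from choice[OF this] obtain F where F: "!!n. X n = lin_comb W (F n)" by blast
  define Y where "Y n = lin_comb G (F n)" for n
  have diff: "norm (Y m - Y n) \<le> K * norm (X m - X n)" for m n
   using bound[of "F m @ map (%(c, w). (- 1 * c, w)) (F n)"]
   by (simp only: lin_comb_simps lin_comb_scale scaleC_minus_left scaleC_one flip: F) (simp add: Y_def)
  have "Cauchy Y"
  proof (rule Cauchy_power_bound[where k = 1])
   show "dist (Y m) (Y n) ^ 1 \<le> \<bar>K\<bar> * dist (X m) x + \<bar>K\<bar> * dist (X n) x" for m n
   proof -
    have "dist (Y m) (Y n) \<le> \<bar>K\<bar> * dist (X m) (X n)"
     using order_trans[OF diff[of m n] mult_right_mono[OF abs_ge_self norm_ge_zero]] by (simp add: dist_norm)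
    also have "\<dots> \<le> \<bar>K\<bar> * (dist (X m) x + dist (X n) x)" by (intro mult_left_mono dist_triangle2) simp
    finally show ?thesis by (simp add: distrib_left)
   qed
   show "(%n. \<bar>K\<bar> * dist (X n) x) ----> 0"
    by (rule tendsto_mult_right_zero[OF tendsto_dist_iff[THEN iffD1, OF X(2)]])
  qed
  then obtain y where "Y ----> y" using Cauchy_convergent convergent_def by blast
  then have lim: "(%n. (X n, Y n)) ----> (x, y)" using X(2) by (intro tendsto_Pair)
  have "closed R" by (simp add: R_def)
  moreover have "(X n, Y n) \<in> R" for n using R_I[of "F n"] by (simp add: F Y_def)
  ultimately have "(x, y) \<in> R" using lim by (rule closed_sequentially)
  then show ?thesis ..
 qed
 have unique: "y = y'" if "(x, y) \<in> R" "(x, y') \<in> R" for x y y'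
  using R_bound[of "x + (- 1) *C x" "y + (- 1) *C y'"] R_lin[OF that, of "- 1"] by simp
 define T where "T x = (THE y. (x, y) \<in> R)" for x
 have TR: "(x, T x) \<in> R" for x unfolding T_def using ex unique by (metis theI)
 have T_eq: "T x = y" if "(x, y) \<in> R" for x y using TR unique that by blast
 have zero: "(0, 0) \<in> R" using R_I[of "[]"] by simp
 have "bounded_clinear T"
 proof (rule bounded_clinearI[where K = K])
  show "T (x + y) = T x + T y" for x y using R_lin[OF TR TR, of x 1 y] by (intro T_eq) simp
  show "T (c *C x) = c *C T x" for c x using R_lin[OF zero TR, of c x] by (intro T_eq) simp
 qed (rule R_bound[OF TR])
 moreover have "T (W w) = G w" for w using R_I[of "[(1, w)]"] by (intro T_eq) simp
 ultimately show thesis using that R_bound[OF TR] by blast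
qed

section \<open>Operators on the q-Fock space\<close>

lemma lin_comb_isometry:
 assumes "!!w w'. cinner (G w) (G w') = cinner (W w) (W w')"
 shows "norm (lin_comb G F) = norm (lin_comb W F)"
proof -
 have 1: "cinner (G w) (lin_comb G H) = cinner (W w) (lin_comb W H)" for w H
  by (induction H) (auto simp: cinner_add_right cinner_scaleC_right assms)
 have "cinner (lin_comb G F') (lin_comb G F) = cinner (lin_comb W F') (lin_comb W F)" for F'
  by (induction F') (auto simp: cinner_add_left cinner_scaleC_left 1)
 from arg_cong[OF this[of F], of Re] show ?thesis by (simp add: Re_cinner norm_eq_sqrt_inner)
qed

locale q_fock =
 fixes q :: real and tens :: "'h::complex_hilbert list \<Rightarrow> 'f::complex_hilbert"
 assumes q: "- 1 < q" "q < 1" and fock: "q_fock_space q tens"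
begin

lemma tens_linear: "clinear (%x. tens (xs @ x # ys))"
 and tens_cinner: "cinner (tens xs) (tens ys) = q_inner q xs ys"
 and tens_dense: "closure (span {c *C tens xs | c xs. True}) = UNIV"
 using fock by (auto simp: q_fock_space_def)

lemma operator_eqI:
 assumes "bounded_clinear S" "bounded_clinear T" "!!xs. S (tens xs) = T (tens xs)"
 shows "S = T" using assms by (intro clinear_eq_on_dense[OF _ _ tens_dense]) (auto simp: clinear_scaleC)

lemma vector_eqI:
 assumes "!!xs. cinner (tens xs) v = cinner (tens xs) w"
 shows "v = w"
proof -
 have "cinner (v - w) (tens xs) = 0" for xs
  using assms[of xs] by (metis cinner.diff_right cinner_commute complex_cnj_zero right_minus_eq)
 then have "v - w = 0" by (intro corthogonal_to_dense[OF tens_dense]) (auto simp: cinner_scaleC_right)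
 then show ?thesis by simp
qed

abbreviation vac :: 'f where "vac \<equiv> tens []"

lemma norm_vac [simp]: "norm vac = 1"
proof -
 have "complex_of_real ((norm vac)\<^sup>2) = 1"
  using tens_cinner[of "[]" "[]"] by (simp only: q_inner_Nil cinner_self)
 then have "(norm vac)\<^sup>2 = 1" by (simp only: of_real_eq_1_iff)
 then show ?thesis using norm_ge_zero[of vac] by (auto simp: power2_eq_1_iff)
qed

definition ann :: "'h \<Rightarrow> 'h list \<Rightarrow> 'f"
 where "ann g xs = lin_comb tens (annihilate q g xs)"

lemma tens_Cons_cinner: "cinner (tens (g # ys)) (tens xs) = cinner (tens ys) (ann g xs)"
proof -
 have "cinner (tens ys) (lin_comb tens F) = (\<Sum>(c, w)\<leftarrow>F. c * q_inner q ys w)" for F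
  by (induction F) (auto simp: cinner_add_right cinner_scaleC_right tens_cinner)
 then show ?thesis by (simp add: tens_cinner q_inner_annihilate ann_def)
qed

definition prepend :: "'h \<Rightarrow> (complex \<times> 'h list) list \<Rightarrow> (complex \<times> 'h list) list"
 where "prepend h F = map (%(c, w). (c, h # w)) F"

definition annihilate_comb :: "'h \<Rightarrow> (complex \<times> 'h list) list \<Rightarrow> (complex \<times> 'h list) list"
 where "annihilate_comb h F = concat (map (%(c, w). map (%(d, v). (c * d, v)) (annihilate q h w)) F)"

lemma prepend_append [simp]: "prepend h (F @ G) = prepend h F @ prepend h G" by (simp add: prepend_def)

lemma prepend_scale: "prepend h (map (%(c, w). (a * c, w)) F) = map (%(c, w). (a * c, w)) (prepend h F)"
 by (simp add: prepend_def case_prod_unfold)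

lemma lin_comb_prepend: "lin_comb tens (prepend h F) = lin_comb (%w. tens (h # w)) F"
 by (induction F) (auto simp: prepend_def)

lemma annihilate_comb_Cons: "annihilate_comb h ((c, w) # F) =
  map (%(d, v). (c * d, v)) (annihilate q h w) @ annihilate_comb h F"
 by (simp add: annihilate_comb_def)

lemma ann_Nil: "ann g [] = 0" by (simp add: ann_def)

lemma ann_Cons: "ann g (x # xs) = cinner g x *C tens xs + of_real q *C lin_comb tens (prepend x (annihilate q g xs))"
proof -
 have "map (%(c, w). (complex_of_real q * c, x # w)) F = map (%(c, w). (of_real q * c, w)) (prepend x F)" for F
  by (simp add: prepend_def case_prod_unfold)
 then show ?thesis by (simp add: ann_def lin_comb_scale)
qed

lemma prepend_adjoint: "cinner (lin_comb tens (prepend h G)) (lin_comb tens F) =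
  cinner (lin_comb tens G) (lin_comb tens (annihilate_comb h F))"
proof -
 have 1: "cinner (lin_comb tens (prepend h G)) (tens w) = cinner (lin_comb tens G) (ann h w)" for w
  by (induction G) (auto simp: prepend_def cinner_add_left cinner_scaleC_left tens_Cons_cinner)
 show ?thesis
  by (induction F) (auto simp: annihilate_comb_Cons lin_comb_scale cinner_add_right cinner_scaleC_right 1
    ann_def[symmetric] annihilate_comb_def[of _ "[]"])
qed

text \<open>Weak form, on formal combinations, of the q-commutation relation: annihilation after
  creation by h equals the squared norm of h plus q times creation after annihilation.\<close>

lemma prepend_cinner: "cinner (lin_comb tens (prepend h G)) (lin_comb tens (prepend h F)) =
  cinner h h * cinner (lin_comb tens G) (lin_comb tens F) +
  of_real q * cinner (lin_comb tens G) (lin_comb tens (prepend h (annihilate_comb h F)))"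
proof (induction F)
 case Nil
 then show ?case by (simp add: prepend_def annihilate_comb_def)
next
 case (Cons p F)
 obtain c w where p: "p = (c, w)" by (cases p)
 have "cinner (lin_comb tens (prepend h G)) (tens (h # w)) = cinner (lin_comb tens G) (ann h (h # w))"
  using prepend_adjoint[of h G "[(1, h # w)]"] lin_comb_scale[of tens 1 "annihilate q h (h # w)"]
  by (simp add: annihilate_comb_def ann_def del: annihilate.simps)
 moreover have "prepend h (p # F) = (c, h # w) # prepend h F" by (simp add: p prepend_def)
 ultimately show ?case
  using Cons by (simp add: p annihilate_comb_Cons ann_Cons prepend_scale lin_comb_scale cinner_add_right
    cinner_scaleC_right) (simp add: algebra_simps)
qed

text \<open>The solution C of C^2 = |h|^2 + |q| C^2, the equation that closes the inductive estimate
  for creation.\<close>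

definition cre_norm :: "'h \<Rightarrow> real"
 where "cre_norm h = norm h / sqrt (1 - \<bar>q\<bar>)"

lemma q_abs: "\<bar>q\<bar> < 1" using q by auto

text \<open>Induction on the degree. The q-commutation relation leaves a term in which creation
  follows annihilation; annihilation lowers the degree, so the induction hypothesis applies to the
  creation, and by duality it also bounds the annihilation.\<close>

lemma prepend_bound: "norm (lin_comb tens (prepend h F)) \<le> cre_norm h * norm (lin_comb tens F)"
proof -
 define C where "C = cre_norm h"
 have C: "0 \<le> C" "C\<^sup>2 * (1 - \<bar>q\<bar>) = (norm h)\<^sup>2"
  using q_abs by (simp_all add: C_def cre_norm_def power_divide)
 have "norm (lin_comb tens (prepend h F)) \<le> C * norm (lin_comb tens F)"
  if "!!c w. (c, w) \<in> set F ==> length w < N" for F N using that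
 proof (induction N arbitrary: F)
  case 0
  then have "F = []" by (cases F) force+
  then show ?case by (simp add: prepend_def)
 next
  case (Suc N)
  define v where "v = lin_comb tens F"
  define d where "d = lin_comb tens (annihilate_comb h F)"
  define d' where "d' = lin_comb tens (prepend h (annihilate_comb h F))"
  have d'_le: "norm d' \<le> C * norm d" unfolding d_def d'_def
  proof (rule Suc.IH)
   fix c w
   assume "(c, w) \<in> set (annihilate_comb h F)"
   then obtain c' w' d where "(c', w') \<in> set F" "(d, w) \<in> set (annihilate q h w')"
    by (auto simp: annihilate_comb_def)
   then show "length w < N" using Suc.prems[of c' w'] annihilate_length[of d w q h w'] by simp
  qed
  have "cinner d d = cinner d' v" unfolding d_def d'_def v_def by (rule prepend_adjoint[symmetric])
  then have "(norm d)\<^sup>2 = cmod (cinner d' v)"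
   by (metis cinner_self norm_of_real abs_power2 abs_norm_cancel)
  also have "\<dots> \<le> norm d' * norm v" by (rule cinner_Cauchy_Schwarz)
  also have "\<dots> \<le> C * norm d * norm v" by (intro mult_right_mono d'_le) simp
  finally have "norm d * norm d \<le> norm d * (C * norm v)" by (simp add: power2_eq_square mult_ac)
  then have d_le: "norm d \<le> C * norm v" using C(1) by (cases "d = 0") auto
  define w where "w = lin_comb tens (prepend h F)"
  have "complex_of_real ((norm w)\<^sup>2) = of_real ((norm h)\<^sup>2 * (norm v)\<^sup>2) + of_real q * cinner v d'"
   using prepend_cinner[of h F F] by (simp add: cinner_self w_def v_def d'_def)
  then have "(norm w)\<^sup>2 = (norm h)\<^sup>2 * (norm v)\<^sup>2 + q * Re (cinner v d')"
   by (auto dest: arg_cong[of _ _ Re])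
  also have "q * Re (cinner v d') \<le> \<bar>q\<bar> * (norm v * norm d')"
   using abs_Re_le_cmod[of "cinner v d'"] cinner_Cauchy_Schwarz[of v d']
   by (metis abs_ge_self abs_ge_zero abs_mult mult_left_mono order_trans)
  also have "\<bar>q\<bar> * (norm v * norm d') \<le> \<bar>q\<bar> * (norm v * (C * (C * norm v)))"
   using d'_le d_le C(1) by (intro mult_left_mono) (auto intro: order_trans[OF d'_le] mult_left_mono)
  also have "(norm h)\<^sup>2 * (norm v)\<^sup>2 + \<bar>q\<bar> * (norm v * (C * (C * norm v))) = (C * norm v)\<^sup>2"
   unfolding C(2)[symmetric] by (simp add: power2_eq_square algebra_simps)
  finally have "(norm w)\<^sup>2 \<le> (C * norm v)\<^sup>2" by simp
  then show ?case unfolding w_def v_def by (rule power2_le_imp_le) (simp add: C(1))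
 qed
 moreover have "length w < Suc (Max (insert 0 ((length \<circ> snd) ` set F)))" if "(c, w) \<in> set F" for c w
  using that by (force simp: less_Suc_eq_le intro: Max_ge)
 ultimately show ?thesis unfolding C_def by blast
qed

definition cre :: "'h \<Rightarrow> 'f \<Rightarrow> 'f"
 where "cre h = creation tens h"

lemma cre_bounded [simp]: "bounded_clinear (cre h)"
 and cre_tens [simp]: "cre h (tens xs) = tens (h # xs)"
 and cre_bound: "norm (cre h v) \<le> cre_norm h * norm v"
proof -
 obtain S where S: "bounded_clinear S" "!!w. S (tens w) = tens (h # w)" "!!v. norm (S v) \<le> cre_norm h * norm v"
 proof (rule bounded_extension[OF tens_dense])
  show "norm (lin_comb (%w. tens (h # w)) F) \<le> cre_norm h * norm (lin_comb tens F)" for F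
   using prepend_bound by (simp add: lin_comb_prepend)
 qed (rule that)
 have "cre h = S" unfolding cre_def creation_def using S by (intro the_equality operator_eqI) auto
 then show "bounded_clinear (cre h)" "cre h (tens xs) = tens (h # xs)" "norm (cre h v) \<le> cre_norm h * norm v"
  using S by auto
qed

definition can :: "'h \<Rightarrow> 'f \<Rightarrow> 'f"
 where "can h = cadjoint (cre h)"

lemma can_bounded [simp]: "bounded_clinear (can h)" by (simp add: can_def clinear_cadjoint)

lemma cinner_can: "cinner (can h v) w = cinner v (cre h w)" "cinner v (can h w) = cinner (cre h v) w"
 by (simp_all add: can_def cinner_cadjoint_left cinner_cadjoint_right)

lemma lin_comb_cre: "lin_comb tens (prepend h F) = cre h (lin_comb tens F)"
 by (induction F) (auto simp: prepend_def clinear_simps[OF cre_bounded])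

lemma can_tens: "can g (tens xs) = ann g xs" by (rule vector_eqI) (simp add: cinner_can tens_Cons_cinner)

lemma can_vac [simp]: "can g vac = 0" by (simp add: can_tens ann_Nil)

lemma can_tens_Cons: "can g (tens (x # xs)) = cinner g x *C tens xs + of_real q *C cre x (can g (tens xs))"
 by (simp add: can_tens ann_Cons lin_comb_cre) (simp add: ann_def)

lemma can_cre: "can g (cre h v) = cinner g h *C v + of_real q *C cre h (can g v)"
proof -
 have "(%v. can g (cre h v)) = (%v. cinner g h *C v + of_real q *C cre h (can g v))"
  by (rule operator_eqI) (auto simp: can_tens_Cons intro!: clinear_compose[OF can_bounded]
    clinear_plus clinear_cmul clinear_id clinear_compose[OF cre_bounded])
 then show ?thesis by (rule fun_cong)
qed

lemma cre_add: "cre (g + h) v = cre g v + cre h v"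
proof -
 have "cre (g + h) = (%v. cre g v + cre h v)"
  using tens_linear[of "[]"] by (intro operator_eqI clinear_plus)
   (auto simp: clinear_def linear_iff)
 then show ?thesis by simp
qed

lemma cre_scaleC: "cre (c *C h) v = c *C cre h v"
proof -
 have "cre (c *C h) = (%v. c *C cre h v)"
  using tens_linear[of "[]"] by (intro operator_eqI clinear_cmul) (auto simp: clinear_def)
 then show ?thesis by simp
qed

lemma can_add: "can (g + h) v = can g v + can h v"
 by (rule cinner_eqI) (simp add: cinner_can cre_add cinner_add_left cinner_add_right)

lemma can_scaleC: "can (c *C h) v = cnj c *C can h v"
 by (rule cinner_eqI) (simp add: cinner_can cre_scaleC cinner_scaleC_left cinner_scaleC_right)

text \<open>Reversal of words is unitary and exchanges the two ends, so right operators are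
  conjugates of left ones and inherit their properties.\<close>

definition flip :: "'f \<Rightarrow> 'f"
 where "flip = (THE S. bounded_clinear S \<and> (\<forall>xs. S (tens xs) = tens (rev xs)))"

lemma flip_bounded [simp]: "bounded_clinear flip"
 and flip_tens [simp]: "flip (tens xs) = tens (rev xs)"
proof -
 obtain S where S: "bounded_clinear S" "!!w. S (tens w) = tens (rev w)"
 proof (rule bounded_extension[OF tens_dense])
  show "norm (lin_comb (%w. tens (rev w)) F) \<le> 1 * norm (lin_comb tens F)" for F
   using lin_comb_isometry[of "%w. tens (rev w)" tens F] by (simp add: tens_cinner q_inner_rev)
 qed (rule that)
 have "flip = S" unfolding flip_def using S by (intro the_equality operator_eqI) auto
 then show "bounded_clinear flip" "flip (tens xs) = tens (rev xs)" using S by auto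
qed

lemma flip_flip [simp]: "flip (flip v) = v"
 using operator_eqI[OF clinear_compose[OF flip_bounded flip_bounded] clinear_id]
 by (simp add: fun_eq_iff)

lemma cinner_flip: "cinner (flip v) w = cinner v (flip w)"
proof -
 have "cadjoint flip = flip"
 proof (rule operator_eqI)
  show "cadjoint flip (tens xs) = flip (tens xs)" for xs
   by (rule vector_eqI) (simp add: cinner_cadjoint_right tens_cinner,
     metis q_inner_rev rev_rev_ident)
 qed (simp_all add: clinear_cadjoint)
 then show ?thesis using cinner_cadjoint_left[OF flip_bounded, of v w] by simp
qed

definition rcre :: "'h \<Rightarrow> 'f \<Rightarrow> 'f"
 where "rcre h v = flip (cre h (flip v))"

definition rcan :: "'h \<Rightarrow> 'f \<Rightarrow> 'f"
 where "rcan h v = flip (can h (flip v))"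

lemma rcre_bounded [simp]: "bounded_clinear (rcre h)" and rcan_bounded [simp]: "bounded_clinear (rcan h)"
 unfolding rcre_def[abs_def] rcan_def[abs_def]
 by (intro clinear_compose[OF flip_bounded] clinear_compose[OF cre_bounded]
   clinear_compose[OF can_bounded] flip_bounded)+

lemma rcre_tens [simp]: "rcre h (tens xs) = tens (xs @ [h])" by (simp add: rcre_def)

lemma rcan_vac [simp]: "rcan h vac = 0" by (simp add: rcan_def clinear_zero)

lemma cinner_rcan: "cinner (rcan h v) w = cinner v (rcre h w)" "cinner v (rcan h w) = cinner (rcre h v) w"
 by (simp_all add: rcre_def rcan_def cinner_flip[symmetric] cinner_can) (simp_all add: cinner_flip cinner_can)

lemma rcre_scaleC: "rcre (c *C h) v = c *C rcre h v" and rcan_scaleC: "rcan (c *C h) v = cnj c *C rcan h v"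
 by (simp_all add: rcre_def rcan_def cre_scaleC can_scaleC clinear_simps[OF flip_bounded])

lemma rcan_rcre: "rcan g (rcre h v) = cinner g h *C v + of_real q *C rcre h (rcan g v)"
 by (simp add: rcre_def rcan_def can_cre clinear_simps[OF flip_bounded])

lemma rcre_cre: "rcre g (cre h v) = cre h (rcre g v)"
 using operator_eqI[OF clinear_compose[OF rcre_bounded cre_bounded] clinear_compose[OF cre_bounded rcre_bounded], of g h h g]
 by (simp add: fun_eq_iff)

lemma rcan_can: "rcan g (can h v) = can h (rcan g v)"
 by (rule cinner_eqI) (simp add: cinner_can cinner_rcan rcre_cre)

end

lemma closure_span_minimal: "closed K ==> subspace K ==> G \<subseteq> K ==> closure (span G) \<subseteq> K"
 by (meson closure_minimal span_minimal)

lemma closed_subspace_vimage: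
 assumes S: "bounded_linear S" and K: "closed K" "subspace K"
 shows "closed {v. S v \<in> K}" "subspace {v. S v \<in> K}"
proof -
 show "closed {v. S v \<in> K}"
  using continuous_closed_vimage[OF K(1), of S] linear_continuous_at[OF S] by (simp add: vimage_def)
 show "subspace {v. S v \<in> K}"
  using linear_subspace_vimage[OF bounded_linear.linear[OF S] K(2)] by (simp add: vimage_def)
qed

lemma closure_span_invariant:
 assumes S: "bounded_linear S" and G: "!!g. g \<in> G ==> S g \<in> closure (span G)" and v: "v \<in> closure (span G)"
 shows "S v \<in> closure (span G)"
 using closure_span_minimal[OF closed_subspace_vimage[OF S closed_closure subspace_closure[OF subspace_span[of G]]], of G] G v
 by auto

text \<open>Invariance under the operator and under its adjoint makes K reducing.\<close>

lemma projection_commute: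
 assumes P: "orthogonal_projection P" "!!x. P x \<in> K" "!!x. x \<in> K ==> P x = x" "!!x s. s \<in> K ==> cinner s (x - P x) = 0"
  and S: "bounded_clinear S" "!!x. x \<in> K ==> S x \<in> K" "!!x. x \<in> K ==> S' x \<in> K" "!!x y. cinner (S' x) y = cinner x (S y)"
 shows "P (S x) = S (P x)"
proof -
 have bP: "bounded_clinear P" and sym: "cinner (P x) y = cinner x (P y)" for x y
  using P(1) by (auto simp: orthogonal_projection_def)
 have "P (S (x - P x)) = 0"
 proof (rule cinner_eqI)
  fix z
  have "cinner z (P (S (x - P x))) = cinner (S' (P z)) (x - P x)" by (simp add: S(4) sym[symmetric])
  also have "\<dots> = 0" by (intro P(4) S(3) P(2))
  finally show "cinner z (P (S (x - P x))) = cinner z 0" by (simp add: cinner.zero_right)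
 qed
 then show ?thesis
  using P(3)[OF S(2)[OF P(2)[of x]]] by (simp add: clinear_diff[OF bP] clinear_diff[OF S(1)])
qed

context q_fock
begin

subsection \<open>Functions of the number operator\<close>

lemma lin_comb_tens_orthogonal:
 assumes "\<forall>(c, w) \<in> set F. length w = m" "\<forall>(c, w) \<in> set G. length w = n" "m \<noteq> n"
 shows "cinner (lin_comb tens F) (lin_comb tens G) = 0"
proof -
 have "cinner (tens w) (lin_comb tens G) = 0" if "length w = m" for w
  using assms(2,3) that by (induction G) (auto simp: cinner_add_right cinner_scaleC_right tens_cinner q_inner_def cinner.zero_right)
 then show ?thesis
  using assms(1) by (induction F) (auto simp: cinner_add_left cinner_scaleC_left cinner.zero_left)
qed

lemma lin_comb_degrees:
 assumes "\<forall>(c, w) \<in> set F. length w < M"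
 shows "lin_comb (%w. of_real (a (length w)) *C tens w) F =
  (\<Sum>n<M. of_real (a n) *C lin_comb tens (filter (%p. length (snd p) = n) F))"
 using assms
proof (induction F)
 case (Cons p F)
 obtain c w where p: "p = (c, w)" by (cases p)
 have "lin_comb tens (filter (%p. length (snd p) = n) (p # F)) =
   (if n = length w then c *C tens w else 0) + lin_comb tens (filter (%p. length (snd p) = n) F)" for n
  by (simp add: p)
 then have "(\<Sum>n<M. of_real (a n) *C lin_comb tens (filter (%p. length (snd p) = n) (p # F))) =
   (\<Sum>n<M. if n = length w then of_real (a n) *C c *C tens w else 0) +
   (\<Sum>n<M. of_real (a n) *C lin_comb tens (filter (%p. length (snd p) = n) F))"
  by (simp add: scaleC_add_right sum.distrib if_distrib[of "%x. _ *C x"] cong: if_cong)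
 also have "(\<Sum>n<M. if n = length w then of_real (a n) *C c *C tens w else 0) = of_real (a (length w)) *C c *C tens w"
  using Cons.prems p by simp
 finally show ?case using Cons by (simp add: p scaleC_scaleC mult.commute)
qed simp

definition diag :: "(nat \<Rightarrow> real) \<Rightarrow> 'f \<Rightarrow> 'f"
 where "diag a = (THE S. bounded_clinear S \<and> (\<forall>xs. S (tens xs) = of_real (a (length xs)) *C tens xs))"

lemma
 assumes a: "!!n. \<bar>a n\<bar> \<le> K"
 shows diag_bounded: "bounded_clinear (diag a)"
  and diag_tens: "diag a (tens xs) = of_real (a (length xs)) *C tens xs"
  and diag_bound: "norm (diag a v) \<le> K * norm v"
proof -
 have K: "0 \<le> K" using a[of 0] by simp
 obtain S where S: "bounded_clinear S" "!!w. S (tens w) = of_real (a (length w)) *C tens w" "!!v. norm (S v) \<le> K * norm v"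
 proof (rule bounded_extension[OF tens_dense])
  fix F :: "(complex \<times> 'h list) list"
  define M where "M = Suc (Max (insert 0 ((length \<circ> snd) ` set F)))"
  have M: "\<forall>(c, w) \<in> set F. length w < M" by (force simp: M_def less_Suc_eq_le intro: Max_ge)
  define v where "v n = lin_comb tens (filter (%p. length (snd p) = n) F)" for n
  have orth: "orthogonal (of_real (b m) *C v m) (of_real (b n) *C v n)" if "m \<noteq> n" for m n and b :: "nat \<Rightarrow> real"
   unfolding orthogonal_def Re_cinner[symmetric] v_def cinner_scaleC_left cinner_scaleC_right
   using that by (subst lin_comb_tens_orthogonal[where m = m and n = n]) auto
  have sum: "(norm (\<Sum>n<M. of_real (b n) *C v n))\<^sup>2 = (\<Sum>n<M. (b n)\<^sup>2 * (norm (v n))\<^sup>2)" for b :: "nat \<Rightarrow> real"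
   using orth by (subst norm_sum_Pythagorean) (auto simp: pairwise_def norm_scaleC power_mult_distrib)
  have "(norm (lin_comb (%w. of_real (a (length w)) *C tens w) F))\<^sup>2 = (\<Sum>n<M. (a n)\<^sup>2 * (norm (v n))\<^sup>2)"
   unfolding lin_comb_degrees[OF M] by (simp only: sum flip: v_def)
  also have "\<dots> \<le> (\<Sum>n<M. K\<^sup>2 * (1\<^sup>2 * (norm (v n))\<^sup>2))"
   using power_mono[OF a, of _ 2] by (intro sum_mono) (simp add: mult_right_mono)
  also have "\<dots> = K\<^sup>2 * (norm (lin_comb tens F))\<^sup>2"
   using lin_comb_degrees[OF M, of "%_. 1"] sum[of "%_. 1"] by (simp add: sum_distrib_left v_def)
  finally have "(norm (lin_comb (%w. of_real (a (length w)) *C tens w) F))\<^sup>2 \<le> (K * norm (lin_comb tens F))\<^sup>2"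
   by (simp add: power_mult_distrib)
  then show "norm (lin_comb (%w. of_real (a (length w)) *C tens w) F) \<le> K * norm (lin_comb tens F)"
   by (rule power2_le_imp_le) (simp add: K)
 qed (rule that)
 have "diag a = S" unfolding diag_def using S by (intro the_equality operator_eqI) auto
 then show "bounded_clinear (diag a)" "diag a (tens xs) = of_real (a (length xs)) *C tens xs" "norm (diag a v) \<le> K * norm v"
  using S by auto
qed

lemma cinner_diag:
 assumes a: "!!n. \<bar>a n\<bar> \<le> K"
 shows "cinner (diag a v) w = cinner v (diag a w)"
proof -
 note b = diag_bounded[of a, OF a]
 have "cadjoint (diag a) = diag a"
 proof (rule operator_eqI)
  show "cadjoint (diag a) (tens xs) = diag a (tens xs)" for xs
  proof (rule vector_eqI)
   show "cinner (tens ys) (cadjoint (diag a) (tens xs)) = cinner (tens ys) (diag a (tens xs))" for ys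
    using b by (simp add: cinner_cadjoint_right diag_tens[of a, OF a] cinner_scaleC_left cinner_scaleC_right tens_cinner q_inner_def)
  qed
 qed (simp_all add: b clinear_cadjoint)
 then show ?thesis using cinner_cadjoint_left[OF b, of v w] by simp
qed

lemma diag_comp:
 assumes a: "!!n. \<bar>a n\<bar> \<le> K" and b: "!!n. \<bar>b n\<bar> \<le> L" and ab: "!!n. \<bar>a n * b n\<bar> \<le> M"
 shows "diag a (diag b v) = diag (%n. a n * b n) v"
proof -
 have "(%v. diag a (diag b v)) = diag (%n. a n * b n)"
  by (rule operator_eqI[OF clinear_compose[OF diag_bounded[of a, OF a] diag_bounded[of b, OF b]]
     diag_bounded[of "%n. a n * b n", OF ab]])
   (simp add: diag_tens[of a, OF a] diag_tens[of b, OF b] diag_tens[of "%n. a n * b n", OF ab]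
    clinear_scaleC[OF diag_bounded[of a, OF a]] scaleC_scaleC mult.commute)
 then show ?thesis by (rule fun_cong)
qed

text \<open>r to the power of the number operator, the second quantization of the scalar r. For r =
  0 it is the vacuum projection, as 0^0 = 1.\<close>

definition num :: "real \<Rightarrow> 'f \<Rightarrow> 'f"
 where "num r = diag (%n. r ^ n)"

context
 fixes r :: real
 assumes r: "\<bar>r\<bar> \<le> 1"
begin

lemma abs_power_le_1: "\<bar>r ^ n\<bar> \<le> 1" using r by (simp add: power_abs power_le_one)

lemma num_bounded: "bounded_clinear (num r)"
 and num_tens: "num r (tens xs) = of_real (r ^ length xs) *C tens xs"
 and num_bound: "norm (num r v) \<le> norm v"
 and cinner_num: "cinner (num r v) w = cinner v (num r w)"
 using diag_bounded[of "(^) r", OF abs_power_le_1] diag_tens[of "(^) r", OF abs_power_le_1]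
  diag_bound[of "(^) r", OF abs_power_le_1] cinner_diag[of "(^) r", OF abs_power_le_1]
 by (simp_all add: num_def)

lemma num_cre: "num r (cre h v) = of_real r *C cre h (num r v)"
proof -
 have "(%v. num r (cre h v)) = (%v. of_real r *C cre h (num r v))"
  by (intro operator_eqI clinear_cmul clinear_compose[OF num_bounded] clinear_compose[OF cre_bounded]
    num_bounded cre_bounded) (simp add: num_tens clinear_simps[OF cre_bounded] scaleC_scaleC)
 then show ?thesis by (rule fun_cong)
qed

lemma num_flip: "num r (flip v) = flip (num r v)"
proof -
 have "(%v. num r (flip v)) = (%v. flip (num r v))"
  by (rule operator_eqI[OF clinear_compose[OF num_bounded flip_bounded] clinear_compose[OF flip_bounded num_bounded]])
   (simp add: num_tens clinear_simps[OF flip_bounded])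
 then show ?thesis by (rule fun_cong)
qed

lemma num_rcre: "num r (rcre h v) = of_real r *C rcre h (num r v)"
 by (simp add: rcre_def num_flip num_cre clinear_simps[OF flip_bounded])

lemma rcan_num: "rcan h (num r v) = of_real r *C num r (rcan h v)"
 by (rule cinner_eqI) (simp add: cinner_rcan cinner_num[symmetric] num_rcre cinner_scaleC_left cinner_scaleC_right)

end

lemma q_le: "\<bar>q\<bar> \<le> 1" using q by auto

text \<open>Moving a left annihilator through a word costs a factor q per letter, so the letter
  created at the right end is met with q^N.\<close>

lemma can_rcre: "can g (rcre h v) = rcre h (can g v) + cinner g h *C num q v"
proof -
 have "can g (rcre h (tens xs)) = rcre h (can g (tens xs)) + cinner g h *C num q (tens xs)" for xs
 proof (induction xs)
  case Nil
  then show ?case by (simp add: can_tens_Cons clinear_zero num_tens q_le)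
 next
  case (Cons x xs)
  have "can g (rcre h (tens (x # xs))) = can g (cre x (rcre h (tens xs)))" by simp
  also have "\<dots> = rcre h (cinner g x *C tens xs + of_real q *C cre x (can g (tens xs))) +
    cinner g h *C num q (cre x (tens xs))"
   unfolding can_cre Cons
   by (simp add: num_cre q_le clinear_simps[OF rcre_bounded] clinear_simps[OF cre_bounded] scaleC_add_right rcre_cre
     scaleC_scaleC mult.commute del: cre_tens)
  finally show ?case by (simp add: can_tens_Cons)
 qed
 then have "(%v. can g (rcre h v)) = (%v. rcre h (can g v) + cinner g h *C num q v)"
  by (intro operator_eqI clinear_plus clinear_cmul clinear_compose[OF can_bounded]
    clinear_compose[OF rcre_bounded] num_bounded q_le can_bounded rcre_bounded) simp
 then show ?thesis by (rule fun_cong)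
qed

lemma rcan_cre: "rcan g (cre h v) = cre h (rcan g v) + cinner g h *C num q v"
proof (rule cinner_eqI)
 fix z
 have "cinner z (rcan g (cre h v)) = cinner (can h (rcre g z)) v" by (simp add: cinner_can cinner_rcan)
 also have "\<dots> = cinner z (cre h (rcan g v)) + cinner g h * cinner z (num q v)"
  using cinner_commute[of g h]
  by (simp add: can_rcre cinner_add_left cinner_scaleC_left cinner_can cinner_rcan(2)[symmetric] cinner_num[OF q_le])
 finally show "cinner z (rcan g (cre h v)) = cinner z (cre h (rcan g v) + cinner g h *C num q v)"
  by (simp add: cinner_add_right cinner_scaleC_right)
qed

subsection \<open>Cyclicity of the vacuum and irreducibility\<close>

lemma tens_subspace_UNIV:
 assumes "closed K" "csubspace K" "!!xs. tens xs \<in> K"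
 shows "K = UNIV"
proof -
 have "{c *C tens xs | c xs. True} \<subseteq> K" using assms(2,3) by (auto simp: csubspace_def)
 then show ?thesis
  using closure_span_minimal[of K "{c *C tens xs | c xs. True}"] assms tens_dense by (auto simp: csubspace_def)
qed

lemma cinner_tens_vac: "xs \<noteq> [] ==> cinner (tens xs) vac = 0" by (simp add: tens_cinner q_inner_def)

lemma vacuum_vector:
 assumes "!!h. can h v = 0"
 obtains c where "v = c *C vac"
proof
 show "v = cinner vac v *C vac"
 proof (rule vector_eqI)
  fix xs
  show "cinner (tens xs) v = cinner (tens xs) (cinner vac v *C vac)"
  proof (cases xs)
   case (Cons h ys)
   then have "cinner (tens xs) v = cinner (tens ys) (can h v)" by (simp add: cinner_can)
   then show ?thesis
    using Cons assms by (simp add: cinner_scaleC_right cinner_tens_vac cinner.zero_right)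
  qed (simp add: cinner_scaleC_right cinner_self)
 qed
qed

lemma can_bound: "norm (can h v) \<le> cre_norm h * norm v"
proof (cases "can h v = 0")
 case False
 have "(norm (can h v))\<^sup>2 = cmod (cinner (can h v) (can h v))" unfolding cinner_self norm_of_real by simp
 also have "\<dots> = cmod (cinner v (cre h (can h v)))" by (simp only: cinner_can(1))
 also have "\<dots> \<le> norm v * norm (cre h (can h v))" by (rule cinner_Cauchy_Schwarz)
 also have "\<dots> \<le> norm v * (cre_norm h * norm (can h v))" by (intro mult_left_mono cre_bound) simp
 finally show ?thesis using False by (simp add: power2_eq_square mult_ac)
qed (use q_abs in \<open>simp add: cre_norm_def\<close>)

lemma bounded_linear_cre: "bounded_linear (%h. cre h v)" and bounded_linear_can: "bounded_linear (%h. can h v)"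
proof -
 have "cre (r *\<^sub>R h) v = r *\<^sub>R cre h v" "can (r *\<^sub>R h) v = r *\<^sub>R can h v" for r :: real and h
  by (simp_all add: scaleR_scaleC cre_scaleC can_scaleC)
 then show "bounded_linear (%h. cre h v)" "bounded_linear (%h. can h v)"
  using cre_bound can_bound by (auto intro!: bounded_linear_intro[where K = "norm v / sqrt (1 - \<bar>q\<bar>)"]
    simp: cre_add can_add cre_norm_def mult_ac)
qed

lemma bounded_linear_rcre: "bounded_linear (%h. rcre h v)" and bounded_linear_rcan: "bounded_linear (%h. rcan h v)"
 unfolding rcre_def rcan_def
 by (intro bounded_linear_compose[OF clinear_boundedD[OF flip_bounded]] bounded_linear_cre bounded_linear_can)+

lemma dense_closed:
 assumes "closure (range c) = UNIV" "bounded_linear S" "closed K" "!!i. S (c i) \<in> K"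
 shows "S h \<in> K"
proof -
 have "closed {h. S h \<in> K}"
  using continuous_closed_vimage[OF assms(3), of S] linear_continuous_at[OF assms(2)] by (simp add: vimage_def)
 then have "closure (range c) \<subseteq> {h. S h \<in> K}" using assms(4) by (intro closure_minimal) auto
 then show ?thesis using assms(1) by auto
qed

lemma tens_dense_letters:
 assumes c: "closure (range c) = UNIV" and K: "closed K" and D: "!!is. tens (map c is) \<in> K"
 shows "tens xs \<in> K"
proof -
 have app: "tens (xs @ ys) = foldr cre xs (tens ys)" for xs ys
  by (induction xs) (auto simp flip: cre_tens)
 have bf: "bounded_clinear (foldr cre xs)" for xs
  by (induction xs) (auto simp: foldr.simps(2) id_def[symmetric] intro: clinear_id' clinear_comp simp del: comp_apply)
 have "tens (xs @ map c is) \<in> K" for "is"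
 proof (induction xs arbitrary: "is" rule: rev_induct)
  case (snoc x xs)
  have "bounded_linear (%x. foldr cre xs (cre x (tens (map c is))))"
   by (intro bounded_linear_compose[OF clinear_boundedD[OF bf]] bounded_linear_cre)
  then have "foldr cre xs (cre x (tens (map c is))) \<in> K"
  proof (rule dense_closed[OF c _ K])
   show "foldr cre xs (cre (c i) (tens (map c is))) \<in> K" for i using snoc[of "i # is"] by (simp add: app)
  qed
  then show ?case by (simp add: app)
 qed (simp add: D)
 from this[of "[]"] show ?thesis by simp
qed

text \<open>Induction on word length: a field applied to a word creates the next longer one up to an
  annihilation term, which is a combination of shorter words in the same letters.\<close>

lemma cyclic_left:
 assumes c: "closure (range c) = UNIV" and K: "closed K" "csubspace K" "vac \<in> K"
  and inv: "!!i v. v \<in> K ==> cre (c i) v + can (d i) v \<in> K"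
 shows "K = UNIV"
proof (rule tens_subspace_UNIV[OF K(1,2)])
 have sub: "subspace K" and sc: "!!a x. x \<in> K ==> a *C x \<in> K" using K(2) by (auto simp: csubspace_def)
 have "tens (map c is) \<in> K" if "length is \<le> n" for n "is" using that
 proof (induction n arbitrary: "is")
  case 0
  then show ?case using K(3) by simp
 next
  case (Suc n)
  show ?case
  proof (cases "is")
   case (Cons i js)
   have "lin_comb tens F \<in> K" if "\<forall>(a, w) \<in> set F. \<exists>js. w = map c js \<and> length js \<le> n" for F using that
   proof (induction F)
    case (Cons p F)
    then show ?case using Suc.IH sc by (cases p) (auto intro!: subspace_add[OF sub])
   qed (use subspace_0[OF sub] in simp)
   moreover have "\<exists>ks. w = map c ks \<and> length ks \<le> n" if aw: "(a, w) \<in> set (annihilate q (d i) (map c js))" for a w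
   proof -
    obtain k where "w = map c (take k js @ drop (Suc k) js)"
     using aw by (auto simp: annihilate_eq take_map drop_map)
    then show ?thesis using annihilate_length[OF aw] Suc.prems Cons
     by (intro exI[of _ "take k js @ drop (Suc k) js"]) auto
   qed
   ultimately have "can (d i) (tens (map c js)) \<in> K" unfolding can_tens ann_def by fast
   moreover have "tens (map c js) \<in> K" using Suc.IH Suc.prems Cons by simp
   ultimately show ?thesis using subspace_diff[OF sub inv[of "tens (map c js)" i]] Cons by fastforce
  qed (use K(3) in simp)
 qed
 from tens_dense_letters[OF c K(1) this[OF order_refl]] show "tens xs \<in> K" for xs .
qed

lemma flip_subspace:
 assumes K: "closed K" "csubspace K"
 shows "closed {v. flip v \<in> K}" "csubspace {v. flip v \<in> K}"
 using closed_subspace_vimage[OF clinear_boundedD[OF flip_bounded], of K] K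
 by (auto simp: csubspace_def clinear_simps[OF flip_bounded])

lemma cyclic_right:
 assumes c: "closure (range c) = UNIV" and K: "closed K" "csubspace K" "vac \<in> K"
  and inv: "!!i v. v \<in> K ==> rcre (c i) v + rcan (d i) v \<in> K"
 shows "K = UNIV"
proof -
 have "{v. flip v \<in> K} = UNIV"
 proof (rule cyclic_left[OF c flip_subspace[OF K(1,2)]])
  show "cre (c i) v + can (d i) v \<in> {v. flip v \<in> K}" if "v \<in> {v. flip v \<in> K}" for i v
   using inv[of "flip v" i] that by (simp add: rcre_def rcan_def clinear_simps[OF flip_bounded])
 qed (use K in simp)
 then show ?thesis by (metis (mono_tags) UNIV_eq_I UNIV_I flip_flip mem_Collect_eq)
qed

text \<open>By continuity K is invariant under all right creation and annihilation operators, so its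
  projection commutes with them. The projection maps the vacuum to a vector killed by all
  annihilators, hence to a multiple of the vacuum, and creation spreads this to all words.\<close>

lemma irreducible:
 assumes c: "closure (range c) = UNIV" and d: "closure (range d) = UNIV" and K: "closed K" "csubspace K"
  and inv: "!!i v. v \<in> K ==> rcre (c i) v \<in> K" "!!i v. v \<in> K ==> rcan (d i) v \<in> K"
 shows "K = {0} \<or> K = UNIV"
proof -
 have rcre: "rcre h v \<in> K" and rcan: "rcan h v \<in> K" if "v \<in> K" for h v
  using dense_closed[OF c bounded_linear_rcre K(1)] dense_closed[OF d bounded_linear_rcan K(1)] inv that by blast+
 obtain P where P: "orthogonal_projection P" "!!x. P x \<in> K" "!!x. x \<in> K ==> P x = x" "!!x s. s \<in> K ==> cinner s (x - P x) = 0"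
  using orthogonal_projection_onto[OF K] by blast
 have bP: "bounded_clinear P" using P(1) by (simp add: orthogonal_projection_def)
 have Pr: "P (rcre h v) = rcre h (P v)" "P (rcan h v) = rcan h (P v)" for h v
  by (rule projection_commute[OF P, where S' = "rcan h"]; simp add: rcre rcan cinner_rcan(1))
   (rule projection_commute[OF P, where S' = "rcre h"]; simp add: rcre rcan cinner_rcan(2))
 have "can h (flip (P vac)) = flip (P (rcan h vac))" for h unfolding Pr(2) by (simp add: rcan_def)
 then have "can h (flip (P vac)) = 0" for h by (simp add: clinear_zero[OF bP] clinear_zero)
 then obtain a where "flip (P vac) = a *C vac" by (rule vacuum_vector)
 then have Pv: "P vac = a *C vac"
  by (metis flip_flip clinear_scaleC[OF flip_bounded] flip_tens rev.simps(1))
 show ?thesis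
 proof (cases "a = 0")
  case True
  have "P (tens xs) = 0" for xs
  proof (induction xs rule: rev_induct)
   case (snoc x xs)
   then show ?case using Pr(1)[of x "tens xs"] by (simp add: clinear_zero)
  qed (simp add: Pv True)
  then have "P = (%v. 0)" by (intro operator_eqI bP clinear_const_zero)
  then have "K \<subseteq> {0}" using P(3) by fastforce
  moreover have "0 \<in> K" using K(2) by (simp add: csubspace_def subspace_0)
  ultimately show ?thesis by blast
 next
  case False
  have "inverse a *C P vac \<in> K" using K(2) P(2) by (simp add: csubspace_def)
  then have vac: "vac \<in> K" using False by (simp add: Pv scaleC_scaleC)
  have "tens xs \<in> K" for xs
  proof (induction xs rule: rev_induct)
   case (snoc x xs)
   then show ?case using rcre[of "tens xs" x] by simp
  qed (rule vac)
  then show ?thesis using tens_subspace_UNIV[OF K] by blast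
 qed
qed

end

context q_fock
begin

subsection \<open>Pairs of invariant subspaces orthogonal for the q-deformation\<close>

context
 fixes c d :: "'i \<Rightarrow> 'h"
begin

definition cre_word :: "'i list \<Rightarrow> 'f \<Rightarrow> 'f"
 where "cre_word w v = foldr (%a. rcre (c a)) w v"

definition can_word :: "'i list \<Rightarrow> 'f \<Rightarrow> 'f"
 where "can_word w v = foldr (%a. rcan (d a)) w v"

lemma word_simps [simp]: "cre_word [] v = v" "cre_word (a # w) v = rcre (c a) (cre_word w v)"
  "cre_word (w @ w') v = cre_word w (cre_word w' v)"
  "can_word [] v = v" "can_word (a # w) v = rcan (d a) (can_word w v)"
  "can_word (w @ w') v = can_word w (can_word w' v)"
 by (simp_all add: cre_word_def can_word_def)

lemma word_bounded: "bounded_clinear (cre_word w)" "bounded_clinear (can_word w)"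
proof -
 show "bounded_clinear (cre_word w)"
  by (induction w) (simp_all add: fun_eq_iff[symmetric] clinear_id clinear_compose[OF rcre_bounded])
 show "bounded_clinear (can_word w)"
  by (induction w) (simp_all add: clinear_id clinear_compose[OF rcan_bounded])
qed

lemmas word_linear = clinear_simps[OF word_bounded(1)] clinear_simps[OF word_bounded(2)]
 clinear_simps[OF rcre_bounded] clinear_simps[OF rcan_bounded]

text \<open>\<open>L\<close> collects the contractions with letters of the word; its coefficients do
  not depend on the vector v.\<close>

lemma rcan_cre_word: "\<exists>L. (\<forall>(a, w') \<in> set L. length w = Suc (length w')) \<and>
  (\<forall>v. rcan g (cre_word w v) = of_real (q ^ length w) *C cre_word w (rcan g v) + lin_comb (%w'. cre_word w' v) L)"
proof (induction w)
 case Nil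
 show ?case by (rule exI[of _ "[]"]) simp
next
 case (Cons b w)
 then obtain L where L: "\<forall>(a, w') \<in> set L. length w = Suc (length w')"
  "!!v. rcan g (cre_word w v) = of_real (q ^ length w) *C cre_word w (rcan g v) + lin_comb (%w'. cre_word w' v) L"
  by blast
 have "lin_comb (%w'. cre_word w' v) (map (%(a, w'). (of_real q * a, b # w')) M) =
   of_real q *C rcre (c b) (lin_comb (%w'. cre_word w' v) M)" for M v
  by (induction M) (auto simp: word_linear scaleC_add_right scaleC_scaleC)
 then show ?case
  using L by (intro exI[of _ "(cinner g (c b), w) # map (%(a, w'). (of_real q * a, b # w')) L"])
   (auto simp: rcan_rcre word_linear scaleC_add_right scaleC_scaleC)
qed

lemma can_word_rcre: "\<exists>L. (\<forall>(a, w') \<in> set L. length w = Suc (length w')) \<and>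
  (\<forall>v. can_word w (rcre h v) = of_real (q ^ length w) *C rcre h (can_word w v) + lin_comb (%w'. can_word w' v) L)"
proof (induction w)
 case Nil
 show ?case by (rule exI[of _ "[]"]) simp
next
 case (Cons b w)
 then obtain L where L: "\<forall>(a, w') \<in> set L. length w = Suc (length w')"
  "!!v. can_word w (rcre h v) = of_real (q ^ length w) *C rcre h (can_word w v) + lin_comb (%w'. can_word w' v) L"
  by blast
 have "lin_comb (%w'. can_word w' v) (map (%(a, w'). (a, b # w')) M) =
   rcan (d b) (lin_comb (%w'. can_word w' v) M)" for M v
  by (induction M) (auto simp: word_linear)
 then show ?case
  using L by (intro exI[of _ "(of_real (q ^ length w) * cinner (d b) h, w) # map (%(a, w'). (a, b # w')) L"])
   (auto simp: rcan_rcre word_linear scaleC_add_right scaleC_scaleC mult.commute)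
qed

text \<open>
 Modulo words of smaller degree, the two closure properties of \<open>Z\<close> trade creation letters for annihilation
 letters in two ways, with coefficients of modulus at most 1 and greater than 1 respectively;
 comparing them puts every word into \<open>Z\<close>.
\<close>

lemma all_words:
 fixes Z :: "('f \<Rightarrow> 'f) \<Rightarrow> bool"
 assumes q0: "q \<noteq> 0"
  and Zid: "Z (%v. v)"
  and Zadd: "!!X Y. Z X ==> Z Y ==> Z (%v. X v + Y v)"
  and Zscale: "!!a X. Z X ==> Z (%v. a *C X v)"
  and Zleft: "!!a X. Z X ==> Z (%v. rcre (c a) (X v) + rcan (d a) (X v))"
  and Zright: "!!a X. bounded_clinear X ==> Z X ==>
   Z (%v. X (of_real q *C rcre (c a) v + of_real (inverse q) *C rcan (d a) v))"
 shows "Z (%v. cre_word w (can_word w' v))"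
proof -
 define S where "S w w' v = cre_word w (can_word w' v)" for w w' v
 have Zdiff: "Z (%v. X v - Y v)" if "Z X" "Z Y" for X Y
  using Zadd[OF that(1) Zscale[OF that(2), of "- 1"]] by simp
 have Zzero: "Z (%v. 0)" using Zscale[OF Zid, of 0] by simp
 have Zlin1: "Z (%v. lin_comb (%w. S w w' v) L)" if "\<forall>(a, w) \<in> set L. Z (S w w')" for L w'
  using that by (induction L) (auto intro!: Zadd Zscale Zzero)
 have Zlin2: "Z (%v. cre_word w (lin_comb (%w'. can_word w' v) L))" if "\<forall>(a, w') \<in> set L. Z (S w w')" for L w
  using that by (induction L) (auto simp: word_linear S_def[abs_def] intro!: Zadd Zscale Zzero)
 have "\<forall>w w'. length w + length w' = n \<longrightarrow> Z (S w w')" for n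
 proof (induction n rule: less_induct)
  case (less n)
  \<comment> \<open>By \<open>Zleft\<close> the new letter enters at the left end, as creation and
    as annihilation. Moved through the creations of w the latter acquires q^|w| and shorter words,
    which belong to Z by induction.\<close>
  have A: "Z (%v. S (a # w) w' v + of_real (q ^ length w) *C S w (a # w') v)"
   if len: "Suc (length w + length w') = n" for a w w'
  proof -
   obtain L where L: "\<forall>(b, w') \<in> set L. length w = Suc (length w')"
    "!!v. rcan (d a) (cre_word w v) = of_real (q ^ length w) *C cre_word w (rcan (d a) v) + lin_comb (%w'. cre_word w' v) L"
    using rcan_cre_word by blast
   have "Z (S w w')" using less[of "length w + length w'"] len by simp
   from Zleft[OF this, of a]
   have "Z (%v. rcre (c a) (S w w' v) + rcan (d a) (S w w' v))" .
   moreover have "Z (%v. lin_comb (%w0. S w0 w' v) L)"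
   proof (rule Zlin1, safe)
    fix b w0
    assume "(b, w0) \<in> set L"
    then have "length w = Suc (length w0)" using L(1) by blast
    then show "Z (S w0 w')" using less[of "length w0 + length w'"] len by simp
   qed
   ultimately have "Z (%v. rcre (c a) (S w w' v) + rcan (d a) (S w w' v) - lin_comb (%w0. S w0 w' v) L)"
    by (rule Zdiff)
   then show ?thesis by (simp add: S_def L(2) add.assoc)
  qed
  \<comment> \<open>By \<open>Zright\<close> the new letter enters at the right end: the
    annihilation is in place with coefficient 1/q, and the creation is moved through the
    annihilations of w'.\<close>
  have B: "Z (%v. of_real (q ^ Suc (length w')) *C S (w @ [a]) w' v + of_real (inverse q) *C S w (w' @ [a]) v)"
   if len: "Suc (length w + length w') = n" for a w w'
  proof -
   obtain L where L: "\<forall>(b, w0) \<in> set L. length w' = Suc (length w0)"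
    "!!v. can_word w' (rcre (c a) v) = of_real (q ^ length w') *C rcre (c a) (can_word w' v) + lin_comb (%w'. can_word w' v) L"
    using can_word_rcre by blast
   have "Z (S w w')" using less[of "length w + length w'"] len by simp
   moreover have "bounded_clinear (S w w')"
    unfolding S_def[abs_def] by (intro clinear_compose[OF word_bounded(1)] word_bounded(2))
   ultimately have "Z (%v. S w w' (of_real q *C rcre (c a) v + of_real (inverse q) *C rcan (d a) v))"
    by (intro Zright)
   moreover have "Z (%v. of_real q *C cre_word w (lin_comb (%w'. can_word w' v) L))"
   proof (rule Zscale, rule Zlin2, safe)
    fix b w0
    assume "(b, w0) \<in> set L"
    then have "length w' = Suc (length w0)" using L(1) by blast
    then show "Z (S w w0)" using less[of "length w + length w0"] len by simp
   qed
   ultimately have "Z (%v. S w w' (of_real q *C rcre (c a) v + of_real (inverse q) *C rcan (d a) v) -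
     of_real q *C cre_word w (lin_comb (%w'. can_word w' v) L))"
    by (rule Zdiff)
   moreover have "S w w' (of_real q *C rcre (c a) v + of_real (inverse q) *C rcan (d a) v) -
     of_real q *C cre_word w (lin_comb (%w'. can_word w' v) L) =
     of_real (q ^ Suc (length w')) *C S (w @ [a]) w' v + of_real (inverse q) *C S w (w' @ [a]) v" for v
    by (simp add: S_def word_linear L(2) scaleC_add_right scaleC_scaleC)
   ultimately show ?thesis by simp
  qed
  \<comment> \<open>Creation letters are converted one by one; each conversion multiplies by a power
    of q up to sign, so the coefficient stays in the unit disc.\<close>
  have A': "\<exists>\<alpha>. cmod \<alpha> \<le> 1 \<and> Z (%v. S w w' v - \<alpha> *C S [] (rev w @ w') v)" if "length w + length w' = n" for w w'
   using that
  proof (induction w arbitrary: w')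
   case Nil
   then show ?case using Zzero by (intro exI[of _ 1]) simp
  next
   case (Cons a w)
   obtain \<alpha> where \<alpha>: "cmod \<alpha> \<le> 1" "Z (%v. S w (a # w') v - \<alpha> *C S [] (rev w @ a # w') v)"
    using Cons.IH[of "a # w'"] Cons.prems by auto
   let ?k = "complex_of_real (q ^ length w)"
   have k: "cmod ?k \<le> 1" using abs_power_le_1[OF q_le] by (simp only: norm_of_real)
   have "Z (%v. (S (a # w) w' v + ?k *C S w (a # w') v) - ?k *C (S w (a # w') v - \<alpha> *C S [] (rev w @ a # w') v))"
    using Cons.prems by (intro Zdiff Zscale \<alpha> A) simp
   then have "Z (%v. S (a # w) w' v - (- (?k * \<alpha>)) *C S [] (rev (a # w) @ w') v)"
    by (simp add: scaleC_diff_right scaleC_scaleC)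
   moreover have "cmod (- (?k * \<alpha>)) \<le> 1" using mult_mono[OF k \<alpha>(1)] by (simp add: norm_mult)
   ultimately show ?case by blast
  qed
  \<comment> \<open>Conversion through B divides by positive powers of q, so the coefficient leaves
    the closed unit disc once a letter is converted.\<close>
  have B': "\<exists>\<beta>. 1 \<le> cmod \<beta> \<and> (w \<noteq> [] \<longrightarrow> 1 < cmod \<beta>) \<and> Z (%v. S w w' v - \<beta> *C S [] (w' @ rev w) v)"
   if "length w + length w' = n" for w w' using that
  proof (induction w arbitrary: w' rule: rev_induct)
   case Nil
   then show ?case using Zzero by (intro exI[of _ 1]) simp
  next
   case (snoc a w)
   obtain \<beta> where \<beta>: "1 \<le> cmod \<beta>" "Z (%v. S w (w' @ [a]) v - \<beta> *C S [] ((w' @ [a]) @ rev w) v)"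
    using snoc.IH[of "w' @ [a]"] snoc.prems by auto
   let ?k = "complex_of_real (inverse (q ^ Suc (length w')))" and ?i = "complex_of_real (inverse q)"
   have k: "1 < cmod (?k * ?i)"
   proof -
    have "\<bar>q\<bar> ^ Suc (Suc (length w')) < 1" using q_abs q0 by (intro power_Suc_less_one) auto
    then have "1 < inverse (\<bar>q\<bar> ^ Suc (Suc (length w')))" using q0 by (intro one_less_inverse) auto
    also have "inverse (\<bar>q\<bar> ^ Suc (Suc (length w'))) = cmod (?k * ?i)"
     by (simp add: norm_mult norm_inverse norm_power power_abs abs_mult mult.commute)
    finally show ?thesis .
   qed
   have "inverse (q ^ Suc (length w')) * q ^ Suc (length w') = 1" using q0 by (intro left_inverse) simp
   then have "?k *C complex_of_real (q ^ Suc (length w')) *C x = x" for x :: 'f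
    by (simp only: scaleC_scaleC of_real_mult[symmetric]) simp
   moreover have "Z (%v. ?k *C (of_real (q ^ Suc (length w')) *C S (w @ [a]) w' v + ?i *C S w (w' @ [a]) v)
     - (?k * ?i) *C (S w (w' @ [a]) v - \<beta> *C S [] ((w' @ [a]) @ rev w) v))"
    using snoc.prems by (intro Zdiff Zscale \<beta> B) simp
   ultimately have "Z (%v. S (w @ [a]) w' v - (- (?k * ?i * \<beta>)) *C S [] (w' @ rev (w @ [a])) v)"
    by (simp add: scaleC_add_right scaleC_diff_right scaleC_scaleC del: of_real_power of_real_inverse)
   moreover have "1 < cmod (- (?k * ?i * \<beta>))"
   proof -
    have "cmod (?k * ?i) * 1 \<le> cmod (?k * ?i) * cmod \<beta>" by (intro mult_left_mono \<beta>) simp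
    then show ?thesis using k by (simp only: norm_minus_cancel norm_mult)
   qed
   ultimately show ?case by (intro exI[of _ "- (?k * ?i * \<beta>)"]) (simp only:, simp)
  qed
  \<comment> \<open>Both conversions of the pure creation word \<open>rev u\<close> end in the
    annihilation word u. Their coefficients differ, so subtraction puts u into Z.\<close>
  have base: "Z (S [] u)" if u: "length u = n" for u
  proof (cases "u = []")
   case False
   obtain \<alpha> where \<alpha>: "cmod \<alpha> \<le> 1" "Z (%v. S (rev u) [] v - \<alpha> *C S [] u v)"
    using A'[of "rev u" "[]"] u by auto
   obtain \<beta> where \<beta>: "1 < cmod \<beta>" "Z (%v. S (rev u) [] v - \<beta> *C S [] u v)"
    using B'[of "rev u" "[]"] u False by auto
   have "\<beta> \<noteq> \<alpha>" using \<alpha> \<beta> by auto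
   have "Z (%v. inverse (\<beta> - \<alpha>) *C ((S (rev u) [] v - \<alpha> *C S [] u v) - (S (rev u) [] v - \<beta> *C S [] u v)))"
    by (intro Zscale Zdiff \<alpha> \<beta>)
   moreover have "(S (rev u) [] v - \<alpha> *C S [] u v) - (S (rev u) [] v - \<beta> *C S [] u v) = (\<beta> - \<alpha>) *C S [] u v" for v
    by (simp add: scaleC_diff_left)
   ultimately show ?thesis using \<open>\<beta> \<noteq> \<alpha>\<close> by (simp add: scaleC_scaleC)
  next
   case True
   then have "S [] u = (%v. v)" by (simp add: S_def fun_eq_iff)
   then show ?thesis using Zid by simp
  qed
  show ?case
  proof (intro allI impI)
   fix w w' :: "'i list"
   assume n: "length w + length w' = n"
   then obtain \<alpha> where "Z (%v. S w w' v - \<alpha> *C S [] (rev w @ w') v)" using A' by blast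
   from Zadd[OF this Zscale[OF base, of "rev w @ w'" \<alpha>]] show "Z (S w w')" using n by simp
  qed
 qed
 then show ?thesis by (simp add: S_def[abs_def])
qed

end

lemma num_zero: "num 0 v = cinner vac v *C vac"
proof -
 have "num 0 = (%v. cinner vac v *C vac)"
 proof (rule operator_eqI)
  show "bounded_clinear (%v. cinner vac v *C vac)" by (rule bounded_clinearI[where K = 1])
    (auto simp: cinner_add_right cinner_scaleC_right scaleC_add_left scaleC_scaleC norm_scaleC
     intro: order_trans[OF cinner_Cauchy_Schwarz])
  show "num 0 (tens xs) = cinner vac (tens xs) *C vac" for xs
   by (cases xs) (simp_all add: num_tens tens_cinner q_inner_Nil, simp add: q_inner_def)
 qed (simp add: num_bounded)
 then show ?thesis by simp
qed

text \<open>Let F belong to Z if <v, F q^N w> vanishes for v in X and w in Y. Invariance of X lets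
  fields be multiplied from the left; invariance of Y does so from the right once the field is
  pulled through q^N, which rescales creation by q and annihilation by 1/q. So Z contains all words,
  and by irreducibility the words applied to q^N Y span a dense subspace unless Y is
  trivial.\<close>

lemma orthogonal_invariant_sets:
 fixes c d :: "'i \<Rightarrow> 'h" and \<sigma> :: "'i \<Rightarrow> 'i"
 assumes dense: "closure (range c) = UNIV" and adj: "!!a. c (\<sigma> a) = d a" "!!a. d (\<sigma> a) = c a"
  and X: "!!a v. v \<in> X ==> rcre (c a) v + rcan (d a) v \<in> X"
  and Y: "!!a v. v \<in> Y ==> rcre (c a) v + rcan (d a) v \<in> Y"
  and orth: "!!v w. v \<in> X ==> w \<in> Y ==> cinner v (num q w) = 0"
 shows "X \<subseteq> {0} \<or> Y \<subseteq> {0}"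
proof -
 define s where "s a v = rcre (c a) v + rcan (d a) v" for a v
 have s_adj: "cinner (s a v) w = cinner v (s (\<sigma> a) w)" for a v w
  by (simp add: s_def cinner_add_left cinner_add_right adj cinner_rcan(1) cinner_rcan(2)[symmetric])
 show ?thesis
 proof (cases "q = 0")
  \<comment> \<open>For q = 0 the operator q^N is the vacuum projection, so one of the sets is
    orthogonal to the vacuum, and cyclicity makes it trivial.\<close>
  case True
  have trivial: "W \<subseteq> {0}" if W: "!!a v. v \<in> W ==> s a v \<in> W" "!!w. w \<in> W ==> cinner vac w = 0" for W
  proof
   fix w
   assume "w \<in> W"
   define K where "K = {u. \<forall>w\<in>W. cinner u w = 0}"
   have "K = (\<Inter>w\<in>W. {u. cinner u w = 0})" by (auto simp: K_def)
   then have "closed K"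
    by (auto intro!: closed_Collect_eq continuous_intros bounded_linear.continuous_on[OF cinner.bounded_linear_left])
   moreover have "csubspace K"
    by (auto simp: csubspace_def subspace_def K_def cinner_add_left cinner_scaleC_left cinner_scaleR_left cinner.zero_left)
   moreover have "rcre (c a) u + rcan (d a) u \<in> K" if "u \<in> K" for a u
    using that W(1) s_adj[of a u] by (simp add: K_def s_def[symmetric])
   ultimately have "K = UNIV" using W(2) by (intro cyclic_right[OF dense]) (auto simp: K_def)
   then have "cinner w w = 0" using \<open>w \<in> W\<close> by (auto simp: K_def)
   then show "w \<in> {0}" by (simp add: cinner_self)
  qed
  have "cinner vac v = 0 \<or> cinner vac w = 0" if "v \<in> X" "w \<in> Y" for v w
   using orth[OF that] cinner_commute[of v vac] by (auto simp: True num_zero cinner_scaleC_right)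
  then have "(\<forall>v\<in>X. cinner vac v = 0) \<or> (\<forall>w\<in>Y. cinner vac w = 0)" by blast
  then show ?thesis using trivial[of X] trivial[of Y] X Y by (auto simp: s_def)
 next
  case False
  define Z where "Z F \<longleftrightarrow> (\<forall>v\<in>X. \<forall>w\<in>Y. cinner v (F (num q w)) = 0)" for F :: "'f \<Rightarrow> 'f"
  have words: "Z (%v. cre_word c w (can_word d w' v))" for w w'
  proof (rule all_words[OF False])
   show "Z (%v. v)" using orth by (simp add: Z_def)
   show "Z (%v. rcre (c a) (F v) + rcan (d a) (F v))" if F: "Z F" for a F unfolding Z_def
   proof (intro ballI)
    fix v w
    assume vw: "v \<in> X" "w \<in> Y"
    have "cinner v (s a x) = cinner (s (\<sigma> a) v) x" for x
     using s_adj[of "\<sigma> a" v x] by (simp add: s_def adj)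
    moreover have "s (\<sigma> a) v \<in> X" using X[OF vw(1), of "\<sigma> a"] by (simp add: s_def)
    ultimately show "cinner v (rcre (c a) (F (num q w)) + rcan (d a) (F (num q w))) = 0"
     using F vw(2) by (simp add: Z_def s_def)
   qed
   show "Z (%v. F (of_real q *C rcre (c a) v + of_real (inverse q) *C rcan (d a) v))"
    if F: "bounded_clinear F" "Z F" for a F unfolding Z_def
   proof (intro ballI)
    fix v w
    assume vw: "v \<in> X" "w \<in> Y"
    have "of_real (inverse q) *C rcan (d a) (num q w) = num q (rcan (d a) w)"
     using False unfolding rcan_num[OF q_le] scaleC_scaleC of_real_mult[symmetric] by simp
    then have "of_real q *C rcre (c a) (num q w) + of_real (inverse q) *C rcan (d a) (num q w) = num q (s a w)"
     by (simp add: s_def clinear_add[OF num_bounded] q_le num_rcre del: of_real_inverse)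
    then show "cinner v (F (of_real q *C rcre (c a) (num q w) + of_real (inverse q) *C rcan (d a) (num q w))) = 0"
     using F(2) vw Y[OF vw(2), of a] by (simp add: Z_def s_def)
   qed
  qed (auto simp: Z_def cinner_add_right cinner_scaleC_right)
  define G where "G = {b *C cre_word c w (can_word d w' (num q y)) | b w w' y. y \<in> Y}"
  define K where "K = closure (span G)"
  have K: "closed K" "csubspace K"
  proof -
   have "b *C g \<in> G" if "g \<in> G" for b g
    using that unfolding G_def by (clarsimp simp: scaleC_scaleC) blast
   then show "closed K" "csubspace K" unfolding K_def by (auto intro: csubspace_closure csubspace_span)
  qed
  have GK: "G \<subseteq> K" unfolding K_def by (meson closure_subset span_superset subset_trans)
  have gen: "cre_word c w (can_word d w' (num q y)) \<in> G" if "y \<in> Y" for w w' y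
  proof -
   have "1 *C cre_word c w (can_word d w' (num q y)) \<in> G" unfolding G_def using that by blast
   then show ?thesis by simp
  qed
  have "rcre (c a) v \<in> K" if "v \<in> K" for a v unfolding K_def
  proof (rule closure_span_invariant[OF clinear_boundedD[OF rcre_bounded] _ that[unfolded K_def]])
   fix g
   assume "g \<in> G"
   then obtain b w w' y where g: "g = b *C cre_word c w (can_word d w' (num q y))" "y \<in> Y"
    by (auto simp: G_def)
   have "rcre (c a) g \<in> G"
    unfolding G_def using g(2) by (auto simp: g(1) clinear_simps[OF rcre_bounded] word_simps(2)[symmetric] simp del: word_simps)
   then show "rcre (c a) g \<in> closure (span G)" using GK by (auto simp: K_def)
  qed
  moreover have "rcan (d a) v \<in> K" if "v \<in> K" for a v unfolding K_def
  proof (rule closure_span_invariant[OF clinear_boundedD[OF rcan_bounded] _ that[unfolded K_def]])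
   fix g
   assume "g \<in> G"
   then obtain b w w' y where g: "g = b *C cre_word c w (can_word d w' (num q y))" "y \<in> Y"
    by (auto simp: G_def)
   obtain L where L: "!!v. rcan (d a) (cre_word c w v) = of_real (q ^ length w) *C cre_word c w (rcan (d a) v) + lin_comb (%w'. cre_word c w' v) L"
    using rcan_cre_word by blast
   have KI: "cre_word c w (can_word d w' (num q y)) \<in> K" for w w' using gen[OF g(2)] GK by blast
   have "lin_comb (%w. cre_word c w (can_word d w' (num q y))) L \<in> K"
    using K(2) KI by (induction L) (auto simp: csubspace_def subspace_0 subspace_add)
   then have "rcan (d a) g \<in> K"
    using K(2) KI[of w "a # w'"] by (simp add: g(1) clinear_simps[OF rcan_bounded] L csubspace_def subspace_add)
   then show "rcan (d a) g \<in> closure (span G)" by (simp add: K_def)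
  qed
  moreover have "closure (range d) = UNIV"
  proof -
   have "range c \<subseteq> range d" using adj(2) by (metis image_subsetI rangeI)
   then show ?thesis using dense closure_mono by blast
  qed
  ultimately have "K = {0} \<or> K = UNIV" using dense by (intro irreducible[where c = c and d = d] K)
  then show ?thesis
  proof
   assume "K = {0}"
   have "y = 0" if "y \<in> Y" for y
   proof (rule vector_eqI)
    have "num q y = 0" using gen[OF that, of "[]" "[]"] GK \<open>K = {0}\<close> by auto
    then have "of_real (q ^ length xs) * cinner (tens xs) y = 0" for xs
     using cinner_num[OF q_le, of "tens xs" y] by (simp add: num_tens[OF q_le] cinner_scaleC_left cinner.zero_right)
    then show "cinner (tens xs) y = cinner (tens xs) 0" for xs
     using False by (simp add: cinner.zero_right)
   qed
   then show ?thesis by auto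
  next
   assume "K = UNIV"
   have "v = 0" if "v \<in> X" for v
   proof (rule corthogonal_to_dense[of G])
    show "closure (span G) = UNIV" using \<open>K = UNIV\<close> by (simp add: K_def)
    show "cinner v g = 0" if "g \<in> G" for g
     using that words \<open>v \<in> X\<close> by (auto simp: G_def Z_def cinner_scaleC_right)
   qed
   then show ?thesis by auto
  qed
 qed
qed

end

section \<open>Commutants and modular theory\<close>

lemma commutant_bounded: "x \<in> commutant S ==> bounded_clinear x" by (simp add: commutant_def)

lemma commutant_commute: "x \<in> commutant S ==> y \<in> S ==> x (y v) = y (x v)"
 by (auto simp: commutant_def fun_eq_iff)

lemma commutantI: "bounded_clinear x ==> (!!y v. y \<in> S ==> x (y v) = y (x v)) ==> x \<in> commutant S"
 by (auto simp: commutant_def fun_eq_iff)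

lemma commutant_comp: "x \<in> commutant S ==> y \<in> commutant S ==> (%v. x (y v)) \<in> commutant S"
 by (rule commutantI) (auto intro: clinear_compose commutant_bounded simp: commutant_commute)

lemma commutant_add: 
 assumes "!!s. s \<in> S ==> bounded_clinear s" "x \<in> commutant S" "y \<in> commutant S"
 shows "(%v. x v + y v) \<in> commutant S"
 using assms by (intro commutantI clinear_plus) (auto intro: commutant_bounded simp: commutant_commute clinear_add)

lemma commutant_scale:
 assumes "!!s. s \<in> S ==> bounded_clinear s" "x \<in> commutant S"
 shows "(%v. c *C x v) \<in> commutant S"
 using assms by (intro commutantI clinear_cmul) (auto intro: commutant_bounded simp: commutant_commute clinear_scaleC)

lemma commutant_id: "(%v. v) \<in> commutant S" by (rule commutantI) (auto intro: clinear_id)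

lemma commutant_double: "(!!s. s \<in> S ==> bounded_clinear s) ==> S \<subseteq> commutant (commutant S)"
 by (auto intro!: commutantI simp: commutant_commute)

lemma commutant_antimono: "S \<subseteq> S' ==> commutant S' \<subseteq> commutant S" by (auto simp: commutant_def)

lemma commutant_triple:
 assumes "!!s. s \<in> S ==> bounded_clinear s"
 shows "commutant (commutant (commutant S)) = commutant S"
 using commutant_antimono[OF commutant_double[OF assms]] commutant_double[of "commutant S"] commutant_bounded by blast

lemma commutant_cadjoint:
 assumes S: "!!s. s \<in> S ==> bounded_clinear s" "!!s. s \<in> S ==> cadjoint s \<in> S" and x: "x \<in> commutant S"
 shows "cadjoint x \<in> commutant S"
proof (rule commutantI)
 note bx = commutant_bounded[OF x]
 show "bounded_clinear (cadjoint x)" by (rule clinear_cadjoint[OF bx])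
 fix s v
 assume s: "s \<in> S"
 show "cadjoint x (s v) = s (cadjoint x v)"
 proof (rule cinner_eqI_left)
  fix z
  have "cinner (cadjoint x (s v)) z = cinner v (cadjoint s (x z))"
   by (simp add: cinner_cadjoint_left[OF bx] cinner_cadjoint_right[OF S(1)[OF s]])
  also have "\<dots> = cinner v (x (cadjoint s z))" by (simp add: commutant_commute[OF x S(2)[OF s]])
  also have "\<dots> = cinner (s (cadjoint x v)) z"
   by (simp add: cinner_cadjoint_left[OF bx, symmetric] cinner_cadjoint_right[OF S(1)[OF s]])
  finally show "cinner (cadjoint x (s v)) z = cinner (s (cadjoint x v)) z" .
 qed
qed

text \<open>The counterpart of the criterion with A + \<i> and A - \<i> that suits the modular
  operator, for which 1 + A is onto by a projection argument.\<close>

lemma symmetric_self_adjoint_plus_one: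
 fixes A :: "('a::complex_hilbert \<times> 'a) set"
 assumes add: "!!x x' y y'. (x, x') \<in> A ==> (y, y') \<in> A ==> (x + y, x' + y') \<in> A"
  and scale: "!!c x y. (x, y) \<in> A ==> (c *C x, c *C y) \<in> A"
  and sym: "!!x x' y y'. (x, x') \<in> A ==> (y, y') \<in> A ==> cinner y x' = cinner y' x"
  and surj: "!!w. \<exists>x x'. (x, x') \<in> A \<and> x + x' = w" and zero: "!!v. (0, v) \<in> A ==> v = 0"
 shows "self_adjoint A"
proof -
 have "(y, z) \<in> A" if yz: "(y, z) \<in> graph_adjoint A" for y z
 proof -
  obtain x x' where x: "(x, x') \<in> A" "x + x' = y + z" using surj by blast
  have "y = x"
  proof (rule cinner_eqI_left)
   fix w
   obtain u u' where u: "(u, u') \<in> A" "u + u' = w" using surj by blast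
   have "cinner y u' = cinner z u" using yz u(1) by (auto simp: graph_adjoint_def)
   then have "cinner y w = cinner (x + x') u"
    using x(2) by (simp add: u(2)[symmetric] cinner_add_left cinner_add_right)
   also have "\<dots> = cinner x w"
    using sym[OF u(1) x(1)] by (simp add: u(2)[symmetric] cinner_add_left cinner_add_right)
   finally show "cinner y w = cinner x w" .
  qed
  then show ?thesis using x by simp
 qed
 moreover have "(y, z) \<in> graph_adjoint A" if "(y, z) \<in> A" for y z
  using sym[OF _ that] by (auto simp: graph_adjoint_def)
 moreover have "closure (Domain A) = UNIV"
 proof -
  obtain x0 x0' where x0: "(x0, x0') \<in> A" using surj by blast
  have sub: "csubspace (Domain A)" using scale[OF x0, of 0] add scale
   by (fastforce simp: csubspace_def subspace_def scaleR_scaleC)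
  have "v = 0" if v: "!!x. x \<in> Domain A ==> inner v x = 0" for v
  proof -
   obtain x x' where x: "(x, x') \<in> A" "x + x' = v" using surj by blast
   have "x = 0"
   proof (rule cinner_eqI_left)
    fix w
    obtain u u' where u: "(u, u') \<in> A" "u + u' = w" using surj by blast
    have "cinner v u = 0" using u(1) by (intro corthogonal_if_orthogonal[OF sub v]) auto
    then show "cinner x w = cinner 0 w"
     using sym[OF u(1) x(1)] by (simp add: x(2)[symmetric] u(2)[symmetric] cinner_add_left cinner_add_right cinner.zero_left)
   qed
   then show ?thesis using x zero by simp
  qed
  then have "closure (span (Domain A)) = UNIV" by (rule dense_if_orthogonal_trivial)
  then show ?thesis using sub by (metis csubspace_def span_eq_iff)
 qed
 ultimately show ?thesis by (auto simp: self_adjoint_def)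
qed

lemma (in pvm) commute_op_calc:
 assumes y: "bounded_clinear y" and op: "!!v v'. (v, v') \<in> op ==> (y v, y v') \<in> op" and f: "bdd_borel f"
 shows "y (calc f v) = calc f (y v)"
proof -
 have Q: "y (Q z) = Q (y z)" for z
 proof -
  have "(Q z, z - \<i> *C Q z) \<in> op" by (simp add: op_def)
  from op[OF this] obtain z' where z': "y (Q z) = Q z'" "y (z - \<i> *C Q z) = z' - \<i> *C Q z'"
   by (auto simp: op_def)
  then have "y z = z'" by (simp add: clinear_simps[OF y])
  then show ?thesis using z'(1) by simp
 qed
 have c: "y (calc cayley x) = calc cayley (y x)" for x by (simp add: calc_cayley clinear_simps[OF y] Q)
 have "y (calc (%s. cnj (cayley s)) x) = calc (%s. cnj (cayley s)) (y x)" for x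
  using c[of "calc (%s. cnj (cayley s)) x"] by (metis calc_cayley_inverse)
 with c show ?thesis by (intro calc_intertwine[OF pvm_axioms pvm_axioms y _ _ f])
qed

section \<open>The Tomita operator of a cyclic and separating vector\<close>

locale modular =
 fixes M :: "('f::complex_hilbert \<Rightarrow> 'f) set" and w :: 'f
 assumes M_double: "commutant (commutant M) = M" and M_cadjoint: "!!x. x \<in> M ==> cadjoint x \<in> M"
  and M_cyclic: "closure (span {x w | x. x \<in> M}) = UNIV"
  and M'_cyclic: "closure (span {x w | x. x \<in> commutant M}) = UNIV"
begin

lemma M_bounded: "x \<in> M ==> bounded_clinear x" using M_double commutant_bounded by blast

lemma M'_bounded: "x \<in> commutant M ==> bounded_clinear x" by (rule commutant_bounded)

lemma M_comp: "x \<in> M ==> y \<in> M ==> (%v. x (y v)) \<in> M"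
 using commutant_comp[of x "commutant M" y] by (simp add: M_double)

lemma M_add: "x \<in> M ==> y \<in> M ==> (%v. x v + y v) \<in> M"
 using commutant_add[of "commutant M" x y] M'_bounded by (simp add: M_double)

lemma M_scale: "x \<in> M ==> (%v. c *C x v) \<in> M"
 using commutant_scale[of "commutant M" x c] M'_bounded by (simp add: M_double)

lemma M_id: "(%v. v) \<in> M" using commutant_id[of "commutant M"] by (simp add: M_double)

lemma M_M': "x \<in> M ==> y \<in> commutant M ==> x (y v) = y (x v)" using commutant_commute[of y M x v] by simp

text \<open>Elements of the commutant carry the eigenvalue equation from w to a dense set of
  vectors.\<close>

lemma separating:
 assumes x: "x \<in> M" "x w = c *C w"
 shows "x = (%v. c *C v)"
proof (rule clinear_eq_on_dense[OF M_bounded[OF x(1)] _ M'_cyclic])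
 fix v
 assume "v \<in> {x w | x. x \<in> commutant M}"
 then obtain y where y: "v = y w" "y \<in> commutant M" by blast
 then show "x v = c *C v" using x M_M'[OF x(1) y(2)] by (simp add: clinear_scaleC[OF M'_bounded])
qed (intro clinear_cmul clinear_id)

definition S0 where "S0 = {(x w, cadjoint x w) | x. x \<in> M}"

lemma S0_I: "x \<in> M ==> p = (x w, cadjoint x w) ==> p \<in> S0" by (auto simp: S0_def)

definition S where "S = closure S0"

lemma S_eq: "tomita_operator M w = S" by (simp add: tomita_operator_def S_def S0_def)

text \<open>Continuity reduces claims about the closed graph to its generating pairs; the two
  coordinates may be moved by different operators.\<close>

lemma S_map:
 assumes "bounded_linear A" "bounded_linear B" "!!x. x \<in> M ==> (A (x w), B (cadjoint x w)) \<in> S" "(v, v') \<in> S"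
 shows "(A v, B v') \<in> S"
proof -
 have "(%p. (A (fst p), B (snd p))) ` closure S0 \<subseteq> S"
 proof (rule image_closure_subset)
  show "continuous_on (closure S0) (%p. (A (fst p), B (snd p)))"
   by (intro continuous_intros bounded_linear.continuous_on[OF assms(1)] bounded_linear.continuous_on[OF assms(2)])
 qed (use assms(3) in \<open>auto simp: S_def S0_def\<close>)
 then show ?thesis using assms(4) by (force simp: S_def)
qed

lemma S_I: "x \<in> M ==> (x w, cadjoint x w) \<in> S"
 unfolding S_def S0_def by (rule subsetD[OF closure_subset]) blast

lemma S_scale: "(v, v') \<in> S ==> (c *C v, cnj c *C v') \<in> S"
proof (rule S_map[OF scaleC.bounded_linear_right scaleC.bounded_linear_right])
 fix x
 assume x: "x \<in> M"
 have "cadjoint (%v. c *C x v) = (%v. cnj c *C cadjoint x v)"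
  by (rule cadjoint_unique) (auto intro: clinear_cmul clinear_cadjoint M_bounded x
    simp: cinner_scaleC_left cinner_scaleC_right cinner_cadjoint_left[OF M_bounded[OF x]])
 then show "(c *C x w, cnj c *C cadjoint x w) \<in> S" using S_I[OF M_scale[OF x, of c]] by simp
qed

lemma S_subspace: "subspace S" unfolding S_def
proof (rule subspace_closure, rule subspaceI)
 have adj0: "cadjoint (%v. 0 :: 'f) = (%v. 0)"
  by (rule cadjoint_unique) (auto intro: clinear_const_zero simp: cinner.zero_left cinner.zero_right)
 show "0 \<in> S0" using M_scale[OF M_id, of 0] adj0 by (force simp: S0_def zero_prod_def)
 show "p + p' \<in> S0" if p: "p \<in> S0" "p' \<in> S0" for p p'
 proof -
  obtain x y where xy: "p = (x w, cadjoint x w)" "x \<in> M" "p' = (y w, cadjoint y w)" "y \<in> M"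
   using p by (auto simp: S0_def)
  have "cadjoint (%v. x v + y v) = (%v. cadjoint x v + cadjoint y v)"
   by (rule cadjoint_unique) (auto intro: clinear_plus clinear_cadjoint M_bounded xy
     simp: cinner_add_left cinner_add_right cinner_cadjoint_left[OF M_bounded[OF xy(2)]] cinner_cadjoint_left[OF M_bounded[OF xy(4)]])
  then show ?thesis by (intro S0_I[OF M_add[OF xy(2,4)]]) (simp add: xy)
 qed
 show "r *\<^sub>R p \<in> S0" if p: "p \<in> S0" for r p
 proof -
  obtain x where x: "p = (x w, cadjoint x w)" "x \<in> M" using p by (auto simp: S0_def)
  have "cadjoint (%v. of_real r *C x v) = (%v. of_real r *C cadjoint x v)"
   by (rule cadjoint_unique) (auto intro: clinear_cmul clinear_cadjoint M_bounded x
     simp: cinner_scaleC_left cinner_scaleC_right cinner_cadjoint_left[OF M_bounded[OF x(2)]])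
  then show ?thesis by (intro S0_I[OF M_scale[OF x(2), of "of_real r"]]) (simp add: x scaleC_of_real)
 qed
qed

lemma S_swap: "(v, v') \<in> S ==> (v', v) \<in> S"
proof -
 assume v: "(v, v') \<in> S"
 have "prod.swap ` closure S0 \<subseteq> S"
 proof (rule image_closure_subset)
  show "prod.swap ` S0 \<subseteq> S"
   using S_I[OF M_cadjoint] by (auto simp: S0_def cadjoint_cadjoint[OF M_bounded])
 qed (auto simp: S_def prod.swap_def intro!: continuous_intros)
 then show ?thesis using v by (force simp: S_def)
qed

lemma M'_cadjoint: "y \<in> commutant M ==> cadjoint y \<in> commutant M"
 using M_cadjoint M_bounded by (intro commutant_cadjoint)

text \<open>The relation <x* w, y w> = <y* w, x w> for commuting x and y passes to the closure. As
  the vectors y w are dense, it forces the closed graph to be single-valued.\<close>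

lemma S_commutant:
 assumes v: "(v, v') \<in> S" and y: "y \<in> commutant M"
 shows "cinner v' (y w) = cinner (cadjoint y w) v"
proof -
 have "closed {p. cinner (snd p) (y w) = cinner (cadjoint y w) (fst p)}"
  by (intro closed_Collect_eq continuous_intros bounded_linear.continuous_on[OF cinner.bounded_linear_left]
    bounded_linear.continuous_on[OF cinner.bounded_linear_right])
 moreover have "S0 \<subseteq> {p. cinner (snd p) (y w) = cinner (cadjoint y w) (fst p)}"
  using y by (auto simp: S0_def cinner_cadjoint_left[OF M'_bounded[OF y]] cinner_cadjoint_left[OF M_bounded] M_M'[OF _ y, symmetric])
 ultimately have "S \<subseteq> {p. cinner (snd p) (y w) = cinner (cadjoint y w) (fst p)}"
  unfolding S_def by (rule closure_minimal[rotated])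
 then show ?thesis using v by auto
qed

lemma S_zero: "(0, v) \<in> S ==> v = 0"
 using S_commutant[of 0 v] by (intro corthogonal_to_dense[OF M'_cyclic]) (auto simp: cinner.zero_right)

abbreviation Delta where "Delta \<equiv> modular_operator M w"

lemma Delta_iff: "(v, u) \<in> Delta \<longleftrightarrow> (\<exists>v'. (v, v') \<in> S \<and> (\<forall>x x'. (x, x') \<in> S \<longrightarrow> cinner v' x' = cinner x u))"
 by (auto simp: modular_operator_def S_eq graph_antiadjoint_def)

text \<open>The form of S* S at v is the squared norm of S v. Self-adjointness is von Neumann's
  theorem for a closed operator, and a kernel is excluded because S is its own inverse.\<close>

lemma Delta_positive_nonsingular: "positive_nonsingular Delta"
proof -
 note closed = closed_closure[of S0, folded S_def]
 have sym: "cinner y x' = cinner y' x" if "(x, x') \<in> Delta" "(y, y') \<in> Delta" for x x' y y'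
 proof -
  obtain u where u: "(x, u) \<in> S" "!!z z'. (z, z') \<in> S ==> cinner u z' = cinner z x'"
   using \<open>(x, x') \<in> Delta\<close> by (auto simp: Delta_iff)
  obtain v where v: "(y, v) \<in> S" "!!z z'. (z, z') \<in> S ==> cinner v z' = cinner z y'"
   using \<open>(y, y') \<in> Delta\<close> by (auto simp: Delta_iff)
  show ?thesis using u(2)[OF v(1)] v(2)[OF u(1)] by (metis cinner_commute)
 qed
 have form: "\<exists>v'. (v, v') \<in> S \<and> cinner v u = cinner v' v'" if "(v, u) \<in> Delta" for v u
  using that by (fastforce simp: Delta_iff)
 have "self_adjoint Delta"
 proof (rule symmetric_self_adjoint_plus_one)
  show "(x + y, x' + y') \<in> Delta" if xy: "(x, x') \<in> Delta" "(y, y') \<in> Delta" for x x' y y'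
  proof -
   obtain u v where "(x, u) \<in> S" "\<forall>z z'. (z, z') \<in> S \<longrightarrow> cinner u z' = cinner z x'"
    "(y, v) \<in> S" "\<forall>z z'. (z, z') \<in> S \<longrightarrow> cinner v z' = cinner z y'" using xy unfolding Delta_iff by blast
   then show ?thesis using subspace_add[OF S_subspace, of "(x, u)" "(y, v)"]
    by (auto simp: Delta_iff cinner_add_left cinner_add_right intro!: exI[of _ "u + v"])
  qed
  show "(c *C x, c *C x') \<in> Delta" if x: "(x, x') \<in> Delta" for c x x'
  proof -
   obtain u where "(x, u) \<in> S" "\<forall>z z'. (z, z') \<in> S \<longrightarrow> cinner u z' = cinner z x'"
    using x unfolding Delta_iff by blast
   then show ?thesis
    using S_scale[of x u c] by (auto simp: Delta_iff cinner_scaleC_left cinner_scaleC_right intro!: exI[of _ "cnj c *C u"])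
  qed
  show "\<exists>x x'. (x, x') \<in> Delta \<and> x + x' = z" for z
  proof -
   \<comment> \<open>Projecting (z, 0) onto the graph of S yields v with v' = S v; orthogonality of
     the remainder will say that z - v is the modular operator applied to v.\<close>
   obtain p where p: "p \<in> S" "!!s. s \<in> S ==> inner ((z, 0) - p) s = 0"
    using projection_exists[OF closed S_subspace] by blast
   obtain v v' where v: "p = (v, v')" by (cases p)
   have re: "Re (cinner (z - v) x) = Re (cinner v' x')" if "(x, x') \<in> S" for x x'
    using p(2)[OF that] by (simp add: v inner_prod_def Re_cinner)
   have "cinner v' x' = cinner x (z - v)" if x: "(x, x') \<in> S" for x x'
   proof -
    \<comment> \<open>S is antilinear: replacing x by \<i> x multiplies x' by -\<i>, whence the
      conjugate in the identity that follows.\<close>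
    have "Im (cinner (z - v) x) = - Im (cinner v' x')"
     using re[OF S_scale[OF x, of \<i>]] by (simp add: cinner_scaleC_right cinner.minus_right)
    then have "cinner v' x' = cnj (cinner (z - v) x)" using re[OF x] by (simp add: complex_eq_iff)
    then show ?thesis by (metis cinner_commute)
   qed
   then have "(v, z - v) \<in> Delta" using p(1) v by (auto simp: Delta_iff)
   then show ?thesis by (intro exI[of _ v] exI[of _ "z - v"]) simp
  qed
  show "v = 0" if v0: "(0, v) \<in> Delta" for v
  proof -
   obtain v' where v': "(0, v') \<in> S" "\<forall>x x'. (x, x') \<in> S \<longrightarrow> cinner v' x' = cinner x v"
    using v0 unfolding Delta_iff by blast
   have "cinner v (x w) = 0" if "x \<in> M" for x
    using v' S_zero S_I[OF that] cinner_commute[of v "x w"] by (fastforce simp: cinner.zero_left)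
   then show ?thesis by (intro corthogonal_to_dense[OF M_cyclic]) auto
  qed
 qed (rule sym)
 moreover have "cinner v u \<in> \<real> \<and> 0 \<le> Re (cinner v u)" if "(v, u) \<in> Delta" for v u
  using form[OF that] by (auto simp: cinner_self)
 moreover have "v = 0" if v0: "(v, 0) \<in> Delta" for v
 proof -
  obtain v' where "(v, v') \<in> S" "cinner v' v' = 0" using form[OF v0] by (auto simp: cinner.zero_right)
  then show ?thesis using S_swap S_zero by (auto simp: cinner_self)
 qed
 ultimately show ?thesis by (auto simp: positive_nonsingular_def)
qed

abbreviation W where "W \<equiv> imaginary_power Delta"

lemma W_properties:
 obtains E where "pvm E" "pvm.op E = Delta" "!!t. W t = pvm.calc E (%s. character t (ln s))"
 using positive_nonsingular_pvm[OF Delta_positive_nonsingular] imaginary_power_op by metis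

lemma W_bounded: "bounded_clinear (W t)" and W_inverse: "W t (W (- t) v) = v" and W_cadjoint: "cadjoint (W t) = W (- t)"
proof -
 obtain E where pvm: "pvm E" and E: "!!t. W t = pvm.calc E (%s. character t (ln s))"
  using W_properties by blast
 note W = E
 interpret pvm E by (rule pvm)
 show b: "bounded_clinear (W t)" for t by (simp add: W bounded_calc bdd_borel_character_ln)
 show "W t (W (- t) v) = v"
  using calc_mult[OF bdd_borel_character_ln bdd_borel_character_ln, of t "- t" v] calc_const[of 1 v]
   character_inverse[of "- t"] by (simp add: W)
 show "cadjoint (W t) = W (- t)"
 proof (rule cadjoint_unique[OF b])
  show "cinner (W (- t) x) y = cinner x (W t y)" for x y
   using calc_adj[OF bdd_borel_character_ln, of "- t" x y] by (simp add: W character_cnj)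
 qed
qed

lemma centralizer_iff: "x \<in> centralizer M w \<longleftrightarrow> x \<in> M \<and> (\<forall>t v. x (W t v) = W t (x v))"
proof -
 have "modular_automorphism M w t x = x \<longleftrightarrow> (\<forall>v. x (W t v) = W t (x v))" for t
 proof -
  have "modular_automorphism M w t x = x \<longleftrightarrow> (\<forall>v. W t (x (W (- t) v)) = x v)"
   by (auto simp: modular_automorphism_def fun_eq_iff)
  also have "\<dots> \<longleftrightarrow> (\<forall>v. x (W t v) = W t (x v))"
   using W_inverse[of t] W_inverse[of "- t"] by (metis minus_minus)
  finally show ?thesis .
 qed
 then show ?thesis by (auto simp: centralizer_def)
qed

text \<open>As the commutant of an adjoint-closed set the centralizer is visibly a von Neumann
  algebra.\<close>

lemma centralizer_commutant: "centralizer M w = commutant (commutant M \<union> range W)"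
proof -
 have "x \<in> centralizer M w \<longleftrightarrow> x \<in> M \<and> x \<in> commutant (range W)" for x
  using M_bounded[of x] by (auto simp: centralizer_iff commutant_def fun_eq_iff)
 moreover have "commutant (A \<union> B) = commutant A \<inter> commutant B" for A B :: "('f \<Rightarrow> 'f) set"
  by (auto simp: commutant_def)
 ultimately show ?thesis by (simp add: M_double set_eq_iff)
qed

lemma von_neumann_algebra_centralizer: "von_neumann_algebra (centralizer M w)"
proof -
 have b: "bounded_clinear s" if "s \<in> commutant M \<union> range W" for s using that M'_bounded W_bounded by auto
 have "cadjoint s \<in> commutant M \<union> range W" if "s \<in> commutant M \<union> range W" for s
  using that M'_cadjoint W_cadjoint by auto
 then show ?thesis unfolding von_neumann_algebra_def centralizer_commutant
  using commutant_cadjoint[of "commutant M \<union> range W", OF b] commutant_triple[of "commutant M \<union> range W", OF b] by auto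
qed

text \<open>Since y and z agree at w, S y = z S on the core: S (y x w) = x* y w = x* z w = z x* w.
  Self-adjointness of both transfers this to the adjoint of S, so y commutes with S* S and with its
  imaginary powers.\<close>

lemma centralizerI:
 assumes y: "y \<in> M" "cadjoint y = y" and z: "z \<in> commutant M" "cadjoint z = z" and eq: "y w = z w"
 shows "y \<in> centralizer M w"
proof -
 note bY = M_bounded[OF y(1)] and bz = M'_bounded[OF z(1)]
 have yz: "(y v, z v') \<in> S" if "(v, v') \<in> S" for v v'
 proof (rule S_map[OF clinear_boundedD[OF bY] clinear_boundedD[OF bz] _ that])
  fix x
  assume x: "x \<in> M"
  have "cadjoint (y \<circ> x) w = z (cadjoint x w)"
   using M_M'[OF M_cadjoint[OF x] z(1)] by (simp add: cadjoint_comp bY M_bounded[OF x] y(2) eq)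
  then show "(y (x w), z (cadjoint x w)) \<in> S" using S_I[OF M_comp[OF y(1) x]] by (simp add: o_def)
 qed
 have "(y v, y u) \<in> Delta" if "(v, u) \<in> Delta" for v u
 proof -
  obtain v' where v': "(v, v') \<in> S" "!!x x'. (x, x') \<in> S ==> cinner v' x' = cinner x u"
   using \<open>(v, u) \<in> Delta\<close> by (auto simp: Delta_iff)
  have "cinner (z v') x' = cinner x (y u)" if "(x, x') \<in> S" for x x'
   using v'(2)[OF yz[OF that]] cinner_cadjoint_left[OF bz, of v' x'] cinner_cadjoint_right[OF bY, of x u] y(2) z(2)
   by simp
  then show ?thesis using yz[OF v'(1)] by (auto simp: Delta_iff)
 qed
 note op = this
 obtain E where E: "pvm E" "pvm.op E = Delta" "!!t. W t = pvm.calc E (%s. character t (ln s))"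
  by (rule W_properties) (rule that)
 have "y (W t v) = W t (y v)" for t v
  using pvm.commute_op_calc[OF E(1) bY _ bdd_borel_character_ln] op by (simp add: E)
 then show ?thesis using y(1) by (simp add: centralizer_iff)
qed

end

section \<open>Wiener's lemma\<close>

lemma cesaro_geometric:
 fixes z :: complex
 assumes "cmod z = 1" "z \<noteq> 1"
 shows "(%N. (\<Sum>n<N. z ^ n) / of_nat N) ----> 0"
proof (rule Lim_null_comparison[OF always_eventually[OF allI]])
 have "cmod (\<Sum>n<N. z ^ n) \<le> 2 / cmod (1 - z)" for N
 proof -
  have "cmod (\<Sum>n<N. z ^ n) = cmod (1 - z ^ N) / cmod (1 - z)"
   using assms(2) by (simp add: sum_gp_strict norm_divide)
  also have "\<dots> \<le> 2 / cmod (1 - z)"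
   using norm_triangle_ineq4[of 1 "z ^ N"] assms(1) by (intro divide_right_mono) (auto simp: norm_power)
  finally show ?thesis .
 qed
 then show "norm ((\<Sum>n<N. z ^ n) / of_nat N) \<le> 2 / cmod (1 - z) * inverse (of_nat N)" for N
  by (simp add: divide_inverse norm_mult norm_inverse mult_right_mono)
 show "(%N. 2 / cmod (1 - z) * inverse (of_nat N)) ----> 0"
  by (rule tendsto_mult_right_zero[OF lim_inverse_n])
qed

text \<open>The average of the squared moments is a double integral of the Cesaro kernel at \<phi> s
  times the conjugate of \<phi> t, which tends to 0 unless the two values agree. As no value has
  positive mass, dominated convergence applies in s for fixed t, and then in t.\<close>

lemma wiener_measure:
 fixes \<mu> :: "real measure" and \<phi> :: "real \<Rightarrow> complex"
 assumes fin: "finite_measure \<mu>" and sets: "sets \<mu> = sets borel"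
  and \<phi>: "\<phi> \<in> borel_measurable borel" "!!s. cmod (\<phi> s) = 1"
  and null: "!!w. AE s in \<mu>. \<phi> s \<noteq> w"
 shows "(%N. (\<Sum>n<N. (cmod (\<integral>s. \<phi> s ^ n \<partial>\<mu>))\<^sup>2) / real N) ----> 0"
proof -
 note [measurable] = \<phi>(1)
 note [measurable_cong] = sets
 have int: "integrable \<mu> g" if "g \<in> borel_measurable borel" "!!s. cmod (g s) \<le> K" for g :: "real \<Rightarrow> complex" and K
  using that sets by (intro finite_measure.integrable_const_bound[OF fin, where B = K]) (auto simp: measurable_cong_sets[OF sets refl])
 define m where "m n = (\<integral>s. \<phi> s ^ n \<partial>\<mu>)" for n
 define k where "k N z = (\<Sum>n<N. z ^ n) / of_nat N" for N and z :: complex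
 have k_le: "cmod (k N z) \<le> 1" if "cmod z = 1" for N z
 proof (cases "N = 0")
  case False
  have "cmod (\<Sum>n<N. z ^ n) \<le> (\<Sum>n<N. 1)" using that by (intro sum_norm_le) (simp add: norm_power)
  then show ?thesis using False by (simp add: k_def norm_divide)
 qed (simp add: k_def)
 define g where "g N t = (\<Sum>n<N. m n * cnj (\<phi> t) ^ n) / of_nat N" for N t
 have cnj_meas [measurable]: "(%t. cnj (\<phi> t)) \<in> borel_measurable borel"
  by (rule measurable_compose[OF \<phi>(1)]) (intro borel_measurable_continuous_onI continuous_intros)
 have g_eq: "g N t = (\<integral>s. k N (\<phi> s * cnj (\<phi> t)) \<partial>\<mu>)" for N t
 proof -
  have "(\<integral>s. k N (\<phi> s * cnj (\<phi> t)) \<partial>\<mu>) = (\<integral>s. (\<Sum>n<N. \<phi> s ^ n * cnj (\<phi> t) ^ n) \<partial>\<mu>) / of_nat N"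
   by (simp add: k_def power_mult_distrib)
  also have "(\<integral>s. (\<Sum>n<N. \<phi> s ^ n * cnj (\<phi> t) ^ n) \<partial>\<mu>) = (\<Sum>n<N. m n * cnj (\<phi> t) ^ n)"
   unfolding m_def by (subst Bochner_Integration.integral_sum)
    (auto intro!: integrable_mult_left int[where K = 1] simp: norm_power \<phi>(2))
  finally show ?thesis by (simp add: g_def)
 qed
 have g_lim: "(%N. g N t) ----> 0" for t
 proof -
  have "(%N. \<integral>s. k N (\<phi> s * cnj (\<phi> t)) \<partial>\<mu>) ----> (\<integral>s. 0 \<partial>\<mu>)"
  proof (rule integral_dominated_convergence[where w = "%_. 1"])
   show "AE s in \<mu>. (%N. k N (\<phi> s * cnj (\<phi> t))) ----> 0" using null[of "\<phi> t"]
   proof eventually_elim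
    case (elim s)
    have "cnj (\<phi> t) * \<phi> t = 1" by (metis \<phi>(2) complex_norm_square mult.commute of_real_1 power_one)
    then have "\<phi> s * cnj (\<phi> t) \<noteq> 1" using elim by (metis mult.assoc mult.right_neutral mult_1)
    then show ?case unfolding k_def using \<phi>(2) by (intro cesaro_geometric) (auto simp: norm_mult)
   qed
   show "AE s in \<mu>. norm (k N (\<phi> s * cnj (\<phi> t))) \<le> 1" for N using k_le \<phi>(2) by (simp add: norm_mult)
   show "integrable \<mu> (%_. 1 :: real)" by (rule finite_measure.integrable_const[OF fin])
  qed (auto simp: k_def)
  then show ?thesis by (simp add: g_eq)
 qed
 have g_bound: "cmod (g N t) \<le> measure \<mu> UNIV" for N t
 proof -
  have "cmod (\<integral>s. k N (\<phi> s * cnj (\<phi> t)) \<partial>\<mu>) \<le> (\<integral>s. 1 \<partial>\<mu>)"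
   using k_le \<phi>(2) by (intro Bochner_Integration.integral_norm_bound_integral int[where K = 1]
     finite_measure.integrable_const[OF fin]) (auto simp: norm_mult k_def)
  then show ?thesis using sets_eq_imp_space_eq[OF sets] by (simp add: g_eq)
 qed
 have meas_g: "g N \<in> borel_measurable borel" for N unfolding g_def by measurable
 have "(%N. \<integral>t. g N t \<partial>\<mu>) ----> (\<integral>t. 0 \<partial>\<mu>)" using meas_g g_lim g_bound
  by (intro integral_dominated_convergence[where w = "%_. measure \<mu> UNIV"] finite_measure.integrable_const[OF fin])
   (auto simp: measurable_cong_sets[OF sets refl])
 moreover have "(\<integral>t. g N t \<partial>\<mu>) = complex_of_real ((\<Sum>n<N. (cmod (m n))\<^sup>2) / real N)" for N
 proof -
  have cnj: "(\<integral>t. cnj (\<phi> t) ^ n \<partial>\<mu>) = cnj (m n)" for n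
   unfolding m_def Bochner_Integration.integral_cnj[symmetric] by simp
  have "(\<integral>t. g N t \<partial>\<mu>) = (\<Sum>n<N. m n * (\<integral>t. cnj (\<phi> t) ^ n \<partial>\<mu>)) / of_nat N"
   unfolding g_def by (simp, subst Bochner_Integration.integral_sum)
    (auto intro!: integrable_mult_right int[where K = 1] simp: norm_power \<phi>(2))
  then show ?thesis by (simp add: cnj complex_norm_square del: of_real_power)
 qed
 ultimately show ?thesis unfolding m_def[symmetric] using tendsto_Re by fastforce
qed

context pvm
begin

text \<open>Once the averages, summed over the finitely many vectors, drop below
  \<open>e\<^sup>2\<close>, a single index has all squares below it.\<close>

lemma wiener_diagonal:
 assumes F: "finite F" and e: "0 < e" and \<phi>: "bdd_borel \<phi>" "!!s. cmod (\<phi> s) = 1"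
  and null: "!!x w. x \<in> F ==> E {s. \<phi> s = w} x = 0"
 shows "\<exists>n. \<forall>x\<in>F. cmod (cinner x (calc (%s. \<phi> s ^ n) x)) < e"
proof -
 have pow: "bdd_borel (%s. \<phi> s ^ n)" for n by (induction n) (simp_all add: \<phi>)
 define a where "a x n = (cmod (cinner x (calc (%s. \<phi> s ^ n) x)))\<^sup>2" for x n
 have "(%N. (\<Sum>n<N. a x n) / real N) ----> 0" if x: "x \<in> F" for x unfolding a_def cinner_calc[OF pow]
 proof (rule wiener_measure[OF finite_sd _ bdd_borel_measurable[OF \<phi>(1)] \<phi>(2)])
  fix w
  have "{s. \<phi> s = w} = \<phi> -` {w} \<inter> space borel" by auto
  also have "\<dots> \<in> sets borel" using bdd_borel_measurable[OF \<phi>(1)] by (rule measurable_sets) simp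
  finally have "- {s. \<phi> s = w} \<in> sets borel" by auto
  from AE_sd_iff[OF this, of x] show "AE s in sd x. \<phi> s \<noteq> w" using null[OF x] by simp
 qed simp
 then have "(%N. \<Sum>x\<in>F. (\<Sum>n<N. a x n) / real N) ----> (\<Sum>x\<in>F. 0)" by (intro tendsto_sum)
 then have "\<forall>\<^sub>F N in sequentially. (\<Sum>x\<in>F. (\<Sum>n<N. a x n) / real N) < e\<^sup>2"
  using e by (intro order_tendstoD) auto
 then obtain M where M: "!!N. N \<ge> M ==> (\<Sum>x\<in>F. (\<Sum>n<N. a x n) / real N) < e\<^sup>2"
  by (auto simp: eventually_sequentially)
 define N where "N = Suc M"
 have "(\<Sum>n<N. \<Sum>x\<in>F. a x n) = (\<Sum>x\<in>F. (\<Sum>n<N. a x n) / real N) * real N"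
  unfolding sum.swap[of "%n x. a x n"] by (simp add: N_def sum_distrib_right)
 also have "\<dots> < e\<^sup>2 * real N" using M[of N] by (intro mult_strict_right_mono) (auto simp: N_def)
 finally have sum: "(\<Sum>n<N. \<Sum>x\<in>F. a x n) < (\<Sum>n<N. e\<^sup>2)" by (simp add: mult.commute)
 have "\<exists>n<N. (\<Sum>x\<in>F. a x n) < e\<^sup>2"
 proof (rule ccontr)
  assume "\<not> ?thesis"
  then have "e\<^sup>2 \<le> (\<Sum>x\<in>F. a x n)" if "n < N" for n using that by (meson linorder_not_less)
  then have "(\<Sum>n<N. e\<^sup>2) \<le> (\<Sum>n<N. \<Sum>x\<in>F. a x n)" by (intro sum_mono) simp
  then show False using sum by simp
 qed
 then obtain n where n: "(\<Sum>x\<in>F. a x n) < e\<^sup>2" by blast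
 have "cmod (cinner x (calc (%s. \<phi> s ^ n) x)) < e" if "x \<in> F" for x
 proof -
  have "a x n \<le> (\<Sum>x\<in>F. a x n)" using F that by (intro member_le_sum) (auto simp: a_def)
  then have "(cmod (cinner x (calc (%s. \<phi> s ^ n) x)))\<^sup>2 < e\<^sup>2" using n by (simp add: a_def)
  then show ?thesis using e by (simp add: power_less_imp_less_base)
 qed
 then show ?thesis by blast
qed

text \<open>Polarization: the diagonal statement is applied to the finitely many vectors y + c x
  with c a fourth root of unity, which have no atoms either.\<close>

lemma wiener:
 assumes F: "finite F" and e: "0 < e" and \<phi>: "bdd_borel \<phi>" "!!s. cmod (\<phi> s) = 1"
  and null: "!!x w. x \<in> F ==> E {s. \<phi> s = w} x = 0"
 shows "\<exists>n. \<forall>x\<in>F. \<forall>y\<in>F. cmod (cinner y (calc (%s. \<phi> s ^ n) x)) < e"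
proof -
 let ?C = "{1, - 1, \<i>, - \<i>} :: complex set"
 define G where "G = (%(x, y, c). y + c *C x) ` (F \<times> F \<times> ?C)"
 have E_bounded: "bounded_clinear (E {s. \<phi> s = w})" for w
 proof (rule pvm_bounded[OF E])
  have "{s. \<phi> s = w} = \<phi> -` {w} \<inter> space borel" by auto
  then show "{s. \<phi> s = w} \<in> sets borel"
   using measurable_sets[OF bdd_borel_measurable[OF \<phi>(1)], of "{w}"] by simp
 qed
 have "\<exists>n. \<forall>u\<in>G. cmod (cinner u (calc (%s. \<phi> s ^ n) u)) < e"
 proof (rule wiener_diagonal[OF _ e \<phi>])
  show "finite G" using F by (simp add: G_def)
  show "E {s. \<phi> s = w} x = 0" if "x \<in> G" for x w
   using that null by (auto simp: G_def clinear_simps[OF E_bounded])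
 qed
 then obtain n where n: "!!u. u \<in> G ==> cmod (cinner u (calc (%s. \<phi> s ^ n) u)) < e" by blast
 define A where "A = calc (%s. \<phi> s ^ n)"
 have "bdd_borel (%s. \<phi> s ^ n)" by (induction n) (simp_all add: \<phi>)
 then have A: "bounded_clinear A" by (simp add: A_def bounded_calc)
 have "cmod (cinner y (A x)) < e" if xy: "x \<in> F" "y \<in> F" for x y
 proof -
  define Q where "Q c = cinner (y + c *C x) (A (y + c *C x))" for c
  have Q: "cmod (Q c) < e" if "c \<in> ?C" for c
   unfolding Q_def A_def using that xy by (intro n) (auto simp: G_def intro!: rev_image_eqI[of "(x, y, c)"])
  have "4 * cinner y (A x) = Q 1 - Q (- 1) - \<i> * Q \<i> + \<i> * Q (- \<i>)"
   by (simp add: Q_def clinear_simps[OF A] cinner_add_left cinner_add_right cinner_scaleC_left cinner_scaleC_right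
     cinner.diff_left cinner.diff_right algebra_simps)
  then have "4 * cmod (cinner y (A x)) = cmod (Q 1 - Q (- 1) - \<i> * Q \<i> + \<i> * Q (- \<i>))"
   by (metis norm_mult norm_numeral)
  also have "\<dots> \<le> cmod (Q 1) + cmod (Q (- 1)) + cmod (\<i> * Q \<i>) + cmod (\<i> * Q (- \<i>))"
   by (meson add_mono norm_triangle_ineq norm_triangle_ineq4 order_refl order_trans)
  also have "\<dots> < 4 * e" using Q[of 1] Q[of "- 1"] Q[of \<i>] Q[of "- \<i>"] by (simp add: norm_mult)
  finally show ?thesis by simp
 qed
 then show ?thesis unfolding A_def by blast
qed

lemma E_point_op: "(E {s} v, of_real s *C E {s} v) \<in> op"
proof -
 define z where "z = (of_real s + \<i>) *C E {s} v"
 have "Q (E {s} v) = calc (%r. resolvent_fun r * indicator {s} r) v"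
  using E_calc_commute[of "{s}" resolvent_fun v] by simp
 also have "(%r. resolvent_fun r * indicator {s} r) = (%r. resolvent_fun s * indicator {s} r)"
  by (auto simp: indicator_def)
 also have "calc (%r. resolvent_fun s * indicator {s} r) v = resolvent_fun s *C E {s} v"
  by (subst calc_cmul) (auto simp: calc_indicator)
 finally have "Q z = E {s} v"
  using resolvent_fun_mult[of s] by (simp add: z_def clinear_scaleC[OF bounded_calc] scaleC_scaleC mult.commute)
 then have "(E {s} v, z - \<i> *C E {s} v) \<in> op" unfolding op_def by (intro image_eqI[of _ _ z]) simp_all
 then show ?thesis by (simp add: z_def scaleC_add_left)
qed

end

lemma self_adjoint_graph:
 assumes y: "bounded_clinear y" and sym: "!!u v. cinner (y u) v = cinner u (y v)"
 shows "self_adjoint (range (%v. (v, y v)))"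
proof -
 have "y a = b" if "!!x. cinner a (y x) = cinner b x" for a b
  using that sym[of a] by (intro cinner_eqI_left) simp
 then have "graph_adjoint (range (%v. (v, y v))) = range (%v. (v, y v))"
  using sym by (auto simp: graph_adjoint_def image_iff)
 moreover have "Domain (range (%v. (v, y v))) = UNIV" by auto
 ultimately show ?thesis by (simp add: self_adjoint_def)
qed

section \<open>The q-Araki-Woods algebra\<close>

locale araki_woods = orthogonal_flow U + q_fock q tens
 for U :: "real \<Rightarrow> 'a::{real_inner, complete_space} \<Rightarrow> 'a" and q :: real
  and tens :: "'h::complex_hilbert list \<Rightarrow> 'f::complex_hilbert" +
 fixes j :: "'a complexification \<Rightarrow> 'h"
 assumes completion: "U_completion U j"
begin

lemma j_lin: "j (x + y) = j x + j y" "j (c *C x) = c *C j x" "j (x - y) = j x - j y" "j 0 = 0"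
 using completion by (auto simp: U_completion_def clinear_def linear_add linear_diff linear_0)

lemma j_cinner: "cinner (j x) (j y) = cinner (T x) y"
 using completion by (simp add: U_completion_def U_inner_T)

lemma j_dense: "closure (range j) = UNIV" using completion by (simp add: U_completion_def)

lemma j_bounded: "bounded_linear j"
proof -
 obtain K where K: "0 \<le> K" "!!x. norm (T x) \<le> K * norm x" using clinear_bound[OF T_bounded] by blast
 have "norm (j x) \<le> sqrt K * norm x" for x
 proof (rule power2_le_imp_le)
  have "(norm (j x))\<^sup>2 = cmod (cinner (T x) x)"
   using arg_cong[OF j_cinner[of x x], of cmod] by (simp add: cinner_self norm_power)
  also have "\<dots> \<le> norm (T x) * norm x" by (rule cinner_Cauchy_Schwarz)
  also have "\<dots> \<le> K * norm x * norm x" by (intro mult_right_mono K) simp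
  finally show "(norm (j x))\<^sup>2 \<le> (sqrt K * norm x)\<^sup>2"
   using K(1) by (simp add: power_mult_distrib power2_eq_square[of "norm x"] mult.assoc)
 qed (simp add: K)
 then show ?thesis
  by (intro bounded_linear_intro[where K = "sqrt K"]) (auto simp: j_lin scaleR_scaleC mult.commute)
qed

lemma csubspace_range:
 assumes "bounded_clinear S"
 shows "csubspace (range S)"
 using linear_subspace_image[OF bounded_linear.linear[OF clinear_boundedD[OF assms]] subspace_UNIV]
 by (auto simp: csubspace_def clinear_scaleC[OF assms, symmetric])

text \<open>Through the conjugation 2 - T is equivalent to T, hence injective; being symmetric it
  has dense range.\<close>

lemma j_dense': "closure (range (%v. j (2 *C v - T v))) = UNIV"
proof -
 define R where "R = range (%v. 2 *C v - T v)"
 have R: "csubspace R"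
  unfolding R_def by (intro csubspace_range clinear_sub clinear_cmul clinear_id T_bounded)
 have "v = 0" if v: "!!x. x \<in> R ==> inner v x = 0" for v
 proof -
  have "cinner v (2 *C x - T x) = 0" for x using corthogonal_if_orthogonal[OF R v] by (auto simp: R_def)
  then have "cinner (2 *C v - T v) x = 0" for x
   by (simp add: cinner.diff_left cinner.diff_right cinner_scaleC_left cinner_scaleC_right T_sym)
  then have "2 *C v - T v = 0" by (intro cinner_eqI_left) (simp add: cinner.zero_left)
  then have "T (cconj v) = 0" by (simp add: T_cconj)
  then show ?thesis using T_inj by fastforce
 qed
 then have "closure (span R) = UNIV" by (rule dense_if_orthogonal_trivial)
 then have clR: "closure R = UNIV" using R by (metis csubspace_def span_eq_iff)
 have "j ` closure R \<subseteq> closure (j ` R)"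
  by (intro image_closure_subset bounded_linear.continuous_on[OF j_bounded] continuous_on_id closed_closure closure_subset)
 then have "closure (range j) \<subseteq> closure (j ` R)" by (intro closure_minimal) (simp_all add: clR)
 then show ?thesis using j_dense by (auto simp: R_def image_image)
qed

section \<open>Left and right field operators\<close>

definition lf :: "'a complexification \<Rightarrow> 'f \<Rightarrow> 'f"
 where "lf v u = cre (j v) u + can (j (cconj v)) u"

text \<open>While \<open>lf\<close> extends the field operators complex linearly, \<open>rf\<close>
  uses the letters j ((2 - T) v) for creation and, since cconj (T v) = (2 - T) (cconj v), the same
  expression at \<open>cconj v\<close> for annihilation. The weight makes the corrections from
  passing a left field through creation and annihilation cancel.\<close>

definition rf :: "'a complexification \<Rightarrow> 'f \<Rightarrow> 'f"
 where "rf v u = rcre (j (2 *C v - T v)) u + rcan (j (cconj (T v))) u"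

lemma lf_bounded: "bounded_clinear (lf v)" and rf_bounded: "bounded_clinear (rf v)"
 unfolding lf_def[abs_def] rf_def[abs_def] by (intro clinear_plus; simp)+

lemmas lf_lin = clinear_simps[OF lf_bounded] and rf_lin = clinear_simps[OF rf_bounded]

lemma lf_adj: "cinner (lf v u) w = cinner u (lf (cconj v) w)"
 by (simp add: lf_def cinner_add_left cinner_add_right cinner_can(1) cinner_can(2)[symmetric])

lemma rf_index: "2 *C cconj v - T (cconj v) = cconj (T v)" "cconj (T (cconj v)) = 2 *C v - T v"
 by (simp_all add: T_cconj)

lemma rf_adj: "cinner (rf v u) w = cinner u (rf (cconj v) w)" unfolding rf_def rf_index
 by (simp add: cinner_add_left cinner_add_right cinner_rcan(1) cinner_rcan(2)[symmetric])

lemma lf_rcan: "lf v (rcan k u) = rcan k (lf v u) - cinner k (j v) *C num q u"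
 by (simp add: lf_def clinear_simps[OF rcan_bounded] rcan_cre rcan_can)

lemma lf_rcre: "lf v (rcre k u) = rcre k (lf v u) + cinner (j (cconj v)) k *C num q u"
 by (simp add: lf_def clinear_simps[OF rcre_bounded] rcre_cre can_rcre)

text \<open>Both corrections are multiples of \<open>num q u\<close>, with coefficients that cancel
  by the conjugation symmetry of T.\<close>

lemma lf_rf: "lf v (rf w u) = rf w (lf v u)"
proof -
 have "cinner (j (cconj v)) (j (2 *C w - T w)) = cinner (cconj v) (2 *C T w - T (T w))"
  by (simp add: j_cinner T_sym T_simps)
 also have "\<dots> = cnj (cinner v (cconj (2 *C T w - T (T w))))" by (rule cinner_cconj_left)
 also have "\<dots> = cinner (T (cconj (T w))) v" by (metis T_cconj cinner_commute)
 also have "\<dots> = cinner (j (cconj (T w))) (j v)" by (simp add: j_cinner)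
 finally show ?thesis by (simp add: rf_def lf_lin lf_rcan lf_rcre)
qed

abbreviation M where "M \<equiv> q_araki_woods j tens"

definition fields :: "('f \<Rightarrow> 'f) set"
 where "fields = range (%x. lf (of_real_vector x))"

lemma M_eq: "M = commutant (commutant fields)"
 by (simp add: q_araki_woods_def fields_def lf_def[abs_def] field_operator_def cre_def[symmetric] can_def[symmetric])

lemma fields_bounded: "s \<in> fields ==> bounded_clinear s" by (auto simp: fields_def lf_bounded)

lemma commutant_M: "commutant M = commutant fields" by (simp add: M_eq commutant_triple fields_bounded)

lemma rf_M': "rf v \<in> commutant M"
 unfolding commutant_M by (intro commutantI rf_bounded) (auto simp: fields_def lf_rf)

lemma lf_M: "lf v \<in> M"
proof -
 obtain x y where v: "v = Complexify x y" by (cases v)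
 have v': "v = of_real_vector x + \<i> *C of_real_vector y" "cconj v = of_real_vector x - \<i> *C of_real_vector y"
  by (simp_all add: v cconj_def complexification_defs)
 have "lf v u = lf (of_real_vector x) u + \<i> *C lf (of_real_vector y) u" for u
  unfolding lf_def v'(2) unfolding v'(1)
  using can_add[of "j (of_real_vector x)" "(- \<i>) *C j (of_real_vector y)" u]
   can_scaleC[of "- \<i>" "j (of_real_vector y)" u]
  by (simp add: j_lin cre_add cre_scaleC scaleC_add_right)
 then have "lf v = (%u. lf (of_real_vector x) u + \<i> *C lf (of_real_vector y) u)"
  by (simp add: fun_eq_iff)
 moreover have "lf (of_real_vector z) \<in> M" for z
  unfolding M_eq using commutant_double[of fields] fields_bounded by (auto simp: fields_def)
 ultimately show ?thesis
  unfolding M_eq by (auto intro!: commutant_add commutant_scale commutant_bounded[of _ fields])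
qed

sublocale modular M vac
proof
 show MM: "commutant (commutant M) = M" unfolding commutant_M by (simp add: M_eq)
 have adj: "cadjoint s \<in> fields" if sf: "s \<in> fields" for s
 proof -
  obtain x where s: "s = lf (of_real_vector x)" using sf by (auto simp: fields_def)
  have "cadjoint s = s" unfolding s by (rule cadjoint_unique[OF lf_bounded]) (simp add: lf_adj)
  then show ?thesis using that by simp
 qed
 have adj': "cadjoint s \<in> commutant fields" if "s \<in> commutant fields" for s
  using that by (intro commutant_cadjoint fields_bounded adj)
 show "cadjoint x \<in> M" if "x \<in> M" for x
  using that unfolding M_eq by (intro commutant_cadjoint commutant_bounded adj')
 have sub: "csubspace (closure (span {x vac | x. x \<in> N}))"
  if "!!x c. x \<in> N ==> (%v. c *C x v) \<in> N" for N
  using that by (intro csubspace_closure csubspace_span) force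
 have inv: "s v \<in> closure (span {x vac | x. x \<in> N})"
  if "bounded_clinear s" "!!x. x \<in> N ==> (%v. s (x v)) \<in> N" "v \<in> closure (span {x vac | x. x \<in> N})" for N s v
  using clinear_boundedD[OF that(1)] _ that(3)
 proof (rule closure_span_invariant)
  fix g
  assume "g \<in> {x vac | x. x \<in> N}"
  then show "s g \<in> closure (span {x vac | x. x \<in> N})"
   using that(2) by (intro subsetD[OF closure_subset] span_base) force
 qed
 have vac: "vac \<in> closure (span {x vac | x. x \<in> N})" if "(%v. v) \<in> N" for N
  using that by (intro subsetD[OF closure_subset] span_base) force
 show "closure (span {x vac | x. x \<in> M}) = UNIV"
 proof (rule cyclic_left[OF j_dense closed_closure sub vac])
  show "(%v. c *C x v) \<in> M" if "x \<in> M" for x c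
   using that unfolding M_eq by (intro commutant_scale commutant_bounded)
  show "(%v. v) \<in> M" unfolding M_eq by (rule commutant_id)
  show "cre (j i) v + can (j (cconj i)) v \<in> closure (span {x vac | x. x \<in> M})"
   if "v \<in> closure (span {x vac | x. x \<in> M})" for i v
   using inv[OF lf_bounded _ that, of i] lf_M[of i] unfolding lf_def[symmetric] M_eq by (auto intro: commutant_comp)
 qed
 show "closure (span {x vac | x. x \<in> commutant M}) = UNIV"
 proof (rule cyclic_right[OF j_dense' closed_closure sub vac])
  show "(%v. c *C x v) \<in> commutant M" if "x \<in> commutant M" for x c
   using that unfolding commutant_M by (intro commutant_scale fields_bounded)
  show "(%v. v) \<in> commutant M" by (rule commutant_id)
  show "rcre (j (2 *C i - T i)) v + rcan (j (cconj (T i))) v \<in> closure (span {x vac | x. x \<in> commutant M})"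
   if "v \<in> closure (span {x vac | x. x \<in> commutant M})" for i v
   using inv[OF rf_bounded _ that, of i] rf_M'[of i] unfolding rf_def[symmetric] by (auto intro: commutant_comp)
 qed
qed

lemma orthogonal_right_invariant:
 assumes "!!a v. v \<in> X ==> rf a v \<in> X" "!!a v. v \<in> Y ==> rf a v \<in> Y"
  and "!!v w. v \<in> X ==> w \<in> Y ==> cinner v (num q w) = 0"
 shows "X \<subseteq> {0} \<or> Y \<subseteq> {0}" using assms unfolding rf_def
 by (intro orthogonal_invariant_sets[OF j_dense', where d = "%a. j (cconj (T a))" and \<sigma> = cconj]) (simp_all add: rf_index)

subsection \<open>Eigenvectors of the product of the field operators of a block\<close>

text \<open>An eigenvector of T as it comes from an invariant line (fixed by conjugation) or an
  invariant plane (orthogonal to its conjugate).\<close>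

definition block :: "'a complexification \<Rightarrow> real \<Rightarrow> bool"
 where "block e t \<longleftrightarrow> e \<noteq> 0 \<and> 0 < t \<and> t < 2 \<and> T e = of_real t *C e \<and> (cconj e = e \<or> cinner e (cconj e) = 0)"

lemma block_cconj:
 assumes "block e t"
 shows "block (cconj e) (2 - t)"
proof -
 have "T (cconj e) = of_real (2 - t) *C cconj e"
  using assms by (simp add: block_def T_cconj scaleC_diff_left)
 moreover have "e = cconj e \<or> cinner (cconj e) e = 0"
  using assms unfolding block_def by (metis cinner_commute complex_cnj_zero)
 ultimately show ?thesis using assms by (simp add: block_def)
qed

lemma block_j: "block e t ==> cinner (j e) (j x) = of_real t * cinner e x"
 by (simp add: block_def j_cinner cinner_scaleC_left)

lemma block_j_nonzero: "block e t ==> cinner (j e) (j e) \<noteq> 0"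
 using block_j[of e t e] by (auto simp: block_def cinner_self)

text \<open>Passing \<open>lf e\<close> through \<open>rcan (j e)\<close> leaves a nonzero multiple
  of q^N. Hence the kernels of \<open>lf e\<close> and of its adjoint, both invariant under right
  fields, are orthogonal for the q^N form.\<close>

lemma field_kernel:
 assumes "block e t"
 shows "(\<forall>v. lf e v = 0 \<longrightarrow> v = 0) \<or> (\<forall>v. lf (cconj e) v = 0 \<longrightarrow> v = 0)"
proof -
 have "{v. lf (cconj e) v = 0} \<subseteq> {0} \<or> {v. lf e v = 0} \<subseteq> {0}"
 proof (rule orthogonal_right_invariant)
  fix w v
  assume "w \<in> {v. lf (cconj e) v = 0}" "v \<in> {v. lf e v = 0}"
  then have "cinner w (lf e (rcan (j e) v)) = 0" "lf e v = 0"
   using lf_adj[of "cconj e" w] by (simp_all add: cinner.zero_left)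
  then show "cinner w (num q v) = 0" using block_j_nonzero[OF assms]
   by (simp add: lf_rcan clinear_simps[OF rcan_bounded] cinner.minus_right cinner_scaleC_right)
 qed (simp_all add: lf_rf rf_lin)
 then show ?thesis by auto
qed

text \<open>The commutator with a right annihilator produces a q^N term that vanishes between
  eigenvectors. For a plane the eigenspace is paired with its image under
  \<open>lf (cconj e)\<close>; for a line an eigenspace of the self-adjoint \<open>lf e\<close> is
  paired with itself.\<close>

lemma block_eigenvector:
 assumes e: "block e t" and ker: "!!v. lf (cconj e) v = 0 ==> v = 0" and v: "lf e (lf (cconj e) v) = of_real r *C v"
 shows "v = 0"
proof (cases "cconj e = e")
 case False
 define Y where "Y = {v. lf e (lf (cconj e) v) = of_real r *C v}"
 have orth: "cinner e (cconj e) = 0" using e False by (auto simp: block_def)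
 have "lf (cconj e) ` Y \<subseteq> {0} \<or> Y \<subseteq> {0}"
 proof (rule orthogonal_right_invariant)
  show "rf a v \<in> Y" if "v \<in> Y" for a v using that by (simp add: Y_def lf_rf rf_lin)
  then show "rf a v \<in> lf (cconj e) ` Y" if "v \<in> lf (cconj e) ` Y" for a v
   using that by (auto simp flip: lf_rf)
  fix w' v
  assume "w' \<in> lf (cconj e) ` Y" "v \<in> Y"
  then obtain w where w: "w' = lf (cconj e) w" "w \<in> Y" by auto
  \<comment> \<open>This letter is orthogonal to \<open>j e\<close>, so only the inner factor
    \<open>lf (cconj e)\<close> contributes a correction.\<close>
  let ?k = "j (cconj e)"
  have "lf e (lf (cconj e) (rcan ?k v)) = rcan ?k (of_real r *C v) - cinner ?k (j e) *C num q (lf (cconj e) v)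
    - cinner ?k ?k *C lf e (num q v)"
   using \<open>v \<in> Y\<close> by (simp add: lf_rcan lf_lin Y_def)
  moreover have "cinner ?k (j e) = 0"
   using block_j[OF block_cconj[OF e], of e] orth cinner_commute[of "cconj e" e] by simp
  moreover have "cinner w (lf e (lf (cconj e) (rcan ?k v))) = cinner w (rcan ?k (of_real r *C v))"
  proof -
   have "cinner w (lf e (lf (cconj e) x)) = cinner (lf e (lf (cconj e) w)) x" for x by (simp add: lf_adj)
   then show ?thesis
    using w(2) by (simp add: Y_def cinner_scaleC_left cinner_scaleC_right clinear_simps[OF rcan_bounded])
  qed
  ultimately have "cinner ?k ?k * cinner w (lf e (num q v)) = 0"
   by (simp add: cinner.diff_right cinner_scaleC_right)
  then have "cinner w (lf e (num q v)) = 0" using block_j_nonzero[OF block_cconj[OF e]] by simp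
  then show "cinner w' (num q v) = 0" using lf_adj[of "cconj e" w "num q v"] by (simp add: w(1))
 qed
 then show ?thesis using v ker by (auto simp: Y_def)
next
 case True
 have no_eigen: "v = 0" if v: "lf e v = of_real r *C v" for r v
 proof -
  define Y where "Y = {v. lf e v = of_real r *C v}"
  have "Y \<subseteq> {0} \<or> Y \<subseteq> {0}"
  proof (rule orthogonal_right_invariant)
   show "rf a v \<in> Y" if "v \<in> Y" for a v using that by (simp add: Y_def lf_rf rf_lin)
   then show "rf a v \<in> Y" if "v \<in> Y" for a v using that .
   fix w v
   assume wv: "w \<in> Y" "v \<in> Y"
   have "cinner w (lf e (rcan (j e) v)) = cinner (lf e w) (rcan (j e) v)"
    using True lf_adj[of e w] by simp
   then show "cinner w (num q v) = 0"
    using wv block_j_nonzero[OF e] by (simp add: Y_def lf_rcan clinear_simps[OF rcan_bounded]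
      cinner_scaleC_left cinner_scaleC_right cinner.diff_right)
  qed
  then show ?thesis using v by (auto simp: Y_def)
 qed
 show ?thesis
 proof (rule ccontr)
  assume "v \<noteq> 0"
  have "cinner (lf e v) (lf e v) = of_real r * cinner v v"
   using v True lf_adj[of e v "lf e v"] by (simp add: cinner_scaleC_right)
  then have "complex_of_real ((norm (lf e v))\<^sup>2) = of_real (r * (norm v)\<^sup>2)" by (simp add: cinner_self)
  then have "(norm (lf e v))\<^sup>2 = r * (norm v)\<^sup>2" by (simp only: of_real_eq_iff)
  then have "0 \<le> r"
   using \<open>v \<noteq> 0\<close> by (metis zero_le_mult_iff zero_le_power2 power2_eq_iff norm_eq_zero not_le zero_less_power2)
  \<comment> \<open>On a line the product is the square of \<open>lf e\<close>, so
    \<open>lf e\<close> - m and \<open>lf e\<close> + m together kill v, and one of them exhibits an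
    eigenvector of \<open>lf e\<close>.\<close>
  define m where "m = sqrt r"
  have m: "of_real r = (of_real m * of_real m :: complex)"
   using \<open>0 \<le> r\<close> by (simp add: m_def flip: of_real_mult)
  define u where "u = lf e v + of_real m *C v"
  have "lf e u = of_real m *C u"
   using v True by (simp add: u_def lf_lin scaleC_add_right scaleC_scaleC m)
  then have "u = 0" by (rule no_eigen)
  then have "lf e v = of_real (- m) *C v" by (simp add: u_def eq_neg_iff_add_eq_0)
  then show False using no_eigen[of v "- m"] \<open>v \<noteq> 0\<close> by blast
 qed
qed

end

lemma commute_calc:
 assumes "pvm E" and E: "pvm.op E = range (%v. (v, z v))" and x: "bounded_clinear x" and xz: "!!v. x (z v) = z (x v)"
  and f: "bdd_borel f"
 shows "x (pvm.calc E f v) = pvm.calc E f (x v)"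
proof (rule pvm.commute_op_calc[OF \<open>pvm E\<close> x _ f])
 show "(x v, x v') \<in> pvm.op E" if "(v, v') \<in> pvm.op E" for v v' using that xz by (auto simp: E)
qed

section \<open>Degree cutoffs on the Fock space\<close>

context q_fock
begin

text \<open>A number below 1 that dominates |q| and is positive even for q = 0, since its inverse is
  taken.\<close>

definition rho :: real
 where "rho = max \<bar>q\<bar> (1 / 2)"

lemma rho: "0 < rho" "rho < 1" "\<bar>q\<bar> \<le> rho" "\<bar>rho\<bar> \<le> 1" using q_abs by (auto simp: rho_def)

lemma num_q_le: "norm (num q v) \<le> norm (num rho v)"
proof -
 have le: "\<bar>(q / rho) ^ n\<bar> \<le> 1" for n using rho by (intro abs_power_le_1) (simp add: abs_divide)
 have "diag (%n. (q / rho) ^ n) (num rho v) = num q v"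
  using diag_comp[of "%n. (q / rho) ^ n" 1 "%n. rho ^ n" 1 1 v, OF le abs_power_le_1[OF rho(4)]] abs_power_le_1[OF q_le] rho(1)
  by (simp add: num_def power_divide)
 then show ?thesis using diag_bound[of "%n. (q / rho) ^ n" 1 "num rho v", OF le] by simp
qed

definition low :: "nat \<Rightarrow> 'f \<Rightarrow> 'f"
 where "low k = diag (%n. of_bool (n \<le> k))"

lemma low_bounded: "bounded_clinear (low k)" and low_tens: "low k (tens xs) = of_bool (length xs \<le> k) *C tens xs"
 using diag_bounded[of "%n. of_bool (n \<le> k)" 1] diag_tens[of "%n. of_bool (n \<le> k)" 1] by (simp_all add: low_def)

lemma num_rho_le: "norm (num rho v) \<le> norm (low k v) + rho ^ k * norm v"
proof -
 define a where "a n = (if n \<le> k then 0 else rho ^ n)" for n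
 have a: "\<bar>a n\<bar> \<le> rho ^ k" for n using rho by (auto simp: a_def intro: power_decreasing)
 have "num rho = (%v. num rho (low k v) + diag a v)"
  by (rule operator_eqI[OF num_bounded[OF rho(4)] clinear_plus[OF clinear_compose[OF num_bounded[OF rho(4)] low_bounded]
     diag_bounded[of a, OF a]]])
   (simp add: low_tens diag_tens[of a, OF a] num_tens[OF rho(4)] clinear_simps[OF num_bounded[OF rho(4)]] a_def)
 then have "norm (num rho v) \<le> norm (num rho (low k v)) + norm (diag a v)" by (metis norm_triangle_ineq)
 also have "\<dots> \<le> norm (low k v) + rho ^ k * norm v" by (intro add_mono num_bound rho diag_bound a)
 finally show ?thesis .
qed

text \<open>A finite alphabet has finitely many words of length at most k, so finitely many inner
  products control the low degree part; this upgrades weak convergence to norm convergence.\<close>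

lemma low_finite_rank:
 fixes L :: "'h set"
 assumes "finite L"
 obtains C K where "finite C" "0 \<le> K"
  "!!p. p \<in> closure (span {c *C tens ws | c ws. set ws \<subseteq> L}) ==> norm (low k p) \<le> K * (\<Sum>c\<in>C. cmod (cinner c p))"
proof -
 define W where "W = {ws. set ws \<subseteq> L \<and> length ws \<le> k}"
 \<comment> \<open>Orthogonalisation is over the reals, so the words are taken together with their
   multiples by \<i>.\<close>
 define B where "B = tens ` W \<union> (%ws. \<i> *C tens ws) ` W"
 have "finite B" using finite_lists_length_le[OF assms] by (simp add: B_def W_def)
 then obtain C where C: "finite C" "span C = span B" "pairwise orthogonal C"
  using basis_orthogonal by blast
 define D where "D v = low k v - (\<Sum>c\<in>C. (c \<bullet> v / (c \<bullet> c)) *\<^sub>R c)" for v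
 have D: "bounded_linear D" unfolding D_def divide_inverse
  by (intro bounded_linear_sub clinear_boundedD low_bounded bounded_linear_sum
    bounded_linear_compose[OF bounded_linear_scaleR_left] bounded_linear_mult_left[THEN bounded_linear_compose] bounded_linear_inner_right)
 have "D g = 0" if gW: "g \<in> {c *C tens ws | c ws. set ws \<subseteq> L}" for g
 proof -
  obtain a ws where g: "g = a *C tens ws" "set ws \<subseteq> L" using gW by auto
  show ?thesis
  proof (cases "length ws \<le> k")
   case True
   have "a *C tens ws = Re a *\<^sub>R tens ws + Im a *\<^sub>R (\<i> *C tens ws)"
    unfolding scaleR_scaleC scaleC_scaleC scaleC_add_left[symmetric] by (simp add: complex_eq[symmetric] mult.commute)
   moreover have "tens ws \<in> B" "\<i> *C tens ws \<in> B" using True g(2) by (auto simp: B_def W_def)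
   ultimately have gC: "g \<in> span C" unfolding g C(2) by (simp add: span_add span_scale span_base)
   have "low k g = g" using True by (simp add: g low_tens clinear_scaleC[OF low_bounded])
   then have Dg: "D g = g - (\<Sum>c\<in>C. (c \<bullet> g / (c \<bullet> c)) *\<^sub>R c)" by (simp add: D_def)
   have "D g \<in> span C" unfolding Dg by (intro span_diff gC span_sum span_scale span_base)
   moreover have "orthogonal (D g) b" if b: "b \<in> C" for b
   proof -
    have "(\<Sum>c\<in>C. (c \<bullet> g / (c \<bullet> c)) * (c \<bullet> b)) = (\<Sum>c\<in>C. if c = b then b \<bullet> g else 0)"
     using C(3) b by (intro sum.cong) (auto simp: pairwise_def orthogonal_def)
    then show ?thesis
     using C(1) b inner_commute[of b g] by (simp add: Dg orthogonal_def inner_diff_left inner_sum_left)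
   qed
   ultimately have "orthogonal (D g) (D g)" by (rule orthogonal_to_span)
   then show ?thesis by (simp add: orthogonal_def)
  next
   case False
   have "orthogonal g b" if "b \<in> B" for b
   proof -
    have "cinner (tens ws) (tens us) = 0" if "us \<in> W" for us
     using that False by (auto simp: W_def tens_cinner q_inner_def)
    then have "cinner g b = 0"
     using \<open>b \<in> B\<close> by (auto simp: B_def g cinner_scaleC_left cinner_scaleC_right)
    then show ?thesis by (simp add: orthogonal_def flip: Re_cinner)
   qed
   then have "c \<bullet> g = 0" if "c \<in> C" for c
    using orthogonal_to_span[of c B g] span_base[OF that] by (simp add: C(2) orthogonal_def inner_commute)
   then show ?thesis using False by (simp add: D_def g low_tens clinear_scaleC[OF low_bounded])
  qed
 qed
 then have "{c *C tens ws | c ws. set ws \<subseteq> L} \<subseteq> {v. D v \<in> {0}}" by auto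
 then have D0: "closure (span {c *C tens ws | c ws. set ws \<subseteq> L}) \<subseteq> {v. D v \<in> {0}}"
  by (intro closure_span_minimal closed_subspace_vimage[OF D] closed_singleton subspace_single_0)
 define K where "K = (\<Sum>c\<in>C. norm c / (c \<bullet> c))"
 have "norm (low k p) \<le> K * (\<Sum>c\<in>C. cmod (cinner c p))" if "p \<in> closure (span {c *C tens ws | c ws. set ws \<subseteq> L})" for p
 proof -
  have "low k p = (\<Sum>c\<in>C. (c \<bullet> p / (c \<bullet> c)) *\<^sub>R c)" using D0 that by (auto simp: D_def)
  also have "norm \<dots> \<le> (\<Sum>c\<in>C. (norm c / (c \<bullet> c)) * cmod (cinner c p))"
  proof (rule sum_norm_le)
   fix c
   have "\<bar>c \<bullet> p\<bar> \<le> cmod (cinner c p)" using abs_Re_le_cmod[of "cinner c p"] by (simp add: Re_cinner)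
   then show "norm ((c \<bullet> p / (c \<bullet> c)) *\<^sub>R c) \<le> (norm c / (c \<bullet> c)) * cmod (cinner c p)"
    by (simp add: mult.commute mult_left_mono divide_right_mono)
  qed
  also have "\<dots> \<le> (\<Sum>c\<in>C. (norm c / (c \<bullet> c)) * (\<Sum>c\<in>C. cmod (cinner c p)))"
   using C(1) by (intro sum_mono mult_left_mono member_le_sum) auto
  finally show ?thesis by (simp add: K_def sum_distrib_right)
 qed
 moreover have "0 \<le> K" by (simp add: K_def sum_nonneg)
 ultimately show thesis using that[OF C(1)] by blast
qed

end

context araki_woods
begin

subsection \<open>Mixing\<close>

text \<open>The commutant elements used to approximate \<open>x vac\<close>. They are bounded for
  the norm of rho^N w, and that norm also bounds what \<open>can f\<close> sees after R has been
  applied to a vector killed by \<open>can f\<close>.\<close>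

definition good :: "('f \<Rightarrow> 'f) \<Rightarrow> bool"
 where "good R \<longleftrightarrow> R \<in> commutant M \<and> (\<exists>C. \<forall>w. norm (num rho (R w)) \<le> C * norm (num rho w)) \<and>
  (\<forall>f. \<exists>C. \<forall>w. can f w = 0 \<longrightarrow> norm (can f (R w)) \<le> C * norm (num rho w))"

lemma good_id: "good (%v. v)"
 unfolding good_def by (auto simp: commutant_id intro: exI[of _ 1] exI[of _ 0])

lemma good_combine:
 assumes R: "good R" and X: "good X"
 shows "good (%v. R v + c *C X v)"
proof -
 note n = clinear_simps[OF num_bounded[OF rho(4)]]
 have tri: "norm (x + c *C y) \<le> (C + cmod c * D) * r" if "norm x \<le> C * r" "norm y \<le> D * r" for x y :: 'f and C D r
 proof -
  have "norm (x + c *C y) \<le> norm x + cmod c * norm y" by (metis norm_scaleC norm_triangle_ineq)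
  also have "\<dots> \<le> C * r + cmod c * (D * r)" using that by (intro add_mono mult_left_mono) auto
  finally show ?thesis by (simp add: algebra_simps)
 qed
 have "(%v. R v + c *C X v) \<in> commutant M"
  using R X by (auto simp: good_def intro!: commutant_add commutant_scale M_bounded)
 moreover obtain C D where "\<forall>w. norm (num rho (R w)) \<le> C * norm (num rho w)" "\<forall>w. norm (num rho (X w)) \<le> D * norm (num rho w)"
  using R X by (auto simp: good_def)
 then have "\<forall>w. norm (num rho (R w + c *C X w)) \<le> (C + cmod c * D) * norm (num rho w)"
  by (auto simp: n intro: tri)
 moreover have "\<exists>C. \<forall>w. can f w = 0 \<longrightarrow> norm (can f (R w + c *C X w)) \<le> C * norm (num rho w)" for f
 proof -
  obtain C D where "\<forall>w. can f w = 0 \<longrightarrow> norm (can f (R w)) \<le> C * norm (num rho w)"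
   "\<forall>w. can f w = 0 \<longrightarrow> norm (can f (X w)) \<le> D * norm (num rho w)" using R X unfolding good_def by meson
  then have "\<forall>w. can f w = 0 \<longrightarrow> norm (can f (R w + c *C X w)) \<le> (C + cmod c * D) * norm (num rho w)"
   by (auto simp: clinear_simps[OF can_bounded] intro: tri)
  then show ?thesis ..
 qed
 ultimately show ?thesis unfolding good_def by blast
qed

text \<open>rho^N passes creation with a factor rho and annihilation with 1/rho, which keeps the
  first bound. For the second, \<open>can f\<close> commutes with a right field up to a multiple of
  q^N, which rho^N dominates.\<close>

lemma good_rf:
 assumes R: "good R"
 shows "good (%v. rf a (R v))"
proof -
 define g where "g = j (2 *C a - T a)"
 define h where "h = j (cconj (T a))"
 have rf: "rf a u = rcre g u + rcan h u" for u by (simp add: rf_def g_def h_def)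
 obtain C D where C: "0 \<le> C" "!!w. norm (num rho (R w)) \<le> C * norm (num rho w)"
  and D: "!!f w. can f w = 0 ==> norm (can f (R w)) \<le> D f * norm (num rho w)"
 proof -
  obtain C where "!!w. norm (num rho (R w)) \<le> C * norm (num rho w)" using R by (auto simp: good_def)
  then have C: "norm (num rho (R w)) \<le> \<bar>C\<bar> * norm (num rho w)" for w
   by (rule order_trans) (simp add: mult_right_mono)
  have "\<forall>f. \<exists>D. \<forall>w. can f w = 0 \<longrightarrow> norm (can f (R w)) \<le> D * norm (num rho w)"
   using R by (simp add: good_def)
  from choice[OF this] show thesis using that[OF _ C] by auto
 qed
 obtain K where K: "0 \<le> K" "!!w. norm (rcre g w) \<le> K * norm w"
  using clinear_bound[OF rcre_bounded] by blast
 obtain L where L: "0 \<le> L" "!!w. norm (rcan h w) \<le> L * norm w"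
  using clinear_bound[OF rcan_bounded] by blast
 have num: "norm (num rho (rf a u)) \<le> (rho * K + inverse rho * L) * norm (num rho u)" for u
 proof -
  have "inverse rho * rho = 1" using rho(1) by simp
  then have "num rho (rcan h u) = of_real (inverse rho) *C rcan h (num rho u)"
   unfolding rcan_num[OF rho(4)] scaleC_scaleC of_real_mult[symmetric] by simp
  then have "num rho (rf a u) = of_real rho *C rcre g (num rho u) + of_real (inverse rho) *C rcan h (num rho u)"
   by (simp add: rf clinear_add[OF num_bounded] rho num_rcre)
  then have "norm (num rho (rf a u)) \<le> rho * norm (rcre g (num rho u)) + inverse rho * norm (rcan h (num rho u))"
   using norm_triangle_ineq[of "of_real rho *C rcre g (num rho u)" "of_real (inverse rho) *C rcan h (num rho u)"] rho(1)
   by (simp add: norm_scaleC norm_inverse)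
  also have "\<dots> \<le> rho * (K * norm (num rho u)) + inverse rho * (L * norm (num rho u))"
   using rho(1) by (intro add_mono mult_left_mono K L) auto
  finally show ?thesis by (simp add: algebra_simps)
 qed
 have "(%v. rf a (R v)) \<in> commutant M" using R by (intro commutant_comp[OF rf_M']) (simp add: good_def)
 moreover have "norm (num rho (rf a (R w))) \<le> ((rho * K + inverse rho * L) * C) * norm (num rho w)" for w
 proof -
  have "norm (num rho (rf a (R w))) \<le> (rho * K + inverse rho * L) * norm (num rho (R w))" by (rule num)
  also have "\<dots> \<le> (rho * K + inverse rho * L) * (C * norm (num rho w))"
   using rho(1) K(1) L(1) by (intro mult_left_mono C) auto
  finally show ?thesis by (simp add: mult_ac)
 qed
 moreover have "norm (can f (rf a (R w))) \<le> ((K + L) * D f + cmod (cinner f g) * C) * norm (num rho w)" if "can f w = 0" for f w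
 proof -
  have "can f (rf a (R w)) = (rcre g (can f (R w)) + rcan h (can f (R w))) + cinner f g *C num q (R w)"
   by (simp add: rf clinear_add[OF can_bounded] can_rcre rcan_can)
  also have "norm \<dots> \<le> (norm (rcre g (can f (R w))) + norm (rcan h (can f (R w)))) + cmod (cinner f g) * norm (num q (R w))"
   by (metis add_mono norm_scaleC norm_triangle_ineq norm_triangle_le order_refl)
  also have "\<dots> \<le> (K * norm (can f (R w)) + L * norm (can f (R w))) + cmod (cinner f g) * (C * norm (num rho w))"
   by (intro add_mono K L mult_left_mono order_trans[OF num_q_le C(2)]) simp
  also have "\<dots> \<le> (K * (D f * norm (num rho w)) + L * (D f * norm (num rho w))) + cmod (cinner f g) * (C * norm (num rho w))"
   by (intro add_mono mult_left_mono D that K(1) L(1) order_refl)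
  finally show ?thesis by (simp add: algebra_simps)
 qed
 ultimately show ?thesis unfolding good_def by blast
qed

lemma good_dense: "closure {R vac | R. good R} = UNIV"
proof -
 define G where "G = {R vac | R. good R}"
 have comb: "v + c *C w \<in> G" if vw: "v \<in> G" "w \<in> G" for v w c
 proof -
  obtain R X where "v = R vac" "good R" "w = X vac" "good X" using vw by (auto simp: G_def)
  then show ?thesis using good_combine[of R X c] by (auto simp: G_def)
 qed
 have vac: "vac \<in> G" using good_id by (auto simp: G_def)
 have "0 \<in> G" using comb[OF vac vac, of "- 1"] by simp
 then have sub: "csubspace G"
  using comb comb[of _ _ 1] comb[of 0] unfolding csubspace_def subspace_def by (auto simp: scaleR_scaleC)
 have "closure G = UNIV"
 proof (rule cyclic_right[OF j_dense' closed_closure csubspace_closure[OF sub]])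
  show "vac \<in> closure G" using vac closure_subset by blast
  show "rcre (j (2 *C a - T a)) v + rcan (j (cconj (T a))) v \<in> closure G" if v: "v \<in> closure G" for a v
  proof -
   have "rf a ` closure G \<subseteq> closure G"
   proof (rule image_closure_subset[OF _ closed_closure])
    show "continuous_on (closure G) (rf a)"
     by (intro bounded_linear.continuous_on[OF clinear_boundedD[OF rf_bounded]] continuous_on_id)
    show "rf a ` G \<subseteq> closure G" using good_rf closure_subset[of G] by (auto simp: G_def)
   qed
   then show ?thesis using v by (auto simp: rf_def[symmetric])
  qed
 qed
 then show ?thesis by (simp add: G_def)
qed

context
 fixes e t
 assumes block: "block e t" and ker: "!!v. lf (cconj e) v = 0 ==> v = 0"
begin

definition y :: "'f \<Rightarrow> 'f"
 where "y v = lf e (lf (cconj e) v)"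

text \<open>On the vacuum \<open>rf e\<close> yields the factor 2 - t and
  \<open>rf (cconj e)\<close> the factor t; the constant removes both, so that y and
  \<open>y'\<close> agree there.\<close>

definition y' :: "'f \<Rightarrow> 'f"
 where "y' v = of_real (inverse (t * (2 - t))) *C rf (cconj e) (rf e v)"

lemma y_bounded: "bounded_clinear y" and y'_bounded: "bounded_clinear y'"
 unfolding y_def[abs_def] y'_def[abs_def]
 by (intro clinear_compose[OF lf_bounded lf_bounded] clinear_cmul clinear_compose[OF rf_bounded rf_bounded])+

lemma y_adj: "cinner (y u) v = cinner u (y v)" and y'_adj: "cinner (y' u) v = cinner u (y' v)"
 by (simp_all add: y_def y'_def lf_adj rf_adj cinner_scaleC_left cinner_scaleC_right)

lemma y_M: "y \<in> M" and y'_M': "y' \<in> commutant M" unfolding y_def[abs_def] y'_def[abs_def]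
 by (intro M_comp[OF lf_M lf_M] commutant_scale[OF M_bounded commutant_comp[OF rf_M' rf_M']]; assumption)+

lemma y_y': "y (y' v) = y' (y v)" by (rule M_M'[OF y_M y'_M'])

lemma T_e: "T e = of_real t *C e" "T (cconj e) = of_real (2 - t) *C cconj e"
 using block block_cconj[OF block] by (simp_all add: block_def)

lemma y_vac: "y vac = y' vac"
proof -
 have t: "t \<noteq> 0" "2 - t \<noteq> 0" using block by (auto simp: block_def)
 have can1: "can g (tens [x]) = cinner g x *C vac" for g x
  by (simp add: can_tens_Cons clinear_simps[OF cre_bounded])
 have rcan1: "rcan g (tens [x]) = cinner g x *C vac" for g x
  by (simp add: rcan_def can1 clinear_simps[OF flip_bounded])
 have nn: "cinner (j (cconj e)) (j (cconj e)) = of_real (2 - t) * cinner e e"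
  using block_j[OF block_cconj[OF block], of "cconj e"] cinner_cconj[of e e] cinner_commute[of e e] by simp
 have lhs: "y vac = tens [j e, j (cconj e)] + (of_real (2 - t) * cinner e e) *C vac"
  by (simp add: y_def lf_def can1 nn clinear_simps[OF can_bounded] clinear_simps[OF cre_bounded])
 have 1: "rf e vac = of_real (2 - t) *C tens [j e]"
 proof -
  have "2 *C e - T e = of_real (2 - t) *C e" by (simp add: T_e scaleC_diff_left)
  then show ?thesis unfolding rf_def by (simp only: j_lin rcre_scaleC) simp
 qed
 have 2: "rf (cconj e) (tens [j e]) = of_real t *C tens [j e, j (cconj e)] + (of_real ((2 - t) * t) * cinner e e) *C vac"
 proof -
  have "2 *C cconj e - T (cconj e) = of_real t *C cconj e" "cconj (T (cconj e)) = of_real (2 - t) *C e"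
   by (simp_all add: T_e scaleC_diff_left)
  then show ?thesis unfolding rf_def using block_j[OF block, of e]
   by (simp only: j_lin rcre_scaleC rcan_scaleC rcan1) (simp add: cinner_scaleC_left scaleC_scaleC mult_ac)
 qed
 have "y' vac = (of_real (inverse (t * (2 - t))) * of_real (2 - t) * of_real t) *C (tens [j e, j (cconj e)] + (of_real (2 - t) * cinner e e) *C vac)"
  by (simp add: y'_def 1 rf_lin 2 scaleC_scaleC scaleC_add_right mult_ac del: of_real_diff of_real_inverse)
 also have "of_real (inverse (t * (2 - t))) * of_real (2 - t) * of_real t = (1 :: complex)"
  unfolding of_real_mult[symmetric] using t by (simp add: field_simps del: of_real_diff)
 finally show ?thesis by (simp add: lhs)
qed

lemma y_centralizer: "y \<in> centralizer M vac"
 by (rule centralizerI[OF y_M cadjoint_unique[OF y_bounded y_adj] y'_M' cadjoint_unique[OF y'_bounded y'_adj] y_vac])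

text \<open>A letter orthogonal to the block is not contracted with the right fields of the block,
  so the q^N corrections vanish.\<close>

lemma can_y':
 assumes f: "cinner f (j e) = 0" "cinner f (j (cconj e)) = 0"
 shows "can f (y' v) = y' (can f v)" "cre f (y' v) = y' (cre f v)"
proof -
 have f': "cinner (j e) f = 0" "cinner (j (cconj e)) f = 0"
  using f cinner_commute[of _ f] by (metis complex_cnj_zero)+
 have "can f (rf a u) = rf a (can f u) \<and> cre f (rf a u) = rf a (cre f u)" if "a \<in> {e, cconj e}" for a u
  using that f f' T_e
  by (auto simp: rf_def T_simps j_lin rcre_scaleC rcan_scaleC scaleC_diff_left[symmetric] clinear_simps[OF can_bounded] clinear_simps[OF cre_bounded]
    can_rcre rcan_can rcre_cre rcan_cre cinner_scaleC_left cinner_scaleC_right)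
 then show "can f (y' v) = y' (can f v)" "cre f (y' v) = y' (cre f v)"
  by (simp_all add: y'_def clinear_scaleC)
qed

text \<open>If some <x vac, cre f (A vac)> were nonzero, applying \<open>u n\<close>, which agrees
  with \<open>u' n\<close> on \<open>x vac\<close>, would preserve the pairing, while
  \<open>u' n\<close> moves past \<open>cre f\<close> and A onto the vacuum. With
  \<open>x vac\<close> replaced by a nearby \<open>R vac\<close>, R good, the pairing is bounded by
  a multiple of the norm of rho^N \<open>u n vac\<close>, which can be made arbitrarily
  small.\<close>

lemma mixing:
 assumes x: "x \<in> M" "!!v. x (y v) = y (x v)" and f: "cinner f (j e) = 0" "cinner f (j (cconj e)) = 0"
 shows "can f (x vac) = 0"
proof -
 obtain E where E: "pvm E" "pvm.op E = range (%v. (v, y v))"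
  using spectral_theorem_self_adjoint[OF self_adjoint_graph[OF y_bounded y_adj]] by blast
 obtain F where F: "pvm F" "pvm.op F = range (%v. (v, y' v))"
  using spectral_theorem_self_adjoint[OF self_adjoint_graph[OF y'_bounded y'_adj]] by blast
 interpret E: pvm E by (rule E(1))
 interpret F: pvm F by (rule F(1))
 define u where "u n = E.calc (%s. cayley s ^ n)" for n
 define u' where "u' n = F.calc (%s. cayley s ^ n)" for n
 have pow: "bdd_borel (%s. cayley s ^ n)" for n by (induction n) simp_all
 note comm = commute_calc[OF E] and comm' = commute_calc[OF F]
 have xb: "bounded_clinear x" by (rule M_bounded[OF x(1)])
 \<comment> \<open>y and \<open>y'\<close> commute and agree at the vacuum, so their resolvents
   agree there, and with them all powers of the Cayley transforms.\<close>
 have u_vac: "u n vac = u' n vac" for n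
 proof (induction n)
  case 0
  then show ?case by (simp add: u_def u'_def E.calc_const F.calc_const)
 next
  case (Suc n)
  have "y (F.Q vac) = vac - \<i> *C F.Q vac"
  proof -
   have "(F.Q vac, vac - \<i> *C F.Q vac) \<in> F.op" by (simp add: F.op_def)
   then have "y' (F.Q vac) = vac - \<i> *C F.Q vac" by (auto simp: F(2))
   moreover have "y' (F.Q vac) = F.Q (y' vac)" "y (F.Q vac) = F.Q (y vac)"
    by (intro comm' y_bounded y'_bounded y_y' refl bdd_borel_resolvent)+
   ultimately show ?thesis by (simp add: y_vac)
  qed
  then have "(F.Q vac, vac - \<i> *C F.Q vac) \<in> E.op" by (auto simp: E(2))
  then have "E.Q vac = F.Q vac" by (auto simp: E.op_def)
  then have c: "E.calc cayley vac = F.calc cayley vac" by (simp add: E.calc_cayley F.calc_cayley)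
  have y'E: "y' (E.calc cayley v) = E.calc cayley (y' v)" for v
   by (intro comm y'_bounded y_y'[symmetric] E.bdd_borel_cayley)
  have "u (Suc n) vac = E.calc cayley (u n vac)"
   using E.calc_mult[OF E.bdd_borel_cayley pow] by (simp add: u_def)
  also have "\<dots> = E.calc cayley (u' n vac)" by (simp add: Suc)
  also have "\<dots> = u' n (E.calc cayley vac)"
   unfolding u'_def by (intro comm' E.bounded_calc E.bdd_borel_cayley y'E[symmetric] pow)
  also have "\<dots> = u' (Suc n) vac"
   using F.calc_mult[OF pow E.bdd_borel_cayley] by (simp add: c u'_def mult.commute)
  finally show ?case .
 qed
 have u'_iso: "cinner (u' n v) (u' n w) = cinner v w" for n v w
 proof -
  have "(%s. cnj (cayley s ^ n) * cayley s ^ n) = (%s. 1)"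
   by (simp add: cayley_cnj flip: power_mult_distrib)
  then show ?thesis using F.calc_mult[OF bdd_borel_cnj[OF pow] pow, of n n w] F.calc_const[of 1 w]
   by (simp add: u'_def F.calc_adj[OF pow])
 qed
 have u_iso: "norm (u n v) = norm v" for n v
 proof -
  have "(norm (u n v))\<^sup>2 = (norm v)\<^sup>2"
   using E.norm_calc[OF pow, of n v] by (simp add: u_def norm_power E.measure_sd_UNIV)
  then show ?thesis by simp
 qed
 have u'_norm: "norm (u' n v) = norm v" for n v
  using arg_cong[OF u'_iso[of n v v], of Re] by (simp add: Re_cinner norm_eq_sqrt_inner)
 \<comment> \<open>As f is orthogonal to the block, \<open>can f\<close> commutes with
   \<open>y'\<close> and so with \<open>u' n\<close>, and it kills the vacuum.\<close>
 have can_u: "can f (u n vac) = 0" for n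
 proof -
  have "can f (u' n vac) = u' n (can f vac)"
   unfolding u'_def by (intro comm' can_bounded can_y'[OF f] pow)
  then show ?thesis unfolding u_vac by (simp add: u'_def clinear_zero[OF F.bounded_calc[OF pow]])
 qed
 \<comment> \<open>The Fock space over the two letters of the block. It is invariant under y, so its
   projection commutes with \<open>u n\<close>, and \<open>u n vac\<close> stays inside.\<close>
 define K0 where "K0 = closure (span {c *C tens ws | c ws. set ws \<subseteq> {j e, j (cconj e)}})"
 have uK: "u n vac \<in> K0" for n
 proof -
  define G where "G = {c *C tens ws | c ws. set ws \<subseteq> {j e, j (cconj e)}}"
  have GI: "c *C tens ws \<in> K0" if "set ws \<subseteq> {j e, j (cconj e)}" for c ws
   unfolding K0_def using that by (intro subsetD[OF closure_subset] span_base) blast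
  have "c *C g \<in> G" if "g \<in> G" for c g
   using that unfolding G_def by (clarsimp simp: scaleC_scaleC) blast
  then have K0: "closed K0" "csubspace K0"
   unfolding K0_def G_def[symmetric] by (auto intro: csubspace_closure csubspace_span)
  then have sub: "subspace K0" "!!c v. v \<in> K0 ==> c *C v \<in> K0" by (auto simp: csubspace_def)
  have lfK: "lf a v \<in> K0" if "v \<in> K0" "a \<in> {e, cconj e}" for a v using that(1) unfolding K0_def
  proof (rule closure_span_invariant[OF clinear_boundedD[OF lf_bounded], rotated])
   fix g
   assume "g \<in> {c *C tens ws | c ws. set ws \<subseteq> {j e, j (cconj e)}}"
   then obtain c ws where g: "g = c *C tens ws" "set ws \<subseteq> {j e, j (cconj e)}" by blast
   have "lin_comb tens L \<in> K0" if "\<forall>(c, w) \<in> set L. set w \<subseteq> {j e, j (cconj e)}" for L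
    using that by (induction L) (auto intro!: subspace_add[OF sub(1)] subspace_0[OF sub(1)] GI)
   moreover have "set w \<subseteq> {j e, j (cconj e)}" if "(b, w) \<in> set (annihilate q h ws)" for b w h
    using that g(2) by (auto simp: annihilate_eq dest!: in_set_takeD in_set_dropD)
   ultimately have "can (j (cconj a)) (tens ws) \<in> K0" unfolding can_tens ann_def by fast
   moreover have "tens (j a # ws) \<in> K0" using GI[of "j a # ws" 1] g(2) \<open>a \<in> {e, cconj e}\<close> by auto
   ultimately have "lf a (tens ws) \<in> K0" using subspace_add[OF sub(1)] by (simp add: lf_def)
   then show "lf a g \<in> closure (span {c *C tens ws | c ws. set ws \<subseteq> {j e, j (cconj e)}})"
    using sub(2) by (simp add: g(1) lf_lin K0_def[symmetric])
  qed
  have yK: "y v \<in> K0" if "v \<in> K0" for v using that lfK unfolding y_def by blast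
  obtain P where P: "orthogonal_projection P" "!!x. P x \<in> K0" "!!x. x \<in> K0 ==> P x = x" "!!x s. s \<in> K0 ==> cinner s (x - P x) = 0"
   using orthogonal_projection_onto[OF K0] by blast
  have "P (u n vac) = u n (P vac)" unfolding u_def
  proof (rule comm[OF _ _ pow])
   show "P (y v) = y (P v)" for v by (rule projection_commute[OF P y_bounded yK yK y_adj])
  qed (use P(1) in \<open>simp add: orthogonal_projection_def\<close>)
  moreover have "P vac = vac" using GI[of "[]" 1] by (intro P(3)) simp
  ultimately show ?thesis using P(2)[of "u n vac"] by simp
 qed
 \<comment> \<open>The Cayley map is injective, so a charged level set would be an atom of the
   spectral measure of y, that is, an eigenvector.\<close>
 have E_null: "E {s. cayley s = w} v = 0" for w v
 proof (cases "\<exists>s. cayley s = w")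
  case True
  then obtain s where s: "cayley s = w" by blast
  have "{s. cayley s = w} = {s}"
   using s by (auto dest: arg_cong[of _ _ cayley_inv] simp: cayley_inv_cayley)
  moreover have "y (E {s} v) = of_real s *C E {s} v" using E.E_point_op[of s v] by (auto simp: E(2))
  then have "E {s} v = 0" using block_eigenvector[OF block ker] unfolding y_def by blast
  ultimately show ?thesis by simp
 next
  case False
  then have "{s. cayley s = w} = {}" by auto
  then show ?thesis by (simp only: pvm_empty[OF E.E])
 qed
 \<comment> \<open>Degrees above k are damped by rho^k. Up to degree k finitely many coefficients
   matter, and Wiener's lemma makes them small for a common n.\<close>
 have small: "\<exists>n. norm (num rho (u n vac)) < \<epsilon>" if "0 < \<epsilon>" for \<epsilon>
 proof -
  have "(%k. rho ^ k) ----> 0" using rho by (intro LIMSEQ_power_zero) auto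
  then have "\<forall>\<^sub>F k in sequentially. rho ^ k < \<epsilon> / 2" using that by (intro order_tendstoD) auto
  then obtain k where k: "rho ^ k < \<epsilon> / 2" by (auto simp: eventually_sequentially)
  obtain C K where C: "finite C" "0 \<le> K" "!!p. p \<in> K0 ==> norm (low k p) \<le> K * (\<Sum>c\<in>C. cmod (cinner c p))"
   unfolding K0_def using low_finite_rank[of "{j e, j (cconj e)}" k] by blast
  define m where "m = K * (card C + 1) + 1"
  define \<delta> where "\<delta> = \<epsilon> / (2 * m)"
  have pos: "0 < m" using C(2) by (simp add: m_def add_nonneg_pos)
  then have "0 < \<delta>" using that pos by (simp add: \<delta>_def)
  have "\<exists>n. \<forall>x\<in>insert vac C. \<forall>z\<in>insert vac C. cmod (cinner z (E.calc (%s. cayley s ^ n) x)) < \<delta>"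
   using C(1) \<open>0 < \<delta>\<close> E_null by (intro E.wiener) auto
  then obtain n where n: "!!c. c \<in> C ==> cmod (cinner c (u n vac)) < \<delta>" by (auto simp: u_def)
  have "norm (low k (u n vac)) \<le> K * (\<Sum>c\<in>C. cmod (cinner c (u n vac)))" by (rule C(3)[OF uK])
  also have "\<dots> \<le> K * (\<Sum>c\<in>C. \<delta>)" using n C(2) by (intro mult_left_mono sum_mono) (auto intro: less_imp_le)
  also have "\<dots> \<le> m * \<delta>" using C(2) \<open>0 < \<delta>\<close> by (simp add: m_def algebra_simps)
  also have "\<dots> = \<epsilon> / 2" using pos by (simp add: \<delta>_def)
  finally have "norm (low k (u n vac)) \<le> \<epsilon> / 2" .
  moreover have "norm (num rho (u n vac)) \<le> norm (low k (u n vac)) + rho ^ k * 1"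
   using num_rho_le[of "u n vac" k] by (simp add: u_iso)
  ultimately show ?thesis using k by (intro exI[of _ n]) argo
 qed
 define \<xi> where "\<xi> = x vac"
 have "cinner \<xi> (cre f (A vac)) = 0" if A: "A \<in> M" for A
 proof (rule ccontr)
  define \<zeta> where "\<zeta> = cre f (A vac)"
  define B where "B = cmod (cinner \<xi> \<zeta>)"
  assume "cinner \<xi> (cre f (A vac)) \<noteq> 0"
  then have B: "0 < B" by (simp add: B_def \<zeta>_def)
  \<comment> \<open>x commutes with y by assumption and with \<open>y'\<close> as an element of M,
    which transports the equality of orbits from the vacuum to \<open>x vac\<close>.\<close>
  have u\<xi>: "u n \<xi> = u' n \<xi>" for n
  proof -
   have "u n \<xi> = x (u n vac)" unfolding u_def \<xi>_def by (intro comm[symmetric] xb x(2) pow)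
   also have "\<dots> = x (u' n vac)" by (simp add: u_vac)
   also have "\<dots> = u' n \<xi>" unfolding u'_def \<xi>_def by (intro comm' xb M_M'[OF x(1) y'_M'] pow)
   finally show ?thesis .
  qed
  have u\<zeta>: "u' n \<zeta> = cre f (A (u n vac))" for n
  proof -
   have "u' n \<zeta> = cre f (u' n (A vac))"
    unfolding u'_def \<zeta>_def by (intro comm'[symmetric] cre_bounded can_y'[OF f] pow)
   also have "u' n (A vac) = A (u' n vac)"
    unfolding u'_def by (intro comm'[symmetric] M_bounded[OF A] M_M'[OF A y'_M'] pow)
   finally show ?thesis by (simp add: u_vac)
  qed
  obtain K where K: "0 \<le> K" "!!v. norm (A v) \<le> K * norm v"
   using clinear_bound[OF M_bounded[OF A]] by blast
  have "\<xi> \<in> closure {R vac | R. good R}" unfolding good_dense ..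
  \<comment> \<open>The tolerance limits the error of the replacement to B / 2; the summand 1 keeps
    the denominator positive.\<close>
  then obtain R where R: "good R" "dist (R vac) \<xi> < B / (2 * (norm \<zeta> + 1))"
   using B unfolding closure_approachable by (smt (verit) mem_Collect_eq norm_ge_zero zero_less_divide_iff)
  obtain D where D: "!!w. can f w = 0 ==> norm (can f (R w)) \<le> D * norm (num rho w)"
   using R(1) unfolding good_def by blast
  have RM: "R \<in> commutant M" "bounded_clinear R" using R(1) commutant_bounded by (auto simp: good_def)
  define m where "m = (\<bar>D\<bar> + 1) * (K + 1)"
  have m: "0 < m" using K(1) by (simp add: m_def add_nonneg_pos)
  then obtain n where n: "norm (num rho (u n vac)) < B / (2 * m)" using small[of "B / (2 * m)"] B by auto
  have uR: "u n (R vac) = R (u n vac)"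
   unfolding u_def by (intro comm[symmetric] RM M_M'[OF y_M RM(1), symmetric] pow)
  have ub: "bounded_clinear (u n)" unfolding u_def by (rule E.bounded_calc[OF pow])
  have 1: "cmod (cinner (u n (\<xi> - R vac)) (u' n \<zeta>)) \<le> B / 2"
  proof -
   have "cmod (cinner (u n (\<xi> - R vac)) (u' n \<zeta>)) \<le> norm (\<xi> - R vac) * norm \<zeta>"
    using cinner_Cauchy_Schwarz[of "u n (\<xi> - R vac)" "u' n \<zeta>"] by (simp add: u_iso u'_norm)
   also have "\<dots> \<le> B / (2 * (norm \<zeta> + 1)) * (norm \<zeta> + 1)"
    using R(2) B by (intro mult_mono) (auto simp: dist_norm norm_minus_commute)
   also have "\<dots> = B / 2" using norm_ge_zero[of \<zeta>] by (simp add: divide_simps add_nonneg_eq_0_iff)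
   finally show ?thesis .
  qed
  have 2: "cmod (cinner (R (u n vac)) (u' n \<zeta>)) < B / 2"
  proof -
   have "cmod (cinner (R (u n vac)) (u' n \<zeta>)) = cmod (cinner (can f (R (u n vac))) (A (u n vac)))"
    by (simp add: u\<zeta> cinner_can)
   also have "\<dots> \<le> norm (can f (R (u n vac))) * norm (A (u n vac))" by (rule cinner_Cauchy_Schwarz)
   also have "\<dots> \<le> ((\<bar>D\<bar> + 1) * norm (num rho (u n vac))) * (K + 1)"
   proof (rule mult_mono)
    have "D * norm (num rho (u n vac)) \<le> (\<bar>D\<bar> + 1) * norm (num rho (u n vac))"
     by (intro mult_right_mono) auto
    then show "norm (can f (R (u n vac))) \<le> (\<bar>D\<bar> + 1) * norm (num rho (u n vac))"
     using D[OF can_u, of n] by linarith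
    show "norm (A (u n vac)) \<le> K + 1" using K(2)[of "u n vac"] by (simp add: u_iso)
   qed (use K in auto)
   also have "\<dots> = m * norm (num rho (u n vac))" by (simp add: m_def mult_ac)
   also have "\<dots> < m * (B / (2 * m))" by (rule mult_strict_left_mono[OF n m])
   also have "\<dots> = B / 2" using m by simp
   finally show ?thesis .
  qed
  have "cinner \<xi> \<zeta> = cinner (u n \<xi>) (u' n \<zeta>)" by (simp add: u\<xi> u'_iso)
  also have "\<dots> = cinner (u n (\<xi> - R vac)) (u' n \<zeta>) + cinner (R (u n vac)) (u' n \<zeta>)"
   by (simp add: clinear_diff[OF ub] uR cinner.diff_left)
  finally have "B \<le> cmod (cinner (u n (\<xi> - R vac)) (u' n \<zeta>)) + cmod (cinner (R (u n vac)) (u' n \<zeta>))"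
   unfolding B_def by (metis norm_triangle_ineq)
  then show False using 1 2 by linarith
 qed
 then have "cinner (can f \<xi>) (A vac) = 0" if "A \<in> M" for A using that by (simp add: cinner_can)
 then show ?thesis unfolding \<xi>_def by (intro corthogonal_to_dense[OF M_cyclic]) auto
qed

end

section \<open>The relative commutant of the centralizer\<close>

lemma relative_commutant_annihilated:
 assumes x: "x \<in> M" "x \<in> commutant (centralizer M vac)" and e: "block e t"
  and f: "cinner f (j e) = 0" "cinner f (j (cconj e)) = 0"
 shows "can f (x vac) = 0"
proof -
 \<comment> \<open>By \<open>field_kernel\<close> the kernel condition holds for e or for its
   conjugate, and the conditions on f are symmetric in the two.\<close>
 obtain e' t' where e': "block e' t'" "e' \<in> {e, cconj e}" "!!v. lf (cconj e') v = 0 ==> v = 0"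
  using field_kernel[OF e] e block_cconj[OF e] by fastforce
 show ?thesis
 proof (rule mixing[OF e'(1,3) x(1)])
  show "x (y e' v) = y e' (x v)" for v using commutant_commute[OF x(2) y_centralizer[OF e'(1,3)]] .
 qed (use e'(2) f in auto)
qed

text \<open>Let K consist of the letters annihilating \<open>x vac\<close>. The second block puts
  the letters of the first into K, since they are orthogonal to it. A vector orthogonal to K is then
  orthogonal to the first block, so it lies in K and is zero.\<close>

theorem relative_commutant_trivial:
 assumes e: "block e t" "block e' t'" and orth: "cinner e e' = 0" "cinner e (cconj e') = 0"
  and x: "x \<in> M" "x \<in> commutant (centralizer M vac)"
 shows "x \<in> scalar_operators"
proof -
 note ann = relative_commutant_annihilated[OF x]
 define K where "K = {f. can f (x vac) = 0}"
 have "cinner (cconj e) e' = 0" "cinner (cconj e) (cconj e') = 0"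
  using orth by (simp_all add: cinner_cconj_left)
 then have je: "j e \<in> K" "j (cconj e) \<in> K"
  using orth block_j[OF e(1)] block_j[OF block_cconj[OF e(1)]] by (auto simp: K_def intro!: ann[OF e(2)])
 have K: "csubspace K" unfolding csubspace_def subspace_def K_def scaleR_scaleC
  using can_scaleC[of 0 0] by (auto simp: can_add can_scaleC)
 have "closed K"
  using closed_subspace_vimage(1)[OF bounded_linear_can closed_singleton subspace_single_0] by (simp add: K_def)
 then have "K = UNIV"
 proof (rule csubspace_all_if_complement_trivial)
  show "subspace K" using K by (simp add: csubspace_def)
  fix v
  assume "!!s. s \<in> K ==> inner v s = 0"
  then have v: "cinner v s = 0" if "s \<in> K" for s using corthogonal_if_orthogonal[OF K] that by blast
  then have "v \<in> K" using je ann[OF e(1)] by (simp add: K_def)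
  from v[OF this] show "v = 0" by (simp add: cinner_self)
 qed
 then have "can f (x vac) = 0" for f by (auto simp: K_def)
 then obtain c where "x vac = c *C vac" by (rule vacuum_vector)
 then show ?thesis using separating[OF x(1)] by (auto simp: scalar_operators_def)
qed

end

section \<open>The almost periodic part\<close>

context orthogonal_flow
begin

text \<open>Invariant lines are the degenerate planes with \<open>g = 0\<close> and \<open>l = 1\<close>.\<close>

definition ap_block :: "'a \<Rightarrow> 'a \<Rightarrow> real \<Rightarrow> bool"
 where "ap_block f g l \<longleftrightarrow> inner f f = 1 \<and> (g = 0 \<and> l = 1 \<or> 0 < l \<and> l < 1 \<and> inner g g = 1 \<and> inner f g = 0) \<and>
  (\<forall>t. U t f = cos (t * ln l) *\<^sub>R f + sin (t * ln l) *\<^sub>R g \<and> U t g = - sin (t * ln l) *\<^sub>R f + cos (t * ln l) *\<^sub>R g)"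

lemma ap_block_line: "inner d d = 1 ==> (!!t. U t d = d) ==> ap_block d 0 1" by (simp add: ap_block_def U_lin)

lemma character_cos_sin: "character t r = Complex (cos (t * r)) (sin (t * r))"
 by (simp add: character_def complex_eq_iff Re_exp Im_exp flip: of_real_mult)

text \<open>The minus sign appears because f + \<i> g is multiplied by the conjugate of the rotation
  phase.\<close>

lemma ap_block_eigenvector: "ap_block f g l ==> V t (Complexify f g) = character t (- ln l) *C Complexify f g"
 by (simp add: ap_block_def V_Complexify character_cos_sin scaleC_complexification_def algebra_simps)

lemma eigenvector_ap_block:
 assumes z: "Complexify a b \<noteq> 0" and V: "!!t. V t (Complexify a b) = character t r *C Complexify a b"
 obtains f g l where "ap_block f g l" "f \<in> span {a, b}" "g \<in> span {a, b}"
proof -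
 have Ua: "U t a = cos (t * r) *\<^sub>R a - sin (t * r) *\<^sub>R b" and Ub: "U t b = sin (t * r) *\<^sub>R a + cos (t * r) *\<^sub>R b" for t
  using V[of t] by (simp_all add: V_Complexify character_cos_sin scaleC_complexification_def algebra_simps)
 have nz: "a \<noteq> 0 \<or> b \<noteq> 0" using z by (auto simp: zero_complexification_def)
 have ab: "a \<in> span {a, b}" "b \<in> span {a, b}" by (simp_all add: span_base)
 show thesis
 proof (cases "r = 0")
  case True
  obtain c where c: "c \<noteq> 0" "c \<in> span {a, b}" "!!t. U t c = c" using nz Ua Ub ab True by force
  have "ap_block ((1 / norm c) *\<^sub>R c) 0 1"
   using c by (intro ap_block_line) (simp_all add: U_lin power2_norm_eq_inner[symmetric] power2_eq_square[symmetric] power_divide)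
  then show thesis using c(2) that[of "(1 / norm c) *\<^sub>R c" 0 1] by (simp add: span_scale span_zero)
 next
  case False
  \<comment> \<open>A quarter period: the flow maps a to -b and b to a, so the two parts have equal
    norm and are orthogonal.\<close>
  define t where "t = pi / (2 * r)"
  have tr: "t * r = pi / 2" using False by (simp add: t_def)
  have "U t a = - b" "U t b = a" unfolding Ua[of t] Ub[of t] tr by simp_all
  then have n: "inner b b = inner a a" "inner a b = 0"
   using U_inner_eq[of t a a] U_inner_eq[of t a b] by (simp_all add: inner_commute)
  then have a: "inner a a \<noteq> 0" using nz by auto
  \<comment> \<open>The orientation is chosen so that \<open>ln l\<close> is -|r|, hence l < 1;
    reversing it replaces g by -g.\<close>
  define s where "s = - sgn r"
  define l where "l = exp (s * r)"
  have s: "s * s = 1" "sin (t * (s * r)) = s * sin (t * r)" "cos (t * (s * r)) = cos (t * r)" for t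
   using False by (auto simp: s_def sgn_if)
  have l: "0 < l" "l < 1" "ln l = s * r" using False by (auto simp: l_def s_def sgn_if)
  define f where "f = (1 / norm a) *\<^sub>R a"
  define g where "g = - (s / norm a) *\<^sub>R b"
  have nn: "inner a a = norm a * norm a" "inner b b = norm a * norm a"
   using n(1) by (simp_all add: dot_square_norm power2_eq_square)
  have "inner g g = (s * s) * (inner b b / (norm a * norm a))" by (simp add: g_def)
  then have "inner f f = 1" "inner g g = 1" "inner f g = 0"
   using a n(2) by (simp_all add: f_def g_def nn s(1) del: mult_minus_left)
  moreover have "U t f = cos (t * ln l) *\<^sub>R f + sin (t * ln l) *\<^sub>R g" "U t g = - sin (t * ln l) *\<^sub>R f + cos (t * ln l) *\<^sub>R g" for t
   using s(1) by (simp_all add: l(3) s(2,3) f_def g_def U_lin Ua Ub scaleR_add_right scaleR_diff_right)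
  ultimately have "ap_block f g l" using l by (simp add: ap_block_def)
  then show thesis using that[of f g l] ab by (simp add: f_def g_def span_scale span_neg)
 qed
qed

text \<open>The components a and b of the block in the complement of K rotate as the block does.
  They are recovered from their images with coefficients of modulus at most 1, so these images
  cannot all be nearly orthogonal to a and b, as weak mixing would allow.\<close>

lemma ap_block_mixing:
 assumes blk: "ap_block f g l" and K: "closed K" "subspace K" "!!t x. x \<in> K ==> U t x \<in> K"
  and wm: "weakly_mixing_on U (orthogonal_comp K)"
 shows "f \<in> K" "g \<in> K"
proof -
 have proj: "\<exists>p\<in>K. x - p \<in> orthogonal_comp K" for x
  using projection_exists[OF K(1,2), of x] by (auto simp: orthogonal_comp_def orthogonal_def inner_commute)
 obtain p r where p: "p \<in> K" "f - p \<in> orthogonal_comp K" and r: "r \<in> K" "g - r \<in> orthogonal_comp K"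
  using proj by blast
 define a where "a = f - p"
 define b where "b = g - r"
 define c where "c t = cos (t * ln l)" for t
 define s where "s t = sin (t * ln l)" for t
 note comp = subspace_orthogonal_comp[of K]
 have UK: "U t x \<in> orthogonal_comp K" if "x \<in> orthogonal_comp K" for t x
  using that K(3) by (simp add: orthogonal_comp_def orthogonal_def) (metis U_adj inner_commute)
 have Uf: "U t f = c t *\<^sub>R f + s t *\<^sub>R g" "U t g = - s t *\<^sub>R f + c t *\<^sub>R g" for t
  using blk by (simp_all add: ap_block_def c_def s_def)
 have zero: "u = 0" if "u \<in> K" "u \<in> orthogonal_comp K" for u
  using that by (auto simp: orthogonal_comp_def orthogonal_def)
 have "U t p - (c t *\<^sub>R p + s t *\<^sub>R r) = 0" for t
 proof (rule zero)
  show "U t p - (c t *\<^sub>R p + s t *\<^sub>R r) \<in> K"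
   using K p r by (intro subspace_diff subspace_add subspace_scale) auto
  have "U t p - (c t *\<^sub>R p + s t *\<^sub>R r) = (c t *\<^sub>R a + s t *\<^sub>R b) - U t a"
   by (simp add: a_def b_def U_lin Uf algebra_simps)
  also have "\<dots> \<in> orthogonal_comp K"
   using p r by (intro subspace_diff subspace_add subspace_scale comp UK) (auto simp: a_def b_def)
  finally show "U t p - (c t *\<^sub>R p + s t *\<^sub>R r) \<in> orthogonal_comp K" .
 qed
 then have Ua: "U t a = c t *\<^sub>R a + s t *\<^sub>R b" for t by (simp add: a_def b_def U_lin Uf algebra_simps)
 have "U t r - (- s t *\<^sub>R p + c t *\<^sub>R r) = 0" for t
 proof (rule zero)
  show "U t r - (- s t *\<^sub>R p + c t *\<^sub>R r) \<in> K"
   using K p r by (intro subspace_diff subspace_add subspace_scale) auto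
  have "U t r - (- s t *\<^sub>R p + c t *\<^sub>R r) = (- s t *\<^sub>R a + c t *\<^sub>R b) - U t b"
   by (simp add: a_def b_def U_lin Uf algebra_simps)
  also have "\<dots> \<in> orthogonal_comp K"
   using p r by (intro subspace_diff subspace_add subspace_scale comp UK) (auto simp: a_def b_def)
  finally show "U t r - (- s t *\<^sub>R p + c t *\<^sub>R r) \<in> orthogonal_comp K" .
 qed
 then have Ub: "U t b = - s t *\<^sub>R a + c t *\<^sub>R b" for t by (simp add: a_def b_def U_lin Uf algebra_simps)
 have "x = 0" if x: "x \<in> {a, b}" for x
 proof (rule ccontr)
  assume "x \<noteq> 0"
  then have pos: "0 < inner x x / 2" by simp
  have "finite {a, b}" "{a, b} \<subseteq> orthogonal_comp K" using p r by (auto simp: a_def b_def)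
  then obtain t where t: "!!v w. v \<in> {a, b} ==> w \<in> {a, b} ==> \<bar>inner (U t v) w\<bar> < inner x x / 2"
   using wm pos unfolding weakly_mixing_on_def by meson
  have cs: "c t * c t + s t * s t = 1" "\<bar>c t\<bar> \<le> 1" "\<bar>s t\<bar> \<le> 1"
   using sin_cos_squared_add2[of "t * ln l"] by (auto simp: c_def s_def power2_eq_square)
  have "a = c t *\<^sub>R U t a - s t *\<^sub>R U t b" "b = s t *\<^sub>R U t a + c t *\<^sub>R U t b"
   unfolding Ua Ub using cs(1) by (simp_all add: algebra_simps flip: scaleR_add_left)
  then have "\<exists>\<alpha> \<beta>. \<bar>\<alpha>\<bar> \<le> 1 \<and> \<bar>\<beta>\<bar> \<le> 1 \<and> x = \<alpha> *\<^sub>R U t a + \<beta> *\<^sub>R U t b"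
   using x cs(2,3) by (metis abs_minus_cancel diff_conv_add_uminus insertE scaleR_minus_left singletonD)
  then obtain \<alpha> \<beta> where \<alpha>: "\<bar>\<alpha>\<bar> \<le> 1" "\<bar>\<beta>\<bar> \<le> 1" "x = \<alpha> *\<^sub>R U t a + \<beta> *\<^sub>R U t b" by blast
  have "inner x x = \<alpha> * inner (U t a) x + \<beta> * inner (U t b) x"
   by (subst (1) \<alpha>(3)) (simp add: inner_add_left)
  also have "\<dots> \<le> \<bar>\<alpha>\<bar> * \<bar>inner (U t a) x\<bar> + \<bar>\<beta>\<bar> * \<bar>inner (U t b) x\<bar>"
   by (metis abs_ge_self abs_mult add_mono)
  also have "\<dots> \<le> \<bar>inner (U t a) x\<bar> + \<bar>inner (U t b) x\<bar>"
   using \<alpha> by (intro add_mono mult_left_le_one_le) auto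
  also have "\<dots> < inner x x" using t[of a x] t[of b x] x by auto
  finally show False by simp
 qed
 from this[of a] this[of b] show "f \<in> K" "g \<in> K" using p r by (auto simp: a_def b_def)
qed

section \<open>Maximal orthogonal families of blocks\<close>

definition ap_compatible :: "'a \<times> 'a \<times> real \<Rightarrow> 'a \<times> 'a \<times> real \<Rightarrow> bool"
 where "ap_compatible = (%(f, g, l) (f', g', l'). ap_block f g l \<and>
  ((f, g, l) \<noteq> (f', g', l') \<longrightarrow> inner f f' = 0 \<and> inner f g' = 0 \<and> inner g f' = 0 \<and> inner g g' = 0))"

text \<open>A condition on pairs, so that it passes to unions of chains; pairing a member with
  itself says that it is a block.\<close>

definition ap_family :: "('a \<times> 'a \<times> real) set \<Rightarrow> bool"
 where "ap_family S \<longleftrightarrow> (\<forall>p\<in>S. \<forall>p'\<in>S. ap_compatible p p')"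

lemma ap_family_block: "ap_family S ==> (f, g, l) \<in> S ==> ap_block f g l"
 by (force simp: ap_family_def ap_compatible_def)

lemma ap_family_orthogonal: "ap_family S ==> (f, g, l) \<in> S ==> (f', g', l') \<in> S ==> (f, g, l) \<noteq> (f', g', l') ==>
  inner f f' = 0 \<and> inner f g' = 0 \<and> inner g f' = 0 \<and> inner g g' = 0"
 by (force simp: ap_family_def ap_compatible_def)

definition ap_vectors :: "('a \<times> 'a \<times> real) set \<Rightarrow> 'a set"
 where "ap_vectors S = (%(f, g, l). f) ` S \<union> (%(f, g, l). g) ` S"

lemma ap_vectors_I: "(f, g, l) \<in> S ==> f \<in> ap_vectors S" "(f, g, l) \<in> S ==> g \<in> ap_vectors S"
 by (force simp: ap_vectors_def)+

lemma maximal_ap_family: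
 obtains S where "ap_family S" "!!f g l. ap_family (insert (f, g, l) S) ==> (f, g, l) \<in> S"
proof -
 have "\<exists>S\<in>Collect ap_family. \<forall>X\<in>Collect ap_family. S \<subseteq> X \<longrightarrow> X = S"
 proof (rule subset_Zorn_nonempty)
  show "Collect ap_family \<noteq> {}" by (auto simp: ap_family_def intro!: exI[of _ "{}"])
  fix \<C>
  assume \<C>: "\<C> \<noteq> {}" "subset.chain (Collect ap_family) \<C>"
  have "\<exists>S\<in>\<C>. p \<in> S \<and> p' \<in> S" if pp: "p \<in> \<Union>\<C>" "p' \<in> \<Union>\<C>" for p p'
  proof -
   obtain X Y where "X \<in> \<C>" "p \<in> X" "Y \<in> \<C>" "p' \<in> Y" using pp by blast
   moreover from this have "X \<subseteq> Y \<or> Y \<subseteq> X" using \<C>(2) by (auto simp: subset.chain_def)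
   ultimately show ?thesis by blast
  qed
  moreover have "!!S. S \<in> \<C> ==> ap_family S" using \<C>(2) by (auto simp: subset.chain_def)
  ultimately show "\<Union>\<C> \<in> Collect ap_family" unfolding ap_family_def by blast
 qed
 then show thesis using that by (metis insertI1 mem_Collect_eq subset_insertI)
qed

text \<open>A spectral atom of a vector orthogonal to the family would give an eigenvector and hence
  a further block orthogonal to the others, against maximality. Without atoms Wiener's lemma makes
  the matrix coefficients small at some integer time.\<close>

lemma weakly_mixing_complement:
 assumes S: "ap_family S" "!!f g l. ap_family (insert (f, g, l) S) ==> (f, g, l) \<in> S"
 shows "weakly_mixing_on U (orthogonal_comp (closure (span (ap_vectors S))))"
 unfolding weakly_mixing_on_def
proof (intro allI impI)
 fix F :: "'a set" and \<epsilon> :: real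
 assume F: "finite F" "F \<subseteq> orthogonal_comp (closure (span (ap_vectors S)))" "0 < \<epsilon>"
 have point: "spec {s} (of_real_vector x) = 0" if x: "x \<in> F" for x s
 proof (rule ccontr)
  assume nz: "spec {s} (of_real_vector x) \<noteq> 0"
  obtain a b where z: "spec {s} (of_real_vector x) = Complexify a b" by (meson complexification.exhaust)
  have "V t (spec {s} (of_real_vector x)) = character t s *C spec {s} (of_real_vector x)" for t
  proof -
   have "V t (spec {s} (of_real_vector x)) = spec.calc (%r. character t r * indicator {s} r) (of_real_vector x)"
    using spec.E_calc_commute[of "{s}" "character t"] by (simp add: spec(2))
   also have "(%r. character t r * indicator {s} r) = (%r. character t s * indicator {s} r)"
    by (auto simp: indicator_def)
   finally show ?thesis by (simp add: spec.calc_cmul spec.calc_indicator)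
  qed
  then obtain f g l where f: "ap_block f g l" "f \<in> span {a, b}" "g \<in> span {a, b}"
   using eigenvector_ap_block[of a b s] nz unfolding z by metis
  \<comment> \<open>The spectral projection at s is self-adjoint and maps the eigenvector of an old
    block to itself or to 0, so orthogonality to the old block passes from x to its
    projection.\<close>
  have orth: "inner v w = 0" if "v \<in> span {a, b}" "w \<in> ap_vectors S" for v w
  proof -
   obtain f' g' l' where w: "(f', g', l') \<in> S" "w \<in> {f', g'}"
    using \<open>w \<in> ap_vectors S\<close> by (auto simp: ap_vectors_def)
   define e where "e = Complexify f' g'"
   have V: "V t e = character t (- ln l') *C e" for t
    unfolding e_def by (rule ap_block_eigenvector[OF ap_family_block[OF S(1) w(1)]])
   have V': "V t (cconj e) = character t (ln l') *C cconj e" for t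
    by (simp add: V_cconj V character_cnj character_minus[symmetric])
   have "f' \<in> closure (span (ap_vectors S))" "g' \<in> closure (span (ap_vectors S))"
    by (intro subsetD[OF closure_subset] span_base ap_vectors_I[OF w(1)])+
   then have x0: "inner f' x = 0" "inner g' x = 0"
    using F(2) x by (auto simp: orthogonal_comp_def orthogonal_def)
   have "cinner e' (Complexify a b) = 0"
    if "!!t. V t e' = character t r *C e'" "cinner e' (of_real_vector x) = 0" for e' r
   proof -
    have "cinner e' (Complexify a b) = cinner (spec {s} e') (of_real_vector x)"
     unfolding z[symmetric] using pvm_adj[OF spec.E, of "{s}"] by simp
    also have "spec {s} e' = indicator {s} r *C e'"
     using spec.calc_eigenvector[of e' r "indicator {s}"] that(1) by (simp add: spec(2)[symmetric] spec.calc_indicator)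
    finally show ?thesis using that(2) by (simp add: cinner_scaleC_left)
   qed
   from this[OF V] this[OF V'] have "inner u v = 0" if "u \<in> {f', g'}" "v \<in> {a, b}" for u v
    using that x0 by (auto simp: e_def cconj_def cinner_complexification_def complex_eq_iff)
   then have "orthogonal w v"
    using w(2) \<open>v \<in> span {a, b}\<close> by (intro orthogonal_to_span[of v "{a, b}"]) (auto simp: orthogonal_def)
   then show ?thesis by (simp add: orthogonal_def inner_commute)
  qed
  have fg: "inner f w = 0 \<and> inner g w = 0 \<and> inner w f = 0 \<and> inner w g = 0" if "w \<in> ap_vectors S" for w
   using orth[OF f(2) that] orth[OF f(3) that] by (simp add: inner_commute)
  have new: "inner f f' = 0 \<and> inner f g' = 0 \<and> inner g f' = 0 \<and> inner g g' = 0 \<and>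
    inner f' f = 0 \<and> inner g' f = 0 \<and> inner f' g = 0 \<and> inner g' g = 0" if "(f', g', l') \<in> S" for f' g' l'
   using fg[OF ap_vectors_I(1)[OF that]] fg[OF ap_vectors_I(2)[OF that]] by simp
  have "ap_compatible p (f, g, l)" "ap_compatible (f, g, l) p" if "p \<in> S" for p
   using that f(1) new ap_family_block[OF S(1)] by (auto simp: ap_compatible_def)
  moreover have "ap_compatible (f, g, l) (f, g, l)" using f(1) by (simp add: ap_compatible_def)
  ultimately have "ap_family (insert (f, g, l) S)" using S(1) by (auto simp: ap_family_def)
  then have "(f, g, l) \<in> S" by (rule S(2))
  \<comment> \<open>As a member of the family the new block would be orthogonal to itself.\<close>
  then show False using new f(1) by (auto simp: ap_block_def)
 qed
 \<comment> \<open>Powers of the character at time 1 give the flow at integer times. Its level sets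
   are countable, so they are null once single points are.\<close>
 define \<phi> where "\<phi> = character 1"
 have "\<exists>n. \<forall>x\<in>of_real_vector ` F. \<forall>y\<in>of_real_vector ` F. cmod (cinner y (spec.calc (%s. \<phi> s ^ n) x)) < \<epsilon>"
 proof (rule spec.wiener[OF _ F(3)])
  fix x w
  assume "x \<in> of_real_vector ` F"
  then have pt: "spec {s} x = 0" for s using point by auto
  define B where "B = {s. \<phi> s = w}"
  have "countable B"
  proof (cases "B = {}")
   case False
   then obtain s0 where s0: "\<phi> s0 = w" by (auto simp: B_def)
   have "B \<subseteq> range (%n :: int. s0 + 2 * pi * of_int n)"
   proof
    fix s
    assume "s \<in> B"
    then have "exp (\<i> * of_real s) = exp (\<i> * of_real s0)"
     using s0 by (simp add: B_def \<phi>_def character_def)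
    then obtain n :: int where "\<i> * of_real s = \<i> * of_real s0 + of_int (2 * n) * of_real pi * \<i>"
     unfolding exp_eq by auto
    then have "s = s0 + 2 * pi * of_int n" by (simp add: complex_eq_iff)
    then show "s \<in> range (%n :: int. s0 + 2 * pi * of_int n)" by blast
   qed
   then show ?thesis by (rule countable_subset) simp
  qed simp
  have "(\<Union>s\<in>B. {s}) \<in> null_sets (spec.sd x)" using \<open>countable B\<close> pt
   by (intro null_sets_UN') (auto simp: null_sets_def emeasure_spectral_distribution[OF spec.E] cinner.zero_right)
  then have "measure (spec.sd x) B = 0" "B \<in> sets borel" by (auto simp: null_sets_def measure_def)
  then show "spec {s. \<phi> s = w} x = 0" by (simp add: spec.measure_sd B_def)
 qed (use F(1) in \<open>simp_all add: \<phi>_def\<close>)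
 then obtain n where n: "!!x y. x \<in> F ==> y \<in> F ==> cmod (cinner (of_real_vector y) (spec.calc (%s. \<phi> s ^ n) (of_real_vector x))) < \<epsilon>"
  by blast
 have "(%s. \<phi> s ^ n) = character (real n)"
  by (simp add: fun_eq_iff \<phi>_def character_def exp_of_nat_mult[symmetric] mult_ac)
 then have "cinner (of_real_vector y) (spec.calc (%s. \<phi> s ^ n) (of_real_vector x)) = of_real (inner (U (real n) x) y)" for x y
  by (simp add: spec(2)[symmetric] V_Complexify U_lin cinner_complexification_def complex_eq_iff inner_commute)
 then have "\<forall>x\<in>F. \<forall>y\<in>F. \<bar>inner (U (real n) x) y\<bar> < \<epsilon>" using n by simp
 then show "\<exists>t. \<forall>x\<in>F. \<forall>y\<in>F. \<bar>inner (U t x) y\<bar> < \<epsilon>" ..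
qed

end

section \<open>Existence and uniqueness of the almost periodic decomposition\<close>

lemma orthonormal_countable:
 fixes X :: "'a::real_inner set"
 assumes D: "countable D" "closure D = (UNIV :: 'a set)"
  and X: "!!x. x \<in> X ==> inner x x = 1" "!!x y. x \<in> X ==> y \<in> X ==> x \<noteq> y ==> inner x y = 0"
 shows "countable X"
proof -
 have "\<forall>x. \<exists>d\<in>D. dist d x < 1 / 2"
  using D(2) closure_approachable[of _ D] by (metis UNIV_I half_gt_zero zero_less_one)
 then obtain h where h: "!!x. h x \<in> D" "!!x. dist (h x) x < 1 / 2" by metis
 \<comment> \<open>Distinct orthonormal vectors have distance sqrt 2, so they cannot both lie within
   1/2 of the same point of D.\<close>
 have "inj_on h X"
 proof (rule inj_onI, rule ccontr)
  fix x y
  assume xy: "x \<in> X" "y \<in> X" "h x = h y" "x \<noteq> y"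
  have "dist x y < 1" using dist_triangle3[of x y "h x"] h(2)[of x] h(2)[of y] xy(3) by simp
  then have "(norm (x - y))\<^sup>2 < 1" by (simp add: dist_norm power_less_one_iff)
  then show False using X(1)[OF xy(1)] X(1)[OF xy(2)] X(2)[OF xy(1,2,4)]
   by (simp add: power2_norm_eq_inner inner_diff_left inner_diff_right inner_commute)
 qed
 moreover have "countable (h ` X)" using h(1) by (intro countable_subset[OF _ D(1)]) auto
 ultimately show ?thesis by (rule countable_image_inj_on[rotated])
qed

lemma countable_enumeration:
 assumes "countable X"
 obtains N :: enat and e where "bij_betw e {i. enat i < N} X"
proof (cases "finite X")
 case True
 then obtain e where "bij_betw e {0..<card X} X" using ex_bij_betw_nat_finite by blast
 then show thesis by (intro that[of e "enat (card X)"]) (simp add: atLeast0LessThan lessThan_def)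
next
 case False
 then show thesis using that[of "from_nat_into X" \<infinity>] bij_betw_from_nat_into[OF assms] by simp
qed

context orthogonal_flow
begin

lemma U_bounded: "bounded_linear (U t)"
 using U_inner_eq[of t] by (intro bounded_linear_intro[where K = 1]) (simp_all add: U_lin norm_eq_sqrt_inner)

lemma ap_decomposition_exists:
 assumes sep: "\<exists>D :: 'a set. countable D \<and> closure D = UNIV" and S: "ap_family S"
  and wm: "weakly_mixing_on U (orthogonal_comp (closure (span (ap_vectors S))))"
 shows "\<exists>N1 d N2 f g l. almost_periodic_decomposition U N1 d N2 f g l (closure (span (ap_vectors S)))"
proof -
 note blk = ap_family_block[OF S] and orth = ap_family_orthogonal[OF S]
 obtain D :: "'a set" where D: "countable D" "closure D = UNIV" using sep by blast
 have orth': "inner (fst p) (fst p') = 0 \<and> inner (fst p) (fst (snd p')) = 0 \<and> inner (fst (snd p)) (fst p') = 0 \<and>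
   inner (fst (snd p)) (fst (snd p')) = 0" if "p \<in> S" "p' \<in> S" "p \<noteq> p'" for p p'
  using orth[of "fst p" "fst (snd p)" "snd (snd p)" "fst p'" "fst (snd p')" "snd (snd p')"] that by simp
 have blk': "ap_block (fst p) (fst (snd p)) (snd (snd p))" if "p \<in> S" for p
  using that blk[of "fst p" "fst (snd p)" "snd (snd p)"] by simp
 have one: "inner (fst p) (fst p) = 1" if "p \<in> S" for p using blk'[OF that] by (simp add: ap_block_def)
 have "inj_on fst S" using one orth' by (metis inj_onI zero_neq_one)
 moreover have "countable (fst ` S)" using one orth' by (intro orthonormal_countable[OF D]) auto
 ultimately have "countable S" by (rule countable_image_inj_on[rotated])
 \<comment> \<open>The label l separates the lines, where it is 1, from the planes; each kind is
   then enumerated by an initial segment of the natural numbers.\<close>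
 define X where "X = {p \<in> S. snd (snd p) = 1}"
 define Y where "Y = {p \<in> S. snd (snd p) \<noteq> 1}"
 have "countable X" "countable Y" using \<open>countable S\<close> by (auto simp: X_def Y_def intro: countable_subset)
 obtain N1 :: enat and a where a: "bij_betw a {i. enat i < N1} X"
  using countable_enumeration[OF \<open>countable X\<close>] by blast
 obtain N2 :: enat and b where b: "bij_betw b {i. enat i < N2} Y"
  using countable_enumeration[OF \<open>countable Y\<close>] by blast
 have aX: "a i \<in> S" "snd (snd (a i)) = 1" "fst (snd (a i)) = 0" if "enat i < N1" for i
  using bij_betwE[OF a] blk'[of "a i"] that by (auto simp: X_def ap_block_def)
 have bY: "b k \<in> S" "snd (snd (b k)) \<noteq> 1" if "enat k < N2" for k
  using bij_betwE[OF b] that by (auto simp: Y_def)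
 have aa: "a i \<noteq> a i'" if "enat i < N1" "enat i' < N1" "i \<noteq> i'" for i i'
  using a that by (auto simp: bij_betw_def inj_on_def)
 have bb: "b i \<noteq> b i'" if "enat i < N2" "enat i' < N2" "i \<noteq> i'" for i i'
  using b that by (auto simp: bij_betw_def inj_on_def)
 have bblk: "0 < snd (snd (b k))" "snd (snd (b k)) < 1" "inner (fst (snd (b k))) (fst (snd (b k))) = 1" "inner (fst (b k)) (fst (snd (b k))) = 0"
   "U t (fst (b k)) = cos (t * ln (snd (snd (b k)))) *\<^sub>R fst (b k) + sin (t * ln (snd (snd (b k)))) *\<^sub>R fst (snd (b k))"
   "U t (fst (snd (b k))) = - sin (t * ln (snd (snd (b k)))) *\<^sub>R fst (b k) + cos (t * ln (snd (snd (b k)))) *\<^sub>R fst (snd (b k))"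
  if "enat k < N2" for k t using blk'[OF bY(1)[OF that]] bY(2)[OF that] by (auto simp: ap_block_def)
 have ab: "a i \<noteq> b k" if "enat i < N1" "enat k < N2" for i k
  using aX(2)[OF that(1)] bY(2)[OF that(2)] by auto
 let ?I = "{i. enat i < N1}" and ?J = "{k. enat k < N2}"
 let ?G = "(fst \<circ> a) ` ?I \<union> (fst \<circ> b) ` ?J \<union> (fst \<circ> snd \<circ> b) ` ?J"
 have "ap_vectors S = fst ` S \<union> (%p. fst (snd p)) ` S" by (auto simp: ap_vectors_def case_prod_unfold)
 moreover have "S = a ` ?I \<union> b ` ?J"
  using bij_betw_imp_surj_on[OF a] bij_betw_imp_surj_on[OF b] by (auto simp: X_def Y_def)
 ultimately have vec: "ap_vectors S = ?G \<union> (%i. fst (snd (a i))) ` ?I"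
  by (auto simp: image_Un image_image)
 have "span (ap_vectors S) = span ?G"
 proof (rule span_eq[THEN iffD2, OF conjI])
  show "ap_vectors S \<subseteq> span ?G" unfolding vec using aX(3) by (auto intro: span_base span_zero)
  show "?G \<subseteq> span (ap_vectors S)" unfolding vec by (auto intro: span_base)
 qed
 then have "almost_periodic_decomposition U N1 (fst \<circ> a) N2 (fst \<circ> b) (fst \<circ> snd \<circ> b) (snd \<circ> snd \<circ> b) (closure (span (ap_vectors S)))"
  unfolding almost_periodic_decomposition_def Let_def using wm
 proof (intro conjI)
  show "\<forall>i\<in>?I. \<forall>i'\<in>?I. inner ((fst \<circ> a) i) ((fst \<circ> a) i') = of_bool (i = i')"
   using one aX(1) orth' aa by auto
  show "\<forall>k\<in>?J. \<forall>k'\<in>?J. inner ((fst \<circ> b) k) ((fst \<circ> b) k') = of_bool (k = k') \<and>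
    inner ((fst \<circ> snd \<circ> b) k) ((fst \<circ> snd \<circ> b) k') = of_bool (k = k') \<and> inner ((fst \<circ> b) k) ((fst \<circ> snd \<circ> b) k') = 0"
  proof (intro ballI)
   fix k k'
   assume "k \<in> ?J" "k' \<in> ?J"
   then show "inner ((fst \<circ> b) k) ((fst \<circ> b) k') = of_bool (k = k') \<and>
    inner ((fst \<circ> snd \<circ> b) k) ((fst \<circ> snd \<circ> b) k') = of_bool (k = k') \<and> inner ((fst \<circ> b) k) ((fst \<circ> snd \<circ> b) k') = 0"
    using one[OF bY(1)] bblk(3,4) orth'[OF bY(1) bY(1) bb] by (cases "k = k'") auto
  qed
  show "\<forall>i\<in>?I. \<forall>k\<in>?J. inner ((fst \<circ> a) i) ((fst \<circ> b) k) = 0 \<and> inner ((fst \<circ> a) i) ((fst \<circ> snd \<circ> b) k) = 0"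
   using orth'[OF aX(1) bY(1) ab] by auto
  show "\<forall>i\<in>?I. \<forall>t. U t ((fst \<circ> a) i) = (fst \<circ> a) i"
   using blk'[OF aX(1)] aX(2,3) by (auto simp: ap_block_def)
 qed (use bblk in auto)
 then show ?thesis by blast
qed

text \<open>The sum K of the blocks is invariant with weakly mixing complement, so every block of
  the other decomposition lies in it. Used in both directions this gives uniqueness.\<close>

lemma ap_decomposition_subset:
 assumes A: "almost_periodic_decomposition U N1 d N2 f g l K" and B: "almost_periodic_decomposition U N1' d' N2' f' g' l' K'"
 shows "K' \<subseteq> K"
proof -
 have blocks: "(\<forall>i\<in>{i. enat i < N1}. ap_block (d i) 0 1) \<and> (\<forall>k\<in>{k. enat k < N2}. ap_block (f k) (g k) (l k))"
  if "almost_periodic_decomposition U N1 d N2 f g l K" for N1 N2 d f g l K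
  using that by (auto simp: almost_periodic_decomposition_def Let_def ap_block_def U_lin)
 have K_eq: "K = closure (span (d ` {i. enat i < N1} \<union> f ` {k. enat k < N2} \<union> g ` {k. enat k < N2}))"
  if "almost_periodic_decomposition U N1 d N2 f g l K" for N1 N2 d f g l K
  using that by (auto simp: almost_periodic_decomposition_def Let_def)
 let ?G = "d ` {i. enat i < N1} \<union> f ` {k. enat k < N2} \<union> g ` {k. enat k < N2}"
 have K: "closed K" "subspace K" unfolding K_eq[OF A] by (simp_all add: subspace_closure)
 have G: "v \<in> closure (span ?G)" if "v \<in> ?G" for v
  using that by (intro subsetD[OF closure_subset] span_base)
 have "U t v \<in> closure (span ?G)" if "v \<in> closure (span ?G)" for t v using _ that
 proof (rule closure_span_invariant[OF U_bounded])
  fix v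
  assume v: "v \<in> ?G"
  have sub: "subspace (closure (span ?G))" by (simp add: subspace_closure)
  have d: "U t (d i) = d i" if "enat i < N1" for i
   using A that by (simp add: almost_periodic_decomposition_def Let_def)
  have fg: "U t (f k) = cos (t * ln (l k)) *\<^sub>R f k + sin (t * ln (l k)) *\<^sub>R g k"
   "U t (g k) = - sin (t * ln (l k)) *\<^sub>R f k + cos (t * ln (l k)) *\<^sub>R g k" if "enat k < N2" for k
   using blocks[OF A] that by (auto simp: ap_block_def)
  consider i where "v = d i" "enat i < N1" | k where "v = f k \<or> v = g k" "enat k < N2" using v by blast
  then show "U t v \<in> closure (span ?G)"
  proof cases
   case 1
   then show ?thesis using G[OF v] d by simp
  next
   case 2
   then have "f k \<in> closure (span ?G)" "g k \<in> closure (span ?G)" by (auto intro!: G)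
   then have "a *\<^sub>R f k + b *\<^sub>R g k \<in> closure (span ?G)" for a b
    by (intro subspace_add[OF sub] subspace_scale[OF sub])
   then show ?thesis using 2 fg by metis
  qed
 qed
 then have inv: "U t v \<in> K" if "v \<in> K" for t v using that unfolding K_eq[OF A] .
 have wm: "weakly_mixing_on U (orthogonal_comp K)"
  using A unfolding almost_periodic_decomposition_def Let_def by blast
 note mem = ap_block_mixing[OF _ K inv wm]
 show ?thesis unfolding K_eq[OF B] using blocks[OF B] mem by (intro closure_span_minimal K) auto
qed

lemma almost_periodic_part_eq:
 assumes "almost_periodic_decomposition U N1 d N2 f g l K"
 shows "almost_periodic_part U = K" unfolding almost_periodic_part_def
proof (rule the_equality)
 show "\<exists>N1 d N2 f g l. almost_periodic_decomposition U N1 d N2 f g l K" using assms by blast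
 show "K' = K" if "\<exists>N1 d N2 f g l. almost_periodic_decomposition U N1 d N2 f g l K'" for K'
  using that ap_decomposition_subset[OF assms] ap_decomposition_subset[OF _ assms] by blast
qed

text \<open>The formula for the projection also covers zero vectors, since division by zero gives
  zero; the degenerate blocks have g = 0.\<close>

lemma closure_span_pair:
 fixes f g :: "'b::real_inner"
 assumes "inner f g = 0"
 shows "closure (span {f, g}) \<subseteq> span {f, g}"
proof -
 define D where "D v = v - ((f \<bullet> v / (f \<bullet> f)) *\<^sub>R f + (g \<bullet> v / (g \<bullet> g)) *\<^sub>R g)" for v
 have "bounded_linear D" unfolding D_def divide_inverse
  by (intro bounded_linear_sub bounded_linear_add bounded_linear_ident bounded_linear_compose[OF bounded_linear_scaleR_left]
    bounded_linear_mult_left[THEN bounded_linear_compose] bounded_linear_inner_right)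
 moreover have "{f, g} \<subseteq> {v. D v \<in> {0}}" using assms by (auto simp: D_def inner_commute)
 ultimately have "closure (span {f, g}) \<subseteq> {v. D v \<in> {0}}"
  by (intro closure_span_minimal closed_subspace_vimage closed_singleton subspace_single_0)
 moreover have "v \<in> span {f, g}" if "D v = 0" for v
 proof -
  have "v = (f \<bullet> v / (f \<bullet> f)) *\<^sub>R f + (g \<bullet> v / (g \<bullet> g)) *\<^sub>R g" using that by (simp add: D_def)
  also have "\<dots> \<in> span {f, g}" by (intro span_add span_scale span_base) auto
  finally show ?thesis .
 qed
 ultimately show ?thesis by auto
qed

text \<open>A maximal family spans a dense subspace of the almost periodic part; with at most one
  member it would leave dimension at most 2.\<close>

lemma two_ap_blocks:
 assumes sep: "\<exists>D :: 'a set. countable D \<and> closure D = UNIV" and dim: "dim_at_least 5 (almost_periodic_part U)"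
 obtains f g l f' g' l' where "ap_block f g l" "ap_block f' g' l'" "inner f f' = 0" "inner f g' = 0" "inner g f' = 0" "inner g g' = 0"
proof -
 obtain S where S: "ap_family S" "!!f g l. ap_family (insert (f, g, l) S) ==> (f, g, l) \<in> S"
  by (rule maximal_ap_family) (rule that)
 have K: "almost_periodic_part U = closure (span (ap_vectors S))"
  using ap_decomposition_exists[OF sep S(1) weakly_mixing_complement[OF S]] almost_periodic_part_eq by blast
 have "\<exists>p\<in>S. \<exists>p'\<in>S. p \<noteq> p'"
 proof (rule ccontr)
  assume single: "\<not> ?thesis"
  have "\<exists>f g. ap_vectors S \<subseteq> {f, g} \<and> inner f g = 0"
  proof (cases "S = {}")
   case False
   then obtain f g l where "(f, g, l) \<in> S" by (metis all_not_in_conv prod_cases3)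
   moreover from this have "S = {(f, g, l)}" using single by blast
   ultimately show ?thesis
    using ap_family_block[OF S(1)] by (intro exI[of _ f] exI[of _ g]) (auto simp: ap_vectors_def ap_block_def)
  qed (auto simp: ap_vectors_def intro!: exI[of _ 0])
  then obtain f g where fg: "ap_vectors S \<subseteq> {f, g}" "inner f g = 0" by blast
  have "almost_periodic_part U \<subseteq> span {f, g}"
   unfolding K using closure_span_pair[OF fg(2)] closure_mono[OF span_mono[OF fg(1)]] by blast
  then obtain B where B: "B \<subseteq> span {f, g}" "independent B" "card B = 5"
   using dim by (auto simp: dim_at_least_def)
  have "card B \<le> card {f, g}" using independent_span_bound[of "{f, g}" B] B by simp
  also have "\<dots> \<le> 2" by (simp add: card_insert_if)
  finally show False using B(3) by simp
 qed
 then obtain f g l f' g' l' where p: "(f, g, l) \<in> S" "(f', g', l') \<in> S" "(f, g, l) \<noteq> (f', g', l')"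
  by (metis prod_cases3)
 then show thesis using that ap_family_block[OF S(1)] ap_family_orthogonal[OF S(1) p] by blast
qed

end

text \<open>The vector f + \<i> g is real for a line, and for a plane it is orthogonal to its
  conjugate because f and g are orthonormal.\<close>

lemma (in araki_woods) ap_block_block:
 assumes "ap_block f g l"
 shows "block (Complexify f g) (weight (- ln l))"
proof -
 have "Complexify f g \<noteq> 0" using assms by (auto simp: ap_block_def zero_complexification_def)
 moreover have "cconj (Complexify f g) = Complexify f g \<or> cinner (Complexify f g) (cconj (Complexify f g)) = 0"
  using assms by (auto simp: ap_block_def cconj_def cinner_complexification_def complex_eq_iff inner_commute)
 ultimately show ?thesis
  using T_eigenvector[OF ap_block_eigenvector[OF assms]] weight_pos weight_less by (simp add: block_def)
qed

theorem theorem5p1: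
  fixes q :: real
    and U :: "real \<Rightarrow> 'a::{real_inner, complete_space} \<Rightarrow> 'a"
    and j :: "'a complexification \<Rightarrow> 'h::complex_hilbert"
    and tens :: "'h list \<Rightarrow> 'f::complex_hilbert"
  assumes "- 1 < q" and "q < 1"
    and separable: "\<exists>D :: 'a set. countable D \<and> closure D = UNIV"
    and "orthogonal_representation U" and "strongly_continuous U"
    and "U_completion U j"
    and "q_fock_space q tens"
    and "dim_at_least 5 (almost_periodic_part U)"
  shows "commutant (centralizer (q_araki_woods j tens) (tens [])) \<inter> q_araki_woods j tens
           = scalar_operators \<and>
         factor (centralizer (q_araki_woods j tens) (tens []))"
proof -
 interpret araki_woods U q tens j by unfold_locales fact+
 obtain f g l f' g' l' where p: "ap_block f g l" "ap_block f' g' l'" "inner f f' = 0" "inner f g' = 0" "inner g f' = 0" "inner g g' = 0"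
  using two_ap_blocks[OF separable assms(8)] .
 have orth: "cinner (Complexify f g) (Complexify f' g') = 0" "cinner (Complexify f g) (cconj (Complexify f' g')) = 0"
  using p by (simp_all add: cconj_def cinner_complexification_def complex_eq_iff)
 define N where "N = centralizer M vac"
 have NM: "N \<subseteq> M" by (auto simp: N_def centralizer_iff)
 have scalar: "commutant N \<inter> M \<subseteq> scalar_operators"
  using relative_commutant_trivial[OF ap_block_block[OF p(1)] ap_block_block[OF p(2)] orth] by (auto simp: N_def)
 have "x \<in> commutant N \<inter> N" if x: "x \<in> scalar_operators" for x
 proof -
  obtain c where c: "x = (%v. c *C v)" using x by (auto simp: scalar_operators_def)
  have "x \<in> commutant N" unfolding c using commutant_scale[OF _ commutant_id] NM M_bounded by blast
  moreover have "x \<in> N"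
   using M_scale[OF M_id, of c] by (auto simp: N_def centralizer_iff c clinear_scaleC[OF W_bounded])
  ultimately show ?thesis by simp
 qed
 then have "commutant N \<inter> M = scalar_operators" "commutant N \<inter> N = scalar_operators"
  using scalar NM by blast+
 then show ?thesis using von_neumann_algebra_centralizer by (simp add: factor_def N_def)
qed

end
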